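(* Let $(X,T^{1,0}X)$ be a (not necessarily compact) locally embeddable strictly pseudoconvex CR manifold. Then every $p\in X$ has a neighborhood $U$ with the following property: there exists a sequence of strictly pseudoconvex CR structures $\{\mathcal{V}^k\}_{k\in\mathbb{N}}$ on $U$ which approximates $T^{1,0}X|_U$ in $\mathscr{C}^\infty$-topology such that for each $k\in\mathbb{N}$ there are $N_k\in\mathbb{N}$ and a smooth embedding $F_k\colon U\to\mathbb{C}^{N_k}$ which is CR with respect to $\mathcal{V}^k$ and satisfies $F_k(U)\subset\mathbb{S}^{2N_k-1}=\{z\in\mathbb{C}^{N_k}:|z|=1\}$.
   Context: CR manifolds $X$ are smooth, connected, orientable, of real dimension $2n+1$, $n\ge1$. A (codimension one) CR structure is a rank-$n$ complex subbundle $T^{1,0}X\subset\mathbb{C}TX$ with $T^{1,0}X\cap\overline{T^{1,0}X}=0$, closed under Lie brackets. It is strictly pseudoconvex if there is a non-vanishing real one form $\alpha$ with $\ker\alpha=\operatorname{Re}T^{1,0}X$ and $\frac{1}{2i}d\alpha(Z,\overline Z)>0$ for all $Z\in T^{1,0}X\setminus\{0\}$. An embedding $F\colon U\to\mathbb{C}^N$ is CR with respect to $\mathcal{V}$ if $F_*\mathcal{V}=\mathbb{C}TF(U)\cap T^{1,0}\mathbb{C}^N$. $(X,T^{1,0}X)$ is locally embeddable if every $p\in X$ has a neighborhood $U$ and a CR map $H\colon U\to\mathbb{C}^{n+1}$ defining a CR diffeomorphism onto its image. $\mathcal{V}^k\to\mathcal{V}$ in $\mathscr{C}^\infty$-topology,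 for complex subbundles of a Hermitian vector bundle $E$ (here $\mathbb{C}TU$), means: there exist a Hermitian vector bundle $Q$ and smooth sections $S,S^k$ of $\operatorname{Lin}(E,Q)$, fiberwise surjective, with $\ker S_x=\mathcal{V}_x$, $\ker S^k_x=\mathcal{V}^k_x$ for all $x$, and $S^k\to S$ in $\mathscr{C}^\infty$-topology (all derivatives, uniformly on compact subsets of $U$). *)

theory Defs
  imports "HOL-Analysis.Analysis"
begin

section \<open>Smooth maps between Euclidean spaces\<close>

primrec iter_deriv ::
    "'b::real_normed_vector list \<Rightarrow> ('b \<Rightarrow> 'c::real_normed_vector) \<Rightarrow> 'b \<Rightarrow> 'c" where
  "iter_deriv [] f = f"
| "iter_deriv (v # vs) f = (\<lambda>x. frechet_derivative (iter_deriv vs f) (at x) v)"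

text \<open>The following two notions are only used for open \<open>S\<close>; \<open>vs\<close> ranges over all lists of
  directions, i.e. over all iterated directional derivatives of all orders.\<close>

definition smooth_on :: "'b::real_normed_vector set \<Rightarrow> ('b \<Rightarrow> 'c::real_normed_vector) \<Rightarrow> bool" where
  "smooth_on S f \<longleftrightarrow> (\<forall>vs. \<forall>x\<in>S. iter_deriv vs f differentiable (at x))"

definition cinf_tendsto ::
    "'b::real_normed_vector set \<Rightarrow> (nat \<Rightarrow> 'b \<Rightarrow> 'c::real_normed_vector) \<Rightarrow> ('b \<Rightarrow> 'c) \<Rightarrow> bool" where
  "cinf_tendsto S F f \<longleftrightarrow>
     (\<forall>vs K. compact K \<and> K \<subseteq> S \<longrightarrow>
        uniform_limit K (\<lambda>k. iter_deriv vs (F k)) (iter_deriv vs f) sequentially)"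


section \<open>Smooth manifolds\<close>

text \<open>A chart is a pair \<open>(D, \<phi>)\<close> of a domain and a coordinate map; values of \<open>\<phi>\<close> outside \<open>D\<close>
  are irrelevant, so that the local inverse of \<open>\<phi>\<close> is \<open>inv_into D \<phi>\<close>.\<close>

type_synonym ('a, 'm) chart = "'a set \<times> ('a \<Rightarrow> real^'m)"

definition smooth_atlas :: "'a topology \<Rightarrow> ('a, 'm::finite) chart set \<Rightarrow> bool" where
  "smooth_atlas X A \<longleftrightarrow>
     (\<Union>(D, \<phi>)\<in>A. D) = topspace X \<and>
     (\<forall>(D, \<phi>)\<in>A. openin X D \<and> open (\<phi> ` D) \<and>
        homeomorphic_map (subtopology X D) (top_of_set (\<phi> ` D)) \<phi>) \<and>
     (\<forall>(D, \<phi>)\<in>A. \<forall>(E, \<psi>)\<in>A. smooth_on (\<phi> ` (D \<inter> E)) (\<psi> \<circ> inv_into D \<phi>))"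

definition smooth_manifold :: "'a topology \<Rightarrow> ('a, 'm::finite) chart set \<Rightarrow> bool" where
  "smooth_manifold X A \<longleftrightarrow> Hausdorff_space X \<and> second_countable X \<and> smooth_atlas X A"

text \<open>Since \<open>A\<close> need not be maximal, orientability asks for an oriented atlas \<open>B\<close> which is
  smoothly compatible with \<open>A\<close>.\<close>

definition orientable :: "'a topology \<Rightarrow> ('a, 'm::finite) chart set \<Rightarrow> bool" where
  "orientable X A \<longleftrightarrow>
     (\<exists>B. smooth_atlas X B \<and> smooth_atlas X (A \<union> B) \<and>
        (\<forall>(D, \<phi>)\<in>B. \<forall>(E, \<psi>)\<in>B. \<forall>x\<in>\<phi> ` (D \<inter> E).
           det (matrix (frechet_derivative (\<psi> \<circ> inv_into D \<phi>) (at x))) > 0))"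

definition smooth_fun ::
    "('a, 'm::finite) chart set \<Rightarrow> 'a set \<Rightarrow> ('a \<Rightarrow> complex) \<Rightarrow> bool" where
  "smooth_fun A W f \<longleftrightarrow> (\<forall>(D, \<phi>)\<in>A. smooth_on (\<phi> ` (D \<inter> W)) (f \<circ> inv_into D \<phi>))"

definition smooth_near ::
    "'a topology \<Rightarrow> ('a, 'm::finite) chart set \<Rightarrow> 'a \<Rightarrow> ('a \<Rightarrow> complex) \<Rightarrow> bool" where
  "smooth_near X A p f \<longleftrightarrow> (\<exists>W. openin X W \<and> p \<in> W \<and> smooth_fun A W f)"


section \<open>The complexified tangent bundle\<close>

text \<open>A complex tangent vector at \<open>p\<close> is a complex derivation of the algebra of germs at \<open>p\<close> of
  smooth complex valued functions. It is represented as a functional on all functions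
  \<open>'a \<Rightarrow> complex\<close> which depends only on the germ; the value \<open>0\<close> on functions that are not smooth
  near \<open>p\<close> makes the representation unique. Because only germs matter, the tangent space at \<open>p\<close>
  of an open neighbourhood of \<open>p\<close> is the same set.\<close>

type_synonym 'a cvector = "('a \<Rightarrow> complex) \<Rightarrow> complex"

definition ctangent :: "'a topology \<Rightarrow> ('a, 'm::finite) chart set \<Rightarrow> 'a \<Rightarrow> 'a cvector set" where
  "ctangent X A p = {Z.
     (\<forall>f. \<not> smooth_near X A p f \<longrightarrow> Z f = 0) \<and>
     (\<forall>f g. smooth_near X A p f \<and> smooth_near X A p g \<longrightarrow>
        ((\<exists>W. openin X W \<and> p \<in> W \<and> (\<forall>q\<in>W. f q = g q)) \<longrightarrow> Z f = Z g) \<and>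
        (\<forall>a b. Z (\<lambda>q. a * f q + b * g q) = a * Z f + b * Z g) \<and>
        Z (\<lambda>q. f q * g q) = Z f * g p + f p * Z g)}"

definition conj_vec :: "'a cvector \<Rightarrow> 'a cvector" where
  "conj_vec Z = (\<lambda>f. cnj (Z (\<lambda>q. cnj (f q))))"

text \<open>The real tangent space, as a subset of the complexified one.\<close>

definition rtangent :: "'a topology \<Rightarrow> ('a, 'm::finite) chart set \<Rightarrow> 'a \<Rightarrow> 'a cvector set" where
  "rtangent X A p = {Z \<in> ctangent X A p. conj_vec Z = Z}"

definition re_part :: "'a cvector set \<Rightarrow> 'a cvector set" where
  "re_part V = {\<lambda>f. Z f + conj_vec Z f |Z. Z \<in> V}"

definition ctangent_linear ::
    "'a topology \<Rightarrow> ('a, 'm::finite) chart set \<Rightarrow> 'a \<Rightarrow> ('a cvector \<Rightarrow> complex) \<Rightarrow> bool" where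
  "ctangent_linear X A p L \<longleftrightarrow>
     (\<forall>Z\<in>ctangent X A p. \<forall>W\<in>ctangent X A p. \<forall>a b.
        L (\<lambda>f. a * Z f + b * W f) = a * L Z + b * L W)"

definition coord_vec ::
    "'a topology \<Rightarrow> ('a, 'm::finite) chart set \<Rightarrow> ('a, 'm) chart \<Rightarrow> 'm \<Rightarrow> 'a \<Rightarrow> 'a cvector" where
  "coord_vec X A = (\<lambda>(D, \<phi>) i q f.
     if smooth_near X A q f
     then frechet_derivative (f \<circ> inv_into D \<phi>) (at (\<phi> q)) (axis i 1) else 0)"

definition smooth_field ::
    "'a topology \<Rightarrow> ('a, 'm::finite) chart set \<Rightarrow> 'a set \<Rightarrow> ('a \<Rightarrow> 'a cvector) \<Rightarrow> bool" where
  "smooth_field X A W Z \<longleftrightarrow>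
     (\<forall>p\<in>W. Z p \<in> ctangent X A p) \<and>
     (\<forall>W' f. openin X W' \<and> W' \<subseteq> W \<and> smooth_fun A W' f \<longrightarrow> smooth_fun A W' (\<lambda>p. Z p f))"

definition lie_bracket ::
    "'a topology \<Rightarrow> ('a, 'm::finite) chart set \<Rightarrow>
     ('a \<Rightarrow> 'a cvector) \<Rightarrow> ('a \<Rightarrow> 'a cvector) \<Rightarrow> 'a \<Rightarrow> 'a cvector" where
  "lie_bracket X A Z W = (\<lambda>p f.
     if smooth_near X A p f then Z p (\<lambda>q. W q f) - W p (\<lambda>q. Z q f) else 0)"


section \<open>CR structures\<close>

text \<open>All structures live on an open set \<open>U\<close> of the manifold; \<open>V p\<close> is the fibre over \<open>p\<close>, and
  the values of \<open>V\<close> outside \<open>U\<close> are irrelevant. Being a complex subbundle of rank \<open>r\<close> is expressed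
  by local smooth frames.\<close>

definition complex_subbundle ::
    "'a topology \<Rightarrow> ('a, 'm::finite) chart set \<Rightarrow> nat \<Rightarrow> 'a set \<Rightarrow> ('a \<Rightarrow> 'a cvector set) \<Rightarrow> bool" where
  "complex_subbundle X A r U V \<longleftrightarrow>
     (\<forall>p\<in>U. \<exists>W E. openin X W \<and> p \<in> W \<and> W \<subseteq> U \<and>
        (\<forall>j<r. smooth_field X A W (E j)) \<and>
        (\<forall>q\<in>W.
           (\<forall>c. (\<lambda>f. \<Sum>j<r. c j * E j q f) = (\<lambda>f. 0) \<longrightarrow> (\<forall>j<r. c j = 0)) \<and>
           V q = {\<lambda>f. \<Sum>j<r. c j * E j q f |c. True}))"

definition smooth_section ::
    "'a topology \<Rightarrow> ('a, 'm::finite) chart set \<Rightarrow> 'a set \<Rightarrow>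
     ('a \<Rightarrow> 'a cvector set) \<Rightarrow> ('a \<Rightarrow> 'a cvector) \<Rightarrow> bool" where
  "smooth_section X A W V Z \<longleftrightarrow> smooth_field X A W Z \<and> (\<forall>p\<in>W. Z p \<in> V p)"

definition cr_structure ::
    "'a topology \<Rightarrow> ('a, 'm::finite) chart set \<Rightarrow> nat \<Rightarrow> 'a set \<Rightarrow> ('a \<Rightarrow> 'a cvector set) \<Rightarrow> bool" where
  "cr_structure X A n U V \<longleftrightarrow>
     complex_subbundle X A n U V \<and>
     (\<forall>p\<in>U. V p \<inter> conj_vec ` V p = {\<lambda>f. 0}) \<and>
     (\<forall>W Z Z'. openin X W \<and> W \<subseteq> U \<and> smooth_section X A W V Z \<and> smooth_section X A W V Z' \<longrightarrow>
        (\<forall>p\<in>W. lie_bracket X A Z Z' p \<in> V p))"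

definition cr_manifold ::
    "'a topology \<Rightarrow> ('a, 'm::finite) chart set \<Rightarrow> nat \<Rightarrow> ('a \<Rightarrow> 'a cvector set) \<Rightarrow> bool" where
  "cr_manifold X A n V \<longleftrightarrow>
     n \<ge> 1 \<and> CARD('m) = 2 * n + 1 \<and>
     smooth_manifold X A \<and> connected_space X \<and> orientable X A \<and>
     cr_structure X A n (topspace X) V"

text \<open>Real one-forms are extended complex linearly to complex tangent vectors.\<close>

definition real_one_form ::
    "'a topology \<Rightarrow> ('a, 'm::finite) chart set \<Rightarrow> 'a set \<Rightarrow> ('a \<Rightarrow> 'a cvector \<Rightarrow> complex) \<Rightarrow> bool" where
  "real_one_form X A U \<alpha> \<longleftrightarrow>
     (\<forall>p\<in>U. ctangent_linear X A p (\<alpha> p) \<and>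
        (\<forall>Z\<in>ctangent X A p. \<alpha> p (conj_vec Z) = cnj (\<alpha> p Z))) \<and>
     (\<forall>W Z. openin X W \<and> W \<subseteq> U \<and> smooth_field X A W Z \<longrightarrow> smooth_fun A W (\<lambda>p. \<alpha> p (Z p)))"

text \<open>The exterior derivative \<open>d\<alpha>(Z, W)\<close>, on vector fields.\<close>

definition ext_deriv ::
    "'a topology \<Rightarrow> ('a, 'm::finite) chart set \<Rightarrow> ('a \<Rightarrow> 'a cvector \<Rightarrow> complex) \<Rightarrow>
     ('a \<Rightarrow> 'a cvector) \<Rightarrow> ('a \<Rightarrow> 'a cvector) \<Rightarrow> 'a \<Rightarrow> complex" where
  "ext_deriv X A \<alpha> Z W p =
     Z p (\<lambda>q. \<alpha> q (W q)) - W p (\<lambda>q. \<alpha> q (Z q)) - \<alpha> p (lie_bracket X A Z W p)"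

text \<open>Positivity of \<open>d\<alpha>(Z, conj Z) / 2i\<close> at a nonzero vector of \<open>V p\<close> is tested on all local
  sections of \<open>V\<close> through that vector: \<open>d\<alpha>\<close> is tensorial and every vector of \<open>V p\<close> extends.\<close>

definition strictly_pseudoconvex ::
    "'a topology \<Rightarrow> ('a, 'm::finite) chart set \<Rightarrow> 'a set \<Rightarrow> ('a \<Rightarrow> 'a cvector set) \<Rightarrow> bool" where
  "strictly_pseudoconvex X A U V \<longleftrightarrow>
     (\<exists>\<alpha>. real_one_form X A U \<alpha> \<and>
        (\<forall>p\<in>U. \<exists>Z\<in>rtangent X A p. \<alpha> p Z \<noteq> 0) \<and>
        (\<forall>p\<in>U. {Z \<in> rtangent X A p. \<alpha> p Z = 0} = re_part (V p)) \<and>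
        (\<forall>W Z. openin X W \<and> W \<subseteq> U \<and> smooth_section X A W V Z \<longrightarrow>
           (\<forall>p\<in>W. Z p \<noteq> (\<lambda>f. 0) \<longrightarrow>
              (\<exists>t>0. ext_deriv X A \<alpha> Z (\<lambda>q. conj_vec (Z q)) p / (2 * \<i>) = complex_of_real t))))"


section \<open>CR embeddings into complex Euclidean space\<close>

text \<open>The dimension \<open>N\<close> of the target varies inside the statements, so complex \<open>N\<close>-space is
  the set of extensional functions on \<open>{..<N}\<close> with the product topology.\<close>

abbreviation cspace :: "nat \<Rightarrow> (nat \<Rightarrow> complex) topology" where
  "cspace N \<equiv> product_topology (\<lambda>_. euclidean) {..<N}"

definition unit_csphere :: "nat \<Rightarrow> (nat \<Rightarrow> complex) set" where
  "unit_csphere N = {z \<in> topspace (cspace N). L2_set (\<lambda>j. cmod (z j)) {..<N} = 1}"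

text \<open>A vector of the complexified tangent space of complex \<open>N\<close>-space is given by its two families
  of components with respect to the basis of all \<open>\<partial>/\<partial>z\<^sub>j\<close> and all \<open>\<partial>/\<partial>(conj z\<^sub>j)\<close>, i.e. by
  the values of \<open>dz\<^sub>j\<close> and \<open>d(conj z\<^sub>j)\<close> on it. The vectors of type (1,0) are those without
  \<open>\<partial>/\<partial>(conj z\<^sub>j)\<close> components.\<close>

definition pushforward ::
    "nat \<Rightarrow> ('a \<Rightarrow> nat \<Rightarrow> complex) \<Rightarrow> 'a cvector \<Rightarrow> (nat \<Rightarrow> complex) \<times> (nat \<Rightarrow> complex)" where
  "pushforward N F Z =
     ((\<lambda>j\<in>{..<N}. Z (\<lambda>q. F q j)), (\<lambda>j\<in>{..<N}. Z (\<lambda>q. cnj (F q j))))"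

definition T10_cspace :: "nat \<Rightarrow> ((nat \<Rightarrow> complex) \<times> (nat \<Rightarrow> complex)) set" where
  "T10_cspace N = {(a, b). a \<in> topspace (cspace N) \<and> b = (\<lambda>j\<in>{..<N}. 0)}"

definition smooth_embedding ::
    "'a topology \<Rightarrow> ('a, 'm::finite) chart set \<Rightarrow> 'a set \<Rightarrow> nat \<Rightarrow> ('a \<Rightarrow> nat \<Rightarrow> complex) \<Rightarrow> bool" where
  "smooth_embedding X A U N F \<longleftrightarrow>
     (\<forall>j<N. smooth_fun A U (\<lambda>q. F q j)) \<and>
     (\<forall>p\<in>U. inj_on (pushforward N F) (ctangent X A p)) \<and>
     embedding_map (subtopology X U) (cspace N) F"

definition cr_embedding ::
    "'a topology \<Rightarrow> ('a, 'm::finite) chart set \<Rightarrow> 'a set \<Rightarrow> ('a \<Rightarrow> 'a cvector set) \<Rightarrow>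
     nat \<Rightarrow> ('a \<Rightarrow> nat \<Rightarrow> complex) \<Rightarrow> bool" where
  "cr_embedding X A U V N F \<longleftrightarrow>
     smooth_embedding X A U N F \<and>
     (\<forall>p\<in>U. pushforward N F ` V p = pushforward N F ` ctangent X A p \<inter> T10_cspace N)"

text \<open>The image of a smooth embedding \<open>H\<close> carries the CR structure induced from complex Euclidean
  space, so \<open>H\<close> is a CR diffeomorphism onto its image iff it is a CR embedding.\<close>

definition locally_embeddable ::
    "'a topology \<Rightarrow> ('a, 'm::finite) chart set \<Rightarrow> nat \<Rightarrow> ('a \<Rightarrow> 'a cvector set) \<Rightarrow> bool" where
  "locally_embeddable X A n V \<longleftrightarrow>
     (\<forall>p\<in>topspace X. \<exists>U H. openin X U \<and> p \<in> U \<and> cr_embedding X A U V (n + 1) H)"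


section \<open>Convergence of subbundles of the complexified tangent bundle\<close>

text \<open>A Hermitian vector bundle of rank \<open>r\<close> over \<open>U\<close>, given by local trivializations: \<open>\<C>\<close> is a
  cover of \<open>U\<close> by open sets (indexing the trivializations by their domains), \<open>g W W'\<close> is the
  matrix valued transition function over \<open>W \<inter> W'\<close>, and \<open>h W\<close> is the matrix of the metric.
  A section is a family of component vectors \<open>s W\<close> over \<open>W\<close> with \<open>s W = g W W' * s W'\<close>.\<close>

definition hermitian_bundle ::
    "'a topology \<Rightarrow> ('a, 'm::finite) chart set \<Rightarrow> 'a set \<Rightarrow> nat \<Rightarrow> 'a set set \<Rightarrow>
     ('a set \<Rightarrow> 'a set \<Rightarrow> 'a \<Rightarrow> nat \<Rightarrow> nat \<Rightarrow> complex) \<Rightarrow>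
     ('a set \<Rightarrow> 'a \<Rightarrow> nat \<Rightarrow> nat \<Rightarrow> complex) \<Rightarrow> bool" where
  "hermitian_bundle X A U r \<C> g h \<longleftrightarrow>
     (\<forall>W\<in>\<C>. openin X W) \<and> \<Union>\<C> = U \<and>
     (\<forall>W\<in>\<C>. \<forall>W'\<in>\<C>. \<forall>i<r. \<forall>j<r. smooth_fun A (W \<inter> W') (\<lambda>q. g W W' q i j)) \<and>
     (\<forall>W\<in>\<C>. \<forall>q\<in>W. \<forall>i<r. \<forall>j<r. g W W q i j = (if i = j then 1 else 0)) \<and>
     (\<forall>W\<in>\<C>. \<forall>W'\<in>\<C>. \<forall>W''\<in>\<C>. \<forall>q\<in>W \<inter> W' \<inter> W''. \<forall>i<r. \<forall>j<r.
        (\<Sum>k<r. g W W' q i k * g W' W'' q k j) = g W W'' q i j) \<and>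
     (\<forall>W\<in>\<C>. \<forall>i<r. \<forall>j<r. smooth_fun A W (\<lambda>q. h W q i j)) \<and>
     (\<forall>W\<in>\<C>. \<forall>q\<in>W. \<forall>i<r. \<forall>j<r. h W q i j = cnj (h W q j i)) \<and>
     (\<forall>W\<in>\<C>. \<forall>q\<in>W. \<forall>v. (\<exists>i<r. v i \<noteq> 0) \<longrightarrow>
        (\<exists>t>0. (\<Sum>i<r. \<Sum>j<r. cnj (v i) * h W q i j * v j) = complex_of_real t)) \<and>
     (\<forall>W\<in>\<C>. \<forall>W'\<in>\<C>. \<forall>q\<in>W \<inter> W'. \<forall>i<r. \<forall>j<r.
        h W' q i j = (\<Sum>k<r. \<Sum>l<r. cnj (g W W' q k i) * h W q k l * g W W' q l j))"

text \<open>Smooth sections \<open>S\<close> of \<open>Lin(CTU, Q)\<close>, where \<open>Q\<close> is the bundle given by \<open>r\<close>, \<open>\<C>\<close>, \<open>g\<close>: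
  \<open>S W q Z j\<close> is the \<open>j\<close>-th component of \<open>S\<^sub>q(Z)\<close> in the trivialization over \<open>W\<close>.\<close>

type_synonym 'a lin_section = "'a set \<Rightarrow> 'a \<Rightarrow> 'a cvector \<Rightarrow> nat \<Rightarrow> complex"

definition smooth_lin_section ::
    "'a topology \<Rightarrow> ('a, 'm::finite) chart set \<Rightarrow> nat \<Rightarrow> 'a set set \<Rightarrow>
     ('a set \<Rightarrow> 'a set \<Rightarrow> 'a \<Rightarrow> nat \<Rightarrow> nat \<Rightarrow> complex) \<Rightarrow> 'a lin_section \<Rightarrow> bool" where
  "smooth_lin_section X A r \<C> g S \<longleftrightarrow>
     (\<forall>W\<in>\<C>. \<forall>q\<in>W. \<forall>j<r. ctangent_linear X A q (\<lambda>Z. S W q Z j)) \<and>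
     (\<forall>W\<in>\<C>. \<forall>W'\<in>\<C>. \<forall>q\<in>W \<inter> W'. \<forall>Z\<in>ctangent X A q. \<forall>i<r.
        S W q Z i = (\<Sum>j<r. g W W' q i j * S W' q Z j)) \<and>
     (\<forall>W\<in>\<C>. \<forall>W' Z. openin X W' \<and> W' \<subseteq> W \<and> smooth_field X A W' Z \<longrightarrow>
        (\<forall>j<r. smooth_fun A W' (\<lambda>q. S W q (Z q) j)))"

definition fibrewise_surjective ::
    "'a topology \<Rightarrow> ('a, 'm::finite) chart set \<Rightarrow> nat \<Rightarrow> 'a set set \<Rightarrow> 'a lin_section \<Rightarrow> bool" where
  "fibrewise_surjective X A r \<C> S \<longleftrightarrow>
     (\<forall>W\<in>\<C>. \<forall>q\<in>W. \<forall>w. \<exists>Z\<in>ctangent X A q. \<forall>j<r. S W q Z j = w j)"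

definition has_kernel ::
    "'a topology \<Rightarrow> ('a, 'm::finite) chart set \<Rightarrow> nat \<Rightarrow> 'a set set \<Rightarrow> 'a lin_section \<Rightarrow>
     ('a \<Rightarrow> 'a cvector set) \<Rightarrow> bool" where
  "has_kernel X A r \<C> S V \<longleftrightarrow>
     (\<forall>W\<in>\<C>. \<forall>q\<in>W. {Z \<in> ctangent X A q. \<forall>j<r. S W q Z j = 0} = V q)"

text \<open>Convergence of sections with all derivatives, uniformly on compact sets: all matrix entries
  with respect to trivializations of \<open>Q\<close> and coordinate frames of the tangent bundle converge in
  this sense.\<close>

definition lin_section_tendsto ::
    "'a topology \<Rightarrow> ('a, 'm::finite) chart set \<Rightarrow> nat \<Rightarrow> 'a set set \<Rightarrow>
     (nat \<Rightarrow> 'a lin_section) \<Rightarrow> 'a lin_section \<Rightarrow> bool" where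
  "lin_section_tendsto X A r \<C> Ss S \<longleftrightarrow>
     (\<forall>W\<in>\<C>. \<forall>(D, \<phi>)\<in>A. \<forall>i. \<forall>j<r.
        let entry = (\<lambda>R x. let q = inv_into D \<phi> x in R W q (coord_vec X A (D, \<phi>) i q) j)
        in cinf_tendsto (\<phi> ` (D \<inter> W)) (\<lambda>k. entry (Ss k)) (entry S))"

definition subbundles_tendsto ::
    "'a topology \<Rightarrow> ('a, 'm::finite) chart set \<Rightarrow> 'a set \<Rightarrow>
     (nat \<Rightarrow> 'a \<Rightarrow> 'a cvector set) \<Rightarrow> ('a \<Rightarrow> 'a cvector set) \<Rightarrow> bool" where
  "subbundles_tendsto X A U Vs V \<longleftrightarrow>
     (\<exists>r \<C> g h S Ss.
        hermitian_bundle X A U r \<C> g h \<and>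
        smooth_lin_section X A r \<C> g S \<and> fibrewise_surjective X A r \<C> S \<and>
        has_kernel X A r \<C> S V \<and>
        (\<forall>k. smooth_lin_section X A r \<C> g (Ss k) \<and> fibrewise_surjective X A r \<C> (Ss k) \<and>
           has_kernel X A r \<C> (Ss k) (Vs k)) \<and>
        lin_section_tendsto X A r \<C> Ss S)"

end

theory Submission
  imports Defs
begin

text \<open>Near a point, \<open>X\<close> is a real hypersurface of \<open>\<complex>\<close>-space which, after a quadratic change of coordinates,
  is the graph \<open>y = u(x)\<close> of a strictly convex function of \<open>2n + 1\<close> real variables. A convex function is
  a limit, with all derivatives, of functions \<open>u\<^sub>k\<close> with \<open>exp (\<lambda> u\<^sub>k(x)) = \<Sum>\<^sub>i exp (g\<^sub>i \<cdot> x + c\<^sub>i)\<close>: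
  finitely many affine minorants give uniform approximation, and averages over translates, which
  preserve this form because it is closed under products of the exponentials, upgrade it to all
  derivatives. Since \<open>x\<close> and \<open>y\<close> are the real parts of complex linear forms \<open>a(\<zeta>)\<close> and \<open>b(\<zeta>)\<close>, the graph
  of \<open>u\<^sub>k\<close> is the preimage of the unit sphere under the holomorphic map with components
  \<open>exp ((g\<^sub>i \<cdot> a(\<zeta>) + c\<^sub>i - \<lambda> b(\<zeta>)) / 2)\<close>, an embedding as soon as \<open>0\<close> and all \<open>\<lambda> e\<^sub>i\<close> occur among
  the \<open>g\<^sub>i\<close>. The chart \<open>x\<close> pulls the CR structures of these graphs back to one neighbourhood in \<open>X\<close>.\<close>

section \<open>Calculus of iterated directional derivatives\<close>

text \<open>A soft maximum of affine minorants is uniformly close to \<open>u\<close>, but nothing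
  bounds the distance of its derivatives from those of \<open>u\<close>, and convolution with a
  mollifier would leave the class of finite exponential sums. The averages used instead are Riemann
  sums, whose discretisation error depends on derivatives of the approximant itself. This dictates
  the order of choices: step length, uniform accuracy, approximant, number of nodes. The number of
  exponentials, hence the dimension of the sphere, grows without control. Strict pseudoconvexity
  makes the Levi form definite only on complex tangent vectors, and only up to a sign relative to
  the chosen normal direction; the sign is absorbed by reversing that direction. The real part of a
  holomorphic quadratic form does not change the Levi form, so it can be spent on making the real
  Hessian positive, a large multiple of one square taking care of the remaining tangent direction. A
  positive lower bound of the Hessian survives smooth convergence on a smaller ball, so all but
  finitely many approximating graphs are strictly pseudoconvex there.\<close>

definition ddir :: "'b::real_normed_vector \<Rightarrow> ('b \<Rightarrow> 'c::real_normed_vector) \<Rightarrow> 'b \<Rightarrow> 'c" where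
  "ddir v f = (\<lambda>x. frechet_derivative f (at x) v)"

text \<open>The list recursion exposes the derivative taken last. Arguments that differentiate a
  function once and then appeal to the smoothness of the result need the derivative taken first,
  which is the last entry of the list.\<close>

lemma iter_deriv_snoc: "iter_deriv (vs @ [v]) f = iter_deriv vs (ddir v f)"
  by (induction vs) (auto simp: ddir_def)

lemma iter_deriv_Cons_ddir: "iter_deriv (v # vs) f = ddir v (iter_deriv vs f)"
  by (simp add: ddir_def)

text \<open>\<open>frechet_derivative\<close> is a choice from the set of all derivatives at the
  point, so it agrees as soon as these sets agree, also where they are empty.\<close>

lemma frechet_derivative_cong_open:
  assumes "open S" "x \<in> S" "\<And>y. y \<in> S \<Longrightarrow> f y = g y"
  shows "frechet_derivative f (at x) = frechet_derivative g (at x)"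
proof -
  have "(f has_derivative D) (at x) \<longleftrightarrow> (g has_derivative D) (at x)" for D
    using has_derivative_transform_within_open[of f D x UNIV S g]
      has_derivative_transform_within_open[of g D x UNIV S f] assms by auto
  then show ?thesis by (simp add: frechet_derivative_def)
qed

lemma ddir_cong:
  assumes "open S" "x \<in> S" "\<And>y. y \<in> S \<Longrightarrow> f y = g y"
  shows "ddir v f x = ddir v g x"
  using frechet_derivative_cong_open[OF assms] by (simp add: ddir_def)

lemma iter_deriv_cong:
  assumes "open S" "x \<in> S" "\<And>y. y \<in> S \<Longrightarrow> f y = g y"
  shows "iter_deriv vs f x = iter_deriv vs g x"
  using assms(2)
proof (induction vs arbitrary: x)
  case Nil
  then show ?case using assms by simp
next
  case (Cons v vs)
  show ?case
    unfolding iter_deriv_Cons_ddir by (rule ddir_cong[OF assms(1)]) (use Cons in auto)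
qed

lemma differentiable_cong_open:
  assumes "open S" "x \<in> S" "\<And>y. y \<in> S \<Longrightarrow> f y = g y"
  shows "f differentiable (at x) \<longleftrightarrow> g differentiable (at x)"
  using has_derivative_transform_within_open[of f _ x UNIV S g]
      has_derivative_transform_within_open[of g _ x UNIV S f] assms
  unfolding differentiable_def by metis

lemma ddir_eqI: "(f has_derivative D) (at x) \<Longrightarrow> ddir v f x = D v"
  unfolding ddir_def using frechet_derivative_at by metis

lemma has_derivative_ddir:
  "f differentiable (at x) \<Longrightarrow> (f has_derivative (\<lambda>v. ddir v f x)) (at x)"
  unfolding ddir_def using frechet_derivative_works by blast

lemma ddir_add:
  assumes "f differentiable (at x)" "g differentiable (at x)"
  shows "ddir v (\<lambda>x. f x + g x) x = ddir v f x + ddir v g x"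
  by (rule ddir_eqI[of _ "\<lambda>v. ddir v f x + ddir v g x"])
    (intro has_derivative_add has_derivative_ddir assms)

text \<open>The one-step unfolding behind the coinductive proofs: the innermost derivative is split
  off the list of directions.\<close>

lemma smooth_on_rec:
  "smooth_on S f \<longleftrightarrow> (\<forall>x\<in>S. f differentiable (at x)) \<and> (\<forall>v. smooth_on S (ddir v f))" (is "?L \<longleftrightarrow> ?R")
proof
  assume L: ?L
  show ?R
    unfolding smooth_on_def iter_deriv_snoc[symmetric]
    using L unfolding smooth_on_def by (metis iter_deriv.simps(1))
next
  assume R: ?R
  have "iter_deriv vs f differentiable (at x)" if "x \<in> S" for vs x
    using R that by (cases vs rule: rev_cases) (auto simp: iter_deriv_snoc smooth_on_def)
  then show ?L by (simp add: smooth_on_def)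
qed

lemma smooth_on_differentiable: "smooth_on S f \<Longrightarrow> x \<in> S \<Longrightarrow> f differentiable (at x)"
  using smooth_on_rec by blast

lemma smooth_on_ddir: "smooth_on S f \<Longrightarrow> smooth_on S (ddir v f)"
  using smooth_on_rec by blast

lemma smooth_on_iter_deriv: "smooth_on S f \<Longrightarrow> smooth_on S (iter_deriv vs f)"
  by (induction vs) (auto simp: iter_deriv_Cons_ddir smooth_on_ddir simp del: iter_deriv.simps(2))

lemma smooth_on_has_derivative:
  "smooth_on S f \<Longrightarrow> x \<in> S \<Longrightarrow> (f has_derivative (\<lambda>v. ddir v f x)) (at x)"
  using has_derivative_ddir smooth_on_differentiable by blast

lemma smooth_on_continuous: "smooth_on S f \<Longrightarrow> continuous_on S f"
  by (meson continuous_at_imp_continuous_on differentiable_imp_continuous_within smooth_on_differentiable)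

lemma smooth_on_subset: "smooth_on S f \<Longrightarrow> T \<subseteq> S \<Longrightarrow> smooth_on T f"
  unfolding smooth_on_def by blast

lemma smooth_on_cong:
  assumes "open S" "\<And>x. x \<in> S \<Longrightarrow> f x = g x"
  shows "smooth_on S f \<longleftrightarrow> smooth_on S g"
  unfolding smooth_on_def
proof (intro all_cong1 ball_cong refl)
  fix vs x assume x: "x \<in> S"
  show "iter_deriv vs f differentiable (at x) \<longleftrightarrow> iter_deriv vs g differentiable (at x)"
    by (rule differentiable_cong_open[OF assms(1) x]) (rule iter_deriv_cong[OF assms(1) _ assms(2)])
qed

lemma smooth_on_locally:
  assumes "\<And>x. x \<in> S \<Longrightarrow> \<exists>T. x \<in> T \<and> smooth_on T f"
  shows "smooth_on S f"
  using assms unfolding smooth_on_def by blast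

text \<open>Smoothness as a greatest fixed point. The invariant \<open>P\<close> describes a class
  of functions that contains, up to equality on \<open>S\<close>, all directional derivatives of its
  members; membership is then propagated along the list of directions. Many of the closure
  properties below amount to finding such a class.\<close>

lemma smooth_on_coinduct:
  assumes S: "open S" and "P f"
    and step: "\<And>f. P f \<Longrightarrow> (\<forall>x\<in>S. f differentiable (at x)) \<and> (\<forall>v. \<exists>g. P g \<and> (\<forall>x\<in>S. ddir v f x = g x))"
  shows "smooth_on S f"
proof -
  have *: "\<exists>g. P g \<and> (\<forall>x\<in>S. iter_deriv vs f x = g x)" for vs
  proof (induction vs)
    case Nil
    then show ?case using assms by auto
  next
    case (Cons v vs)
    then obtain g where g: "P g" "\<forall>x\<in>S. iter_deriv vs f x = g x" by auto
    then obtain h where "P h" "\<forall>x\<in>S. ddir v g x = h x" using step by metis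
    then show ?case
      using ddir_cong[OF S, of _ "iter_deriv vs f" g v] g unfolding iter_deriv_Cons_ddir by metis
  qed
  show ?thesis
    unfolding smooth_on_def
  proof (intro allI ballI)
    fix vs x assume x: "x \<in> S"
    obtain g where g: "P g" "\<forall>x\<in>S. iter_deriv vs f x = g x" using * by blast
    then have "g differentiable at x" using step x by blast
    then show "iter_deriv vs f differentiable at x"
      using differentiable_cong_open[OF S x, of "iter_deriv vs f" g] g by blast
  qed
qed

text \<open>The same principle for a sequence together with its limit. Derivatives of the sequence
  and of the limit must again form a pair in \<open>P\<close>, so uniform convergence has to be
  verified only for the pairs themselves, without differentiating.\<close>

lemma cinf_tendsto_coinduct:
  assumes S: "open S" and "P F f"
    and lim: "\<And>F f K. P F f \<Longrightarrow> compact K \<Longrightarrow> K \<subseteq> S \<Longrightarrow> uniform_limit K F f sequentially"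
    and step: "\<And>F f v. P F f \<Longrightarrow>
      \<exists>G g. P G g \<and> (\<forall>x\<in>S. ddir v f x = g x) \<and> (\<forall>k. \<forall>x\<in>S. ddir v (F k) x = G k x)"
  shows "cinf_tendsto S F f"
proof -
  have *: "\<exists>G g. P G g \<and> (\<forall>x\<in>S. iter_deriv vs f x = g x) \<and>
     (\<forall>k. \<forall>x\<in>S. iter_deriv vs (F k) x = G k x)" for vs
  proof (induction vs)
    case Nil
    then show ?case using assms by auto
  next
    case (Cons v vs)
    then obtain G g where g: "P G g" "\<forall>x\<in>S. iter_deriv vs f x = g x"
        "\<forall>k. \<forall>x\<in>S. iter_deriv vs (F k) x = G k x" by auto
    then obtain H h where "P H h" "\<forall>x\<in>S. ddir v g x = h x" "\<forall>k. \<forall>x\<in>S. ddir v (G k) x = H k x"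
      using step[OF g(1), of v] by metis
    then show ?case
      using ddir_cong[OF S, of _ "iter_deriv vs f" g v] ddir_cong[OF S, of _ "iter_deriv vs (F _)" "G _" v] g
      unfolding iter_deriv_Cons_ddir by metis
  qed
  show ?thesis
    unfolding cinf_tendsto_def
  proof (intro allI impI)
    fix vs K assume K: "compact K \<and> K \<subseteq> S"
    obtain G g where g: "P G g" "\<forall>x\<in>S. iter_deriv vs f x = g x"
        "\<forall>k. \<forall>x\<in>S. iter_deriv vs (F k) x = G k x" using * by blast
    have "uniform_limit K (\<lambda>k. iter_deriv vs (F k)) (iter_deriv vs f) sequentially
       \<longleftrightarrow> uniform_limit K G g sequentially"
      by (rule uniform_limit_cong') (use g K in auto)
    then show "uniform_limit K (\<lambda>k. iter_deriv vs (F k)) (iter_deriv vs f) sequentially"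
      using lim[OF g(1)] K by simp
  qed
qed

lemma cinf_tendsto_uniform:
  "cinf_tendsto S F f \<Longrightarrow> compact K \<Longrightarrow> K \<subseteq> S \<Longrightarrow> uniform_limit K F f sequentially"
  unfolding cinf_tendsto_def by (metis (no_types, lifting) ext iter_deriv.simps(1))

lemma cinf_tendsto_ddir:
  "cinf_tendsto S F f \<Longrightarrow> cinf_tendsto S (\<lambda>k. ddir v (F k)) (ddir v f)"
  unfolding cinf_tendsto_def iter_deriv_snoc[symmetric] by blast

lemma cinf_tendsto_subset: "cinf_tendsto S F f \<Longrightarrow> T \<subseteq> S \<Longrightarrow> cinf_tendsto T F f"
  unfolding cinf_tendsto_def by blast

lemma cinf_tendsto_cong:
  assumes "open S" "\<And>x. x \<in> S \<Longrightarrow> f x = g x" "\<And>k x. x \<in> S \<Longrightarrow> F k x = G k x" "cinf_tendsto S F f"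
  shows "cinf_tendsto S G g"
  unfolding cinf_tendsto_def
proof (intro allI impI)
  fix vs K assume K: "compact K \<and> K \<subseteq> S"
  have "uniform_limit K (\<lambda>k. iter_deriv vs (F k)) (iter_deriv vs f) sequentially
      \<longleftrightarrow> uniform_limit K (\<lambda>k. iter_deriv vs (G k)) (iter_deriv vs g) sequentially"
    by (rule uniform_limit_cong')
      (use K assms in \<open>auto intro!: iter_deriv_cong[OF assms(1)]\<close>)
  then show "uniform_limit K (\<lambda>k. iter_deriv vs (G k)) (iter_deriv vs g) sequentially"
    using assms(4) K unfolding cinf_tendsto_def by blast
qed

lemma cinf_tendsto_const: "cinf_tendsto S (\<lambda>k. f) f"
  unfolding cinf_tendsto_def by (auto intro: uniform_limit_const)

section \<open>Smoothness and smooth convergence of sums, products, composites and elementary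
  functions\<close>

lemma smooth_on_const [simp]: "smooth_on S (\<lambda>x. c)"
proof -
  have "iter_deriv vs (\<lambda>x::'a. c) = (if vs = [] then \<lambda>x. c else (\<lambda>x. 0))" for vs
    by (induction vs) auto
  then show ?thesis unfolding smooth_on_def by auto
qed

lemma smooth_on_linear:
  assumes "bounded_linear f" "open S" shows "smooth_on S f"
proof -
  have D: "(f has_derivative f) (at x)" for x
    using assms by (rule_tac bounded_linear_imp_has_derivative)
  then have "ddir v f = (\<lambda>x. f v)" for v using ddir_eqI by fastforce
  then show ?thesis using D smooth_on_rec unfolding differentiable_def by (metis smooth_on_const)
qed

lemma smooth_on_add:
  assumes S: "open S" and "smooth_on S f" "smooth_on S g" shows "smooth_on S (\<lambda>x. f x + g x)"
proof (rule smooth_on_coinduct[OF S, where P = "\<lambda>h. \<exists>f g. smooth_on S f \<and> smooth_on S g \<and> h = (\<lambda>x. f x + g x)"])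
  show "\<exists>fa ga. smooth_on S fa \<and> smooth_on S ga \<and> (\<lambda>x. f x + g x) = (\<lambda>x. fa x + ga x)" using assms by blast
next
  fix h assume "\<exists>f g. smooth_on S f \<and> smooth_on S g \<and> h = (\<lambda>x. f x + g x)"
  then obtain f g where h: "smooth_on S f" "smooth_on S g" "h = (\<lambda>x. f x + g x)" by blast
  have D: "(h has_derivative (\<lambda>v. ddir v f x + ddir v g x)) (at x)" if "x \<in> S" for x
    unfolding h using that h(1,2) by (auto intro!: has_derivative_add smooth_on_has_derivative)
  show "(\<forall>x\<in>S. h differentiable at x) \<and>
     (\<forall>v. \<exists>ga. (\<exists>f g. smooth_on S f \<and> smooth_on S g \<and> ga = (\<lambda>x. f x + g x)) \<and> (\<forall>x\<in>S. ddir v h x = ga x))"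
  proof (intro conjI ballI allI)
    show "h differentiable (at x)" if "x \<in> S" for x
      using D[OF that] unfolding differentiable_def by blast
    show "\<exists>ga. (\<exists>f g. smooth_on S f \<and> smooth_on S g \<and> ga = (\<lambda>x. f x + g x)) \<and> (\<forall>x\<in>S. ddir v h x = ga x)" for v
      using h(1,2) ddir_eqI[OF D]
      by (intro exI[of _ "\<lambda>x. ddir v f x + ddir v g x"] conjI exI[of _ "ddir v f"] exI[of _ "ddir v g"])
        (auto intro: smooth_on_ddir)
  qed
qed

lemma smooth_on_sum:
  assumes S: "open S" and "\<And>i. i \<in> I \<Longrightarrow> smooth_on S (f i)"
  shows "smooth_on S (\<lambda>x. \<Sum>i\<in>I. f i x)"
  using assms(2) by (induction I rule: infinite_finite_induct) (auto intro: smooth_on_add[OF S])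

text \<open>The Leibniz and chain rules produce sums of terms of the original shape. Building the
  sums into the invariant leaves only single terms to be differentiated.\<close>

inductive sum_closure :: "('b \<Rightarrow> 'c::comm_monoid_add) set \<Rightarrow> ('b \<Rightarrow> 'c) \<Rightarrow> bool" for B where
  zero: "sum_closure B (\<lambda>x. 0)"
| base: "f \<in> B \<Longrightarrow> sum_closure B f"
| add: "sum_closure B f \<Longrightarrow> sum_closure B g \<Longrightarrow> sum_closure B (\<lambda>x. f x + g x)"

lemma sum_closure_sum:
  "finite I \<Longrightarrow> (\<And>i. i \<in> I \<Longrightarrow> sum_closure B (f i)) \<Longrightarrow> sum_closure B (\<lambda>x. \<Sum>i\<in>I. f i x)"
  by (induction I rule: finite_induct) (auto intro: sum_closure.intros)

lemma smooth_on_sum_closure: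
  assumes S: "open S" and "sum_closure B f"
    and step: "\<And>f v. f \<in> B \<Longrightarrow>
      (\<forall>x\<in>S. f differentiable (at x)) \<and> (\<exists>g. sum_closure B g \<and> (\<forall>x\<in>S. ddir v f x = g x))"
  shows "smooth_on S f"
proof (rule smooth_on_coinduct[OF S, where P = "sum_closure B"])
  show "sum_closure B f" by fact
  show "(\<forall>x\<in>S. f differentiable at x) \<and> (\<forall>v. \<exists>g. sum_closure B g \<and> (\<forall>x\<in>S. ddir v f x = g x))"
    if "sum_closure B f" for f
    using that
  proof induction
    case zero
    show ?case by (auto simp: ddir_def intro!: exI[of _ "\<lambda>x. 0"] sum_closure.zero)
  next
    case (base f)
    then show ?case using step by blast
  next
    case (add f g)
    have D: "((\<lambda>x. f x + g x) has_derivative (\<lambda>v. ddir v f x + ddir v g x)) (at x)" if "x \<in> S" for x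
      using that add.IH by (auto intro!: has_derivative_add has_derivative_ddir)
    have "\<exists>h. sum_closure B h \<and> (\<forall>x\<in>S. ddir v (\<lambda>x. f x + g x) x = h x)" for v
    proof -
      obtain f' g' where "sum_closure B f'" "\<forall>x\<in>S. ddir v f x = f' x"
        "sum_closure B g'" "\<forall>x\<in>S. ddir v g x = g' x" using add.IH by blast
      then show ?thesis
        by (intro exI[of _ "\<lambda>x. f' x + g' x"]) (auto intro: sum_closure.add simp: ddir_eqI[OF D])
    qed
    then show ?case using D unfolding differentiable_def by blast
  qed
qed

lemma smooth_on_bilinear:
  assumes S: "open S" and f: "smooth_on S f" and g: "smooth_on S g" and b: "bounded_bilinear pr"
  shows "smooth_on S (\<lambda>x. pr (f x) (g x))"
proof -
  let ?B = "{h. \<exists>f g. smooth_on S f \<and> smooth_on S g \<and> h = (\<lambda>x. pr (f x) (g x))}"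
  have mem: "(\<lambda>x. pr (f x) (g x)) \<in> ?B" if "smooth_on S f" "smooth_on S g" for f g
    using that by auto
  show ?thesis
  proof (rule smooth_on_sum_closure[OF S, where B = ?B])
    show "sum_closure ?B (\<lambda>x. pr (f x) (g x))" by (rule sum_closure.base[OF mem[OF f g]])
    fix h v assume "h \<in> ?B"
    then obtain f g where h: "smooth_on S f" "smooth_on S g" "h = (\<lambda>x. pr (f x) (g x))" by blast
    have D: "(h has_derivative (\<lambda>v. pr (f x) (ddir v g x) + pr (ddir v f x) (g x))) (at x)" if "x \<in> S" for x
      unfolding h(3) using that h(1,2)
      by (intro bounded_bilinear.FDERIV[OF b] smooth_on_has_derivative)
    have "sum_closure ?B (\<lambda>x. pr (f x) (ddir v g x) + pr (ddir v f x) (g x))"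
      by (intro sum_closure.add sum_closure.base mem smooth_on_ddir h)
    then show "(\<forall>x\<in>S. h differentiable at x) \<and> (\<exists>g. sum_closure ?B g \<and> (\<forall>x\<in>S. ddir v h x = g x))"
      using D ddir_eqI[OF D] unfolding differentiable_def
      by (intro conjI exI[of _ "\<lambda>x. pr (f x) (ddir v g x) + pr (ddir v f x) (g x)"]) auto
  qed
qed

lemmas smooth_on_scaleR = smooth_on_bilinear[OF _ _ _ bounded_bilinear_scaleR]
lemmas smooth_on_mult = smooth_on_bilinear[OF _ _ _ bounded_bilinear_mult]
lemmas smooth_on_inner = smooth_on_bilinear[OF _ _ _ bounded_bilinear_inner]

lemma smooth_on_prod:
  fixes f :: "'i \<Rightarrow> 'b::real_normed_vector \<Rightarrow> 'c::{real_normed_algebra, comm_ring_1}"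
  assumes S: "open S" and "\<And>i. i \<in> I \<Longrightarrow> smooth_on S (f i)"
  shows "smooth_on S (\<lambda>x. \<Prod>i\<in>I. f i x)"
  using assms(2) by (induction I rule: infinite_finite_induct) (auto intro: smooth_on_mult[OF S])

text \<open>The inner direction \<open>ddir v f x\<close> varies with \<open>x\<close>, so the
  derivative of \<open>h\<close> in that direction is not a fixed function composed with
  \<open>f\<close>. Expanding it in \<open>Basis\<close> yields fixed directions and scalar
  coefficients, a shape that the coinductions can iterate.\<close>

lemma ddir_chain:
  fixes f :: "'b::real_normed_vector \<Rightarrow> 'c::euclidean_space" and h :: "'c \<Rightarrow> 'd::real_normed_vector"
  assumes "f differentiable (at x)" "h differentiable (at (f x))"
  shows "((\<lambda>x. h (f x)) has_derivative (\<lambda>v. \<Sum>i\<in>Basis. (ddir v f x \<bullet> i) *\<^sub>R ddir i h (f x))) (at x)"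
proof -
  have D: "((\<lambda>x. h (f x)) has_derivative (\<lambda>v. ddir (ddir v f x) h (f x))) (at x)"
    using has_derivative_compose[OF has_derivative_ddir[OF assms(1)] has_derivative_ddir[OF assms(2)]] .
  have l: "linear (\<lambda>v. ddir v h (f x))"
    using linear_frechet_derivative[OF assms(2)] by (simp add: ddir_def)
  have "ddir w h (f x) = (\<Sum>i\<in>Basis. (w \<bullet> i) *\<^sub>R ddir i h (f x))" for w
  proof -
    have "ddir w h (f x) = ddir (\<Sum>i\<in>Basis. (w \<bullet> i) *\<^sub>R i) h (f x)" by (simp add: euclidean_representation)
    also have "\<dots> = (\<Sum>i\<in>Basis. (w \<bullet> i) *\<^sub>R ddir i h (f x))"
      by (simp only: linear_sum[OF l] linear_scale[OF l])
    finally show ?thesis .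
  qed
  then have "(\<lambda>v. ddir (ddir v f x) h (f x)) = (\<lambda>v. \<Sum>i\<in>Basis. (ddir v f x \<bullet> i) *\<^sub>R ddir i h (f x))"
    by (intro ext)
  with D show ?thesis by metis
qed

inductive seq_sum_closure ::
    "((nat \<Rightarrow> 'b \<Rightarrow> 'c::comm_monoid_add) \<Rightarrow> ('b \<Rightarrow> 'c) \<Rightarrow> bool) \<Rightarrow> (nat \<Rightarrow> 'b \<Rightarrow> 'c) \<Rightarrow> ('b \<Rightarrow> 'c) \<Rightarrow> bool"
  for B where
  zero: "seq_sum_closure B (\<lambda>k x. 0) (\<lambda>x. 0)"
| base: "B F f \<Longrightarrow> seq_sum_closure B F f"
| add: "seq_sum_closure B F f \<Longrightarrow> seq_sum_closure B G g \<Longrightarrow>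
    seq_sum_closure B (\<lambda>k x. F k x + G k x) (\<lambda>x. f x + g x)"

lemma seq_sum_closure_sum:
  "finite I \<Longrightarrow> (\<And>i. i \<in> I \<Longrightarrow> seq_sum_closure B (F i) (f i)) \<Longrightarrow>
    seq_sum_closure B (\<lambda>k x. \<Sum>i\<in>I. F i k x) (\<lambda>x. \<Sum>i\<in>I. f i x)"
  by (induction I rule: finite_induct) (auto intro: seq_sum_closure.intros)

lemma cinf_tendsto_sum_closure:
  assumes S: "open S" and "seq_sum_closure B F f"
    and lim: "\<And>F f K. B F f \<Longrightarrow> compact K \<Longrightarrow> K \<subseteq> S \<Longrightarrow> uniform_limit K F f sequentially"
    and diff: "\<And>F f x k. B F f \<Longrightarrow> x \<in> S \<Longrightarrow> f differentiable (at x) \<and> F k differentiable (at x)"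
    and step: "\<And>F f v. B F f \<Longrightarrow> \<exists>G g. seq_sum_closure B G g \<and>
       (\<forall>x\<in>S. ddir v f x = g x) \<and> (\<forall>k. \<forall>x\<in>S. ddir v (F k) x = G k x)"
  shows "cinf_tendsto S F f"
proof (rule cinf_tendsto_coinduct[OF S, where P = "seq_sum_closure B"])
  show "seq_sum_closure B F f" by fact
  show "uniform_limit K F f sequentially" if "seq_sum_closure B F f" "compact K" "K \<subseteq> S" for F f K
    using that by induction (auto intro: lim uniform_limit_add uniform_limit_const)
  show "\<exists>G g. seq_sum_closure B G g \<and> (\<forall>x\<in>S. ddir v f x = g x) \<and> (\<forall>k. \<forall>x\<in>S. ddir v (F k) x = G k x)"
    if "seq_sum_closure B F f" for F f v
  proof -
    have "(\<exists>G g. seq_sum_closure B G g \<and> (\<forall>x\<in>S. ddir v f x = g x) \<and> (\<forall>k. \<forall>x\<in>S. ddir v (F k) x = G k x)) \<and>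
      (\<forall>x\<in>S. f differentiable (at x)) \<and> (\<forall>k. \<forall>x\<in>S. F k differentiable (at x))"
      using that
    proof induction
      case zero
      show ?case
        by (intro conjI exI[of _ "\<lambda>k x. 0"] exI[of _ "\<lambda>x. 0"] seq_sum_closure.zero) (auto simp: ddir_def)
    next
      case (base F f)
      then show ?case using step[of F f v] diff by blast
    next
      case (add F f G g)
      obtain F' f' G' g' where
        1: "seq_sum_closure B F' f'" "\<forall>x\<in>S. ddir v f x = f' x" "\<forall>k. \<forall>x\<in>S. ddir v (F k) x = F' k x" and
        2: "seq_sum_closure B G' g'" "\<forall>x\<in>S. ddir v g x = g' x" "\<forall>k. \<forall>x\<in>S. ddir v (G k) x = G' k x"
        using add.IH by blast
      have "\<exists>H h. seq_sum_closure B H h \<and> (\<forall>x\<in>S. ddir v (\<lambda>x. f x + g x) x = h x) \<and>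
          (\<forall>k. \<forall>x\<in>S. ddir v (\<lambda>x. F k x + G k x) x = H k x)"
      proof (intro exI conjI)
        show "seq_sum_closure B (\<lambda>k x. F' k x + G' k x) (\<lambda>x. f' x + g' x)"
          by (rule seq_sum_closure.add[OF 1(1) 2(1)])
        show "\<forall>x\<in>S. ddir v (\<lambda>x. f x + g x) x = f' x + g' x" using 1 2 add.IH by (simp add: ddir_add)
        show "\<forall>k. \<forall>x\<in>S. ddir v (\<lambda>x. F k x + G k x) x = F' k x + G' k x" using 1 2 add.IH by (simp add: ddir_add)
      qed
      then show ?case using add.IH by auto
    qed
    then show ?thesis by blast
  qed
qed

lemma has_derivative_scaleR_compose:
  fixes f :: "'b::real_normed_vector \<Rightarrow> 'c::euclidean_space" and h :: "'c \<Rightarrow> 'd::real_normed_vector"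
  assumes "f differentiable (at x)" "a differentiable (at x)" "h differentiable (at (f x))"
  shows "((\<lambda>x. a x *\<^sub>R h (f x)) has_derivative
     (\<lambda>v. ddir v a x *\<^sub>R h (f x) + (\<Sum>i\<in>Basis. (a x * (ddir v f x \<bullet> i)) *\<^sub>R ddir i h (f x)))) (at x)"
proof -
  have "((\<lambda>x. a x *\<^sub>R h (f x)) has_derivative
     (\<lambda>v. a x *\<^sub>R (\<Sum>i\<in>Basis. (ddir v f x \<bullet> i) *\<^sub>R ddir i h (f x)) + ddir v a x *\<^sub>R h (f x))) (at x)"
    by (rule has_derivative_scaleR[OF has_derivative_ddir[OF assms(2)] ddir_chain[OF assms(1,3)]])
  then show ?thesis by (simp add: scaleR_sum_right add.commute)
qed

text \<open>Up to sums, the class of all \<open>a x *\<^sub>R h (f x)\<close> with smooth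
  \<open>a\<close> and \<open>h\<close> is closed under differentiation: components of the
  derivative of \<open>f\<close> are collected in the scalar \<open>a\<close>, and \<open>h\<close>
  is replaced by a partial derivative.\<close>

lemma smooth_on_compose:
  fixes f :: "'b::real_normed_vector \<Rightarrow> 'c::euclidean_space" and h :: "'c \<Rightarrow> 'd::real_normed_vector"
  assumes S: "open S" and f: "smooth_on S f" and fST: "f ` S \<subseteq> T" and h: "smooth_on T h"
  shows "smooth_on S (\<lambda>x. h (f x))"
proof -
  let ?B = "{g. \<exists>a h. smooth_on S a \<and> smooth_on T h \<and> g = (\<lambda>x. a x *\<^sub>R h (f x))}"
  have mem: "(\<lambda>x. a x *\<^sub>R h (f x)) \<in> ?B" if "smooth_on S a" "smooth_on T h" for a h
    using that by auto
  show ?thesis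
  proof (rule smooth_on_sum_closure[OF S, where B = ?B])
    show "sum_closure ?B (\<lambda>x. h (f x))"
      using mem[OF smooth_on_const[of S 1] h] by (intro sum_closure.base) simp
    fix g v assume "g \<in> ?B"
    then obtain a h where g: "smooth_on S a" "smooth_on T h" "g = (\<lambda>x. a x *\<^sub>R h (f x))" by blast
    let ?D = "\<lambda>v x. ddir v a x *\<^sub>R h (f x) + (\<Sum>i\<in>Basis. (a x * (ddir v f x \<bullet> i)) *\<^sub>R ddir i h (f x))"
    have D: "(g has_derivative (\<lambda>v. ?D v x)) (at x)" if "x \<in> S" for x
      unfolding g(3)
      by (rule has_derivative_scaleR_compose)
        (use that f g(1,2) fST in \<open>auto intro: smooth_on_differentiable\<close>)
    have "sum_closure ?B (?D v)"
      by (intro sum_closure.add sum_closure_sum sum_closure.base finite_Basis mem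
        smooth_on_mult[OF S] smooth_on_inner[OF S] smooth_on_ddir g f smooth_on_const)
    then show "(\<forall>x\<in>S. g differentiable at x) \<and> (\<exists>h. sum_closure ?B h \<and> (\<forall>x\<in>S. ddir v g x = h x))"
      using D ddir_eqI[OF D] unfolding differentiable_def by (intro conjI exI[of _ "?D v"]) auto
  qed
qed

text \<open>The scalar factor is present for the sake of the coinduction. Only \<open>h\<close>
  varies with \<open>k\<close>; the coefficients created by the chain rule come from the fixed map
  \<open>f\<close>, and their boundedness on compact sets suffices.\<close>

lemma cinf_tendsto_scaleR_compose:
  fixes f :: "'b::real_normed_vector \<Rightarrow> 'c::euclidean_space" and h :: "'c \<Rightarrow> 'd::real_normed_vector"
  assumes S: "open S" and f: "smooth_on S f" and fST: "f ` S \<subseteq> T" and a: "smooth_on S a"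
    and h: "smooth_on T h" "\<And>k. smooth_on T (H k)" "cinf_tendsto T H h"
  shows "cinf_tendsto S (\<lambda>k x. a x *\<^sub>R H k (f x)) (\<lambda>x. a x *\<^sub>R h (f x))"
proof -
  define B where "B = (\<lambda>(G :: nat \<Rightarrow> 'b \<Rightarrow> 'd) (g :: 'b \<Rightarrow> 'd). \<exists>a H h.
     smooth_on S a \<and> smooth_on T h \<and> (\<forall>k. smooth_on T (H k)) \<and> cinf_tendsto T H h \<and>
     G = (\<lambda>k x. a x *\<^sub>R H k (f x)) \<and> g = (\<lambda>x. a x *\<^sub>R h (f x)))"
  show ?thesis
  proof (rule cinf_tendsto_sum_closure[OF S, where B = B])
    show "seq_sum_closure B (\<lambda>k x. a x *\<^sub>R H k (f x)) (\<lambda>x. a x *\<^sub>R h (f x))"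
      using a h by (intro seq_sum_closure.base) (auto simp: B_def)
  next
    fix G g and K :: "'b set" assume "B G g" and K: "compact K" "K \<subseteq> S"
    then obtain a H h where g: "smooth_on S a" "smooth_on T h" "cinf_tendsto T H h"
      "G = (\<lambda>k x. a x *\<^sub>R H k (f x))" "g = (\<lambda>x. a x *\<^sub>R h (f x))" unfolding B_def by blast
    have cf: "continuous_on K f" "continuous_on K a"
      using f g(1) K smooth_on_continuous continuous_on_subset by blast+
    \<comment> \<open>Uniform convergence of \<open>H\<close> is used on the compact image of
      \<open>K\<close> and pulled back along \<open>f\<close>.\<close>
    have fK: "compact (f ` K)" "f ` K \<subseteq> T" using cf K fST by (auto intro: compact_continuous_image)
    have "uniform_limit (f ` K) H h sequentially" using cinf_tendsto_uniform[OF g(3) fK] .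
    then have 1: "uniform_limit K (\<lambda>k x. H k (f x)) (\<lambda>x. h (f x)) sequentially"
      by (auto simp: uniform_limit_iff)
    have hf: "continuous_on (f ` K) h"
      using g(2) fK smooth_on_continuous continuous_on_subset by blast
    have 2: "bounded ((\<lambda>x. h (f x)) ` K)"
      using compact_imp_bounded[OF compact_continuous_image[OF hf fK(1)]] by (simp add: image_image)
    have 3: "bounded (a ` K)" using compact_imp_bounded compact_continuous_image cf K by blast
    show "uniform_limit K G g sequentially"
      unfolding g(4,5)
      by (rule bounded_bilinear.bounded_uniform_limit[OF bounded_bilinear_scaleR uniform_limit_const 1 2 3])
  next
    fix G g x k assume "B G g" "x \<in> S"
    then obtain a H h where g: "smooth_on S a" "smooth_on T h" "\<forall>k. smooth_on T (H k)"
      "G = (\<lambda>k x. a x *\<^sub>R H k (f x))" "g = (\<lambda>x. a x *\<^sub>R h (f x))" unfolding B_def by blast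
    have "(\<lambda>x. a x *\<^sub>R h (f x)) differentiable (at x)" if "smooth_on T h" for h
      unfolding differentiable_def
      by (rule exI, rule has_derivative_scaleR_compose)
        (use that \<open>x \<in> S\<close> f g(1) fST in \<open>auto intro: smooth_on_differentiable\<close>)
    then show "g differentiable (at x) \<and> G k differentiable (at x)"
      using g by auto
  next
    fix G g v assume "B G g"
    then obtain a H h where g: "smooth_on S a" "smooth_on T h" "\<forall>k. smooth_on T (H k)" "cinf_tendsto T H h"
      "G = (\<lambda>k x. a x *\<^sub>R H k (f x))" "g = (\<lambda>x. a x *\<^sub>R h (f x))" unfolding B_def by blast
    have D: "ddir v (\<lambda>x. a x *\<^sub>R h (f x)) x =
     ddir v a x *\<^sub>R h (f x) + (\<Sum>i\<in>Basis. (a x * (ddir v f x \<bullet> i)) *\<^sub>R ddir i h (f x))"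
      if "x \<in> S" "smooth_on T h" for x h
      by (rule ddir_eqI[OF has_derivative_scaleR_compose]) (use that f g(1) fST in \<open>auto intro: smooth_on_differentiable\<close>)
    have SC: "seq_sum_closure B
       (\<lambda>k x. ddir v a x *\<^sub>R H k (f x) + (\<Sum>i\<in>Basis. (a x * (ddir v f x \<bullet> i)) *\<^sub>R ddir i (H k) (f x)))
       (\<lambda>x. ddir v a x *\<^sub>R h (f x) + (\<Sum>i\<in>Basis. (a x * (ddir v f x \<bullet> i)) *\<^sub>R ddir i h (f x)))"
    proof (intro seq_sum_closure.add seq_sum_closure_sum seq_sum_closure.base finite_Basis)
      show "B (\<lambda>k x. ddir v a x *\<^sub>R H k (f x)) (\<lambda>x. ddir v a x *\<^sub>R h (f x))"
        unfolding B_def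
        by (rule exI[of _ "ddir v a"], rule exI[of _ H], rule exI[of _ h]) (use g smooth_on_ddir in auto)
      fix i :: 'c
      have "smooth_on S (\<lambda>x. a x * (ddir v f x \<bullet> i))"
        using g f by (intro smooth_on_mult[OF S] smooth_on_inner[OF S] smooth_on_ddir smooth_on_const)
      moreover have "\<forall>k. smooth_on T (ddir i (H k))" using g smooth_on_ddir by blast
      ultimately show "B (\<lambda>k x. (a x * (ddir v f x \<bullet> i)) *\<^sub>R ddir i (H k) (f x))
         (\<lambda>x. (a x * (ddir v f x \<bullet> i)) *\<^sub>R ddir i h (f x))"
        unfolding B_def
        by (intro exI[of _ "\<lambda>x. a x * (ddir v f x \<bullet> i)"] exI[of _ "\<lambda>k. ddir i (H k)"] exI[of _ "ddir i h"])
          (auto intro: smooth_on_ddir[OF g(2)] cinf_tendsto_ddir[OF g(4)])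
    qed
    show "\<exists>G' g'. seq_sum_closure B G' g' \<and> (\<forall>x\<in>S. ddir v g x = g' x) \<and> (\<forall>k. \<forall>x\<in>S. ddir v (G k) x = G' k x)"
      unfolding g(5,6) by (rule exI, rule exI, rule conjI, rule SC) (use D g(2,3) in auto)
  qed
qed

lemma cinf_tendsto_compose:
  fixes f :: "'b::real_normed_vector \<Rightarrow> 'c::euclidean_space" and h :: "'c \<Rightarrow> 'd::real_normed_vector"
  assumes "open S" "smooth_on S f" "f ` S \<subseteq> T"
    and "smooth_on T h" "\<And>k. smooth_on T (H k)" "cinf_tendsto T H h"
  shows "cinf_tendsto S (\<lambda>k x. H k (f x)) (\<lambda>x. h (f x))"
  using cinf_tendsto_scaleR_compose[OF assms(1-3) smooth_on_const[of S 1] assms(4-6)] by simp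

lemma bounded_linear_ddir:
  assumes "bounded_linear L" "f differentiable (at x)"
  shows "ddir v (\<lambda>x. L (f x)) x = L (ddir v f x)"
  by (rule ddir_eqI[OF bounded_linear.has_derivative[OF assms(1) has_derivative_ddir[OF assms(2)]]])

lemma cinf_tendsto_add:
  assumes S: "open S" and "smooth_on S f" "\<And>k. smooth_on S (F k)" "cinf_tendsto S F f"
    "smooth_on S g" "\<And>k. smooth_on S (G k)" "cinf_tendsto S G g"
  shows "cinf_tendsto S (\<lambda>k x. F k x + G k x) (\<lambda>x. f x + g x)"
proof -
  let ?B = "\<lambda>F f. smooth_on S f \<and> (\<forall>k. smooth_on S (F k)) \<and> cinf_tendsto S F f"
  show ?thesis
  proof (rule cinf_tendsto_sum_closure[OF S, where B = ?B])
    show "seq_sum_closure ?B (\<lambda>k x. F k x + G k x) (\<lambda>x. f x + g x)"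
      using assms by (intro seq_sum_closure.add seq_sum_closure.base) auto
    show "\<exists>G g. seq_sum_closure ?B G g \<and> (\<forall>x\<in>S. ddir v f x = g x) \<and> (\<forall>k. \<forall>x\<in>S. ddir v (F k) x = G k x)"
      if "?B F f" for F f v
      using that smooth_on_ddir cinf_tendsto_ddir
      by (intro exI[of _ "\<lambda>k. ddir v (F k)"] exI[of _ "ddir v f"] conjI seq_sum_closure.base) auto
  qed (auto intro: cinf_tendsto_uniform smooth_on_differentiable)
qed

lemma cinf_tendsto_linear:
  assumes S: "open S" and L: "bounded_linear L" and "smooth_on S f" "\<And>k. smooth_on S (F k)" "cinf_tendsto S F f"
  shows "cinf_tendsto S (\<lambda>k x. L (F k x)) (\<lambda>x. L (f x))"
proof -
  let ?P = "\<lambda>G g. \<exists>F f. smooth_on S f \<and> (\<forall>k. smooth_on S (F k)) \<and> cinf_tendsto S F f \<and>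
    G = (\<lambda>k x. L (F k x)) \<and> g = (\<lambda>x. L (f x))"
  show ?thesis
  proof (rule cinf_tendsto_coinduct[OF S, where P = ?P])
    show "?P (\<lambda>k x. L (F k x)) (\<lambda>x. L (f x))" using assms by blast
    show "uniform_limit K F f sequentially" if "?P F f" "compact K" "K \<subseteq> S" for F f K
      using that cinf_tendsto_uniform bounded_linear.uniform_limit[OF L] by blast
    show "\<exists>G g. ?P G g \<and> (\<forall>x\<in>S. ddir v f x = g x) \<and> (\<forall>k. \<forall>x\<in>S. ddir v (F k) x = G k x)"
      if FF: "?P F f" for F f v
    proof -
      obtain F' f' where F: "smooth_on S f'" "\<forall>k. smooth_on S (F' k)" "cinf_tendsto S F' f'"
        "F = (\<lambda>k x. L (F' k x))" "f = (\<lambda>x. L (f' x))" using FF by blast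
      have SC: "?P (\<lambda>k x. L (ddir v (F' k) x)) (\<lambda>x. L (ddir v f' x))"
        using F smooth_on_ddir cinf_tendsto_ddir
        by (intro exI[of _ "\<lambda>k. ddir v (F' k)"] exI[of _ "ddir v f'"]) auto
      show ?thesis
        unfolding F(4,5)
        by (rule exI, rule exI, rule conjI, rule SC) (use F(1,2) in \<open>auto intro!: bounded_linear_ddir[OF L] intro: smooth_on_differentiable\<close>)
    qed
  qed
qed

lemma smooth_on_linear_compose:
  assumes S: "open S" and L: "bounded_linear L" and f: "smooth_on S f"
  shows "smooth_on S (\<lambda>x. L (f x))"
proof (rule smooth_on_coinduct[OF S, where P = "\<lambda>g. \<exists>f. smooth_on S f \<and> g = (\<lambda>x. L (f x))"])
  show "\<exists>fa. smooth_on S fa \<and> (\<lambda>x. L (f x)) = (\<lambda>x. L (fa x))" using f by blast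
  fix g assume "\<exists>f. smooth_on S f \<and> g = (\<lambda>x. L (f x))"
  then obtain f where f: "smooth_on S f" "g = (\<lambda>x. L (f x))" by blast
  have D: "(g has_derivative (\<lambda>v. L (ddir v f x))) (at x)" if "x \<in> S" for x
    unfolding f(2) by (rule bounded_linear.has_derivative[OF L smooth_on_has_derivative[OF f(1) that]])
  then show "(\<forall>x\<in>S. g differentiable at x) \<and>
     (\<forall>v. \<exists>h. (\<exists>f. smooth_on S f \<and> h = (\<lambda>x. L (f x))) \<and> (\<forall>x\<in>S. ddir v g x = h x))"
  proof (intro conjI ballI allI)
    show "g differentiable at x" if "x \<in> S" for x using D[OF that] unfolding differentiable_def by blast
    show "\<exists>h. (\<exists>f. smooth_on S f \<and> h = (\<lambda>x. L (f x))) \<and> (\<forall>x\<in>S. ddir v g x = h x)" for v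
      using ddir_eqI[OF D] smooth_on_ddir[OF f(1)]
      by (intro exI[of _ "\<lambda>x. L (ddir v f x)"] conjI exI[of _ "ddir v f"]) auto
  qed
qed

lemma smooth_on_minus:
  assumes "open S" "smooth_on S f" "smooth_on S g" shows "smooth_on S (\<lambda>x. f x - g x)"
  using smooth_on_add[OF assms(1,2) smooth_on_linear_compose[OF assms(1) bounded_linear_minus[OF bounded_linear_ident] assms(3)]]
  by simp

lemma smooth_on_exp:
  fixes S :: "'c::{real_normed_field,banach} set"
  assumes S: "open S" shows "smooth_on S (exp :: 'c \<Rightarrow> 'c)"
proof (rule smooth_on_coinduct[OF S, where P = "\<lambda>g. \<exists>c. g = (\<lambda>x. exp x * c)"])
  show "\<exists>c. exp = (\<lambda>x::'c. exp x * c)" by (intro exI[of _ 1]) auto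
  fix g :: "'c \<Rightarrow> 'c" assume "\<exists>c. g = (\<lambda>x. exp x * c)"
  then obtain c where g: "g = (\<lambda>x. exp x * c)" by blast
  have D: "(g has_derivative (\<lambda>v. (exp x * v) * c)) (at x)" for x
    unfolding g by (intro has_derivative_mult_left) (use DERIV_exp[of x] in \<open>simp add: has_field_derivative_def\<close>)
  then show "(\<forall>x\<in>S. g differentiable at x) \<and> (\<forall>v. \<exists>ga. (\<exists>c. ga = (\<lambda>x. exp x * c)) \<and> (\<forall>x\<in>S. ddir v g x = ga x))"
  proof (intro conjI ballI allI)
    show "g differentiable at x" for x using D unfolding differentiable_def by blast
    show "\<exists>ga. (\<exists>c. ga = (\<lambda>x. exp x * c)) \<and> (\<forall>x\<in>S. ddir v g x = ga x)" for v
      using ddir_eqI[OF D]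
      by (intro exI[of _ "\<lambda>x. exp x * (v * c)"] conjI) (auto simp: mult.assoc)
  qed
qed

lemma smooth_on_inverse:
  fixes S :: "'c::real_normed_field set"
  assumes S: "open S" "0 \<notin> S" shows "smooth_on S (inverse :: 'c \<Rightarrow> 'c)"
proof (rule smooth_on_coinduct[OF S(1), where P = "\<lambda>g. \<exists>c n. g = (\<lambda>x. inverse x ^ n * c)"])
  show "\<exists>c n. inverse = (\<lambda>x::'c. inverse x ^ n * c)" by (intro exI[of _ 1]) auto
  fix g :: "'c \<Rightarrow> 'c" assume "\<exists>c n. g = (\<lambda>x. inverse x ^ n * c)"
  then obtain c n where g: "g = (\<lambda>x. inverse x ^ n * c)" by blast
  have D: "(g has_derivative (\<lambda>v. inverse x ^ Suc n * (- of_nat n * v * c))) (at x)" if "x \<in> S" for x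
  proof -
    have x: "x \<noteq> 0" using that S by auto
    have "(g has_field_derivative (of_nat n * (- (inverse x ^ Suc (Suc 0)) * inverse x ^ (n - Suc 0)) * c)) (at x)"
      unfolding g using x by (auto intro!: derivative_eq_intros simp: power2_eq_square)
    \<comment> \<open>The exponent \<open>n - Suc 0\<close> is truncated for \<open>n = 0\<close>;
      the factor \<open>of_nat n\<close> vanishes in that case.\<close>
    moreover have "of_nat n * (- (inverse x ^ Suc (Suc 0)) * inverse x ^ (n - Suc 0)) * c = inverse x ^ Suc n * (- of_nat n * c)"
      by (cases n) (auto simp: algebra_simps)
    ultimately have "(g has_field_derivative (inverse x ^ Suc n * (- of_nat n * c))) (at x)" by metis
    then show ?thesis unfolding has_field_derivative_def
      by (rule has_derivative_eq_rhs) (simp add: fun_eq_iff mult_ac)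
  qed
  then show "(\<forall>x\<in>S. g differentiable at x) \<and> (\<forall>v. \<exists>ga. (\<exists>c n. ga = (\<lambda>x. inverse x ^ n * c)) \<and> (\<forall>x\<in>S. ddir v g x = ga x))"
  proof (intro conjI ballI allI)
    show "g differentiable at x" if "x \<in> S" for x using D[OF that] unfolding differentiable_def by blast
    show "\<exists>ga. (\<exists>c n. ga = (\<lambda>x. inverse x ^ n * c)) \<and> (\<forall>x\<in>S. ddir v g x = ga x)" for v
      using ddir_eqI[OF D]
      by (intro exI[of _ "\<lambda>x. inverse x ^ Suc n * (- of_nat n * v * c)"] conjI) blast+
  qed
qed

lemma smooth_on_ln: "smooth_on {0::real<..} ln"
proof -
  have D: "(ln has_derivative (\<lambda>v. inverse x * v)) (at x)" if "x > 0" for x :: real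
    using DERIV_ln[OF that] by (simp add: has_field_derivative_def)
  have "smooth_on {0<..} (ddir v ln)" for v :: real
  proof -
    have "smooth_on {0<..} (\<lambda>x::real. inverse x * v)"
      by (intro smooth_on_mult smooth_on_inverse smooth_on_const) auto
    then show ?thesis using smooth_on_cong[of "{0<..}" "ddir v ln" "\<lambda>x. inverse x * v"] ddir_eqI[OF D] by auto
  qed
  then show ?thesis using D unfolding smooth_on_rec[of _ ln] differentiable_def by auto
qed

section \<open>Iterated derivatives of translates and sums, and reduction to coordinate
  directions\<close>

lemma iter_deriv_translate:
  fixes f :: "'a::real_normed_vector \<Rightarrow> 'b::real_normed_vector"
  shows "iter_deriv vs (\<lambda>x. f (x + c)) x = iter_deriv vs f (x + c)"
proof (induction vs arbitrary: x)
  case (Cons v vs)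
  \<comment> \<open>An equivalence of derivative predicates, so that it transports the chosen
    \<open>frechet_derivative\<close> also at points where no derivative exists.\<close>
  have "((\<lambda>x. g (x + c)) has_derivative D) (at x) \<longleftrightarrow> (g has_derivative D) (at (x + c))"
    for g :: "'a \<Rightarrow> 'b" and D
  proof
    assume "(g has_derivative D) (at (x + c))"
    moreover have "((\<lambda>y. y + c) has_derivative (\<lambda>v. v)) (at x)"
      by (auto intro!: derivative_eq_intros)
    ultimately show "((\<lambda>x. g (x + c)) has_derivative D) (at x)"
      using has_derivative_compose[of "\<lambda>x. x + c" "\<lambda>v. v" x UNIV g D] by simp
  next
    assume "((\<lambda>x. g (x + c)) has_derivative D) (at x)"
    moreover have "((\<lambda>y. y - c) has_derivative (\<lambda>v. v)) (at (x + c))"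
      by (auto intro!: derivative_eq_intros)
    ultimately show "(g has_derivative D) (at (x + c))"
      using has_derivative_compose[of "\<lambda>y. y - c" "\<lambda>v. v" "x + c" UNIV "\<lambda>x. g (x + c)" D] by simp
  qed
  then have "frechet_derivative (\<lambda>x. g (x + c)) (at x) = frechet_derivative g (at (x + c))"
    for g :: "'a \<Rightarrow> 'b" by (simp add: frechet_derivative_def)
  moreover have "iter_deriv vs (\<lambda>x. f (x + c)) = (\<lambda>x. iter_deriv vs f (x + c))"
    using Cons.IH by (intro ext)
  ultimately show ?case by simp
qed simp

lemma smooth_on_translate:
  assumes "smooth_on T f" "\<And>x. x \<in> S \<Longrightarrow> x + c \<in> T"
  shows "smooth_on S (\<lambda>x. f (x + c))"
  unfolding smooth_on_def
proof (intro allI ballI)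
  fix vs x assume "x \<in> S"
  then have "(iter_deriv vs f has_derivative frechet_derivative (iter_deriv vs f) (at (x + c))) (at (x + c))"
    using assms unfolding smooth_on_def frechet_derivative_works[symmetric] by blast
  moreover have "((\<lambda>y. y + c) has_derivative (\<lambda>v. v)) (at x)"
    by (auto intro!: derivative_eq_intros)
  ultimately have "((\<lambda>x. iter_deriv vs f (x + c)) has_derivative frechet_derivative (iter_deriv vs f) (at (x + c))) (at x)"
    using has_derivative_compose[of "\<lambda>x. x + c" "\<lambda>v. v" x UNIV "iter_deriv vs f"] by simp
  moreover have "iter_deriv vs (\<lambda>x. f (x + c)) = (\<lambda>x. iter_deriv vs f (x + c))"
    by (rule ext) (rule iter_deriv_translate)
  ultimately show "iter_deriv vs (\<lambda>x. f (x + c)) differentiable at x"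
    unfolding differentiable_def by auto
qed

lemma iter_deriv_add:
  assumes S: "open S" "x \<in> S" and f: "smooth_on S f" "smooth_on S g"
  shows "iter_deriv vs (\<lambda>x. f x + g x) x = iter_deriv vs f x + iter_deriv vs g x"
  using S(2)
proof (induction vs arbitrary: x)
  case (Cons v vs)
  have "ddir v (iter_deriv vs (\<lambda>x. f x + g x)) x = ddir v (\<lambda>x. iter_deriv vs f x + iter_deriv vs g x) x"
    by (rule ddir_cong[OF S(1)]) (use Cons in auto)
  also have "\<dots> = ddir v (iter_deriv vs f) x + ddir v (iter_deriv vs g) x"
    by (rule ddir_add) (use Cons.prems f smooth_on_iter_deriv smooth_on_differentiable in blast)+
  finally show ?case by (simp only: iter_deriv_Cons_ddir)
qed simp

lemma iter_deriv_linear: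
  assumes S: "open S" "x \<in> S" and L: "bounded_linear L" and f: "smooth_on S f"
  shows "iter_deriv vs (\<lambda>x. L (f x)) x = L (iter_deriv vs f x)"
  using S(2)
proof (induction vs arbitrary: x)
  case (Cons v vs)
  have "ddir v (iter_deriv vs (\<lambda>x. L (f x))) x = ddir v (\<lambda>x. L (iter_deriv vs f x)) x"
    by (rule ddir_cong[OF S(1)]) (use Cons in auto)
  also have "\<dots> = L (ddir v (iter_deriv vs f) x)"
    by (rule bounded_linear_ddir[OF L]) (use Cons.prems f smooth_on_iter_deriv smooth_on_differentiable in blast)+
  finally show ?case by (simp only: iter_deriv_Cons_ddir)
qed simp

lemma iter_deriv_zero: "iter_deriv vs (\<lambda>x::'a::real_normed_vector. 0::'b::real_normed_vector) x = 0"
proof -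
  have "iter_deriv vs (\<lambda>x::'a. 0::'b) = (\<lambda>x. 0)" by (induction vs) auto
  then show ?thesis by simp
qed

lemma iter_deriv_sum:
  assumes S: "open S" "x \<in> S" and f: "\<And>i. i \<in> I \<Longrightarrow> smooth_on S (f i)"
  shows "iter_deriv vs (\<lambda>x. \<Sum>i\<in>I. f i x) x = (\<Sum>i\<in>I. iter_deriv vs (f i) x)"
  using f
proof (induction I rule: infinite_finite_induct)
  case (insert i I)
  then have "iter_deriv vs (\<lambda>x. f i x + (\<Sum>i\<in>I. f i x)) x = iter_deriv vs (f i) x + iter_deriv vs (\<lambda>x. \<Sum>i\<in>I. f i x) x"
    by (intro iter_deriv_add[OF S] smooth_on_sum[OF S(1)]) auto
  then show ?case using insert by simp
qed (auto simp: iter_deriv_zero)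

lemma ddir_basis_expansion:
  fixes f :: "'b::euclidean_space \<Rightarrow> 'c::real_normed_vector"
  assumes "f differentiable (at x)"
  shows "ddir v f x = (\<Sum>i\<in>Basis. (v \<bullet> i) *\<^sub>R ddir i f x)"
proof -
  have l: "linear (\<lambda>v. ddir v f x)"
    using linear_frechet_derivative[OF assms] by (simp add: ddir_def)
  have "ddir v f x = ddir (\<Sum>i\<in>Basis. (v \<bullet> i) *\<^sub>R i) f x" by (simp add: euclidean_representation)
  also have "\<dots> = (\<Sum>i\<in>Basis. (v \<bullet> i) *\<^sub>R ddir i f x)"
    by (simp only: linear_sum[OF l] linear_scale[OF l])
  finally show ?thesis .
qed

text \<open>There are only finitely many lists of basis directions of a given length, whereas
  \<open>cinf_tendsto\<close> ranges over all directions. The invariant is stable because a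
  derivative in direction \<open>v\<close> is a linear combination, with constant coefficients, of
  derivatives in basis directions.\<close>

lemma cinf_tendsto_BasisI:
  fixes f :: "'b::euclidean_space \<Rightarrow> 'c::real_normed_vector"
  assumes S: "open S" and f: "smooth_on S f" "\<And>k. smooth_on S (F k)"
    and lim: "\<And>bs K. set bs \<subseteq> Basis \<Longrightarrow> compact K \<Longrightarrow> K \<subseteq> S \<Longrightarrow>
       uniform_limit K (\<lambda>k. iter_deriv bs (F k)) (iter_deriv bs f) sequentially"
  shows "cinf_tendsto S F f"
proof -
  define P where "P = (\<lambda>(F :: nat \<Rightarrow> 'b \<Rightarrow> 'c) (f :: 'b \<Rightarrow> 'c). smooth_on S f \<and> (\<forall>k. smooth_on S (F k)) \<and>
     (\<forall>bs K. set bs \<subseteq> Basis \<longrightarrow> compact K \<longrightarrow> K \<subseteq> S \<longrightarrow>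
       uniform_limit K (\<lambda>k. iter_deriv bs (F k)) (iter_deriv bs f) sequentially))"
  show ?thesis
  proof (rule cinf_tendsto_coinduct[OF S, where P = P])
    show "P F f" using assms by (simp add: P_def)
    show "uniform_limit K F f sequentially" if "P F f" "compact K" "K \<subseteq> S" for F f K
      using that unfolding P_def by (metis (no_types, lifting) ext empty_set empty_subsetI iter_deriv.simps(1))
  next
    fix F f and v :: 'b assume P: "P F f"
    let ?D = "\<lambda>f x. \<Sum>i\<in>Basis. (v \<bullet> i) *\<^sub>R ddir i f x"
    have sm: "smooth_on S (\<lambda>x. (v \<bullet> i) *\<^sub>R ddir i f x)" if "smooth_on S f" for f :: "'b \<Rightarrow> 'c" and i
      by (rule smooth_on_linear_compose[OF S bounded_linear_scaleR_right smooth_on_ddir[OF that]])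
    have it: "iter_deriv bs (?D f) x = (\<Sum>i\<in>Basis. (v \<bullet> i) *\<^sub>R iter_deriv (bs @ [i]) f x)"
      if "smooth_on S f" "x \<in> S" for f :: "'b \<Rightarrow> 'c" and x bs
    proof -
      have "iter_deriv bs (?D f) x = (\<Sum>i\<in>Basis. iter_deriv bs (\<lambda>x. (v \<bullet> i) *\<^sub>R ddir i f x) x)"
        by (rule iter_deriv_sum[OF S that(2)]) (rule sm[OF that(1)])
      also have "\<dots> = (\<Sum>i\<in>Basis. (v \<bullet> i) *\<^sub>R iter_deriv (bs @ [i]) f x)"
      proof (rule sum.cong[OF refl])
        fix i
        show "iter_deriv bs (\<lambda>x. (v \<bullet> i) *\<^sub>R ddir i f x) x = (v \<bullet> i) *\<^sub>R iter_deriv (bs @ [i]) f x"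
          unfolding iter_deriv_snoc
          by (rule iter_deriv_linear[OF S that(2) bounded_linear_scaleR_right smooth_on_ddir[OF that(1)]])
      qed
      finally show ?thesis .
    qed
    have "P (\<lambda>k. ?D (F k)) (?D f)"
      unfolding P_def
    proof (intro conjI allI impI)
      show "smooth_on S (?D f)" "smooth_on S (?D (F k))" for k
        using P sm unfolding P_def by (auto intro!: smooth_on_sum[OF S])
      fix bs :: "'b list" and K :: "'b set" assume bs: "set bs \<subseteq> Basis" and K: "compact K" "K \<subseteq> S"
      have s: "uniform_limit K (\<lambda>k x. \<Sum>i\<in>I. (v \<bullet> i) *\<^sub>R iter_deriv (bs @ [i]) (F k) x)
          (\<lambda>x. \<Sum>i\<in>I. (v \<bullet> i) *\<^sub>R iter_deriv (bs @ [i]) f x) sequentially" if "I \<subseteq> Basis" "finite I" for I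
        using that(2,1)
      proof (induction I rule: finite_induct)
        case (insert j I)
        have "uniform_limit K (\<lambda>k x. (v \<bullet> j) *\<^sub>R iter_deriv (bs @ [j]) (F k) x) (\<lambda>x. (v \<bullet> j) *\<^sub>R iter_deriv (bs @ [j]) f x) sequentially"
          using P bs K insert unfolding P_def
          by (intro bounded_linear.uniform_limit[OF bounded_linear_scaleR_right]) auto
        then show ?case using insert by (auto intro!: uniform_limit_add)
      qed (auto intro: uniform_limit_const)
      have "uniform_limit K (\<lambda>k. iter_deriv bs (?D (F k))) (iter_deriv bs (?D f)) sequentially \<longleftrightarrow>
        uniform_limit K (\<lambda>k x. \<Sum>i\<in>Basis. (v \<bullet> i) *\<^sub>R iter_deriv (bs @ [i]) (F k) x)
          (\<lambda>x. \<Sum>i\<in>Basis. (v \<bullet> i) *\<^sub>R iter_deriv (bs @ [i]) f x) sequentially"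
        by (rule uniform_limit_cong') (use P K it in \<open>auto simp: P_def\<close>)
      then show "uniform_limit K (\<lambda>k. iter_deriv bs (?D (F k))) (iter_deriv bs (?D f)) sequentially"
        using s[of Basis] by simp
    qed
    moreover have "\<forall>x\<in>S. ddir v f x = ?D f x" "\<forall>k. \<forall>x\<in>S. ddir v (F k) x = ?D (F k) x"
      using P unfolding P_def by (auto intro!: ddir_basis_expansion intro: smooth_on_differentiable)
    ultimately show "\<exists>G g. P G g \<and> (\<forall>x\<in>S. ddir v f x = g x) \<and> (\<forall>k. \<forall>x\<in>S. ddir v (F k) x = G k x)"
      by blast
  qed
qed

section \<open>Averages over translates\<close>

text \<open>A left Riemann sum for the mean of \<open>f\<close> over the segment from
  \<open>x\<close> to \<open>x + h\<close>. It takes the place of a convolution because a finite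
  average keeps logarithms of finite exponential sums within their class.\<close>

definition shift_avg :: "nat \<Rightarrow> 'b::real_normed_vector \<Rightarrow> ('b \<Rightarrow> real) \<Rightarrow> 'b \<Rightarrow> real" where
  "shift_avg N h f = (\<lambda>x. (\<Sum>l<N. f (x + (real l / real N) *\<^sub>R h)) / real N)"

text \<open>An entry that is a unit vector moves the argument by at most \<open>e\<close>, which is
  why the radii below shrink by \<open>e\<close> per entry of the list.\<close>

primrec multi_avg :: "nat \<Rightarrow> real \<Rightarrow> 'b::real_normed_vector list \<Rightarrow> ('b \<Rightarrow> real) \<Rightarrow> 'b \<Rightarrow> real" where
  "multi_avg N e [] f = f"
| "multi_avg N e (h # hs) f = shift_avg N (e *\<^sub>R h) (multi_avg N e hs f)"

lemma shift_avg_close: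
  assumes "N \<ge> 1" "\<And>y. y \<in> cball x (norm h) \<Longrightarrow> \<bar>g y - a\<bar> \<le> \<delta>"
  shows "\<bar>shift_avg N h g x - a\<bar> \<le> \<delta>"
proof -
  have 1: "\<bar>g (x + (real l / real N) *\<^sub>R h) - a\<bar> \<le> \<delta>" if "l < N" for l
  proof (rule assms(2))
    have "real l / real N * norm h \<le> 1 * norm h" using that by (intro mult_right_mono) auto
    then show "x + (real l / real N) *\<^sub>R h \<in> cball x (norm h)" by (simp add: dist_norm)
  qed
  have "shift_avg N h g x - a = (\<Sum>l<N. g (x + (real l / real N) *\<^sub>R h) - a) / real N"
    using assms(1) by (simp add: shift_avg_def sum_subtractf diff_divide_distrib)
  also have "\<bar>\<dots>\<bar> \<le> (\<Sum>l<N. \<bar>g (x + (real l / real N) *\<^sub>R h) - a\<bar>) / real N"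
    using sum_abs by (simp add: divide_right_mono)
  also have "\<dots> \<le> (\<Sum>l<N. \<delta>) / real N"
    using 1 by (intro divide_right_mono sum_mono) auto
  finally show ?thesis using assms(1) by simp
qed

lemma multi_avg_close:
  fixes e :: real
  assumes "N \<ge> 1" "e \<ge> 0" "\<And>h. h \<in> set hs \<Longrightarrow> norm h = 1"
    "\<And>y. y \<in> cball x (e * real (length hs)) \<Longrightarrow> \<bar>g y - a\<bar> \<le> \<delta>"
  shows "\<bar>multi_avg N e hs g x - a\<bar> \<le> \<delta>"
  using assms(3,4)
proof (induction hs arbitrary: x)
  case (Cons h hs)
  show ?case
    unfolding multi_avg.simps
  proof (rule shift_avg_close[OF assms(1)])
    fix y assume "y \<in> cball x (norm (e *\<^sub>R h))"
    then have y: "dist x y \<le> e" using Cons.prems assms by simp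
    show "\<bar>multi_avg N e hs g y - a\<bar> \<le> \<delta>"
    proof (rule Cons.IH)
      fix z assume "z \<in> cball y (e * real (length hs))"
      then have "dist x z \<le> e * length (h # hs)"
        using y dist_triangle[of x z y] by (simp add: algebra_simps)
      then show "\<bar>g z - a\<bar> \<le> \<delta>" using Cons.prems by simp
    qed (use Cons.prems in simp)
  qed
qed auto

lemma shift_in_ball:
  assumes "x \<in> ball c r" "l < (N::nat)" "r + norm h \<le> R"
  shows "x + (real l / real N) *\<^sub>R h \<in> ball c R"
proof -
  have "real l / real N * norm h \<le> 1 * norm h" using assms(2) by (intro mult_right_mono) auto
  then have "dist x (x + (real l / real N) *\<^sub>R h) \<le> norm h" by (simp add: dist_norm)
  then show ?thesis using assms dist_triangle[of c "x + (real l / real N) *\<^sub>R h" x] by simp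
qed

lemma smooth_on_shift_avg:
  assumes "smooth_on (ball c R) f" "r + norm h \<le> R"
  shows "smooth_on (ball c r) (shift_avg N h f)"
  unfolding shift_avg_def
  by (intro smooth_on_linear_compose[OF open_ball bounded_linear_divide] smooth_on_sum open_ball
    smooth_on_translate[OF assms(1)]) (use shift_in_ball assms(2) in blast)

lemma iter_deriv_shift_avg:
  assumes f: "smooth_on (ball c R) f" "r + norm h \<le> R" and x: "x \<in> ball c r"
  shows "iter_deriv vs (shift_avg N h f) x = shift_avg N h (iter_deriv vs f) x"
proof -
  have sm: "smooth_on (ball c r) (\<lambda>x. f (x + (real l / real N) *\<^sub>R h))" if "l < N" for l
    by (rule smooth_on_translate[OF f(1)]) (use that shift_in_ball f(2) in blast)
  have "iter_deriv vs (shift_avg N h f) x = iter_deriv vs (\<lambda>x. \<Sum>l<N. f (x + (real l / real N) *\<^sub>R h)) x / real N"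
    unfolding shift_avg_def
    by (rule iter_deriv_linear[OF open_ball x bounded_linear_divide])
      (intro smooth_on_sum open_ball sm, simp)
  also have "iter_deriv vs (\<lambda>x. \<Sum>l<N. f (x + (real l / real N) *\<^sub>R h)) x =
     (\<Sum>l<N. iter_deriv vs (\<lambda>x. f (x + (real l / real N) *\<^sub>R h)) x)"
    by (rule iter_deriv_sum[OF open_ball x]) (use sm in auto)
  finally show ?thesis by (simp add: shift_avg_def iter_deriv_translate)
qed

lemma smooth_on_multi_avg:
  fixes e R :: real
  assumes "smooth_on (ball c R) f" "e \<ge> 0" "\<And>h. h \<in> set hs \<Longrightarrow> norm h = 1"
  shows "smooth_on (ball c (R - e * real (length hs))) (multi_avg N e hs f)"
  using assms(3)
proof (induction hs)
  case (Cons h hs)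
  then show ?case using assms(2)
    by (auto intro!: smooth_on_shift_avg[of c "R - e * real (length hs)"] simp: algebra_simps)
qed (use assms in simp)

lemma iter_deriv_multi_avg:
  fixes e R :: real
  assumes f: "smooth_on (ball c R) f" and e: "e \<ge> 0" "\<And>h. h \<in> set hs \<Longrightarrow> norm h = 1"
    and x: "x \<in> ball c (R - e * real (length hs))"
  shows "iter_deriv vs (multi_avg N e hs f) x = multi_avg N e hs (iter_deriv vs f) x"
  using e(2) x
proof (induction hs arbitrary: x)
  case (Cons h hs)
  have le: "R - e * length (h # hs) + norm (e *\<^sub>R h) \<le> R - e * real (length hs)"
    using Cons.prems e(1) by (simp add: algebra_simps)
  have "iter_deriv vs (multi_avg N e (h # hs) f) x = shift_avg N (e *\<^sub>R h) (iter_deriv vs (multi_avg N e hs f)) x"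
    unfolding multi_avg.simps
    by (rule iter_deriv_shift_avg[OF smooth_on_multi_avg[OF f e(1)] le Cons.prems(2)]) (use Cons.prems in auto)
  also have "\<dots> = shift_avg N (e *\<^sub>R h) (multi_avg N e hs (iter_deriv vs f)) x"
    unfolding shift_avg_def
    by (intro arg_cong2[of _ _ _ _ "(/)"] refl sum.cong Cons.IH shift_in_ball[OF Cons.prems(2) _ le])
      (use Cons.prems in auto)
  finally show ?case by simp
qed simp

text \<open>On each cell the mean value theorem replaces the increment of \<phi> by its derivative
  at an intermediate point, and the Lipschitz bound compares this with the left endpoint. The error
  per cell is \<open>K / real N ^ 2\<close>, and there are \<open>N\<close> cells.\<close>

lemma riemann_sum_error:
  fixes \<phi> :: "real \<Rightarrow> real"
  assumes N: "N \<ge> 1" and d: "\<And>t. t \<in> {0..1} \<Longrightarrow> (\<phi> has_real_derivative \<phi>' t) (at t)"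
    and K: "\<And>s t. s \<in> {0..1} \<Longrightarrow> t \<in> {0..1} \<Longrightarrow> \<bar>\<phi>' s - \<phi>' t\<bar> \<le> K * \<bar>s - t\<bar>" "K \<ge> 0"
  shows "\<bar>\<phi> 1 - \<phi> 0 - (\<Sum>l<N. \<phi>' (real l / real N)) / real N\<bar> \<le> K / real N"
proof -
  have 1: "\<bar>\<phi> (real (Suc l) / real N) - \<phi> (real l / real N) - \<phi>' (real l / real N) / real N\<bar> \<le> K / real N ^ 2"
    if "l < N" for l
  proof -
    let ?a = "real l / real N" and ?b = "real (Suc l) / real N"
    have ab: "?a < ?b" "0 \<le> ?a" "?b \<le> 1" "?b - ?a = 1 / real N" using that by (auto simp: field_simps)
    have "(\<phi> has_real_derivative \<phi>' x) (at x)" if "?a \<le> x" "x \<le> ?b" for x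
      using d that ab by (meson atLeastAtMost_iff order_trans)
    from MVT2[OF ab(1) this] obtain z where z: "?a < z" "z < ?b" "\<phi> ?b - \<phi> ?a = (?b - ?a) * \<phi>' z"
      by blast
    have "\<phi> ?b - \<phi> ?a - \<phi>' ?a / real N = (\<phi>' z - \<phi>' ?a) / real N"
      using z(3) unfolding ab(4) by (simp add: diff_divide_distrib)
    also have "\<bar>\<dots>\<bar> = \<bar>\<phi>' z - \<phi>' ?a\<bar> / real N" by simp
    also have "\<dots> \<le> (K * \<bar>z - ?a\<bar>) / real N"
      using z(1,2) ab order_trans[OF ab(2) less_imp_le[OF z(1)]] by (intro divide_right_mono K) auto
    also have "\<dots> \<le> (K * (1 / real N)) / real N"
      using z ab K by (intro divide_right_mono mult_left_mono) auto
    finally show ?thesis by (simp add: power2_eq_square)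
  qed
  have "(\<Sum>l<N. \<phi> (real (Suc l) / real N) - \<phi> (real l / real N)) = \<phi> 1 - \<phi> 0"
    using sum_lessThan_telescope[of "\<lambda>l. \<phi> (real l / real N)" N] N by simp
  then have "\<phi> 1 - \<phi> 0 - (\<Sum>l<N. \<phi>' (real l / real N)) / real N =
     (\<Sum>l<N. \<phi> (real (Suc l) / real N) - \<phi> (real l / real N) - \<phi>' (real l / real N) / real N)"
    by (simp add: sum_subtractf sum_divide_distrib)
  also have "\<bar>\<dots>\<bar> \<le> (\<Sum>l<N. K / real N ^ 2)"
    using 1 by (intro order_trans[OF sum_abs] sum_mono) auto
  also have "\<dots> = K / real N" using N by (simp add: power2_eq_square)
  finally show ?thesis .
qed

lemma has_real_derivative_line:
  fixes G :: "'b::real_normed_vector \<Rightarrow> real"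
  assumes "G differentiable (at (x + t *\<^sub>R h))"
  shows "((\<lambda>t. G (x + t *\<^sub>R h)) has_real_derivative ddir h G (x + t *\<^sub>R h)) (at t)"
proof -
  have "((\<lambda>t. x + t *\<^sub>R h) has_derivative (\<lambda>s. s *\<^sub>R h)) (at t)"
    by (auto intro!: derivative_eq_intros)
  then have "((\<lambda>t. G (x + t *\<^sub>R h)) has_derivative (\<lambda>s. ddir (s *\<^sub>R h) G (x + t *\<^sub>R h))) (at t)"
    by (rule has_derivative_compose[of "\<lambda>t. x + t *\<^sub>R h" "\<lambda>s. s *\<^sub>R h" t UNIV G "\<lambda>v. ddir v G (x + t *\<^sub>R h)"])
      (rule has_derivative_ddir[OF assms])
  moreover have "ddir (s *\<^sub>R h) G (x + t *\<^sub>R h) = ddir h G (x + t *\<^sub>R h) * s" for s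
    using linear_scale[OF linear_frechet_derivative[OF assms]] by (simp add: ddir_def)
  then have "(\<lambda>s. ddir (s *\<^sub>R h) G (x + t *\<^sub>R h)) = (\<lambda>s. ddir h G (x + t *\<^sub>R h) * s)" by (intro ext)
  ultimately show ?thesis unfolding has_field_derivative_def by metis
qed

text \<open>The mean of a derivative along a segment is the difference of the end values, up to the
  Riemann error. \<open>K\<close> bounds the second derivative in direction \<open>h\<close> and
  serves as the Lipschitz constant.\<close>

lemma shift_avg_deriv:
  fixes G :: "'b::real_normed_vector \<Rightarrow> real"
  assumes G: "smooth_on (ball c R) G" and xr: "x \<in> cball c r" "r + norm h < R" and N: "N \<ge> 1"
    and K: "\<And>y. y \<in> cball c (r + norm h) \<Longrightarrow> \<bar>ddir h (ddir h G) y\<bar> \<le> K"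
  shows "\<bar>G (x + h) - G x - shift_avg N h (ddir h G) x\<bar> \<le> K / real N"
proof -
  have inb: "x + t *\<^sub>R h \<in> cball c (r + norm h)" if "t \<in> {0..1}" for t
  proof -
    have "t * norm h \<le> 1 * norm h" using that by (intro mult_right_mono) auto
    then have "dist x (x + t *\<^sub>R h) \<le> norm h" using that by (simp add: dist_norm)
    then show ?thesis using xr dist_triangle[of c "x + t *\<^sub>R h" x] by simp
  qed
  then have inB: "x + t *\<^sub>R h \<in> ball c R" if "t \<in> {0..1}" for t using that xr(2) by fastforce
  have K0: "K \<ge> 0" using K[OF inb[of 0]] by simp
  have d1: "((\<lambda>t. G (x + t *\<^sub>R h)) has_real_derivative ddir h G (x + t *\<^sub>R h)) (at t)" if "t \<in> {0..1}" for t
    by (intro has_real_derivative_line smooth_on_differentiable[OF G inB[OF that]])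
  have d2: "((\<lambda>t. ddir h G (x + t *\<^sub>R h)) has_real_derivative ddir h (ddir h G) (x + t *\<^sub>R h)) (at t)" if "t \<in> {0..1}" for t
    by (intro has_real_derivative_line smooth_on_differentiable[OF smooth_on_ddir[OF G] inB[OF that]])
  have "\<bar>ddir h G (x + s *\<^sub>R h) - ddir h G (x + t *\<^sub>R h)\<bar> \<le> K * \<bar>s - t\<bar>" if "s \<in> {0..1}" "t \<in> {0..1}" for s t
    using field_differentiable_bound[of "{0..1}" "\<lambda>t. ddir h G (x + t *\<^sub>R h)" "\<lambda>t. ddir h (ddir h G) (x + t *\<^sub>R h)" K s t]
      that K[OF inb] d2 by (auto intro: has_field_derivative_at_within)
  from riemann_sum_error[OF N d1 this K0] show ?thesis by (simp add: shift_avg_def)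
qed

lemma smooth_on_bounded_cball:
  fixes f :: "'b::euclidean_space \<Rightarrow> real"
  assumes "smooth_on (ball c R) f" "r < R"
  obtains K where "K \<ge> 0" "\<And>x. x \<in> cball c r \<Longrightarrow> \<bar>f x\<bar> \<le> K"
proof -
  have "continuous_on (cball c r) f"
    using assms by (intro continuous_on_subset[OF smooth_on_continuous[OF assms(1)]]) auto
  then have "bounded (f ` cball c r)" by (intro compact_imp_bounded compact_continuous_image) auto
  then obtain K where "\<forall>x\<in>cball c r. \<bar>f x\<bar> \<le> K" by (auto simp: bounded_iff)
  then show ?thesis using that[of "max K 0"] by fastforce
qed

text \<open>One averaging step per derivative: \<open>D\<^sub>h\<close> of an average in direction \<open>h\<close> is, up to an error
  of order \<open>1 / N\<close>, a difference quotient, so it is controlled by the supremum of the function. The flags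
  in \<open>ps\<close> record which of the averaging steps is used up by a derivative.\<close>

lemma iter_deriv_multi_avg_bound:
  fixes f :: "'b::euclidean_space \<Rightarrow> real" and e r R :: real
  assumes f: "smooth_on (ball c R) f" and e: "e > 0" "\<And>p. p \<in> set ps \<Longrightarrow> norm (fst p) = 1"
    and "r + e * real (length ps) < R" and M: "\<And>x. x \<in> cball c (r + e * real (length ps)) \<Longrightarrow> \<bar>f x\<bar> \<le> M"
  shows "\<exists>C\<ge>0. \<forall>N\<ge>1. \<forall>x\<in>cball c r.
     \<bar>iter_deriv (map fst (filter snd ps)) (multi_avg N e (map fst ps) f) x\<bar> \<le>
       (2 / e) ^ length (filter snd ps) * M + C / real N"
  using assms(3-)
proof (induction ps arbitrary: r)
  case Nil
  then show ?case by (intro exI[of _ 0]) auto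
next
  case (Cons p ps)
  obtain h b where p: "p = (h, b)" by force
  have h: "norm h = 1" "norm (e *\<^sub>R h) = e" using Cons.prems(1)[of p] p e by auto
  let ?vs = "map fst (filter snd ps)" and ?hs = "map fst ps"
  have hs: "\<And>h. h \<in> set ?hs \<Longrightarrow> norm h = 1" using Cons.prems(1) by auto
  have r': "r + e + e * real (length ps) < R" using Cons.prems(2) by (simp add: algebra_simps)
  have "\<exists>C\<ge>0. \<forall>N\<ge>1. \<forall>x\<in>cball c (r + e). \<bar>iter_deriv ?vs (multi_avg N e ?hs f) x\<bar> \<le>
       (2 / e) ^ length (filter snd ps) * M + C / real N"
    by (rule Cons.IH) (use Cons.prems in \<open>auto simp: algebra_simps\<close>)
  then obtain C where C: "C \<ge> 0" "\<And>N x. N \<ge> 1 \<Longrightarrow> x \<in> cball c (r + e) \<Longrightarrow> \<bar>iter_deriv ?vs (multi_avg N e ?hs f) x\<bar> \<le>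
       (2 / e) ^ length (filter snd ps) * M + C / real N" by blast
  define g where "g = (\<lambda>N. multi_avg N e ?hs f)"
  define R' where "R' = R - e * real (length ps)"
  have gs: "smooth_on (ball c R') (g N)" for N
    unfolding g_def R'_def using smooth_on_multi_avg[OF f, of e ?hs] e hs by auto
  have rR: "r + e < R'" using r' by (simp add: R'_def)
  have xin: "x \<in> ball c (R' - e)" if "x \<in> cball c r" for x using that rR by auto
  have it: "iter_deriv vs (multi_avg N e (map fst (p # ps)) f) x = shift_avg N (e *\<^sub>R h) (iter_deriv vs (g N)) x"
    if "x \<in> cball c r" for N x vs
    using iter_deriv_shift_avg[OF gs _ xin[OF that], of "e *\<^sub>R h"] h by (simp add: p g_def)
  have close: "\<bar>shift_avg N (e *\<^sub>R h) (iter_deriv ?vs (g N)) x\<bar> \<le> (2 / e) ^ length (filter snd ps) * M + C / real N"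
    if x: "x \<in> cball c r" and N: "N \<ge> 1" for x N
  proof -
    have "\<bar>shift_avg N (e *\<^sub>R h) (iter_deriv ?vs (g N)) x - 0\<bar> \<le> (2 / e) ^ length (filter snd ps) * M + C / real N"
    proof (rule shift_avg_close[OF N])
      fix y assume "y \<in> cball x (norm (e *\<^sub>R h))"
      then have "y \<in> cball c (r + e)" using x dist_triangle[of c y x] h by simp
      then show "\<bar>iter_deriv ?vs (g N) y - 0\<bar> \<le> (2 / e) ^ length (filter snd ps) * M + C / real N"
        using C(2)[OF N] by (simp add: g_def)
    qed
    then show ?thesis by simp
  qed
  show ?case
  proof (cases b)
    case False
    then have "filter snd (p # ps) = filter snd ps" using p by simp
    then show ?thesis using C(1) close it by (intro exI[of _ C]) auto
  next
    case True
    \<comment> \<open>The Riemann error involves two further derivatives in direction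
      \<open>h\<close>. They are estimated through the corresponding derivatives of \<open>f\<close>
      itself, so that \<open>K\<close>, and with it the final constant, does not depend on
      \<open>N\<close>.\<close>
    let ?ws = "h # h # ?vs"
    have vs: "map fst (filter snd (p # ps)) = h # ?vs" using p True by simp
    obtain K where K: "K \<ge> 0" "\<And>x. x \<in> cball c (r + e + e * real (length ps)) \<Longrightarrow> \<bar>iter_deriv ?ws f x\<bar> \<le> K"
      using smooth_on_bounded_cball[OF smooth_on_iter_deriv[OF f] r'] by blast
    have K': "\<bar>iter_deriv ?ws (g N) y\<bar> \<le> K" if "y \<in> cball c (r + e)" "N \<ge> 1" for y N
    proof -
      have yb: "y \<in> ball c (R - e * length ?hs)" using that rR by (auto simp: R'_def)
      have 1: "iter_deriv ?ws (g N) y = multi_avg N e ?hs (iter_deriv ?ws f) y"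
        unfolding g_def by (rule iter_deriv_multi_avg[OF f _ hs yb]) (use e in auto)
      have "\<bar>multi_avg N e ?hs (iter_deriv ?ws f) y - 0\<bar> \<le> K"
      proof (rule multi_avg_close[OF that(2) _ hs])
        fix z assume "z \<in> cball y (e * length ?hs)"
        then have "dist c z \<le> r + e + e * real (length ps)"
          using that dist_triangle[of c z y] by simp
        then show "\<bar>iter_deriv ?ws f z - 0\<bar> \<le> K" using K(2) by simp
      qed (use e in auto)
      then show ?thesis using 1 by simp
    qed
    \<comment> \<open>Two end values, each bounded by the induction hypothesis, and the Riemann
      error \<open>e ^ 2 * K / real N\<close>, all divided by the step \<open>e\<close>: this
      produces the factor \<open>2 / e\<close> and the new constant.\<close>
    have main: "\<bar>iter_deriv (h # ?vs) (multi_avg N e (map fst (p # ps)) f) x\<bar> \<le>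
       (2 / e) ^ length (filter snd (p # ps)) * M + (2 * C / e + e * K) / real N" if x: "x \<in> cball c r" and N: "N \<ge> 1" for x N
    proof -
      define G where "G = iter_deriv ?vs (g N)"
      have Gs: "smooth_on (ball c R') G" unfolding G_def by (intro smooth_on_iter_deriv gs)
      have sc: "ddir (e *\<^sub>R h) F y = e * ddir h F y" if "F differentiable (at y)" for F :: "'b \<Rightarrow> real" and y
        using linear_scale[OF linear_frechet_derivative[OF that]] by (simp add: ddir_def)
      have inR: "y \<in> ball c R'" if "y \<in> cball c (r + e)" for y using that rR by auto
      have b1: "\<bar>ddir (e *\<^sub>R h) (ddir (e *\<^sub>R h) G) y\<bar> \<le> e ^ 2 * K" if "y \<in> cball c (r + norm (e *\<^sub>R h))" for y
      proof -
        have y: "y \<in> cball c (r + e)" using that h by simp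
        have "ddir (e *\<^sub>R h) (ddir (e *\<^sub>R h) G) y = e * ddir h (ddir (e *\<^sub>R h) G) y"
          by (rule sc) (use smooth_on_differentiable smooth_on_ddir Gs inR[OF y] in blast)
        also have "ddir h (ddir (e *\<^sub>R h) G) y = ddir h (\<lambda>y. e * ddir h G y) y"
          by (rule ddir_cong[OF open_ball inR[OF y]]) (use sc smooth_on_differentiable Gs in blast)
        also have "\<dots> = e * ddir h (ddir h G) y"
          by (rule bounded_linear_ddir[OF bounded_linear_mult_right]) (use smooth_on_differentiable smooth_on_ddir Gs inR[OF y] in blast)
        also have "ddir h (ddir h G) y = iter_deriv ?ws (g N) y" by (simp add: G_def ddir_def)
        finally show ?thesis using K'[OF y N] e by (simp add: abs_mult power2_eq_square mult.assoc)
      qed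
      have "\<bar>G (x + e *\<^sub>R h) - G x - shift_avg N (e *\<^sub>R h) (ddir (e *\<^sub>R h) G) x\<bar> \<le> e ^ 2 * K / real N"
        by (rule shift_avg_deriv[OF Gs x _ N b1]) (use rR h in auto)
      moreover have "shift_avg N (e *\<^sub>R h) (ddir (e *\<^sub>R h) G) x = e * shift_avg N (e *\<^sub>R h) (ddir h G) x"
      proof -
        have "ddir (e *\<^sub>R h) G (x + (real l / real N) *\<^sub>R e *\<^sub>R h) = e * ddir h G (x + (real l / real N) *\<^sub>R e *\<^sub>R h)" if "l < N" for l
          by (rule sc) (use smooth_on_differentiable[OF Gs] shift_in_ball[OF xin[OF x] that, of "e *\<^sub>R h" R'] h in auto)
        then show ?thesis by (simp add: shift_avg_def sum_distrib_left)
      qed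
      moreover have "\<bar>G x\<bar> \<le> (2 / e) ^ length (filter snd ps) * M + C / real N"
        unfolding G_def g_def using x e by (intro C(2)[OF N]) auto
      moreover have "\<bar>G (x + e *\<^sub>R h)\<bar> \<le> (2 / e) ^ length (filter snd ps) * M + C / real N"
        unfolding G_def g_def using x e h dist_triangle[of c "x + e *\<^sub>R h" x] by (intro C(2)[OF N]) (auto simp: dist_norm)
      ultimately have "e * \<bar>shift_avg N (e *\<^sub>R h) (ddir h G) x\<bar> \<le>
          2 * ((2 / e) ^ length (filter snd ps) * M + C / real N) + e ^ 2 * K / real N"
        using e by (simp add: abs_mult[of e, symmetric] abs_of_pos)
      then have "\<bar>shift_avg N (e *\<^sub>R h) (ddir h G) x\<bar> \<le>
          (2 * ((2 / e) ^ length (filter snd ps) * M + C / real N) + e ^ 2 * K / real N) / e"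
        using e by (simp add: pos_le_divide_eq mult.commute)
      also have "\<dots> = (2 / e) ^ length (filter snd (p # ps)) * M + (2 * C / e + e * K) / real N"
      proof -
        have "real N > 0" using N by simp
        then show ?thesis using e p True by (simp add: field_simps power2_eq_square)
      qed
      finally have fin: "\<bar>shift_avg N (e *\<^sub>R h) (ddir h G) x\<bar> \<le> (2 / e) ^ length (filter snd (p # ps)) * M + (2 * C / e + e * K) / real N" .
      have "iter_deriv (h # ?vs) (g N) = ddir h G" by (simp add: G_def ddir_def)
      with fin it[OF x, of "h # ?vs" N] show ?thesis by metis
    qed
    show ?thesis
      unfolding vs using main C(1) K(1) e by (intro exI[of _ "2 * C / e + e * K"]) auto
  qed
qed

section \<open>Convex functions as limits of logarithms of exponential sums\<close>

lemma multi_avg_add: "multi_avg N e hs (\<lambda>x. f x + g x) = (\<lambda>x. multi_avg N e hs f x + multi_avg N e hs g x)"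
  by (induction hs) (auto simp: shift_avg_def sum.distrib add_divide_distrib)

text \<open>Each block of \<open>bl\<close> serves one derivative: the entry equal to the current
  direction is flagged and the others stay idle. Hence one fixed list of averaging directions
  handles all lists \<open>vs\<close> of length at most \<open>m\<close> simultaneously.\<close>

lemma flag_list:
  assumes "distinct bl" "set vs \<subseteq> set bl" "length vs \<le> m"
  shows "\<exists>ps. map fst ps = concat (replicate m bl) \<and> map fst (filter snd ps) = vs"
  using assms(2,3)
proof (induction m arbitrary: vs)
  case (Suc m)
  show ?case
  proof (cases vs)
    case Nil
    then obtain ps where "map fst ps = concat (replicate m bl)" "map fst (filter snd ps) = vs"
      using Suc.IH[of vs] by auto
    then show ?thesis
      by (intro exI[of _ "map (\<lambda>e. (e, False)) bl @ ps"]) (simp add: o_def filter_map)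
  next
    case (Cons v ws)
    then obtain ps where ps: "map fst ps = concat (replicate m bl)" "map fst (filter snd ps) = ws"
      using Suc.IH[of ws] Suc.prems by auto
    have "v \<in> set bl" using Suc.prems Cons by simp
    with assms(1) have "filter (\<lambda>e. e = v) bl = [v]"
      by (induction bl) (auto simp: filter_empty_conv)
    with ps Cons show ?thesis
      by (intro exI[of _ "map (\<lambda>e. (e, e = v)) bl @ ps"]) (simp add: o_def filter_map)
  qed
qed simp

text \<open>Write \<open>f\<close> as \<open>d + u\<close>. Averaging \<open>u\<close> over short
  steps changes its derivatives little, and averaging \<open>d\<close> makes its derivatives small
  once \<open>d\<close> is uniformly small. The step \<open>e\<close> depends on \<open>u\<close>,
  the accuracy \<open>M\<close> on \<open>e\<close>, the function \<open>f\<close> on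
  \<open>M\<close>, and the number \<open>N\<close> of nodes on \<open>f\<close>.\<close>

lemma smooth_approx_upgrade:
  fixes u :: "'b::euclidean_space \<Rightarrow> real" and r R' R \<eta> :: real
  assumes u: "smooth_on (ball c R) u" and r: "r < R'" "R' < R" and \<eta>: "\<eta> > 0"
    and unif: "\<And>\<delta>. \<delta> > 0 \<Longrightarrow> \<exists>f. P f \<and> (\<forall>x\<in>cball c R'. \<bar>f x - u x\<bar> \<le> \<delta>)"
    and sm: "\<And>f. P f \<Longrightarrow> smooth_on UNIV f"
    and avg: "\<And>f N h. P f \<Longrightarrow> N \<ge> 1 \<Longrightarrow> P (shift_avg N h f)"
  shows "\<exists>f. P f \<and> (\<forall>vs. set vs \<subseteq> Basis \<and> length vs \<le> m \<longrightarrow>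
     (\<forall>x\<in>cball c r. \<bar>iter_deriv vs f x - iter_deriv vs u x\<bar> \<le> \<eta>))"
proof -
  have mavg: "P (multi_avg N e hs f)" if "P f" "N \<ge> 1" for N e hs f
    using that by (induction hs) (auto intro: avg)
  obtain bl :: "'b list" where bl: "distinct bl" "set bl = Basis"
    using finite_distinct_list[OF finite_Basis] by blast
  define hs where "hs = concat (replicate m bl)"
  define VS where "VS = {vs. set vs \<subseteq> (Basis :: 'b set) \<and> length vs \<le> m}"
  have finVS: "finite VS" unfolding VS_def by (rule finite_lists_length_le[OF finite_Basis])
  have hs1: "norm h = 1" if "h \<in> set hs" for h
    using that bl by (auto simp: hs_def split: if_splits)
  \<comment> \<open>Uniform continuity on the larger ball decides how short the steps must be for
    the averaged derivatives of \<open>u\<close> to stay within \<open>\<eta> / 2\<close> of the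
    original ones.\<close>
  have uc: "eventually (\<lambda>e. \<forall>x\<in>cball c r. \<forall>y\<in>cball x (e * real (length hs)).
      \<bar>iter_deriv vs u y - iter_deriv vs u x\<bar> \<le> \<eta> / 2) (at_right 0)" for vs
  proof -
    have "uniformly_continuous_on (cball c R') (iter_deriv vs u)"
      by (intro compact_uniformly_continuous continuous_on_subset[OF smooth_on_continuous[OF smooth_on_iter_deriv[OF u]]])
        (use r in auto)
    then obtain d where d: "d > 0" "\<And>x y. x \<in> cball c R' \<Longrightarrow> y \<in> cball c R' \<Longrightarrow> dist y x < d \<Longrightarrow>
       \<bar>iter_deriv vs u y - iter_deriv vs u x\<bar> < \<eta> / 2"
      unfolding uniformly_continuous_on_def dist_real_def using \<eta> half_gt_zero by metis
    define d' where "d' = min d (R' - r) / (real (length hs) + 1)"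
    have d': "d' > 0" using d r by (simp add: d'_def)
    have "eventually (\<lambda>e. e < d') (at_right (0::real))"
      using d' by (intro eventually_at_rightI[of 0 d']) auto
    then show ?thesis
    proof (rule eventually_mono, intro ballI)
      fix e :: real and x y assume e: "e < d'" "x \<in> cball c r" "y \<in> cball x (e * real (length hs))"
      have "e * real (length hs) \<le> d' * real (length hs)" using e by (intro mult_right_mono) auto
      also have "\<dots> < d' * (real (length hs) + 1)" using d' by simp
      also have "\<dots> = min d (R' - r)" unfolding d'_def by simp
      finally have "dist x y < min d (R' - r)" using e by simp
      then show "\<bar>iter_deriv vs u y - iter_deriv vs u x\<bar> \<le> \<eta> / 2"
        using d(2)[of x y] e r dist_triangle[of c y x] by (simp add: dist_commute less_imp_le)
    qed
  qed
  have "eventually (\<lambda>e. \<forall>vs\<in>VS. \<forall>x\<in>cball c r. \<forall>y\<in>cball x (e * real (length hs)).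
      \<bar>iter_deriv vs u y - iter_deriv vs u x\<bar> \<le> \<eta> / 2) (at_right 0)"
    using uc by (intro eventually_ball_finite[OF finVS]) auto
  \<comment> \<open>The bound \<open>e < 1\<close> makes \<open>2 / e\<close> at least one, so that
    the factor for \<open>m\<close> derivatives dominates those for fewer. The other bound keeps all
    translates of points of the inner ball within radius \<open>R'\<close>.\<close>
  moreover have "eventually (\<lambda>e. e < min 1 ((R' - r) / (real (length hs) + 1)) \<and> e > 0) (at_right (0::real))"
    using r by (intro eventually_at_rightI[of 0 "min 1 ((R' - r) / (real (length hs) + 1))"]) auto
  ultimately have "eventually (\<lambda>e. (\<forall>vs\<in>VS. \<forall>x\<in>cball c r. \<forall>y\<in>cball x (e * real (length hs)).
      \<bar>iter_deriv vs u y - iter_deriv vs u x\<bar> \<le> \<eta> / 2) \<and> e < min 1 ((R' - r) / (real (length hs) + 1)) \<and> e > 0) (at_right 0)"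
    by (rule eventually_conj)
  then obtain e where e: "\<And>vs x y. vs \<in> VS \<Longrightarrow> x\<in>cball c r \<Longrightarrow> y\<in>cball x (e * real (length hs)) \<Longrightarrow>
      \<bar>iter_deriv vs u y - iter_deriv vs u x\<bar> \<le> \<eta> / 2" "e < min 1 ((R' - r) / (real (length hs) + 1))" "e > 0"
    using eventually_happens'[OF trivial_limit_at_right_real] by blast
  have eR: "r + e * real (length hs) < R'"
  proof -
    have "e * (real (length hs) + 1) < R' - r" using e(2) by (simp add: pos_less_divide_eq)
    then show ?thesis using e(3) by (simp add: algebra_simps)
  qed
  \<comment> \<open>After amplification by at most \<open>(2 / e) ^ m\<close> the uniform error
    contributes \<open>\<eta> / 4\<close>. Another quarter is reserved for the Riemann error, and
    the remaining half for the averages of \<open>u\<close>.\<close>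
  define M where "M = \<eta> / (4 * (2 / e) ^ m)"
  have M: "M > 0" using \<eta> e by (simp add: M_def)
  obtain f where f: "P f" "\<And>x. x \<in> cball c R' \<Longrightarrow> \<bar>f x - u x\<bar> \<le> M" using unif[OF M] by blast
  define d where "d = (\<lambda>x. f x - u x)"
  have ds: "smooth_on (ball c R) d"
    unfolding d_def by (intro smooth_on_minus open_ball smooth_on_subset[OF sm[OF f(1)]] u) auto
  have Cvs: "\<exists>C\<ge>0. \<forall>N\<ge>1. \<forall>x\<in>cball c r. \<bar>iter_deriv vs (multi_avg N e hs d) x\<bar> \<le> \<eta> / 4 + C / real N"
    if vs: "vs \<in> VS" for vs
  proof -
    obtain ps where ps: "map fst ps = hs" "map fst (filter snd ps) = vs"
      using flag_list[OF bl(1), of vs m] vs bl(2) unfolding hs_def VS_def by auto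
    have lp: "length ps = length hs" "length (filter snd ps) = length vs" using ps by (metis length_map)+
    have n1: "norm (fst p) = 1" if "p \<in> set ps" for p using that hs1 ps(1) by force
    have bd: "\<bar>d x\<bar> \<le> M" if "x \<in> cball c (r + e * real (length ps))" for x
      using f(2)[of x] that eR lp by (simp add: d_def)
    have "r + e * real (length ps) < R" using eR r lp by simp
    from iter_deriv_multi_avg_bound[OF ds e(3) n1 this bd, unfolded ps lp]
    obtain C where C: "C \<ge> 0" "\<forall>N\<ge>1. \<forall>x\<in>cball c r. \<bar>iter_deriv vs (multi_avg N e hs d) x\<bar> \<le> (2 / e) ^ length vs * M + C / real N"
      by blast
    have "(2 / e) ^ length vs * M \<le> (2 / e) ^ m * M"
      using vs e M by (intro mult_right_mono power_increasing) (auto simp: VS_def)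
    also have "\<dots> = \<eta> / 4" using e by (simp add: M_def)
    finally have "\<forall>N\<ge>1. \<forall>x\<in>cball c r. \<bar>iter_deriv vs (multi_avg N e hs d) x\<bar> \<le> \<eta> / 4 + C / real N"
      using C(2) by (meson add_right_mono order_trans)
    with C(1) show ?thesis by blast
  qed
  have "eventually (\<lambda>N. \<forall>vs\<in>VS. \<forall>x\<in>cball c r. \<bar>iter_deriv vs (multi_avg N e hs d) x\<bar> \<le> \<eta> / 2) sequentially"
  proof (intro eventually_ball_finite[OF finVS] ballI)
    fix vs assume "vs \<in> VS"
    then obtain C where C: "C \<ge> 0" "\<forall>N\<ge>1. \<forall>x\<in>cball c r. \<bar>iter_deriv vs (multi_avg N e hs d) x\<bar> \<le> \<eta> / 4 + C / real N"
      using Cvs by blast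
    obtain N0 :: nat where N0: "real N0 > 4 * C / \<eta>" using reals_Archimedean2 by blast
    show "eventually (\<lambda>N. \<forall>x\<in>cball c r. \<bar>iter_deriv vs (multi_avg N e hs d) x\<bar> \<le> \<eta> / 2) sequentially"
    proof (rule eventually_sequentiallyI[of "max 1 N0"], intro ballI)
      fix N x assume N: "max 1 N0 \<le> N" and x: "x \<in> cball c r"
      have "4 * C / \<eta> < real N" using N0 N by linarith
      then have "C / real N \<le> \<eta> / 4" using \<eta> N by (simp add: field_simps)
      moreover have "\<bar>iter_deriv vs (multi_avg N e hs d) x\<bar> \<le> \<eta> / 4 + C / real N" using C(2) N x by auto
      ultimately show "\<bar>iter_deriv vs (multi_avg N e hs d) x\<bar> \<le> \<eta> / 2" by linarith
    qed
  qed
  then have "\<exists>N. N \<ge> 1 \<and> (\<forall>vs\<in>VS. \<forall>x\<in>cball c r. \<bar>iter_deriv vs (multi_avg N e hs d) x\<bar> \<le> \<eta> / 2)"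
    by (intro eventually_happens'[OF sequentially_bot] eventually_conj eventually_ge_at_top)
  then obtain N where N: "N \<ge> 1" "\<And>vs x. vs \<in> VS \<Longrightarrow> x \<in> cball c r \<Longrightarrow> \<bar>iter_deriv vs (multi_avg N e hs d) x\<bar> \<le> \<eta> / 2"
    by blast
  show ?thesis
  proof (intro exI[of _ "multi_avg N e hs f"] conjI allI impI ballI)
    show "P (multi_avg N e hs f)" by (rule mavg[OF f(1) N(1)])
    fix vs :: "'b list" and x assume "set vs \<subseteq> Basis \<and> length vs \<le> m" and x: "x \<in> cball c r"
    then have vs: "vs \<in> VS" by (simp add: VS_def)
    define \<rho> where "\<rho> = R - e * real (length hs)"
    have xr: "x \<in> ball c \<rho>" using x eR r by (auto simp: \<rho>_def)
    have "f = (\<lambda>x. d x + u x)" by (simp add: d_def)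
    then have "iter_deriv vs (multi_avg N e hs f) x = iter_deriv vs (\<lambda>x. multi_avg N e hs d x + multi_avg N e hs u x) x"
      by (simp add: multi_avg_add)
    also have "\<dots> = iter_deriv vs (multi_avg N e hs d) x + iter_deriv vs (multi_avg N e hs u) x"
      by (rule iter_deriv_add[OF open_ball xr])
        (use smooth_on_multi_avg[OF ds _ hs1] smooth_on_multi_avg[OF u _ hs1] e in \<open>auto simp: \<rho>_def\<close>)
    also have "iter_deriv vs (multi_avg N e hs u) x = multi_avg N e hs (iter_deriv vs u) x"
      by (rule iter_deriv_multi_avg[OF u _ hs1]) (use xr e in \<open>auto simp: \<rho>_def\<close>)
    finally have eq: "iter_deriv vs (multi_avg N e hs f) x = iter_deriv vs (multi_avg N e hs d) x + multi_avg N e hs (iter_deriv vs u) x" .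
    have "\<bar>multi_avg N e hs (iter_deriv vs u) x - iter_deriv vs u x\<bar> \<le> \<eta> / 2"
      by (rule multi_avg_close[OF N(1) _ hs1]) (use e x vs in auto)
    with eq N(2)[OF vs x] show "\<bar>iter_deriv vs (multi_avg N e hs f) x - iter_deriv vs u x\<bar> \<le> \<eta>"
      by linarith
  qed
qed

text \<open>A list instead of a set lets products be formed without merging equal exponents, and the
  coefficients \<open>exp c\<close> are positive by construction. The exponents \<open>0\<close> and
  \<open>lam *\<^sub>R i\<close> are markers from which the holomorphic coordinates will be
  recovered.\<close>

definition exp_sum :: "real \<Rightarrow> ('b::euclidean_space \<Rightarrow> real) \<Rightarrow> bool" where
  "exp_sum lam f \<longleftrightarrow> lam > 0 \<and> (\<exists>xs :: ('b \<times> real) list.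
     (\<forall>x. exp (lam * f x) = (\<Sum>(g, c)\<leftarrow>xs. exp (g \<bullet> x + c))) \<and>
     (\<exists>c. (0, c) \<in> set xs) \<and> (\<forall>i\<in>Basis. \<exists>c. (lam *\<^sub>R i, c) \<in> set xs))"

lemma exp_sum_smooth:
  assumes "exp_sum lam f"
  shows "smooth_on UNIV f"
proof -
  obtain xs where l: "lam > 0" and xs: "\<And>x. exp (lam * f x) = (\<Sum>(g, c)\<leftarrow>xs. exp (g \<bullet> x + c))"
    using assms unfolding exp_sum_def by blast
  have s1: "smooth_on UNIV (\<lambda>x. \<Sum>(g, c)\<leftarrow>ys. exp (g \<bullet> x + c :: real))" for ys :: "('a \<times> real) list"
  proof (induction ys)
    case (Cons p ys)
    have "smooth_on UNIV (\<lambda>x. fst p \<bullet> x + snd p)"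
      by (rule smooth_on_add[OF open_UNIV smooth_on_linear[OF bounded_linear_inner_right open_UNIV] smooth_on_const])
    then have "smooth_on UNIV (\<lambda>x. exp (fst p \<bullet> x + snd p))"
      by (rule smooth_on_compose[OF open_UNIV _ subset_UNIV smooth_on_exp[OF open_UNIV]])
    from smooth_on_add[OF open_UNIV this Cons] show ?case by (simp add: case_prod_unfold)
  qed simp
  have "smooth_on UNIV (\<lambda>x. exp (lam * f x))" by (simp only: xs s1)
  then have "smooth_on UNIV (\<lambda>x. ln (exp (lam * f x)))"
    by (rule smooth_on_compose[OF open_UNIV _ _ smooth_on_ln]) auto
  then have "smooth_on UNIV (\<lambda>x. lam * f x)" by simp
  from smooth_on_linear_compose[OF open_UNIV bounded_linear_divide[of lam] this]
  have "smooth_on UNIV (\<lambda>x. (lam * f x) / lam)" .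
  then show ?thesis using l by simp
qed

text \<open>Multiplication by \<open>real N * lam\<close> cancels the division by \<open>N\<close>
  and turns the exponential into a product of \<open>N\<close> translates. In this product the
  marker \<open>0\<close> arises as a sum of zeros and \<open>(real N * lam) *\<^sub>R i\<close> as
  a sum of \<open>N\<close> equal markers, which fits the new parameter.\<close>

lemma exp_sum_shift_avg:
  assumes "exp_sum lam f" "N \<ge> 1"
  shows "exp_sum (real N * lam) (shift_avg N h f)"
proof -
  obtain xs where l: "lam > 0" and xs: "\<And>x. exp (lam * f x) = (\<Sum>(g, c)\<leftarrow>xs. exp (g \<bullet> x + c))"
     "\<exists>c. (0, c) \<in> set xs" "\<And>i. i \<in> Basis \<Longrightarrow> \<exists>c. (lam *\<^sub>R i, c) \<in> set xs"
    using assms unfolding exp_sum_def by blast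
  define t where "t = (\<lambda>l. (real l / real N) *\<^sub>R h)"
  have "\<exists>ys. (\<forall>x. (\<Prod>l<n. exp (lam * f (x + t l))) = (\<Sum>(g, c)\<leftarrow>ys. exp (g \<bullet> x + c))) \<and>
     (\<exists>c. (0, c) \<in> set ys) \<and> (\<forall>i\<in>Basis. \<exists>c. ((real n * lam) *\<^sub>R i, c) \<in> set ys)" for n
  proof (induction n)
    case 0
    show ?case by (intro exI[of _ "[(0, 0)]"]) auto
  next
    case (Suc n)
    then obtain ys where ys: "\<And>x. (\<Prod>l<n. exp (lam * f (x + t l))) = (\<Sum>(g, c)\<leftarrow>ys. exp (g \<bullet> x + c))"
       "\<exists>c. (0, c) \<in> set ys" "\<And>i. i \<in> Basis \<Longrightarrow> \<exists>c. ((real n * lam) *\<^sub>R i, c) \<in> set ys" by blast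
    \<comment> \<open>All pairwise products; the translation by \<open>t n\<close> affects only the
      constants, by \<open>g' \<bullet> t n\<close>.\<close>
    define zs where "zs = map (\<lambda>((g, c), (g', c')). (g + g', c + c' + g' \<bullet> t n)) (List.product ys xs)"
    have prod_sum: "(\<Sum>p\<leftarrow>as. F p) * (\<Sum>q\<leftarrow>bs. G q) = (\<Sum>(p, q)\<leftarrow>List.product as bs. F p * G q)"
      for as bs :: "('a \<times> real) list" and F G :: "_ \<Rightarrow> real"
      by (induction as) (auto simp: distrib_right o_def sum_list_const_mult)
    have "(\<Prod>l<Suc n. exp (lam * f (x + t l))) = (\<Sum>(g, c)\<leftarrow>zs. exp (g \<bullet> x + c))" for x
    proof -
      have "(\<Prod>l<Suc n. exp (lam * f (x + t l))) = (\<Sum>(g, c)\<leftarrow>ys. exp (g \<bullet> x + c)) * (\<Sum>(g, c)\<leftarrow>xs. exp (g \<bullet> (x + t n) + c))"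
        unfolding prod.lessThan_Suc unfolding ys(1) unfolding xs(1) ..
      also have "\<dots> = (\<Sum>(g, c)\<leftarrow>zs. exp (g \<bullet> x + c))"
        unfolding prod_sum zs_def
        by (simp add: o_def case_prod_unfold exp_add[symmetric] inner_add_left inner_add_right algebra_simps)
      finally show ?thesis .
    qed
    moreover have "\<exists>c. (0, c) \<in> set zs"
    proof -
      obtain c c' where "(0, c) \<in> set ys" "(0, c') \<in> set xs" using ys xs by blast
      then show ?thesis unfolding zs_def by force
    qed
    moreover have "\<exists>c. ((real (Suc n) * lam) *\<^sub>R i, c) \<in> set zs" if "i \<in> Basis" for i
    proof -
      obtain c c' where cc: "((real n * lam) *\<^sub>R i, c) \<in> set ys" "(lam *\<^sub>R i, c') \<in> set xs" using ys xs \<open>i \<in> Basis\<close> by blast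
      have "(\<lambda>((g, c), (g', c')). (g + g', c + c' + g' \<bullet> t n)) (((real n * lam) *\<^sub>R i, c), (lam *\<^sub>R i, c')) \<in> set zs"
        unfolding zs_def set_map by (rule imageI) (use cc in simp)
      then show ?thesis by (auto simp: algebra_simps)
    qed
    ultimately show ?case by blast
  qed
  then obtain ys where ys: "\<forall>x. (\<Prod>l<N. exp (lam * f (x + t l))) = (\<Sum>(g, c)\<leftarrow>ys. exp (g \<bullet> x + c))"
     "\<exists>c. (0, c) \<in> set ys" "\<forall>i\<in>Basis. \<exists>c. ((real N * lam) *\<^sub>R i, c) \<in> set ys" by blast
  have "real N * lam * shift_avg N h f x = (\<Sum>l<N. lam * f (x + t l))" for x
    using assms(2) by (simp add: shift_avg_def t_def sum_distrib_left[symmetric])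
  then have "exp (real N * lam * shift_avg N h f x) = (\<Prod>l<N. exp (lam * f (x + t l)))" for x
    by (simp add: exp_sum)
  then show ?thesis using ys l assms(2) unfolding exp_sum_def by auto
qed

text \<open>Near each \<open>y\<close> the tangent plane at \<open>y\<close> deviates from
  \<open>u\<close> by at most \<delta> times the distance, and the radius is cut down to 1. A finite
  subcover of the compact ball supplies the points.\<close>

lemma tangent_net:
  fixes u :: "'b::euclidean_space \<Rightarrow> real"
  assumes u: "smooth_on (ball c R) u" and r: "r < R" and \<delta>: "\<delta> > 0"
  shows "\<exists>Y. finite Y \<and> Y \<subseteq> cball c r \<and> (\<forall>x\<in>cball c r. \<exists>y\<in>Y. u x \<le> u y + ddir (x - y) u y + \<delta>)"
proof -
  have "\<exists>d>0. \<forall>x\<in>ball y d. u x \<le> u y + ddir (x - y) u y + \<delta>" if "y \<in> cball c r" for y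
  proof -
    have D: "(u has_derivative (\<lambda>v. ddir v u y)) (at y)"
      using smooth_on_has_derivative[OF u] that r by auto
    then obtain d where d: "d > 0" "\<And>x. norm (x - y) < d \<Longrightarrow> norm (u x - u y - ddir (x - y) u y) \<le> \<delta> * norm (x - y)"
      unfolding has_derivative_at_alt using \<delta> by blast
    show ?thesis
    proof (intro exI[of _ "min d 1"] conjI ballI)
      fix x assume "x \<in> ball y (min d 1)"
      then have n: "norm (x - y) < d" "norm (x - y) < 1" by (auto simp: dist_norm norm_minus_commute)
      have "\<delta> * norm (x - y) \<le> \<delta> * 1" using n \<delta> by (intro mult_left_mono) auto
      then show "u x \<le> u y + ddir (x - y) u y + \<delta>" using d(2)[OF n(1)] by (simp add: abs_le_iff)
    qed (use d in auto)
  qed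
  then obtain d where d: "\<And>y. y \<in> cball c r \<Longrightarrow> d y > 0"
    "\<And>y x. y \<in> cball c r \<Longrightarrow> x \<in> ball y (d y) \<Longrightarrow> u x \<le> u y + ddir (x - y) u y + \<delta>" by metis
  obtain Y where "Y \<subseteq> cball c r" "finite Y" "cball c r \<subseteq> (\<Union>y\<in>Y. ball y (d y))"
    using compactE_image[OF compact_cball, of "cball c r" "\<lambda>y. ball y (d y)" c r] d(1) by force
  then show ?thesis using d(2) by (intro exI[of _ Y]) blast
qed

text \<open>With \<open>n\<close> affine minorants, the scaled logarithm of the sum of exponentials
  lies between their maximum and the maximum plus \<open>ln n / lam\<close>. The maximum is within
  \<delta> of \<open>u\<close> by the tangent net, and convexity keeps it below
  \<open>u\<close>.\<close>

lemma exp_sum_uniform_approx: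
  fixes u :: "'b::euclidean_space \<Rightarrow> real"
  assumes u: "smooth_on (ball c R) u" and r: "r < R" and \<delta>: "\<delta> > 0"
    and conv: "\<And>x y. x \<in> ball c R \<Longrightarrow> y \<in> ball c R \<Longrightarrow> u y + ddir (x - y) u y \<le> u x"
  shows "\<exists>f lam. exp_sum lam f \<and> (\<forall>x\<in>cball c r. \<bar>f x - u x\<bar> \<le> \<delta>)"
proof -
  obtain Y where Y: "finite Y" "Y \<subseteq> cball c r" "\<And>x. x \<in> cball c r \<Longrightarrow> \<exists>y\<in>Y. u x \<le> u y + ddir (x - y) u y + \<delta>"
    using tangent_net[OF u r \<delta>] by blast
  define G where "G = (\<lambda>y. \<Sum>i\<in>Basis. ddir i u y *\<^sub>R i)"
  have G: "ddir v u y = G y \<bullet> v" if "y \<in> cball c r" for y v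
  proof -
    have "ddir v u y = (\<Sum>i\<in>Basis. (v \<bullet> i) *\<^sub>R ddir i u y)"
      by (rule ddir_basis_expansion) (use smooth_on_differentiable[OF u] that r in auto)
    then show ?thesis by (simp add: G_def inner_sum_left inner_commute[of v] mult.commute)
  qed
  obtain B where B: "B \<ge> 0" "\<And>x. x \<in> cball c r \<Longrightarrow> \<bar>u x\<bar> \<le> B" using smooth_on_bounded_cball[OF u r] by blast
  \<comment> \<open>The two additional families provide the markers required by
    \<open>exp_sum\<close>. Their constants keep them at most \<open>- B\<close> on the ball, hence
    below \<open>u\<close>, since coordinates there are bounded by
    \<open>norm c + \<bar>r\<bar>\<close>.\<close>
  define S where "S = (\<lambda>y. (G y, u y - G y \<bullet> y)) ` Y \<union> {(0, - B)} \<union> (\<lambda>i. (i, - B - (norm c + \<bar>r\<bar>))) ` Basis"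
  have finS: "finite S" using Y by (simp add: S_def)
  have low: "g \<bullet> x + a \<le> u x" if gS: "(g, a) \<in> S" and x: "x \<in> cball c r" for g a x
  proof -
    consider y where "y \<in> Y" "g = G y" "a = u y - G y \<bullet> y" | "g = 0" "a = - B" |
       "g \<in> Basis" "a = - B - (norm c + \<bar>r\<bar>)" using gS by (auto simp: S_def)
    then show ?thesis
    proof cases
      case 1
      then have "u y + ddir (x - y) u y \<le> u x" using conv[of x y] x Y r by auto
      then show ?thesis using 1 G[of y] Y by (auto simp: inner_diff_right)
    next
      case 2
      then show ?thesis using B(2)[OF x] by simp
    next
      case 3
      have "\<bar>g \<bullet> x\<bar> \<le> norm x" using Basis_le_norm[OF 3(1), of x] by (simp add: inner_commute)
      moreover have "norm x \<le> norm c + \<bar>r\<bar>"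
        using x norm_triangle_ineq[of c "x - c"] by (simp add: dist_norm norm_minus_commute)
      ultimately show ?thesis using 3 B(2)[OF x] by linarith
    qed
  qed
  obtain ss where ss: "set ss = S" "distinct ss" using finite_distinct_list[OF finS] by blast
  define n where "n = length ss"
  have n: "n > 0" using ss by (auto simp: n_def S_def)
  \<comment> \<open>Large enough that the counting error \<open>ln n / lam\<close> is at most
    \<delta>; the maximum with 1 keeps it positive when \<open>n = 1\<close>.\<close>
  define lam where "lam = max 1 (ln n / \<delta>)"
  have l: "lam > 0" "ln n \<le> lam * \<delta>"
    using \<delta> by (auto simp: lam_def pos_divide_le_eq[symmetric])
  define E where "E = (\<lambda>x. \<Sum>(g, a)\<leftarrow>ss. exp (lam * (g \<bullet> x + a)))"
  have Eset: "E x = (\<Sum>p\<in>S. exp (lam * (fst p \<bullet> x + snd p)))" for x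
    using ss by (simp add: E_def case_prod_beta sum_list_distinct_conv_sum_set)
  have Epos: "E x > 0" for x unfolding Eset using finS by (intro sum_pos) (auto simp: S_def)
  define f where "f = (\<lambda>x. ln (E x) / lam)"
  have "exp_sum lam f"
    unfolding exp_sum_def
  proof (intro conjI exI[of _ "map (\<lambda>(g, a). (lam *\<^sub>R g, lam * a)) ss"] l allI ballI)
    show "exp (lam * f x) = (\<Sum>(g, c)\<leftarrow>map (\<lambda>(g, a). (lam *\<^sub>R g, lam * a)) ss. exp (g \<bullet> x + c))" for x
      using l Epos[of x] by (simp add: f_def E_def o_def case_prod_unfold distrib_left)
    show "\<exists>c. (0, c) \<in> set (map (\<lambda>(g, a). (lam *\<^sub>R g, lam * a)) ss)"
      using ss(1) by (auto simp: S_def image_iff intro!: exI[of _ "- (lam * B)"])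
    show "\<exists>c. (lam *\<^sub>R i, c) \<in> set (map (\<lambda>(g, a). (lam *\<^sub>R g, lam * a)) ss)" if "i \<in> Basis" for i
    proof -
      have "(i, - B - (norm c + \<bar>r\<bar>)) \<in> S" using that by (simp add: S_def)
      then show ?thesis using ss(1) by force
    qed
  qed
  moreover have "\<bar>f x - u x\<bar> \<le> \<delta>" if x: "x \<in> cball c r" for x
  proof -
    obtain y where y: "y \<in> Y" "u x \<le> u y + ddir (x - y) u y + \<delta>" using Y(3)[OF x] by blast
    then have "u x - \<delta> \<le> G y \<bullet> x + (u y - G y \<bullet> y)" using G[of y] Y by (auto simp: inner_diff_right)
    then have "exp (lam * (u x - \<delta>)) \<le> exp (lam * (fst (G y, u y - G y \<bullet> y) \<bullet> x + snd (G y, u y - G y \<bullet> y)))"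
      using l by simp
    also have "\<dots> \<le> E x" unfolding Eset by (rule member_le_sum[OF _ _ finS]) (use y in \<open>auto simp: S_def\<close>)
    finally have "lam * (u x - \<delta>) \<le> ln (E x)" using Epos[of x] by (simp add: ln_ge_iff)
    then have 1: "u x - \<delta> \<le> f x" using l by (simp add: f_def pos_le_divide_eq mult.commute)
    have "E x \<le> (\<Sum>p\<in>S. exp (lam * u x))"
      unfolding Eset using low[OF _ x] l by (intro sum_mono) auto
    also have "\<dots> = n * exp (lam * u x)" using ss by (simp add: n_def distinct_card[symmetric])
    finally have "ln (E x) \<le> ln (n * exp (lam * u x))" using Epos[of x] by (simp add: ln_mono)
    also have "\<dots> = ln n + lam * u x" using n by (simp add: ln_mult)
    also have "\<dots> \<le> lam * (u x + \<delta>)" using l by (simp add: distrib_left)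
    finally have "f x \<le> u x + \<delta>" using l by (simp add: f_def pos_divide_le_eq mult.commute)
    with 1 show ?thesis by linarith
  qed
  ultimately show ?thesis by blast
qed

theorem convex_cinf_approx:
  fixes u :: "'b::euclidean_space \<Rightarrow> real"
  assumes u: "smooth_on (ball c R) u" and r: "r < R"
    and conv: "\<And>x y. x \<in> ball c R \<Longrightarrow> y \<in> ball c R \<Longrightarrow> u y + ddir (x - y) u y \<le> u x"
  shows "\<exists>F. (\<forall>k. \<exists>lam. exp_sum lam (F k)) \<and> cinf_tendsto (ball c r) F u"
proof -
  define r' where "r' = (r + R) / 2"
  have r': "r < r'" "r' < R" using r by (auto simp: r'_def)
  \<comment> \<open>Diagonal choice: the \<open>k\<close>-th function controls derivatives of order
    up to \<open>k\<close> with error \<open>1 / real (Suc k)\<close>, so any fixed list of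
    directions is controlled from some index on.\<close>
  have "\<exists>f. (\<exists>lam. exp_sum lam f) \<and> (\<forall>vs. set vs \<subseteq> Basis \<and> length vs \<le> k \<longrightarrow>
     (\<forall>x\<in>cball c r. \<bar>iter_deriv vs f x - iter_deriv vs u x\<bar> \<le> 1 / real (Suc k)))" for k
    by (rule smooth_approx_upgrade[OF u r', where P = "\<lambda>f. \<exists>lam. exp_sum lam f"])
      (use exp_sum_uniform_approx[OF u r'(2) _ conv] exp_sum_smooth exp_sum_shift_avg in \<open>blast | simp\<close>)+
  then obtain F where F: "\<And>k. \<exists>lam. exp_sum lam (F k)" "\<And>k vs x. set vs \<subseteq> Basis \<Longrightarrow> length vs \<le> k \<Longrightarrow>
     x\<in>cball c r \<Longrightarrow> \<bar>iter_deriv vs (F k) x - iter_deriv vs u x\<bar> \<le> 1 / real (Suc k)" by metis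
  have Fs: "smooth_on (ball c r) (F k)" for k
    using F(1)[of k] exp_sum_smooth smooth_on_subset by blast
  have us: "smooth_on (ball c r) u" by (rule smooth_on_subset[OF u]) (use r in auto)
  have "cinf_tendsto (ball c r) F u"
  proof (rule cinf_tendsto_BasisI[OF open_ball us Fs])
    fix bs :: "'b list" and K assume bs: "set bs \<subseteq> Basis" and K: "compact K" "K \<subseteq> ball c r"
    show "uniform_limit K (\<lambda>k. iter_deriv bs (F k)) (iter_deriv bs u) sequentially"
    proof (rule uniform_limitI)
      fix e :: real assume e: "e > 0"
      obtain n where n: "inverse (real (Suc n)) < e" using reals_Archimedean[OF e] by blast
      show "eventually (\<lambda>k. \<forall>x\<in>K. dist (iter_deriv bs (F k) x) (iter_deriv bs u x) < e) sequentially"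
      proof (rule eventually_sequentiallyI[of "max n (length bs)"], intro ballI)
        fix k x assume k: "max n (length bs) \<le> k" and x: "x \<in> K"
        have "\<bar>iter_deriv bs (F k) x - iter_deriv bs u x\<bar> \<le> 1 / real (Suc k)"
          using bs k x K by (intro F(2)) auto
        also have "\<dots> \<le> inverse (real (Suc n))" using k by (simp add: inverse_eq_divide frac_le)
        finally show "dist (iter_deriv bs (F k) x) (iter_deriv bs u x) < e" using n by (simp add: dist_real_def)
      qed
    qed
  qed
  with F(1) show ?thesis by blast
qed

section \<open>The smooth inverse function theorem\<close>

lemma smooth_on_vecI:
  fixes f :: "'b::real_normed_vector \<Rightarrow> real^'m"
  assumes S: "open S" and f: "\<And>k. smooth_on S (\<lambda>x. f x $ k)"
  shows "smooth_on S f"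
proof -
  have "smooth_on S (\<lambda>x. \<Sum>k\<in>UNIV. (f x $ k) *\<^sub>R axis k (1::real))"
    by (intro smooth_on_sum[OF S] smooth_on_linear_compose[OF S bounded_linear_scaleR_left] f)
  moreover have "(\<Sum>k\<in>UNIV. (f x $ k) *\<^sub>R axis k (1::real)) = f x" for x
    using basis_expansion[of "f x"] by (simp add: scalar_mult_eq_scaleR)
  ultimately show ?thesis by simp
qed

lemma smooth_on_det:
  fixes M :: "'b::real_normed_vector \<Rightarrow> real^'m^'m"
  assumes S: "open S" and "\<And>i j. smooth_on S (\<lambda>x. M x $ i $ j)"
  shows "smooth_on S (\<lambda>x. det (M x))"
  unfolding det_def
  by (intro smooth_on_sum[OF S] smooth_on_linear_compose[OF S bounded_linear_mult_right] smooth_on_prod[OF S] assms)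

text \<open>Cramer's rule writes \<open>w\<close> as a quotient of determinants with smooth entries.
  This makes \<open>w\<close> smooth although it is given only pointwise, as a solution of a linear
  system.\<close>

lemma smooth_on_matrix_solve:
  fixes M :: "'b::real_normed_vector \<Rightarrow> real^'m^'m"
  assumes S: "open S" and M: "\<And>i j. smooth_on S (\<lambda>x. M x $ i $ j)" and d: "\<And>x. x \<in> S \<Longrightarrow> det (M x) \<noteq> 0"
    and w: "\<And>x. x \<in> S \<Longrightarrow> M x *v w x = v"
  shows "smooth_on S w"
proof -
  let ?N = "\<lambda>k x. \<chi> i j. if j = k then v $ i else M x $ i $ j"
  have "smooth_on S (\<lambda>x. det (?N k x) * inverse (det (M x)))" for k
  proof (rule smooth_on_mult[OF S])
    show "smooth_on S (\<lambda>x. det (?N k x))"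
    proof (rule smooth_on_det[OF S])
      show "smooth_on S (\<lambda>x. ?N k x $ i $ j)" for i j by (cases "j = k") (auto simp: M)
    qed
    show "smooth_on S (\<lambda>x. inverse (det (M x)))"
      by (rule smooth_on_compose[OF S smooth_on_det[OF S M] _ smooth_on_inverse[of "- {0}"]]) (use d in auto)
  qed
  then have sm: "smooth_on S (\<lambda>x. \<chi> k. det (?N k x) / det (M x))"
    by (intro smooth_on_vecI[OF S]) (simp add: divide_inverse)
  have eq: "w x = (\<chi> k. det (?N k x) / det (M x))" if "x \<in> S" for x
    using cramer[OF d[OF that], of "w x" v] w[OF that] by simp
  show ?thesis by (rule iffD2[OF smooth_on_cong[OF S eq] sm])
qed

text \<open>The inverse function theorem for continuously differentiable maps yields a local inverse
  \<open>g\<close> whose derivative at \<open>y\<close> inverts the derivative of \<open>G\<close>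
  at \<open>g y\<close>. Smoothness is bootstrapped with the class of functions
  \<open>a (g y)\<close>: differentiating one of them gives another smooth function on
  \<open>U\<close> composed with \<open>g\<close>.\<close>

theorem smooth_inverse_function:
  fixes G :: "real^'m \<Rightarrow> real^'m"
  assumes T: "open T" and G: "smooth_on T G" and p: "p \<in> T" and id: "\<And>v. ddir v G p = v"
  obtains U V g where "open U" "U \<subseteq> T" "p \<in> U" "open V" "homeomorphism U V G g" "smooth_on V g"
proof -
  define G' where "G' = (\<lambda>x. Blinfun (\<lambda>v. ddir v G x))"
  have bl: "bounded_linear (\<lambda>v. ddir v G x)" if "x \<in> T" for x
    using smooth_on_has_derivative[OF G that] has_derivative_bounded_linear by blast
  have G': "blinfun_apply (G' x) = (\<lambda>v. ddir v G x)" if "x \<in> T" for x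
    unfolding G'_def using bounded_linear_Blinfun_apply[OF bl[OF that]] .
  have der: "(G has_derivative blinfun_apply (G' x)) (at x)" if "x \<in> T" for x
    using smooth_on_has_derivative[OF G that] G'[OF that] by simp
  have cont: "continuous_on T G'"
  proof (rule continuous_on_blinfun_componentwise)
    fix i :: "real^'m"
    have "continuous_on T (ddir i G)" using smooth_on_continuous smooth_on_ddir G by blast
    then show "continuous_on T (\<lambda>x. blinfun_apply (G' x) i)"
      using continuous_on_cong[of T T "\<lambda>x. blinfun_apply (G' x) i" "ddir i G"] G' by simp
  qed
  have inv: "id_blinfun o\<^sub>L G' p = id_blinfun"
    by (rule blinfun_eqI) (simp add: G'[OF p] id)
  obtain U V g g' where U: "open U" "U \<subseteq> T" "p \<in> U" "open V" "homeomorphism U V G g"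
      "\<And>y. y \<in> V \<Longrightarrow> (g has_derivative (g' y)) (at y)"
      "\<And>y. y \<in> V \<Longrightarrow> g' y = Hilbert_Choice.inv (blinfun_apply (G' (g y)))"
      "\<And>y. y \<in> V \<Longrightarrow> bij (blinfun_apply (G' (g y)))"
    using inverse_function_theorem[OF T der cont p inv] by metis
  have gU: "g y \<in> U" if "y \<in> V" for y using U(5) that by (auto simp: homeomorphism_def)
  have surjg: "\<exists>y\<in>V. g y = x" if "x \<in> U" for x using U(5) that by (auto simp: homeomorphism_def)
  define M where "M = (\<lambda>x. matrix (\<lambda>v. ddir v G x))"
  \<comment> \<open>\<open>N v x\<close> solves the linear system with matrix \<open>M x\<close> and
    right-hand side \<open>v\<close>. It is smooth in \<open>x\<close> by Cramer's rule, and the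
    derivative of \<open>g\<close> at \<open>y\<close> in direction \<open>v\<close> is
    \<open>N v (g y)\<close>.\<close>
  define N where "N = (\<lambda>v x. Hilbert_Choice.inv (\<lambda>v. ddir v G x) v)"
  have bij: "bij (\<lambda>v. ddir v G x)" if xU: "x \<in> U" for x
  proof -
    obtain y where "y \<in> V" "g y = x" using surjg[OF xU] by blast
    then show ?thesis using U(8)[of y] G'[of x] U(2) xU by auto
  qed
  have Mv: "M x *v w = ddir w G x" if "x \<in> U" for x w
  proof -
    have "linear (\<lambda>v. ddir v G x)" using bl[of x] U(2) that bounded_linear.linear by blast
    then show ?thesis unfolding M_def by (intro matrix_works) (simp add: linear_matrix_vector_mul_eq)
  qed
  have Ns: "smooth_on U (N v)" for v
  proof (rule smooth_on_matrix_solve[OF U(1)])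
    fix i j
    have "smooth_on U (\<lambda>x. ddir (axis j 1) G x $ i)"
      by (intro smooth_on_linear_compose[OF U(1) bounded_linear_vec_nth] smooth_on_subset[OF smooth_on_ddir[OF G] U(2)])
    then show "smooth_on U (\<lambda>x. M x $ i $ j)" by (simp add: M_def matrix_def)
  next
    fix x assume x: "x \<in> U"
    have "(\<lambda>w. M x *v w) = (\<lambda>v. ddir v G x)" using Mv[OF x] by (intro ext)
    then have "inj (\<lambda>w. M x *v w)" using bij[OF x] by (simp add: bij_def)
    then show "det (M x) \<noteq> 0"
      by (simp add: invertible_det_nz[symmetric] invertible_left_inverse matrix_left_invertible_injective)
    have "ddir (N v x) G x = v"
      using bij_inv_eq_iff[OF bij[OF x], of "N v x" v] by (simp add: N_def)
    then show "M x *v N v x = v" using Mv[OF x] by simp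
  qed
  have "smooth_on V g"
  proof (rule smooth_on_coinduct[OF U(4), where P = "\<lambda>h. \<exists>a. smooth_on U a \<and> h = (\<lambda>y. a (g y))"])
    show "\<exists>a. smooth_on U a \<and> g = (\<lambda>y. a (g y))"
      by (intro exI[of _ "\<lambda>x. x"]) (auto intro: smooth_on_linear[OF bounded_linear_ident U(1)])
    fix h :: "real^'m \<Rightarrow> real^'m" assume "\<exists>a. smooth_on U a \<and> h = (\<lambda>y. a (g y))"
    then obtain a where a: "smooth_on U a" "h = (\<lambda>y. a (g y))" by blast
    have D: "(h has_derivative (\<lambda>v. ddir (g' y v) a (g y))) (at y)" if y: "y \<in> V" for y
      unfolding a(2)
      by (rule has_derivative_compose[OF U(6)[OF y] smooth_on_has_derivative[OF a(1) gU[OF y]]])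
    have gN: "g' y v = N v (g y)" if "y \<in> V" for y v
      using U(7)[OF that] G'[of "g y"] gU[OF that] U(2) by (auto simp: N_def)
    have "ddir v h y = (\<Sum>i\<in>Basis. (N v (g y) \<bullet> i) *\<^sub>R ddir i a (g y))" if y: "y \<in> V" for v y
      unfolding ddir_eqI[OF D[OF y]] gN[OF y]
      by (rule ddir_basis_expansion[OF smooth_on_differentiable[OF a(1) gU[OF y]]])
    moreover have "smooth_on U (\<lambda>x. \<Sum>i\<in>Basis. (N v x \<bullet> i) *\<^sub>R ddir i a x)" for v
      by (intro smooth_on_sum[OF U(1)] smooth_on_scaleR[OF U(1)] smooth_on_inner[OF U(1)] Ns smooth_on_const smooth_on_ddir a(1))
    ultimately have "\<exists>f. (\<exists>a. smooth_on U a \<and> f = (\<lambda>y. a (g y))) \<and> (\<forall>y\<in>V. ddir v h y = f y)" for v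
      by (intro exI[of _ "\<lambda>y. \<Sum>i\<in>Basis. (N v (g y) \<bullet> i) *\<^sub>R ddir i a (g y)"] conjI
          exI[of _ "\<lambda>x. \<Sum>i\<in>Basis. (N v x \<bullet> i) *\<^sub>R ddir i a x"]) auto
    then show "(\<forall>y\<in>V. h differentiable at y) \<and>
       (\<forall>v. \<exists>f. (\<exists>a. smooth_on U a \<and> f = (\<lambda>y. a (g y))) \<and> (\<forall>y\<in>V. ddir v h y = f y))"
      using D unfolding differentiable_def by blast
  qed
  then show ?thesis using that U by blast
qed

section \<open>Charts and tangent vectors in coordinates\<close>

text \<open>Differentiation under the integral brings out another factor \<open>t\<close>, so the
  invariant is the family of such integrals with an arbitrary weight \<open>t ^ k\<close>.\<close>

lemma hadamard_smooth:
  fixes F :: "'b::euclidean_space \<Rightarrow> 'c::banach"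
  assumes F: "smooth_on (ball c R) F"
  shows "smooth_on (ball c R) (\<lambda>x. integral {0..1} (\<lambda>t. F (c + t *\<^sub>R (x - c))))"
proof -
  let ?S = "ball c R"
  let ?P = "\<lambda>h :: 'b \<Rightarrow> 'c. \<exists>k F. smooth_on ?S F \<and> h = (\<lambda>x. integral {0..1} (\<lambda>t. (t::real) ^ k *\<^sub>R F (c + t *\<^sub>R (x - c))))"
  have inS: "c + t *\<^sub>R (x - c) \<in> ?S" if "x \<in> ?S" "t \<in> {0..1}" for x t
  proof -
    have "t * norm (x - c) \<le> 1 * norm (x - c)" using that by (intro mult_right_mono) auto
    then show ?thesis using that by (simp add: dist_norm norm_minus_commute)
  qed
  show ?thesis
  proof (rule smooth_on_coinduct[OF open_ball, where P = ?P])
    show "?P (\<lambda>x. integral {0..1} (\<lambda>t. F (c + t *\<^sub>R (x - c))))"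
      using F by (intro exI[of _ 0] exI[of _ F]) simp
    fix h assume "?P h"
    then obtain k F where F: "smooth_on ?S F" "h = (\<lambda>x. integral {0..1} (\<lambda>t. t ^ k *\<^sub>R F (c + t *\<^sub>R (x - c))))"
      by blast
    define f' where "f' = (\<lambda>x t. Blinfun (\<lambda>v. t ^ Suc k *\<^sub>R ddir v F (c + t *\<^sub>R (x - c))))"
    have D: "((\<lambda>x. t ^ k *\<^sub>R F (c + t *\<^sub>R (x - c))) has_derivative (\<lambda>v. t ^ Suc k *\<^sub>R ddir v F (c + t *\<^sub>R (x - c)))) (at x)"
      if "x \<in> ?S" "t \<in> {0..1}" for x t
    proof -
      have d: "F differentiable at (c + t *\<^sub>R (x - c))" using smooth_on_differentiable[OF F(1) inS[OF that]] .
      have "((\<lambda>x. c + t *\<^sub>R (x - c)) has_derivative (\<lambda>v. t *\<^sub>R v)) (at x)"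
        by (auto intro!: derivative_eq_intros)
      from has_derivative_compose[OF this has_derivative_ddir[OF d]]
      have "((\<lambda>x. F (c + t *\<^sub>R (x - c))) has_derivative (\<lambda>v. ddir (t *\<^sub>R v) F (c + t *\<^sub>R (x - c)))) (at x)" .
      then have "((\<lambda>x. t ^ k *\<^sub>R F (c + t *\<^sub>R (x - c))) has_derivative (\<lambda>v. t ^ k *\<^sub>R ddir (t *\<^sub>R v) F (c + t *\<^sub>R (x - c)))) (at x)"
        by (rule has_derivative_scaleR_right)
      then show ?thesis
        using linear_scale[OF linear_frechet_derivative[OF d]] by (simp add: ddir_def mult.commute)
    qed
    have f'a: "blinfun_apply (f' x t) = (\<lambda>v. t ^ Suc k *\<^sub>R ddir v F (c + t *\<^sub>R (x - c)))"
      if "x \<in> ?S" "t \<in> {0..1}" for x t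
      unfolding f'_def using bounded_linear_Blinfun_apply[OF has_derivative_bounded_linear[OF D[OF that]]] .
    have cmap: "continuous_on (?S \<times> {0..1}) (\<lambda>(x, t). c + t *\<^sub>R (x - c))"
      by (auto intro!: continuous_intros simp: case_prod_beta)
    have cont: "continuous_on (?S \<times> {0..1}) (\<lambda>(x, t). t ^ j *\<^sub>R g (c + t *\<^sub>R (x - c)))" if "smooth_on ?S g" for g :: "'b \<Rightarrow> 'c" and j
    proof -
      have "continuous_on (?S \<times> {0..1}) (\<lambda>p. g ((\<lambda>(x, t). c + t *\<^sub>R (x - c)) p))"
        by (rule continuous_on_compose2[OF smooth_on_continuous[OF that] cmap]) (use inS in auto)
      then show ?thesis by (auto intro!: continuous_intros simp: case_prod_beta)
    qed
    have contb: "continuous_on (?S \<times> cbox 0 1) (\<lambda>(x, t). f' x t)"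
    proof (rule continuous_on_blinfun_componentwise)
      fix i :: 'b
      have "continuous_on (?S \<times> {0..1}) (\<lambda>(x, t). t ^ Suc k *\<^sub>R ddir i F (c + t *\<^sub>R (x - c)))"
        by (intro cont smooth_on_ddir F)
      then show "continuous_on (?S \<times> cbox 0 1) (\<lambda>p. blinfun_apply (case p of (x, t) \<Rightarrow> f' x t) i)"
        unfolding cbox_interval by (rule continuous_on_eq) (auto simp: f'a)
    qed
    have int: "(\<lambda>t. t ^ j *\<^sub>R g (c + t *\<^sub>R (x - c))) integrable_on cbox 0 1" if "x \<in> ?S" "smooth_on ?S g" for x j and g :: "'b \<Rightarrow> 'c"
    proof (rule integrable_continuous)
      have "continuous_on (cbox 0 1) (\<lambda>t. (\<lambda>(x, t). t ^ j *\<^sub>R g (c + t *\<^sub>R (x - c))) (x, t))"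
        by (rule continuous_on_compose2[OF cont[OF that(2)]]) (use that in \<open>auto intro!: continuous_intros\<close>)
      then show "continuous_on (cbox 0 1) (\<lambda>t. t ^ j *\<^sub>R g (c + t *\<^sub>R (x - c)))" by simp
    qed
    have L: "(h has_derivative integral (cbox 0 1) (f' x)) (at x)" if x: "x \<in> ?S" for x
    proof -
      have "((\<lambda>x. integral (cbox 0 1) (\<lambda>t. t ^ k *\<^sub>R F (c + t *\<^sub>R (x - c)))) has_derivative integral (cbox 0 1) (f' x)) (at x within ?S)"
        by (rule leibniz_rule[OF _ int[OF _ F(1)] contb x convex_ball])
          (use D f'a in \<open>auto intro: has_derivative_at_withinI\<close>)
      then show ?thesis using x by (simp add: F(2) at_within_open[OF _ open_ball])
    qed
    have dh: "ddir v h x = integral {0..1} (\<lambda>t. t ^ Suc k *\<^sub>R ddir v F (c + t *\<^sub>R (x - c)))" if x: "x \<in> ?S" for v x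
    proof -
      have fi: "f' x integrable_on cbox 0 1"
      proof (rule integrable_continuous)
        have "continuous_on (cbox 0 1) (\<lambda>t. (\<lambda>(x, t). f' x t) (x, t))"
          by (rule continuous_on_compose2[OF contb]) (use x in \<open>auto intro!: continuous_intros\<close>)
        then show "continuous_on (cbox 0 1) (f' x)" by simp
      qed
      have "ddir v h x = blinfun_apply (integral (cbox 0 1) (f' x)) v" by (rule ddir_eqI[OF L[OF x]])
      also have "\<dots> = integral (cbox 0 1) (\<lambda>t. blinfun_apply (f' x t) v)"
        by (rule blinfun_apply_integral[OF fi])
      also have "\<dots> = integral (cbox 0 1) (\<lambda>t. t ^ Suc k *\<^sub>R ddir v F (c + t *\<^sub>R (x - c)))"
        by (rule integral_cong) (use x f'a in auto)
      finally show ?thesis by simp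
    qed
    show "(\<forall>x\<in>?S. h differentiable at x) \<and> (\<forall>v. \<exists>g. ?P g \<and> (\<forall>x\<in>?S. ddir v h x = g x))"
    proof (intro conjI ballI allI)
      show "h differentiable at x" if "x \<in> ?S" for x using L[OF that] unfolding differentiable_def by blast
      show "\<exists>g. ?P g \<and> (\<forall>x\<in>?S. ddir v h x = g x)" for v
        using dh smooth_on_ddir[OF F(1), of v]
        by (intro exI[of _ "\<lambda>x. integral {0..1} (\<lambda>t. t ^ Suc k *\<^sub>R ddir v F (c + t *\<^sub>R (x - c)))"] conjI
          exI[of _ "Suc k"] exI[of _ "ddir v F"]) auto
    qed
  qed
qed

text \<open>Integrate the derivative of \<open>f\<close> along the segment from \<open>c\<close> to
  \<open>x\<close>; the factors \<open>x $ i - c $ i\<close> come out of the integral. The functions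
  \<open>g i\<close> make it possible to evaluate a derivation on \<open>f\<close> by the product
  rule.\<close>

lemma hadamard:
  fixes f :: "real^'m \<Rightarrow> complex"
  assumes f: "smooth_on (ball c R) f" and R: "R > 0"
  obtains g where "\<And>i. smooth_on (ball c R) (g i)" "\<And>i. g i c = ddir (axis i 1) f c"
    "\<And>x. x \<in> ball c R \<Longrightarrow> f x = f c + (\<Sum>i\<in>UNIV. complex_of_real (x $ i - c $ i) * g i x)"
proof -
  define g where "g = (\<lambda>i x. integral {0..1} (\<lambda>t. ddir (axis i 1) f (c + t *\<^sub>R (x - c))))"
  have "f x = f c + (\<Sum>i\<in>UNIV. complex_of_real (x $ i - c $ i) * g i x)" if x: "x \<in> ball c R" for x
  proof -
    have inS: "c + t *\<^sub>R (x - c) \<in> ball c R" if "t \<in> {0..1}" for t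
    proof -
      have "t * norm (x - c) \<le> 1 * norm (x - c)" using that by (intro mult_right_mono) auto
      then show ?thesis using that x by (simp add: dist_norm norm_minus_commute)
    qed
    have ex: "ddir (x - c) f y = (\<Sum>i\<in>UNIV. complex_of_real (x $ i - c $ i) * ddir (axis i 1) f y)" if "y \<in> ball c R" for y
    proof -
      have d: "f differentiable at y" using smooth_on_differentiable[OF f that] .
      have l: "linear (\<lambda>v. ddir v f y)" using linear_frechet_derivative[OF d] by (simp add: ddir_def)
      have "x - c = (\<Sum>i\<in>UNIV. ((x - c) $ i) *\<^sub>R axis i 1)"
        using basis_expansion[of "x - c"] by (simp add: scalar_mult_eq_scaleR)
      then have "ddir (x - c) f y = ddir (\<Sum>i\<in>UNIV. ((x - c) $ i) *\<^sub>R axis i 1) f y" by (rule arg_cong)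
      also have "\<dots> = (\<Sum>i\<in>UNIV. ((x - c) $ i) *\<^sub>R ddir (axis i 1) f y)"
        by (simp only: linear_sum[OF l] linear_scale[OF l])
      finally show ?thesis by (simp add: scaleR_conv_of_real)
    qed
    have "((\<lambda>t. f (c + t *\<^sub>R (x - c))) has_vector_derivative ddir (x - c) f (c + t *\<^sub>R (x - c))) (at t within {0..1})"
      if "t \<in> {0..1}" for t
    proof -
      have d: "f differentiable at (c + t *\<^sub>R (x - c))" using smooth_on_differentiable[OF f inS[OF that]] .
      have "((\<lambda>t. c + t *\<^sub>R (x - c)) has_derivative (\<lambda>s. s *\<^sub>R (x - c))) (at t within {0..1})"
        by (auto intro!: derivative_eq_intros)
      from has_derivative_compose[OF this has_derivative_ddir[OF d]]
      have "((\<lambda>t. f (c + t *\<^sub>R (x - c))) has_derivative (\<lambda>s. ddir (s *\<^sub>R (x - c)) f (c + t *\<^sub>R (x - c)))) (at t within {0..1})" .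
      then show ?thesis
        using linear_scale[OF linear_frechet_derivative[OF d]] by (simp add: ddir_def has_vector_derivative_def)
    qed
    from fundamental_theorem_of_calculus[OF zero_le_one this]
    have "((\<lambda>t. ddir (x - c) f (c + t *\<^sub>R (x - c))) has_integral f x - f c) {0..1}" by simp
    then have I1: "((\<lambda>t. \<Sum>i\<in>UNIV. complex_of_real (x $ i - c $ i) * ddir (axis i 1) f (c + t *\<^sub>R (x - c))) has_integral f x - f c) {0..1}"
      by (rule has_integral_eq[rotated]) (use ex inS in auto)
    have I2: "((\<lambda>t. \<Sum>i\<in>UNIV. complex_of_real (x $ i - c $ i) * ddir (axis i 1) f (c + t *\<^sub>R (x - c))) has_integral
       (\<Sum>i\<in>UNIV. complex_of_real (x $ i - c $ i) * g i x)) {0..1}"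
    proof (intro has_integral_sum has_integral_mult_right finite)
      fix i :: 'm
      have "continuous_on {0..1} (\<lambda>t. ddir (axis i 1) f (c + t *\<^sub>R (x - c)))"
        by (rule continuous_on_compose2[OF smooth_on_continuous[OF smooth_on_ddir[OF f]]]) 
          (use inS in \<open>auto intro!: continuous_intros\<close>)
      then show "((\<lambda>t. ddir (axis i 1) f (c + t *\<^sub>R (x - c))) has_integral g i x) {0..1}"
        unfolding g_def by (intro integrable_integral integrable_continuous_real)
    qed
    have "f x - f c = (\<Sum>i\<in>UNIV. complex_of_real (x $ i - c $ i) * g i x)"
      by (rule has_integral_unique[OF I1 I2])
    then show ?thesis by (simp only: diff_eq_eq add.commute)
  qed
  moreover have "smooth_on (ball c R) (g i)" for i
    unfolding g_def by (rule hadamard_smooth[OF smooth_on_ddir[OF f]])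
  moreover have "g i c = ddir (axis i 1) f c" for i by (simp add: g_def)
  ultimately show ?thesis using that by blast
qed

text \<open>The atlas need not be maximal, and the graph coordinates constructed later are not among
  its members. This is membership in the maximal atlas, with transition maps smooth in both
  directions.\<close>

definition compatible_chart :: "'a topology \<Rightarrow> ('a, 'm::finite) chart set \<Rightarrow> 'a set \<Rightarrow> ('a \<Rightarrow> real^'m) \<Rightarrow> bool" where
  "compatible_chart X A D \<phi> \<longleftrightarrow> openin X D \<and> open (\<phi> ` D) \<and>
     homeomorphic_map (subtopology X D) (top_of_set (\<phi> ` D)) \<phi> \<and>
     (\<forall>(E, \<psi>)\<in>A. smooth_on (\<phi> ` (D \<inter> E)) (\<psi> \<circ> inv_into D \<phi>) \<and> smooth_on (\<psi> ` (E \<inter> D)) (\<phi> \<circ> inv_into E \<psi>))"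

lemma compatible_chart_atlas:
  assumes "smooth_atlas X A" "(D, \<phi>) \<in> A"
  shows "compatible_chart X A D \<phi>"
  using assms unfolding smooth_atlas_def compatible_chart_def by (fastforce simp: Int_commute)

lemma compatible_chart_inj:
  assumes "compatible_chart X A D \<phi>" shows "inj_on \<phi> D"
proof -
  have "D \<subseteq> topspace X" using assms openin_subset unfolding compatible_chart_def by blast
  then show ?thesis
    using assms homeomorphic_imp_injective_map unfolding compatible_chart_def
    by (metis topspace_subtopology_subset)
qed

lemma compatible_chart_open_image:
  assumes "compatible_chart X A D \<phi>" "openin X W" "W \<subseteq> D"
  shows "open (\<phi> ` W)"
proof -
  have "openin (subtopology X D) W" using assms by (meson openin_subset_topspace_eq openin_subtopology subset_openin_subtopology)
  then have "openin (top_of_set (\<phi> ` D)) (\<phi> ` W)"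
    using assms homeomorphic_imp_open_map unfolding compatible_chart_def open_map_def by metis
  then show ?thesis using assms unfolding compatible_chart_def by (metis openin_open_eq)
qed

lemma compatible_chart_open_preimage:
  assumes "compatible_chart X A D \<phi>" "open B"
  shows "openin X {q \<in> D. \<phi> q \<in> B}"
proof -
  have D: "openin X D" "D \<subseteq> topspace X" using assms openin_subset unfolding compatible_chart_def by blast+
  have "continuous_map (subtopology X D) (top_of_set (\<phi> ` D)) \<phi>"
    using assms homeomorphic_imp_continuous_map unfolding compatible_chart_def by blast
  moreover have "openin (top_of_set (\<phi> ` D)) (\<phi> ` D \<inter> B)" using assms(2) by (simp add: openin_open_Int)
  ultimately have "openin (subtopology X D) {q \<in> topspace (subtopology X D). \<phi> q \<in> \<phi> ` D \<inter> B}"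
    by (rule openin_continuous_map_preimage)
  moreover have "{q \<in> topspace (subtopology X D). \<phi> q \<in> \<phi> ` D \<inter> B} = {q \<in> D. \<phi> q \<in> B}"
    using D by (auto simp: topspace_subtopology)
  ultimately show ?thesis using D(1) openin_trans_full by metis
qed

lemma compatible_chart_image_Int:
  assumes "compatible_chart X A D \<phi>" "openin X W"
  shows "open (\<phi> ` (D \<inter> W))"
proof -
  have "openin X (D \<inter> W)" using assms unfolding compatible_chart_def by auto
  then show ?thesis using compatible_chart_open_image[OF assms(1)] by simp
qed

lemma smooth_fun_subset: "smooth_fun A W f \<Longrightarrow> W' \<subseteq> W \<Longrightarrow> smooth_fun A W' f"
  unfolding smooth_fun_def by (force intro: smooth_on_subset)

section \<open>Smooth functions, tangent vectors and brackets on a manifold with an atlas\<close>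

locale smooth_atlas_on =
  fixes X :: "'a topology" and A :: "('a, 'm::finite) chart set"
  assumes atlas: "smooth_atlas X A"
begin

lemma chart_image_open: "(D, \<phi>) \<in> A \<Longrightarrow> openin X W \<Longrightarrow> open (\<phi> ` (D \<inter> W))"
  using compatible_chart_image_Int compatible_chart_atlas[OF atlas] by blast

lemma chart_inj: "(D, \<phi>) \<in> A \<Longrightarrow> inj_on \<phi> D"
  using compatible_chart_inj compatible_chart_atlas[OF atlas] by blast

lemma chart_cover: "q \<in> topspace X \<Longrightarrow> \<exists>(D, \<phi>)\<in>A. q \<in> D"
  using atlas unfolding smooth_atlas_def by blast

lemma smooth_fun_cong:
  assumes W: "openin X W" and eq: "\<And>q. q \<in> W \<Longrightarrow> f q = g q" and f: "smooth_fun A W f"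
  shows "smooth_fun A W g"
  unfolding smooth_fun_def
proof (clarify)
  fix D \<phi> assume D: "(D, \<phi>) \<in> A"
  have "(f \<circ> inv_into D \<phi>) x = (g \<circ> inv_into D \<phi>) x" if "x \<in> \<phi> ` (D \<inter> W)" for x
    using that eq chart_inj[OF D] by auto
  then show "smooth_on (\<phi> ` (D \<inter> W)) (g \<circ> inv_into D \<phi>)"
    using f D smooth_on_cong[OF chart_image_open[OF D W]] unfolding smooth_fun_def by blast
qed

lemma smooth_fun_const [simp]: "smooth_fun A W (\<lambda>q. c)"
  unfolding smooth_fun_def by (auto simp: o_def)

lemma smooth_fun_add: "openin X W \<Longrightarrow> smooth_fun A W f \<Longrightarrow> smooth_fun A W g \<Longrightarrow> smooth_fun A W (\<lambda>q. f q + g q)"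
  unfolding smooth_fun_def using smooth_on_add[OF chart_image_open] by (fastforce simp: o_def)

lemma smooth_fun_mult: "openin X W \<Longrightarrow> smooth_fun A W f \<Longrightarrow> smooth_fun A W g \<Longrightarrow> smooth_fun A W (\<lambda>q. f q * g q)"
  unfolding smooth_fun_def using smooth_on_mult[OF chart_image_open] by (fastforce simp: o_def)

lemma smooth_fun_cnj: "openin X W \<Longrightarrow> smooth_fun A W f \<Longrightarrow> smooth_fun A W (\<lambda>q. cnj (f q))"
  unfolding smooth_fun_def using smooth_on_linear_compose[OF chart_image_open bounded_linear_cnj] by (fastforce simp: o_def)

lemma smooth_fun_cmult: "openin X W \<Longrightarrow> smooth_fun A W f \<Longrightarrow> smooth_fun A W (\<lambda>q. c * f q)"
  by (rule smooth_fun_mult) auto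

lemma smooth_fun_sum:
  "openin X W \<Longrightarrow> (\<And>i. i \<in> I \<Longrightarrow> smooth_fun A W (f i)) \<Longrightarrow> smooth_fun A W (\<lambda>q. \<Sum>i\<in>I. f i q)"
  by (induction I rule: infinite_finite_induct) (auto intro: smooth_fun_add)

lemma smooth_fun_compose:
  fixes h :: "complex \<Rightarrow> complex"
  assumes W: "openin X W" and f: "smooth_fun A W f" and h: "smooth_on T h" "f ` W \<subseteq> T"
  shows "smooth_fun A W (\<lambda>q. h (f q))"
  unfolding smooth_fun_def
proof (clarify)
  fix D \<phi> assume D: "(D, \<phi>) \<in> A"
  have "smooth_on (\<phi> ` (D \<inter> W)) (\<lambda>x. h ((f \<circ> inv_into D \<phi>) x))"
  proof (rule smooth_on_compose[OF chart_image_open[OF D W] _ _ h(1)])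
    show "smooth_on (\<phi> ` (D \<inter> W)) (f \<circ> inv_into D \<phi>)" using f D unfolding smooth_fun_def by blast
  qed (use h(2) chart_inj[OF D] in auto)
  then show "smooth_on (\<phi> ` (D \<inter> W)) ((\<lambda>q. h (f q)) \<circ> inv_into D \<phi>)" by (simp add: o_def)
qed

lemma smooth_nearI: "openin X W \<Longrightarrow> q \<in> W \<Longrightarrow> smooth_fun A W f \<Longrightarrow> smooth_near X A q f"
  unfolding smooth_near_def by blast

lemma smooth_near_cong:
  assumes "openin X W" "q \<in> W" "\<And>y. y \<in> W \<Longrightarrow> f y = g y" "smooth_near X A q f"
  shows "smooth_near X A q g"
proof -
  obtain W1 where W1: "openin X W1" "q \<in> W1" "smooth_fun A W1 f" using assms(4) unfolding smooth_near_def by blast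
  have "smooth_fun A (W \<inter> W1) g"
    by (rule smooth_fun_cong[of "W \<inter> W1" f]) (use assms W1 smooth_fun_subset[OF W1(3)] in auto)
  then show ?thesis using assms W1 by (intro smooth_nearI[of "W \<inter> W1"]) auto
qed

lemma smooth_near_const [simp]: "q \<in> topspace X \<Longrightarrow> smooth_near X A q (\<lambda>q. c)"
  by (rule smooth_nearI[of "topspace X"]) auto

lemma smooth_near_add:
  assumes "smooth_near X A q f" "smooth_near X A q g" shows "smooth_near X A q (\<lambda>q. f q + g q)"
proof -
  obtain W W1 where "openin X W1" "q \<in> W1" "smooth_fun A W1 f" "openin X W" "q \<in> W" "smooth_fun A W g"
    using assms unfolding smooth_near_def by blast
  then show ?thesis
    by (intro smooth_nearI[of "W \<inter> W1"] smooth_fun_add) (auto intro: smooth_fun_subset)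
qed

lemma smooth_near_mult:
  assumes "smooth_near X A q f" "smooth_near X A q g" shows "smooth_near X A q (\<lambda>q. f q * g q)"
proof -
  obtain W W1 where "openin X W1" "q \<in> W1" "smooth_fun A W1 f" "openin X W" "q \<in> W" "smooth_fun A W g"
    using assms unfolding smooth_near_def by blast
  then show ?thesis
    by (intro smooth_nearI[of "W \<inter> W1"] smooth_fun_mult) (auto intro: smooth_fun_subset)
qed

lemma smooth_near_topspace: "smooth_near X A q f \<Longrightarrow> q \<in> topspace X"
  unfolding smooth_near_def using openin_subset by blast

lemma smooth_near_cmult: "smooth_near X A q f \<Longrightarrow> smooth_near X A q (\<lambda>q. c * f q)"
  by (rule smooth_near_mult) (auto dest: smooth_near_topspace)

lemma smooth_near_cnj: "smooth_near X A q f \<Longrightarrow> smooth_near X A q (\<lambda>q. cnj (f q))"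
  unfolding smooth_near_def using smooth_fun_cnj by blast

lemma smooth_near_sum:
  "q \<in> topspace X \<Longrightarrow> (\<And>i. i \<in> I \<Longrightarrow> smooth_near X A q (f i)) \<Longrightarrow> smooth_near X A q (\<lambda>q. \<Sum>i\<in>I. f i q)"
  by (induction I rule: infinite_finite_induct) (auto intro: smooth_near_add)

lemma ctangent_not_smooth: "Z \<in> ctangent X A q \<Longrightarrow> \<not> smooth_near X A q f \<Longrightarrow> Z f = 0"
  unfolding ctangent_def by blast

lemma ctangent_cong:
  assumes "Z \<in> ctangent X A q" "openin X W" "q \<in> W" "\<And>y. y \<in> W \<Longrightarrow> f y = g y" "smooth_near X A q f"
  shows "Z f = Z g"
  using assms smooth_near_cong[OF assms(2-5)] unfolding ctangent_def by blast

lemma ctangent_lin: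
  assumes "Z \<in> ctangent X A q" "smooth_near X A q f" "smooth_near X A q g"
  shows "Z (\<lambda>q. a * f q + b * g q) = a * Z f + b * Z g"
  using assms unfolding ctangent_def by blast

lemma ctangent_mult:
  assumes "Z \<in> ctangent X A q" "smooth_near X A q f" "smooth_near X A q g"
  shows "Z (\<lambda>q. f q * g q) = Z f * g q + f q * Z g"
  using assms unfolding ctangent_def by blast

lemma ctangent_add:
  assumes "Z \<in> ctangent X A q" "smooth_near X A q f" "smooth_near X A q g"
  shows "Z (\<lambda>q. f q + g q) = Z f + Z g"
  using ctangent_lin[OF assms, of 1 1] by simp

lemma ctangent_cmult:
  assumes "Z \<in> ctangent X A q" "smooth_near X A q f"
  shows "Z (\<lambda>q. a * f q) = a * Z f"
  using ctangent_lin[OF assms assms(2), of a 0] by simp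

lemma ctangent_const:
  assumes "Z \<in> ctangent X A q" "q \<in> topspace X"
  shows "Z (\<lambda>q. c) = 0"
proof -
  have "Z (\<lambda>q. 1 * 1) = Z (\<lambda>q. 1) * 1 + 1 * Z (\<lambda>q. 1)"
    using ctangent_mult[OF assms(1), of "\<lambda>q. 1" "\<lambda>q. 1"] assms(2) by simp
  then have "Z (\<lambda>q. 1) = 0" by simp
  then show ?thesis using ctangent_cmult[OF assms(1), of "\<lambda>q. 1" c] assms(2) by simp
qed

lemma ctangent_sum:
  assumes "Z \<in> ctangent X A q" "q \<in> topspace X" "\<And>i. i \<in> I \<Longrightarrow> smooth_near X A q (f i)"
  shows "Z (\<lambda>q. \<Sum>i\<in>I. f i q) = (\<Sum>i\<in>I. Z (f i))"
  using assms(3)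
proof (induction I rule: infinite_finite_induct)
  case (insert i I)
  then show ?case
    using ctangent_add[OF assms(1), of "f i" "\<lambda>q. \<Sum>i\<in>I. f i q"] smooth_near_sum[OF assms(2), of I f] by auto
qed (use ctangent_const[OF assms(1,2)] in auto)

lemma ctangent_combination:
  assumes "\<And>j. j \<in> J \<Longrightarrow> Z j \<in> ctangent X A q"
  shows "(\<lambda>f. \<Sum>j\<in>J. c j * Z j f) \<in> ctangent X A q"
  unfolding ctangent_def mem_Collect_eq
proof (intro conjI allI impI)
  fix f assume "\<not> smooth_near X A q f"
  then show "(\<Sum>j\<in>J. c j * Z j f) = 0" using ctangent_not_smooth[OF assms] by (intro sum.neutral) auto
next
  fix f g assume "smooth_near X A q f \<and> smooth_near X A q g" "\<exists>W. openin X W \<and> q \<in> W \<and> (\<forall>q\<in>W. f q = g q)"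
  then show "(\<Sum>j\<in>J. c j * Z j f) = (\<Sum>j\<in>J. c j * Z j g)"
    using ctangent_cong assms by (intro sum.cong refl arg_cong2[of _ _ _ _ "(*)"]) blast
next
  fix f g and a b :: complex assume fg: "smooth_near X A q f \<and> smooth_near X A q g"
  have "(\<Sum>j\<in>J. c j * Z j (\<lambda>q. a * f q + b * g q)) = (\<Sum>j\<in>J. a * (c j * Z j f) + b * (c j * Z j g))"
    by (intro sum.cong refl) (use ctangent_lin[OF assms] fg in \<open>simp add: algebra_simps\<close>)
  then show "(\<Sum>j\<in>J. c j * Z j (\<lambda>q. a * f q + b * g q)) = a * (\<Sum>j\<in>J. c j * Z j f) + b * (\<Sum>j\<in>J. c j * Z j g)"
    by (simp add: sum.distrib sum_distrib_left)
next
  fix f g assume fg: "smooth_near X A q f \<and> smooth_near X A q g"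
  have "(\<Sum>j\<in>J. c j * Z j (\<lambda>q. f q * g q)) = (\<Sum>j\<in>J. c j * Z j f * g q + f q * (c j * Z j g))"
    by (intro sum.cong refl) (use ctangent_mult[OF assms] fg in \<open>simp add: algebra_simps\<close>)
  then show "(\<Sum>j\<in>J. c j * Z j (\<lambda>q. f q * g q)) = (\<Sum>j\<in>J. c j * Z j f) * g q + f q * (\<Sum>j\<in>J. c j * Z j g)"
    by (simp add: sum.distrib sum_distrib_left sum_distrib_right)
qed

lemma conj_vec_ctangent:
  assumes Z: "Z \<in> ctangent X A q"
  shows "conj_vec Z \<in> ctangent X A q"
proof -
  have cn: "smooth_near X A q (\<lambda>q. cnj (f q)) \<longleftrightarrow> smooth_near X A q f" for f
    using smooth_near_cnj[of q "\<lambda>q. cnj (f q)"] smooth_near_cnj[of q f] by auto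
  show ?thesis
    unfolding ctangent_def mem_Collect_eq
  proof (intro conjI allI impI)
    fix f assume "\<not> smooth_near X A q f"
    then show "conj_vec Z f = 0" using ctangent_not_smooth[OF Z] cn by (simp add: conj_vec_def)
  next
    fix f g assume "smooth_near X A q f \<and> smooth_near X A q g" "\<exists>W. openin X W \<and> q \<in> W \<and> (\<forall>q\<in>W. f q = g q)"
    then obtain W where "openin X W" "q \<in> W" "\<And>y. y \<in> W \<Longrightarrow> cnj (f y) = cnj (g y)" "smooth_near X A q (\<lambda>q. cnj (f q))"
      using cn by auto
    from ctangent_cong[OF Z this] show "conj_vec Z f = conj_vec Z g" by (simp add: conj_vec_def)
  next
    fix f g a b assume fg: "smooth_near X A q f \<and> smooth_near X A q g"
    show "conj_vec Z (\<lambda>q. a * f q + b * g q) = a * conj_vec Z f + b * conj_vec Z g"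
      using ctangent_lin[OF Z, of "\<lambda>q. cnj (f q)" "\<lambda>q. cnj (g q)" "cnj a" "cnj b"] fg cn by (simp add: conj_vec_def)
  next
    fix f g assume fg: "smooth_near X A q f \<and> smooth_near X A q g"
    show "conj_vec Z (\<lambda>q. f q * g q) = conj_vec Z f * g q + f q * conj_vec Z g"
      using ctangent_mult[OF Z, of "\<lambda>q. cnj (f q)" "\<lambda>q. cnj (g q)"] fg cn by (simp add: conj_vec_def)
  qed
qed

lemma smooth_field_ctangent: "smooth_field X A W Z \<Longrightarrow> p \<in> W \<Longrightarrow> Z p \<in> ctangent X A p"
  unfolding smooth_field_def by blast

lemma smooth_field_apply:
  "smooth_field X A W Z \<Longrightarrow> openin X W' \<Longrightarrow> W' \<subseteq> W \<Longrightarrow> smooth_fun A W' f \<Longrightarrow> smooth_fun A W' (\<lambda>p. Z p f)"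
  unfolding smooth_field_def by blast

lemma smooth_field_near:
  assumes Z: "smooth_field X A W Z" and W: "openin X W" "p \<in> W" and f: "smooth_near X A p f"
  shows "smooth_near X A p (\<lambda>q. Z q f)"
proof -
  obtain W1 where W1: "openin X W1" "p \<in> W1" "smooth_fun A W1 f" using f unfolding smooth_near_def by blast
  have o: "openin X (W \<inter> W1)" "p \<in> W \<inter> W1" using W W1 by auto
  have "smooth_fun A (W \<inter> W1) (\<lambda>q. Z q f)"
    by (rule smooth_field_apply[OF Z o(1) _ smooth_fun_subset[OF W1(3)]]) auto
  then show ?thesis by (rule smooth_nearI[OF o])
qed

lemma smooth_field_conj:
  assumes Z: "smooth_field X A W Z"
  shows "smooth_field X A W (\<lambda>q. conj_vec (Z q))"
  unfolding smooth_field_def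
proof (intro conjI ballI allI impI)
  show "conj_vec (Z p) \<in> ctangent X A p" if "p \<in> W" for p
    using conj_vec_ctangent smooth_field_ctangent[OF Z that] by blast
  fix W' f assume "openin X W' \<and> W' \<subseteq> W \<and> smooth_fun A W' f"
  then show "smooth_fun A W' (\<lambda>p. conj_vec (Z p) f)"
    unfolding conj_vec_def by (intro smooth_fun_cnj smooth_field_apply[OF Z]) auto
qed

text \<open>A field acts on \<open>f\<close> pointwise, so an identity for \<open>Y q f\<close> has
  to hold in a neighbourhood of \<open>p\<close> before another vector at \<open>p\<close> can be
  applied to it.\<close>

lemma second_derivative_cong:
  assumes Z: "smooth_field X A W Z" and Y: "smooth_field X A W Y" and W: "openin X W" "p \<in> W"
    and W1: "openin X W1" "p \<in> W1" "\<And>q. q \<in> W1 \<Longrightarrow> Y q f = g q" and f: "smooth_near X A p f"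
  shows "Z p (\<lambda>q. Y q f) = Z p g"
  by (rule ctangent_cong[OF smooth_field_ctangent[OF Z W(2)] W1(1,2)]) (use W1 smooth_field_near[OF Y W f] in auto)

lemma smooth_near_openE:
  assumes "smooth_near X A p f" "smooth_near X A p g"
  obtains W where "openin X W" "p \<in> W" "\<And>q. q \<in> W \<Longrightarrow> smooth_near X A q f" "\<And>q. q \<in> W \<Longrightarrow> smooth_near X A q g"
proof -
  obtain W W1 where "openin X W1" "p \<in> W1" "smooth_fun A W1 f" "openin X W" "p \<in> W" "smooth_fun A W g"
    using assms unfolding smooth_near_def by blast
  then show ?thesis using that[of "W \<inter> W1"] smooth_near_def by fastforce
qed

lemma lie_bracket_ctangent:
  assumes Z: "smooth_field X A W Z" and Y: "smooth_field X A W Y" and W: "openin X W" "p \<in> W"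
  shows "lie_bracket X A Z Y p \<in> ctangent X A p"
proof -
  note near = smooth_field_near[OF Z W] smooth_field_near[OF Y W]
  note Zp = smooth_field_ctangent[OF Z W(2)] and Yp = smooth_field_ctangent[OF Y W(2)]
  have pX: "p \<in> topspace X" using W openin_subset by blast
  show ?thesis
    unfolding ctangent_def mem_Collect_eq
  proof (intro conjI allI impI)
    fix f assume "\<not> smooth_near X A p f"
    then show "lie_bracket X A Z Y p f = 0" by (simp add: lie_bracket_def)
  next
    fix f g assume fg: "smooth_near X A p f \<and> smooth_near X A p g" and "\<exists>W. openin X W \<and> p \<in> W \<and> (\<forall>q\<in>W. f q = g q)"
    then obtain W1 where W1: "openin X W1" "p \<in> W1" "\<And>q. q \<in> W1 \<Longrightarrow> f q = g q" by blast
    obtain W2 where W2: "openin X W2" "p \<in> W2" "\<And>q. q \<in> W2 \<Longrightarrow> smooth_near X A q f"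
      "\<And>q. q \<in> W2 \<Longrightarrow> smooth_near X A q g"
      by (rule smooth_near_openE[OF conjunct1[OF fg] conjunct2[OF fg]]) blast
    let ?V = "W \<inter> W1 \<inter> W2"
    have V: "openin X ?V" "p \<in> ?V" using W W1 W2 by auto
    have eq: "F q f = F q g" if "q \<in> ?V" "smooth_field X A W F" for F q
      by (rule ctangent_cong[OF smooth_field_ctangent[OF that(2)] W1(1)]) (use that W1 W2 in auto)
    have "Z p (\<lambda>q. Y q f) = Z p (\<lambda>q. Y q g)"
      by (rule second_derivative_cong[OF Z Y W V]) (use fg eq Y in auto)
    moreover have "Y p (\<lambda>q. Z q f) = Y p (\<lambda>q. Z q g)"
      by (rule second_derivative_cong[OF Y Z W V]) (use fg eq Z in auto)
    ultimately show "lie_bracket X A Z Y p f = lie_bracket X A Z Y p g"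
      using fg by (simp add: lie_bracket_def)
  next
    fix f g and a b :: complex assume fg: "smooth_near X A p f \<and> smooth_near X A p g"
    obtain W2 where W2: "openin X W2" "p \<in> W2" "\<And>q. q \<in> W2 \<Longrightarrow> smooth_near X A q f"
      "\<And>q. q \<in> W2 \<Longrightarrow> smooth_near X A q g"
      by (rule smooth_near_openE[OF conjunct1[OF fg] conjunct2[OF fg]]) blast
    have V: "openin X (W \<inter> W2)" "p \<in> W \<inter> W2" using W W2 by auto
    have s: "smooth_near X A p (\<lambda>q. a * f q + b * g q)" using fg by (intro smooth_near_add smooth_near_cmult) auto
    have *: "F p (\<lambda>q. G q (\<lambda>q. a * f q + b * g q)) = a * F p (\<lambda>q. G q f) + b * F p (\<lambda>q. G q g)"
      if F: "smooth_field X A W F" and G: "smooth_field X A W G" for F G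
    proof -
      have "F p (\<lambda>q. G q (\<lambda>q. a * f q + b * g q)) = F p (\<lambda>q. a * G q f + b * G q g)"
        by (rule second_derivative_cong[OF F G W V _ s])
          (use W2 in \<open>auto intro!: ctangent_lin[OF smooth_field_ctangent[OF G]]\<close>)
      also have "\<dots> = a * F p (\<lambda>q. G q f) + b * F p (\<lambda>q. G q g)"
        by (rule ctangent_lin[OF smooth_field_ctangent[OF F W(2)]]) (use fg smooth_field_near[OF G W] in auto)
      finally show ?thesis .
    qed
    show "lie_bracket X A Z Y p (\<lambda>q. a * f q + b * g q) = a * lie_bracket X A Z Y p f + b * lie_bracket X A Z Y p g"
      using fg s *[OF Z Y] *[OF Y Z] by (simp add: lie_bracket_def algebra_simps)
  next
    fix f g assume fg: "smooth_near X A p f \<and> smooth_near X A p g"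
    obtain W2 where W2: "openin X W2" "p \<in> W2" "\<And>q. q \<in> W2 \<Longrightarrow> smooth_near X A q f"
      "\<And>q. q \<in> W2 \<Longrightarrow> smooth_near X A q g"
      by (rule smooth_near_openE[OF conjunct1[OF fg] conjunct2[OF fg]]) blast
    have V: "openin X (W \<inter> W2)" "p \<in> W \<inter> W2" using W W2 by auto
    have s: "smooth_near X A p (\<lambda>q. f q * g q)" using fg by (intro smooth_near_mult) auto
    \<comment> \<open>The two mixed terms are symmetric in \<open>F\<close> and \<open>G\<close>, so
      they cancel in the commutator and the product rule remains.\<close>
    have *: "F p (\<lambda>q. G q (\<lambda>q. f q * g q)) =
        F p (\<lambda>q. G q f) * g p + G p f * F p g + F p f * G p g + f p * F p (\<lambda>q. G q g)"
      if F: "smooth_field X A W F" and G: "smooth_field X A W G" for F G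
    proof -
      note Fp = smooth_field_ctangent[OF F W(2)]
      have n: "smooth_near X A p (\<lambda>q. G q f)" "smooth_near X A p (\<lambda>q. G q g)"
        using fg smooth_field_near[OF G W] by auto
      have "F p (\<lambda>q. G q (\<lambda>q. f q * g q)) = F p (\<lambda>q. G q f * g q + f q * G q g)"
        by (rule second_derivative_cong[OF F G W V _ s])
          (use W2 in \<open>auto intro!: ctangent_mult[OF smooth_field_ctangent[OF G]]\<close>)
      also have "\<dots> = F p (\<lambda>q. G q f * g q) + F p (\<lambda>q. f q * G q g)"
        by (rule ctangent_add[OF Fp]) (use fg n smooth_near_mult in auto)
      also have "\<dots> = F p (\<lambda>q. G q f) * g p + G p f * F p g + F p f * G p g + f p * F p (\<lambda>q. G q g)"
        using ctangent_mult[OF Fp n(1), of g] ctangent_mult[OF Fp _ n(2), of f] fg by simp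
      finally show ?thesis .
    qed
    show "lie_bracket X A Z Y p (\<lambda>q. f q * g q) = lie_bracket X A Z Y p f * g p + f p * lie_bracket X A Z Y p g"
      using fg s *[OF Z Y] *[OF Y Z] by (simp add: lie_bracket_def algebra_simps)
  qed
qed

lemma zero_ctangent: "(\<lambda>f. 0) \<in> ctangent X A q"
  using ctangent_combination[of "{}"] by simp

lemma rtangent_real: "Z \<in> rtangent X A q \<Longrightarrow> Z (\<lambda>y. cnj (f y)) = cnj (Z f)"
  unfolding rtangent_def conj_vec_def mem_Collect_eq by (metis complex_cnj_cnj)

lemma field_zero:
  assumes Z: "smooth_field X A W Z" and W: "openin X W" "q \<in> W" and f: "\<And>y. y \<in> W \<Longrightarrow> f y = 0"
  shows "Z q f = 0"
proof -
  have qX: "q \<in> topspace X" using W openin_subset by blast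
  note Zq = smooth_field_ctangent[OF Z W(2)]
  have "Z q (\<lambda>y. 0) = Z q f"
    by (rule ctangent_cong[OF Zq W(1,2)]) (use f qX in auto)
  then show ?thesis using ctangent_const[OF Zq qX] by simp
qed

text \<open>Conjugation exchanges the two fields, and the bracket is antisymmetric.\<close>

lemma bracket_conj_imaginary:
  "conj_vec (lie_bracket X A Z (\<lambda>y. conj_vec (Z y)) q) = (\<lambda>f. - lie_bracket X A Z (\<lambda>y. conj_vec (Z y)) q f)"
proof
  fix f
  have "smooth_near X A q (\<lambda>y. cnj (f y)) \<longleftrightarrow> smooth_near X A q f"
    using smooth_near_cnj[of q "\<lambda>y. cnj (f y)"] smooth_near_cnj[of q f] by auto
  then show "conj_vec (lie_bracket X A Z (\<lambda>y. conj_vec (Z y)) q) f = - lie_bracket X A Z (\<lambda>y. conj_vec (Z y)) q f"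
    by (simp add: conj_vec_def lie_bracket_def)
qed

end

section \<open>Tangent vectors in a single chart\<close>

locale coordinate_chart = smooth_atlas_on X A
  for X :: "'a topology" and A :: "('a, 'm::finite) chart set" +
  fixes D :: "'a set" and \<phi> :: "'a \<Rightarrow> real^'m"
  assumes compat: "compatible_chart X A D \<phi>"
begin

lemma D_open: "openin X D" and D_image_open: "open (\<phi> ` D)"
  using compat unfolding compatible_chart_def by auto

lemma D_topspace: "q \<in> D \<Longrightarrow> q \<in> topspace X" using D_open openin_subset by blast

lemmas phi_inj = compatible_chart_inj[OF compat]
lemmas image_open = compatible_chart_open_image[OF compat]
lemmas preimage_open = compatible_chart_open_preimage[OF compat]

lemma inv_phi [simp]: "q \<in> D \<Longrightarrow> inv_into D \<phi> (\<phi> q) = q"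
  using phi_inj by simp

text \<open>One compatible chart suffices for testing smoothness, because coordinate changes to the
  members of the atlas are smooth in both directions.\<close>

lemma smooth_fun_iff:
  assumes W: "openin X W" "W \<subseteq> D"
  shows "smooth_fun A W f \<longleftrightarrow> smooth_on (\<phi> ` W) (f \<circ> inv_into D \<phi>)"
proof
  assume f: "smooth_fun A W f"
  show "smooth_on (\<phi> ` W) (f \<circ> inv_into D \<phi>)"
  proof (rule smooth_on_locally)
    fix x assume "x \<in> \<phi> ` W"
    then obtain q where q: "q \<in> W" "x = \<phi> q" by blast
    then obtain E \<psi> where E: "(E, \<psi>) \<in> A" "q \<in> E" using chart_cover D_topspace W by blast
    have oE: "openin X E" using E atlas unfolding smooth_atlas_def by blast
    have o: "open (\<phi> ` (W \<inter> E))" using W oE by (intro image_open) auto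
    have tr: "smooth_on (\<phi> ` (W \<inter> E)) (\<psi> \<circ> inv_into D \<phi>)"
      using compat E W unfolding compatible_chart_def by (fastforce intro: smooth_on_subset)
    have fE: "smooth_on (\<psi> ` (E \<inter> W)) (f \<circ> inv_into E \<psi>)" using f E unfolding smooth_fun_def by blast
    have "smooth_on (\<phi> ` (W \<inter> E)) (\<lambda>x. (f \<circ> inv_into E \<psi>) ((\<psi> \<circ> inv_into D \<phi>) x))"
      by (rule smooth_on_compose[OF o tr _ fE]) (use W in auto)
    then have "smooth_on (\<phi> ` (W \<inter> E)) (f \<circ> inv_into D \<phi>)"
      by (rule iffD1[OF smooth_on_cong[OF o], rotated]) (use W chart_inj[OF E(1)] in auto)
    then show "\<exists>T. x \<in> T \<and> smooth_on T (f \<circ> inv_into D \<phi>)"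
      by (intro exI[of _ "\<phi> ` (W \<inter> E)"]) (use q E in simp)
  qed
next
  assume f: "smooth_on (\<phi> ` W) (f \<circ> inv_into D \<phi>)"
  show "smooth_fun A W f"
    unfolding smooth_fun_def
  proof (clarify)
    fix E \<psi> assume E: "(E, \<psi>) \<in> A"
    have o: "open (\<psi> ` (E \<inter> W))" by (rule chart_image_open[OF E W(1)])
    have tr: "smooth_on (\<psi> ` (E \<inter> W)) (\<phi> \<circ> inv_into E \<psi>)"
      using compat E W unfolding compatible_chart_def by (fastforce intro: smooth_on_subset)
    have "smooth_on (\<psi> ` (E \<inter> W)) (\<lambda>x. (f \<circ> inv_into D \<phi>) ((\<phi> \<circ> inv_into E \<psi>) x))"
      by (rule smooth_on_compose[OF o tr _ f]) (use W chart_inj[OF E(1)] in auto)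
    then show "smooth_on (\<psi> ` (E \<inter> W)) (f \<circ> inv_into E \<psi>)"
      by (rule iffD1[OF smooth_on_cong[OF o], rotated]) (use W chart_inj[OF E] in auto)
  qed
qed

definition xc :: "'m \<Rightarrow> 'a \<Rightarrow> complex" where "xc i q = complex_of_real (\<phi> q $ i)"

lemma xc_cnj: "(\<lambda>y. cnj (xc i y)) = xc i" by (simp add: xc_def fun_eq_iff)

lemma smooth_fun_coords:
  assumes W: "openin X W" "W \<subseteq> D" and h: "smooth_on (\<phi> ` W) h"
  shows "smooth_fun A W (\<lambda>q. h (\<phi> q))"
proof -
  have "smooth_on (\<phi> ` W) ((\<lambda>q. h (\<phi> q)) \<circ> inv_into D \<phi>)"
    by (rule iffD1[OF smooth_on_cong[OF image_open[OF W]] h]) (use W in auto)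
  then show ?thesis using smooth_fun_iff[OF W] by blast
qed

lemma smooth_fun_xc: "smooth_fun A D (xc i)"
proof -
  have "smooth_on (\<phi> ` D) (\<lambda>x. complex_of_real (x $ i))"
    by (intro smooth_on_linear_compose[OF D_image_open bounded_linear_of_real] smooth_on_linear[OF bounded_linear_vec_nth D_image_open])
  then show ?thesis unfolding xc_def[abs_def] by (intro smooth_fun_coords[OF D_open]) auto
qed

lemma smooth_near_xc: "q \<in> D \<Longrightarrow> smooth_near X A q (xc i)"
  by (rule smooth_nearI[OF D_open _ smooth_fun_xc])

lemma smooth_nearE:
  assumes "smooth_near X A q f" "q \<in> D"
  obtains R where "R > 0" "ball (\<phi> q) R \<subseteq> \<phi> ` D" "smooth_on (ball (\<phi> q) R) (f \<circ> inv_into D \<phi>)"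
proof -
  obtain W where W: "openin X W" "q \<in> W" "smooth_fun A W f" using assms unfolding smooth_near_def by blast
  have W': "openin X (W \<inter> D)" "W \<inter> D \<subseteq> D" using W D_open by auto
  have s: "smooth_on (\<phi> ` (W \<inter> D)) (f \<circ> inv_into D \<phi>)"
    using smooth_fun_iff[OF W'] smooth_fun_subset[OF W(3)] by blast
  obtain R where "R > 0" "ball (\<phi> q) R \<subseteq> \<phi> ` (W \<inter> D)"
    using image_open[OF W'] W assms(2) openE by (metis IntI image_eqI)
  then show ?thesis using that[of R] smooth_on_subset[OF s] by blast
qed

lemma ball_preimage:
  assumes "ball (\<phi> q) R \<subseteq> \<phi> ` D" "q \<in> D" "R > 0"
  shows "openin X {y \<in> D. \<phi> y \<in> ball (\<phi> q) R}" "q \<in> {y \<in> D. \<phi> y \<in> ball (\<phi> q) R}"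
    "\<phi> ` {y \<in> D. \<phi> y \<in> ball (\<phi> q) R} = ball (\<phi> q) R"
  using assms preimage_open[OF open_ball] by auto

text \<open>By Hadamard's lemma, \<open>f\<close> differs from its value at \<open>q\<close> by a
  sum of products of \<open>xc i - xc i q\<close>, which vanish at \<open>q\<close>, with smooth
  functions. The product rule leaves only the values \<open>Z (xc i)\<close>, so a derivation has no
  more freedom than its coordinate components.\<close>

lemma ctangent_expansion:
  assumes Z: "Z \<in> ctangent X A q" and q: "q \<in> D" and f: "smooth_near X A q f"
  shows "Z f = (\<Sum>i\<in>UNIV. Z (xc i) * ddir (axis i 1) (f \<circ> inv_into D \<phi>) (\<phi> q))"
proof -
  obtain R where R: "R > 0" "ball (\<phi> q) R \<subseteq> \<phi> ` D" "smooth_on (ball (\<phi> q) R) (f \<circ> inv_into D \<phi>)"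
    using smooth_nearE[OF f q] by blast
  obtain g where g: "\<And>i. smooth_on (ball (\<phi> q) R) (g i)" "\<And>i. g i (\<phi> q) = ddir (axis i 1) (f \<circ> inv_into D \<phi>) (\<phi> q)"
    "\<And>x. x \<in> ball (\<phi> q) R \<Longrightarrow> (f \<circ> inv_into D \<phi>) x = (f \<circ> inv_into D \<phi>) (\<phi> q) + (\<Sum>i\<in>UNIV. complex_of_real (x $ i - \<phi> q $ i) * g i x)"
    using hadamard[OF R(3,1)] by blast
  let ?W = "{y \<in> D. \<phi> y \<in> ball (\<phi> q) R}"
  note W = ball_preimage[OF R(2) q R(1)]
  have qX: "q \<in> topspace X" using D_topspace q by blast
  have gs: "smooth_near X A q (\<lambda>y. g i (\<phi> y))" for i
    by (rule smooth_nearI[OF W(1,2)], rule smooth_fun_coords[OF W(1)]) (use W(3) g(1) in auto)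
  have xs: "smooth_near X A q (\<lambda>y. xc i y + (- xc i q))" for i
    by (intro smooth_near_add smooth_near_xc[OF q] smooth_near_const[OF qX])
  have xZ: "Z (\<lambda>y. xc i y + (- xc i q)) = Z (xc i)" for i
    by (simp only: ctangent_add[OF Z smooth_near_xc[OF q] smooth_near_const[OF qX]] ctangent_const[OF Z qX] add_0_right)
  have ms: "smooth_near X A q (\<lambda>y. (xc i y + (- xc i q)) * g i (\<phi> y))" for i
    by (rule smooth_near_mult[OF xs gs])
  have mss: "smooth_near X A q (\<lambda>y. \<Sum>i\<in>UNIV. (xc i y + (- xc i q)) * g i (\<phi> y))"
    by (rule smooth_near_sum[OF qX]) (rule ms)
  have mZ: "Z (\<lambda>y. \<Sum>i\<in>UNIV. (xc i y + (- xc i q)) * g i (\<phi> y)) =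
      (\<Sum>i\<in>UNIV. Z (\<lambda>y. (xc i y + (- xc i q)) * g i (\<phi> y)))"
    by (rule ctangent_sum[OF Z qX]) (rule ms)
  have "Z f = Z (\<lambda>y. f q + (\<Sum>i\<in>UNIV. (xc i y + (- xc i q)) * g i (\<phi> y)))"
  proof (rule ctangent_cong[OF Z W(1,2) _ f])
    fix y assume y: "y \<in> {y \<in> D. \<phi> y \<in> ball (\<phi> q) R}"
    then have "f y = f q + (\<Sum>i\<in>UNIV. complex_of_real (\<phi> y $ i - \<phi> q $ i) * g i (\<phi> y))"
      using g(3)[of "\<phi> y"] q by simp
    then show "f y = f q + (\<Sum>i\<in>UNIV. (xc i y + (- xc i q)) * g i (\<phi> y))"
      by (simp add: xc_def)
  qed
  also have "\<dots> = (\<Sum>i\<in>UNIV. Z (\<lambda>y. (xc i y + (- xc i q)) * g i (\<phi> y)))"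
    by (simp only: ctangent_add[OF Z smooth_near_const[OF qX] mss] ctangent_const[OF Z qX] mZ add_0_left)
  also have "\<dots> = (\<Sum>i\<in>UNIV. Z (xc i) * g i (\<phi> q))"
    using ctangent_mult[OF Z xs gs] xZ by simp
  finally show ?thesis by (simp add: g(2))
qed

lemma ctangent_chain:
  assumes Z: "Z \<in> ctangent X A q" and B: "open B" "q \<in> D" "\<phi> q \<in> B" and h: "smooth_on B h"
  shows "Z (\<lambda>y. h (\<phi> y)) = (\<Sum>i\<in>UNIV. Z (xc i) * ddir (axis i 1) h (\<phi> q))" "smooth_near X A q (\<lambda>y. h (\<phi> y))"
proof -
  have W: "openin X {y \<in> D. \<phi> y \<in> B}" "{y \<in> D. \<phi> y \<in> B} \<subseteq> D" "q \<in> {y \<in> D. \<phi> y \<in> B}"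
    using preimage_open[OF B(1)] B by auto
  show n: "smooth_near X A q (\<lambda>y. h (\<phi> y))"
    by (rule smooth_nearI[OF W(1,3)], rule smooth_fun_coords[OF W(1,2)], rule smooth_on_subset[OF h]) auto
  have "ddir v ((\<lambda>y. h (\<phi> y)) \<circ> inv_into D \<phi>) (\<phi> q) = ddir v h (\<phi> q)" for v
    by (rule ddir_cong[OF image_open[OF W(1,2)]]) (use W in auto)
  then show "Z (\<lambda>y. h (\<phi> y)) = (\<Sum>i\<in>UNIV. Z (xc i) * ddir (axis i 1) h (\<phi> q))"
    using ctangent_expansion[OF Z B(2) n] by simp
qed

text \<open>The derivation with prescribed components \<open>c\<close>. Together with
  \<open>ctangent_eqI\<close> it identifies the complexified tangent space with the space of complex
  coordinate vectors.\<close>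

definition cvec :: "'a \<Rightarrow> ('m \<Rightarrow> complex) \<Rightarrow> 'a cvector" where
  "cvec q c = (\<lambda>f. if smooth_near X A q f
     then \<Sum>i\<in>UNIV. c i * ddir (axis i 1) (f \<circ> inv_into D \<phi>) (\<phi> q) else 0)"

lemma smooth_near_differentiable:
  assumes "smooth_near X A q f" "q \<in> D" shows "(f \<circ> inv_into D \<phi>) differentiable (at (\<phi> q))"
  using smooth_nearE[OF assms] smooth_on_differentiable centre_in_ball by metis

lemma coord_vec_ctangent:
  assumes q: "q \<in> D"
  shows "(\<lambda>f. if smooth_near X A q f then ddir v (f \<circ> inv_into D \<phi>) (\<phi> q) else 0) \<in> ctangent X A q" (is "?Z \<in> _")
  unfolding ctangent_def mem_Collect_eq
proof (intro conjI allI impI)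
  fix f g assume fg: "smooth_near X A q f \<and> smooth_near X A q g" and "\<exists>W. openin X W \<and> q \<in> W \<and> (\<forall>q\<in>W. f q = g q)"
  then obtain W where W: "openin X W" "q \<in> W" "\<And>y. y \<in> W \<Longrightarrow> f y = g y" by blast
  have W': "openin X (W \<inter> D)" "W \<inter> D \<subseteq> D" using W D_open by auto
  have "ddir v (f \<circ> inv_into D \<phi>) (\<phi> q) = ddir v (g \<circ> inv_into D \<phi>) (\<phi> q)"
    by (rule ddir_cong[OF image_open[OF W']]) (use W q in auto)
  then show "?Z f = ?Z g" using fg by simp
next
  fix f g and a b :: complex assume fg: "smooth_near X A q f \<and> smooth_near X A q g"
  note d = smooth_near_differentiable[OF _ q]
  have "ddir v (\<lambda>x. a * (f \<circ> inv_into D \<phi>) x + b * (g \<circ> inv_into D \<phi>) x) (\<phi> q) =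
      a * ddir v (f \<circ> inv_into D \<phi>) (\<phi> q) + b * ddir v (g \<circ> inv_into D \<phi>) (\<phi> q)"
    by (rule ddir_eqI[of _ "\<lambda>v. a * ddir v (f \<circ> inv_into D \<phi>) (\<phi> q) + b * ddir v (g \<circ> inv_into D \<phi>) (\<phi> q)"])
      (intro has_derivative_add has_derivative_mult_right has_derivative_ddir d, use fg in simp_all)
  then show "?Z (\<lambda>q. a * f q + b * g q) = a * ?Z f + b * ?Z g"
    using fg smooth_near_add[OF smooth_near_cmult smooth_near_cmult] by (simp add: o_def)
next
  fix f g assume fg: "smooth_near X A q f \<and> smooth_near X A q g"
  note d = smooth_near_differentiable[OF _ q]
  have "ddir v (\<lambda>x. (f \<circ> inv_into D \<phi>) x * (g \<circ> inv_into D \<phi>) x) (\<phi> q) =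
      (f \<circ> inv_into D \<phi>) (\<phi> q) * ddir v (g \<circ> inv_into D \<phi>) (\<phi> q) + ddir v (f \<circ> inv_into D \<phi>) (\<phi> q) * (g \<circ> inv_into D \<phi>) (\<phi> q)"
    by (rule ddir_eqI[OF has_derivative_mult[OF has_derivative_ddir[OF d[OF conjunct1[OF fg]]]
      has_derivative_ddir[OF d[OF conjunct2[OF fg]]]]])
  then show "?Z (\<lambda>q. f q * g q) = ?Z f * g q + f q * ?Z g"
    using fg smooth_near_mult q by (simp add: o_def)
qed simp

lemma cvec_ctangent: "q \<in> D \<Longrightarrow> cvec q c \<in> ctangent X A q"
proof -
  assume q: "q \<in> D"
  have "cvec q c = (\<lambda>f. \<Sum>i\<in>UNIV. c i * (if smooth_near X A q f then ddir (axis i 1) (f \<circ> inv_into D \<phi>) (\<phi> q) else 0))"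
    by (auto simp: cvec_def)
  then show ?thesis using ctangent_combination[OF coord_vec_ctangent[OF q]] by simp
qed

lemma cvec_xc: 
  assumes q: "q \<in> D" shows "cvec q c (xc i) = c i"
proof -
  have "ddir (axis j 1) (xc i \<circ> inv_into D \<phi>) (\<phi> q) = ddir (axis j 1) (\<lambda>x. complex_of_real (x $ i)) (\<phi> q)" for j
    by (rule ddir_cong[OF D_image_open]) (use q in \<open>auto simp: xc_def\<close>)
  also have "ddir (axis j 1) (\<lambda>x. complex_of_real (x $ i)) (\<phi> q) = complex_of_real (axis j 1 $ i)" for j
    by (rule ddir_eqI[OF bounded_linear_imp_has_derivative])
      (rule bounded_linear_compose[OF bounded_linear_of_real bounded_linear_vec_nth])
  finally have e: "ddir (axis j 1) (xc i \<circ> inv_into D \<phi>) (\<phi> q) = (if j = i then 1 else 0)" for j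
    by (simp add: axis_def)
  have "(\<Sum>j\<in>UNIV. c j * ddir (axis j 1) (xc i \<circ> inv_into D \<phi>) (\<phi> q)) = (\<Sum>j\<in>UNIV. c j * (if j = i then 1 else 0))"
    by (simp only: e)
  also have "\<dots> = c i" by (simp add: if_distrib cong: if_cong)
  finally show ?thesis using smooth_near_xc[OF q] by (simp add: cvec_def)
qed

lemma ctangent_eqI:
  assumes "Z \<in> ctangent X A q" "Y \<in> ctangent X A q" "q \<in> D" "\<And>i. Z (xc i) = Y (xc i)"
  shows "Z = Y"
proof
  fix f show "Z f = Y f"
    using ctangent_expansion[OF assms(1,3), of f] ctangent_expansion[OF assms(2,3), of f] assms
      ctangent_not_smooth[OF assms(1), of f] ctangent_not_smooth[OF assms(2), of f]
    by (cases "smooth_near X A q f") auto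
qed

lemma smooth_field_iff:
  assumes W: "openin X W" "W \<subseteq> D"
  shows "smooth_field X A W Z \<longleftrightarrow> (\<forall>p\<in>W. Z p \<in> ctangent X A p) \<and> (\<forall>i. smooth_fun A W (\<lambda>p. Z p (xc i)))"
proof
  assume "smooth_field X A W Z"
  then show "(\<forall>p\<in>W. Z p \<in> ctangent X A p) \<and> (\<forall>i. smooth_fun A W (\<lambda>p. Z p (xc i)))"
    using W smooth_fun_subset[OF smooth_fun_xc] unfolding smooth_field_def by blast
next
  assume R: "(\<forall>p\<in>W. Z p \<in> ctangent X A p) \<and> (\<forall>i. smooth_fun A W (\<lambda>p. Z p (xc i)))"
  show "smooth_field X A W Z"
    unfolding smooth_field_def
  proof (intro conjI allI impI)
    show "\<forall>p\<in>W. Z p \<in> ctangent X A p" using R by blast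
    fix W' f assume W': "openin X W' \<and> W' \<subseteq> W \<and> smooth_fun A W' f"
    then have W'D: "openin X W'" "W' \<subseteq> D" using W by auto
    have "smooth_fun A W' (\<lambda>q. ddir (axis i 1) (f \<circ> inv_into D \<phi>) (\<phi> q))" for i
      by (rule smooth_fun_coords[OF W'D]) (use smooth_fun_iff[OF W'D] W' smooth_on_ddir in blast)
    then have S: "smooth_fun A W' (\<lambda>q. \<Sum>i\<in>UNIV. Z q (xc i) * ddir (axis i 1) (f \<circ> inv_into D \<phi>) (\<phi> q))"
      using R W' by (intro smooth_fun_sum smooth_fun_mult W'D(1)) (auto intro: smooth_fun_subset)
    have E: "(\<Sum>i\<in>UNIV. Z q (xc i) * ddir (axis i 1) (f \<circ> inv_into D \<phi>) (\<phi> q)) = Z q f" if "q \<in> W'" for q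
    proof (rule ctangent_expansion[symmetric])
      show "Z q \<in> ctangent X A q" "q \<in> D" using R W' that W'D by auto
      show "smooth_near X A q f" using smooth_nearI[of W' q f] W' that by blast
    qed
    show "smooth_fun A W' (\<lambda>p. Z p f)" by (rule smooth_fun_cong[OF W'D(1) E S])
  qed
qed

end

section \<open>The CR structure of a graph\<close>

lemma sum_half: "(\<Sum>i\<in>I. c i * (S i / 2)) = (\<Sum>i\<in>I. c i * S i) / (2 :: complex)"
  by (simp add: sum_divide_distrib)

text \<open>The real coordinates \<open>(x, y)\<close> of \<open>\<real>\<^sup>m \<times> \<real>\<close> and the complex coordinates \<open>\<zeta>\<^sub>j\<close> (\<open>j \<le> n\<close>) of
  \<open>\<complex>\<close>-space are related by \<open>\<zeta>\<^sub>j = \<Sum>\<^sub>i P i j x\<^sub>i + nu j y\<close>, with inverse \<open>x\<^sub>i = Re (\<Sum>\<^sub>j a i j \<zeta>\<^sub>j)\<close>,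
  \<open>y = Re (\<Sum>\<^sub>j b j \<zeta>\<^sub>j)\<close>. The two \<open>right_inverse\<close> assumptions are the identity \<open>\<zeta> = P x + nu y\<close>
  separated into its complex linear and its antilinear part.\<close>

locale real_frame =
  fixes n :: nat and P :: "'m::finite \<Rightarrow> nat \<Rightarrow> complex" and nu :: "nat \<Rightarrow> complex"
    and a :: "'m \<Rightarrow> nat \<Rightarrow> complex" and b :: "nat \<Rightarrow> complex"
  assumes right_inverse: "\<And>j l. j \<le> n \<Longrightarrow> l \<le> n \<Longrightarrow> (\<Sum>i\<in>UNIV. P i j * a i l) + nu j * b l = (if j = l then 2 else 0)"
    and right_inverse_cnj: "\<And>j l. j \<le> n \<Longrightarrow> l \<le> n \<Longrightarrow> (\<Sum>i\<in>UNIV. cnj (P i j) * a i l) + cnj (nu j) * b l = 0"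
    and left_inverse_x: "\<And>i x y. Re (\<Sum>j\<le>n. a i j * ((\<Sum>k\<in>UNIV. P k j * complex_of_real (x k)) + nu j * complex_of_real y)) = x i"
    and left_inverse_y: "\<And>x y. Re (\<Sum>j\<le>n. b j * ((\<Sum>k\<in>UNIV. P k j * complex_of_real (x k)) + nu j * complex_of_real y)) = y"
begin

lemma apply_right_inverse:
  assumes "j \<le> n"
  shows "(\<Sum>i\<in>UNIV. P i j * (\<Sum>l\<le>n. a i l * z l)) + nu j * (\<Sum>l\<le>n. b l * z l) = 2 * z j"
proof -
  have "(\<Sum>i\<in>UNIV. P i j * (\<Sum>l\<le>n. a i l * z l)) + nu j * (\<Sum>l\<le>n. b l * z l) =
     (\<Sum>l\<le>n. ((\<Sum>i\<in>UNIV. P i j * a i l) + nu j * b l) * z l)"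
    unfolding sum_distrib_left distrib_right sum_distrib_right sum.distrib
    by (subst sum.swap) (simp add: mult.assoc)
  also have "\<dots> = (\<Sum>l\<le>n. (if l = j then 2 * z j else 0))"
    by (intro sum.cong refl) (use right_inverse[OF assms] in auto)
  finally show ?thesis using assms by simp
qed

lemma apply_right_inverse_cnj:
  assumes "j \<le> n"
  shows "(\<Sum>i\<in>UNIV. cnj (P i j) * (\<Sum>l\<le>n. a i l * z l)) + cnj (nu j) * (\<Sum>l\<le>n. b l * z l) = 0"
proof -
  have "(\<Sum>i\<in>UNIV. cnj (P i j) * (\<Sum>l\<le>n. a i l * z l)) + cnj (nu j) * (\<Sum>l\<le>n. b l * z l) =
     (\<Sum>l\<le>n. ((\<Sum>i\<in>UNIV. cnj (P i j) * a i l) + cnj (nu j) * b l) * z l)"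
    unfolding sum_distrib_left distrib_right sum_distrib_right sum.distrib
    by (subst sum.swap) (simp add: mult.assoc)
  then show ?thesis using right_inverse_cnj[OF assms] by simp
qed

text \<open>Real parts are half-sums with conjugates. The holomorphic identity contributes
  \<open>2 * z j\<close>, and the conjugate of the antilinear identity contributes zero.\<close>

lemma real_right_inverse:
  assumes "j \<le> n"
  shows "(\<Sum>i\<in>UNIV. P i j * complex_of_real (Re (\<Sum>l\<le>n. a i l * z l))) + nu j * complex_of_real (Re (\<Sum>l\<le>n. b l * z l)) = z j"
proof -
  have "cnj (\<Sum>i\<in>UNIV. cnj (P i j) * (\<Sum>l\<le>n. a i l * z l)) + cnj (cnj (nu j) * (\<Sum>l\<le>n. b l * z l)) = 0"
    using arg_cong[OF apply_right_inverse_cnj[OF assms, of z], of cnj] by simp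
  then have "(\<Sum>i\<in>UNIV. P i j * cnj (\<Sum>l\<le>n. a i l * z l)) + nu j * cnj (\<Sum>l\<le>n. b l * z l) = 0"
    by (simp only: cnj_sum complex_cnj_mult complex_cnj_cnj)
  with apply_right_inverse[OF assms, of z]
  have "((\<Sum>i\<in>UNIV. P i j * (\<Sum>l\<le>n. a i l * z l)) + nu j * (\<Sum>l\<le>n. b l * z l)) +
     ((\<Sum>i\<in>UNIV. P i j * cnj (\<Sum>l\<le>n. a i l * z l)) + nu j * cnj (\<Sum>l\<le>n. b l * z l)) = 2 * z j"
    by (simp only: add_0_right)
  then have "(\<Sum>i\<in>UNIV. P i j * ((\<Sum>l\<le>n. a i l * z l) + cnj (\<Sum>l\<le>n. a i l * z l))) +
     nu j * ((\<Sum>l\<le>n. b l * z l) + cnj (\<Sum>l\<le>n. b l * z l)) = 2 * z j"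
    by (simp only: distrib_left sum.distrib add_ac)
  then have "(\<Sum>i\<in>UNIV. P i j * (2 * complex_of_real (Re (\<Sum>l\<le>n. a i l * z l)))) +
     nu j * (2 * complex_of_real (Re (\<Sum>l\<le>n. b l * z l))) = 2 * z j"
    by (simp only: complex_add_cnj of_real_mult of_real_numeral)
  then have "2 * ((\<Sum>i\<in>UNIV. P i j * complex_of_real (Re (\<Sum>l\<le>n. a i l * z l))) + nu j * complex_of_real (Re (\<Sum>l\<le>n. b l * z l))) = 2 * z j"
    by (simp only: distrib_left sum_distrib_left mult.left_commute)
  then show ?thesis by (rule iffD1[OF mult_left_cancel, rotated]) simp
qed

lemma Re_a_nu: "Re (\<Sum>j\<le>n. a i j * nu j) = 0" and Re_b_nu: "Re (\<Sum>j\<le>n. b j * nu j) = 1"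
  using left_inverse_x[of i "\<lambda>_. 0" 1] left_inverse_y[of "\<lambda>_. 0" 1] by simp_all

end

locale graph_chart = coordinate_chart X A D \<phi> + real_frame n P nu a b
  for X :: "'a topology" and A :: "('a, 'm::finite) chart set" and D and \<phi> :: "'a \<Rightarrow> real^'m"
    and n :: nat and P :: "'m \<Rightarrow> nat \<Rightarrow> complex" and nu and a :: "'m \<Rightarrow> nat \<Rightarrow> complex" and b
begin

definition gf :: "(real^'m \<Rightarrow> real) \<Rightarrow> 'a \<Rightarrow> complex" where
  "gf u q = complex_of_real (u (\<phi> q))"

text \<open>The graph embedding: the \<open>j\<close>-th complex coordinate of the point of the
  graph of \<open>u\<close> over \<open>\<phi> q\<close>.\<close>

definition H :: "(real^'m \<Rightarrow> real) \<Rightarrow> nat \<Rightarrow> 'a \<Rightarrow> complex" where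
  "H u j q = (\<Sum>i\<in>UNIV. P i j * xc i q) + nu j * gf u q"

text \<open>The structure induced by the graph embedding: vectors of type (1,0) are those
  annihilating the conjugates of the holomorphic coordinates. Pulled back to the fixed domain
  \<open>D\<close>, the structures of different graphs become comparable.\<close>

definition V :: "(real^'m \<Rightarrow> real) \<Rightarrow> 'a \<Rightarrow> 'a cvector set" where
  "V u q = {Z \<in> ctangent X A q. \<forall>j\<le>n. Z (\<lambda>y. cnj (H u j y)) = 0}"

definition grad :: "(real^'m \<Rightarrow> real) \<Rightarrow> 'm \<Rightarrow> 'a \<Rightarrow> complex" where
  "grad u i q = complex_of_real (ddir (axis i 1) u (\<phi> q))"

text \<open>Up to a factor, \<open>rho u\<close> consists of the \<open>\<partial>/\<partial>\<zeta>\<^sub>j\<close>-derivatives of the defining function \<open>u(x) - y\<close>.\<close>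

definition rho :: "(real^'m \<Rightarrow> real) \<Rightarrow> nat \<Rightarrow> 'a \<Rightarrow> complex" where
  "rho u j q = (\<Sum>i\<in>UNIV. grad u i q * a i j) - b j"

text \<open>This is \<open>- \<i>\<close> times twice the (1,0) part of the differential of the
  defining function, pulled back to the graph. It is real there because the full differential
  vanishes on the graph.\<close>

definition contact :: "(real^'m \<Rightarrow> real) \<Rightarrow> 'a \<Rightarrow> 'a cvector \<Rightarrow> complex" where
  "contact u q Z = - \<i> * (\<Sum>j\<le>n. rho u j q * Z (H u j))"

context
  fixes u :: "real^'m \<Rightarrow> real" assumes u: "smooth_on (\<phi> ` D) u"
begin

lemma smooth_fun_gf: "smooth_fun A D (gf u)"
  unfolding gf_def[abs_def]
  by (rule smooth_fun_coords[OF D_open subset_refl]) (rule smooth_on_linear_compose[OF D_image_open bounded_linear_of_real u])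

lemma smooth_fun_grad: "smooth_fun A D (grad u i)"
  unfolding grad_def[abs_def]
  by (rule smooth_fun_coords[OF D_open subset_refl])
    (rule smooth_on_linear_compose[OF D_image_open bounded_linear_of_real smooth_on_ddir[OF u]])

lemma smooth_fun_rho: "smooth_fun A D (rho u j)"
proof -
  have "smooth_fun A D (\<lambda>q. (\<Sum>i\<in>UNIV. grad u i q * a i j) + (- b j))"
    by (intro smooth_fun_add smooth_fun_sum smooth_fun_mult smooth_fun_grad smooth_fun_const D_open)
  then show ?thesis by (simp add: rho_def[abs_def])
qed

lemma smooth_fun_H: "smooth_fun A D (H u j)"
  unfolding H_def[abs_def]
  by (intro smooth_fun_add smooth_fun_sum smooth_fun_mult smooth_fun_gf smooth_fun_xc smooth_fun_const D_open)

lemma near: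
  assumes "q \<in> D"
  shows "smooth_near X A q (gf u)" "smooth_near X A q (H u j)" "smooth_near X A q (\<lambda>y. cnj (H u j y))"
    "smooth_near X A q (rho u j)" "smooth_near X A q (grad u i)"
  using smooth_nearI[OF D_open assms] smooth_fun_gf smooth_fun_H smooth_fun_rho smooth_fun_grad smooth_fun_cnj[OF D_open] by blast+

lemma tangent_gf:
  assumes Z: "Z \<in> ctangent X A q" and q: "q \<in> D"
  shows "Z (gf u) = (\<Sum>i\<in>UNIV. Z (xc i) * grad u i q)"
proof -
  have s: "smooth_on (\<phi> ` D) (\<lambda>x. complex_of_real (u x))"
    by (rule smooth_on_linear_compose[OF D_image_open bounded_linear_of_real u])
  have "Z (gf u) = (\<Sum>i\<in>UNIV. Z (xc i) * ddir (axis i 1) (\<lambda>x. complex_of_real (u x)) (\<phi> q))"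
    unfolding gf_def[abs_def] by (rule ctangent_chain(1)[OF Z D_image_open q _ s]) (use q in simp)
  also have "\<dots> = (\<Sum>i\<in>UNIV. Z (xc i) * grad u i q)"
    unfolding grad_def
    by (intro sum.cong refl arg_cong2[of _ _ _ _ "(*)"] bounded_linear_ddir bounded_linear_of_real
        smooth_on_differentiable[OF u]) (use q in simp)
  finally show ?thesis .
qed

lemma tangent_H:
  assumes Z: "Z \<in> ctangent X A q" and q: "q \<in> D"
  shows "Z (H u j) = (\<Sum>i\<in>UNIV. P i j * Z (xc i)) + nu j * Z (gf u)"
    and "Z (\<lambda>y. cnj (H u j y)) = (\<Sum>i\<in>UNIV. cnj (P i j) * Z (xc i)) + cnj (nu j) * Z (gf u)"
proof -
  have qX: "q \<in> topspace X" by (rule D_topspace[OF q])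
  have *: "Z (\<lambda>q. (\<Sum>i\<in>UNIV. c i * xc i q) + d * gf u q) = (\<Sum>i\<in>UNIV. c i * Z (xc i)) + d * Z (gf u)" for c d
  proof -
    have s: "smooth_near X A q (\<lambda>q. c i * xc i q)" for i by (intro smooth_near_cmult smooth_near_xc q)
    have "Z (\<lambda>q. (\<Sum>i\<in>UNIV. c i * xc i q) + d * gf u q) = Z (\<lambda>q. \<Sum>i\<in>UNIV. c i * xc i q) + Z (\<lambda>q. d * gf u q)"
      by (intro ctangent_add[OF Z] smooth_near_sum[OF qX] s smooth_near_cmult near(1)[OF q])
    also have "Z (\<lambda>q. \<Sum>i\<in>UNIV. c i * xc i q) = (\<Sum>i\<in>UNIV. Z (\<lambda>q. c i * xc i q))"
      by (rule ctangent_sum[OF Z qX]) (rule s)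
    also have "\<dots> = (\<Sum>i\<in>UNIV. c i * Z (xc i))"
      by (intro sum.cong refl ctangent_cmult[OF Z] smooth_near_xc q)
    also have "Z (\<lambda>q. d * gf u q) = d * Z (gf u)" by (rule ctangent_cmult[OF Z near(1)[OF q]])
    finally show ?thesis .
  qed
  show "Z (H u j) = (\<Sum>i\<in>UNIV. P i j * Z (xc i)) + nu j * Z (gf u)"
    unfolding H_def[abs_def] by (rule *)
  have "(\<lambda>y. cnj (H u j y)) = (\<lambda>q. (\<Sum>i\<in>UNIV. cnj (P i j) * xc i q) + cnj (nu j) * gf u q)"
    by (simp add: H_def xc_def gf_def fun_eq_iff)
  then show "Z (\<lambda>y. cnj (H u j y)) = (\<Sum>i\<in>UNIV. cnj (P i j) * Z (xc i)) + cnj (nu j) * Z (gf u)"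
    by (simp only: *)
qed

lemma H_components:
  "Re (\<Sum>j\<le>n. a i j * H u j q) = \<phi> q $ i" "Re (\<Sum>j\<le>n. b j * H u j q) = u (\<phi> q)"
  unfolding H_def xc_def gf_def by (rule left_inverse_x left_inverse_y)+

lemma tangent_components:
  assumes Z: "Z \<in> ctangent X A q" and q: "q \<in> D"
  shows "2 * Z (xc i) = (\<Sum>j\<le>n. a i j * Z (H u j)) + (\<Sum>j\<le>n. cnj (a i j) * Z (\<lambda>y. cnj (H u j y)))"
    and "2 * Z (gf u) = (\<Sum>j\<le>n. b j * Z (H u j)) + (\<Sum>j\<le>n. cnj (b j) * Z (\<lambda>y. cnj (H u j y)))"
proof -
  have qX: "q \<in> topspace X" by (rule D_topspace[OF q])
  have *: "2 * Z f = (\<Sum>j\<le>n. c j * Z (H u j)) + (\<Sum>j\<le>n. cnj (c j) * Z (\<lambda>y. cnj (H u j y)))"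
    if f: "smooth_near X A q f" and eq: "\<And>q. f q = complex_of_real (Re (\<Sum>j\<le>n. c j * H u j q))" for f c
  proof -
    have s: "smooth_near X A q (\<lambda>q. c j * H u j q)" "smooth_near X A q (\<lambda>q. cnj (c j) * cnj (H u j q))" for j c
      by (intro smooth_near_cmult near q)+
    have "2 * f q = (\<Sum>j\<le>n. c j * H u j q) + (\<Sum>j\<le>n. cnj (c j) * cnj (H u j q))" for q
    proof -
      have "(\<Sum>j\<le>n. c j * H u j q) + cnj (\<Sum>j\<le>n. c j * H u j q) = 2 * f q"
        unfolding eq complex_add_cnj by simp
      then show ?thesis by (simp add: cnj_sum)
    qed
    then have "Z (\<lambda>q. 2 * f q) = Z (\<lambda>q. (\<Sum>j\<le>n. c j * H u j q) + (\<Sum>j\<le>n. cnj (c j) * cnj (H u j q)))" by simp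
    also have "\<dots> = Z (\<lambda>q. \<Sum>j\<le>n. c j * H u j q) + Z (\<lambda>q. \<Sum>j\<le>n. cnj (c j) * cnj (H u j q))"
      by (intro ctangent_add[OF Z] smooth_near_sum[OF qX] s)
    also have "Z (\<lambda>q. \<Sum>j\<le>n. c j * H u j q) = (\<Sum>j\<le>n. Z (\<lambda>q. c j * H u j q))"
      by (rule ctangent_sum[OF Z qX]) (rule s)
    also have "\<dots> = (\<Sum>j\<le>n. c j * Z (H u j))"
      by (intro sum.cong refl ctangent_cmult[OF Z] near q)
    also have "Z (\<lambda>q. \<Sum>j\<le>n. cnj (c j) * cnj (H u j q)) = (\<Sum>j\<le>n. Z (\<lambda>q. cnj (c j) * cnj (H u j q)))"
      by (rule ctangent_sum[OF Z qX]) (rule s)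
    also have "\<dots> = (\<Sum>j\<le>n. cnj (c j) * Z (\<lambda>q. cnj (H u j q)))"
      by (intro sum.cong refl ctangent_cmult[OF Z] near q)
    finally show ?thesis using ctangent_cmult[OF Z f, of 2] by simp
  qed
  show "2 * Z (xc i) = (\<Sum>j\<le>n. a i j * Z (H u j)) + (\<Sum>j\<le>n. cnj (a i j) * Z (\<lambda>y. cnj (H u j y)))"
    by (rule *[OF smooth_near_xc[OF q]]) (simp only: H_components xc_def)
  show "2 * Z (gf u) = (\<Sum>j\<le>n. b j * Z (H u j)) + (\<Sum>j\<le>n. cnj (b j) * Z (\<lambda>y. cnj (H u j y)))"
    by (rule *[OF near(1)[OF q]]) (simp only: H_components gf_def)
qed

lemma rho_sum: "(\<Sum>j\<le>n. rho u j q * z j) = (\<Sum>i\<in>UNIV. grad u i q * (\<Sum>j\<le>n. a i j * z j)) - (\<Sum>j\<le>n. b j * z j)"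
proof -
  have "(\<Sum>j\<le>n. rho u j q * z j) = (\<Sum>j\<le>n. \<Sum>i\<in>UNIV. grad u i q * a i j * z j) - (\<Sum>j\<le>n. b j * z j)"
    by (simp add: rho_def left_diff_distrib sum_subtractf sum_distrib_right)
  then show ?thesis by (subst (asm) sum.swap) (simp add: sum_distrib_left mult.assoc)
qed

lemma cnj_grad [simp]: "cnj (grad u i q) = grad u i q" by (simp add: grad_def)

text \<open>The defining function vanishes identically on the graph, so its differential, split into
  the (1,0) and the (0,1) part, annihilates tangent vectors.\<close>

lemma rho_relation:
  assumes Z: "Z \<in> ctangent X A q" and q: "q \<in> D"
  shows "(\<Sum>j\<le>n. rho u j q * Z (H u j)) + (\<Sum>j\<le>n. cnj (rho u j q) * Z (\<lambda>y. cnj (H u j y))) = 0"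
proof -
  have c: "(\<Sum>j\<le>n. cnj (rho u j q) * z j) = (\<Sum>i\<in>UNIV. grad u i q * (\<Sum>j\<le>n. cnj (a i j) * z j)) - (\<Sum>j\<le>n. cnj (b j) * z j)" for z
    using arg_cong[OF rho_sum[of q "\<lambda>j. cnj (z j)"], of cnj] by simp
  have "(\<Sum>j\<le>n. rho u j q * Z (H u j)) + (\<Sum>j\<le>n. cnj (rho u j q) * Z (\<lambda>y. cnj (H u j y))) =
    (\<Sum>i\<in>UNIV. grad u i q * (2 * Z (xc i))) - 2 * Z (gf u)"
    unfolding rho_sum c tangent_components[OF assms] by (simp add: distrib_left sum.distrib)
  also have "\<dots> = 0"
    unfolding tangent_gf[OF assms] sum_distrib_left by (simp add: sum_subtractf[symmetric] mult_ac)
  finally show ?thesis .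
qed

lemma V_D:
  assumes "Z \<in> V u q" and q: "q \<in> D"
  shows "Z \<in> ctangent X A q" "2 * Z (xc i) = (\<Sum>j\<le>n. a i j * Z (H u j))" "(\<Sum>j\<le>n. rho u j q * Z (H u j)) = 0"
proof -
  show Z: "Z \<in> ctangent X A q" using assms by (simp add: V_def)
  have 0: "Z (\<lambda>y. cnj (H u j y)) = 0" if "j \<le> n" for j using assms that by (simp add: V_def)
  show "2 * Z (xc i) = (\<Sum>j\<le>n. a i j * Z (H u j))" "(\<Sum>j\<le>n. rho u j q * Z (H u j)) = 0"
    using tangent_components(1)[OF Z q, of i] rho_relation[OF Z q] 0 by simp_all
qed

text \<open>If all (0,1) components of \<open>Z\<close> vanish, \<open>tangent_components\<close>
  forces \<open>2 * Z (xc i)\<close> to be the form \<open>a i\<close> applied to the (1,0)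
  components. This is the resulting vector for prescribed components \<open>z\<close>.\<close>

definition lift :: "'a \<Rightarrow> (nat \<Rightarrow> complex) \<Rightarrow> 'a cvector" where
  "lift q z = cvec q (\<lambda>i. (\<Sum>j\<le>n. a i j * z j) / 2)"

text \<open>If \<open>z\<close> is not tangent to the graph, the (1,0) and (0,1) components are off
  by multiples of \<open>nu\<close> and of its conjugate, with half the value of \<open>rho\<close>
  on \<open>z\<close> as factor. The exact error is what the surjectivity of
  \<open>dbar_section\<close> is computed from.\<close>

lemma lift_general:
  assumes q: "q \<in> D"
  shows "lift q z \<in> ctangent X A q" "lift q z (xc i) = (\<Sum>j\<le>n. a i j * z j) / 2"
    "j \<le> n \<Longrightarrow> lift q z (H u j) = z j + nu j * (\<Sum>l\<le>n. rho u l q * z l) / 2"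
    "j \<le> n \<Longrightarrow> lift q z (\<lambda>y. cnj (H u j y)) = cnj (nu j) * (\<Sum>l\<le>n. rho u l q * z l) / 2"
proof -
  show t: "lift q z \<in> ctangent X A q" by (simp add: lift_def cvec_ctangent[OF q])
  show x: "lift q z (xc i) = (\<Sum>j\<le>n. a i j * z j) / 2" for i by (simp add: lift_def cvec_xc[OF q])
  have g: "lift q z (gf u) = ((\<Sum>l\<le>n. rho u l q * z l) + (\<Sum>l\<le>n. b l * z l)) / 2"
    unfolding tangent_gf[OF t q] rho_sum x mult.commute[of _ "grad u _ q"] sum_half by simp
  show "lift q z (H u j) = z j + nu j * (\<Sum>l\<le>n. rho u l q * z l) / 2" if j: "j \<le> n"
  proof -
    have "lift q z (H u j) = ((\<Sum>i\<in>UNIV. P i j * (\<Sum>l\<le>n. a i l * z l)) + nu j * (\<Sum>l\<le>n. b l * z l)) / 2 +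
        nu j * (\<Sum>l\<le>n. rho u l q * z l) / 2"
      unfolding tangent_H(1)[OF t q] x g sum_half by (simp only: add_divide_distrib distrib_left times_divide_eq_right add_ac)
    then show ?thesis unfolding apply_right_inverse[OF j] by simp
  qed
  show "lift q z (\<lambda>y. cnj (H u j y)) = cnj (nu j) * (\<Sum>l\<le>n. rho u l q * z l) / 2" if j: "j \<le> n"
  proof -
    have "lift q z (\<lambda>y. cnj (H u j y)) = ((\<Sum>i\<in>UNIV. cnj (P i j) * (\<Sum>l\<le>n. a i l * z l)) + cnj (nu j) * (\<Sum>l\<le>n. b l * z l)) / 2 +
        cnj (nu j) * (\<Sum>l\<le>n. rho u l q * z l) / 2"
      unfolding tangent_H(2)[OF t q] x g sum_half by (simp only: add_divide_distrib distrib_left times_divide_eq_right add_ac)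
    then show ?thesis unfolding apply_right_inverse_cnj[OF j] by simp
  qed
qed

lemma lift_V:
  assumes q: "q \<in> D" and z: "(\<Sum>j\<le>n. rho u j q * z j) = 0"
  shows "lift q z \<in> V u q" "j \<le> n \<Longrightarrow> lift q z (H u j) = z j"
  using lift_general[OF q, where z = z] z by (simp_all add: V_def)

lemma V_eqI:
  assumes "Z \<in> V u q" "Y \<in> V u q" "q \<in> D" "\<And>j. j \<le> n \<Longrightarrow> Z (H u j) = Y (H u j)"
  shows "Z = Y"
proof (rule ctangent_eqI[OF V_D(1)[OF assms(1,3)] V_D(1)[OF assms(2,3)] assms(3)])
  fix i
  have "2 * Z (xc i) = 2 * Y (xc i)"
    unfolding V_D(2)[OF assms(1,3)] V_D(2)[OF assms(2,3)] using assms(4) by simp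
  then show "Z (xc i) = Y (xc i)" by simp
qed

text \<open>The direction \<open>nu\<close> is the \<open>y\<close>-axis, so it is transverse to
  every graph. In particular the coefficients \<open>rho\<close> never vanish
  simultaneously.\<close>

lemma Re_rho_nu: "Re (\<Sum>j\<le>n. rho u j q * nu j) = - 1"
  unfolding rho_sum using Re_a_nu Re_b_nu by (simp add: grad_def)

lemma V_combination:
  assumes "\<And>j. j \<in> J \<Longrightarrow> Z j \<in> V u q"
  shows "(\<lambda>f. \<Sum>j\<in>J. c j * Z j f) \<in> V u q"
  using assms by (auto simp: V_def intro!: ctangent_combination)

text \<open>The fibre corresponds to the hyperplane of all \<open>z\<close> annihilated by
  \<open>rho\<close>. Where \<open>rho u j0\<close> is nonzero, coordinate \<open>j0\<close> is
  solved for, and the other \<open>n\<close> coordinates give a smooth frame.\<close>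

lemma V_subbundle: "complex_subbundle X A n D (V u)"
  unfolding complex_subbundle_def
proof
  fix p assume p: "p \<in> D"
  have "\<exists>j0\<le>n. rho u j0 p \<noteq> 0"
  proof (rule ccontr)
    assume "\<not> ?thesis"
    then have "(\<Sum>j\<le>n. rho u j p * nu j) = 0" by (intro sum.neutral) auto
    then show False using Re_rho_nu[of p] by simp
  qed
  then obtain j0 where j0: "j0 \<le> n" "rho u j0 p \<noteq> 0" by blast
  \<comment> \<open>Enumeration of the indices up to \<open>n\<close> that omits
    \<open>j0\<close>.\<close>
  define \<sigma> where "\<sigma> = (\<lambda>j. if j < j0 then j else Suc j)"
  have \<sigma>: "\<sigma> j \<noteq> j0" "j < n \<Longrightarrow> \<sigma> j \<le> n" "\<sigma> j = \<sigma> k \<Longrightarrow> j = k" for j k using j0 by (auto simp: \<sigma>_def split: if_splits)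
  have \<sigma>_surj: "\<exists>j<n. l = \<sigma> j" if "l \<le> n" "l \<noteq> j0" for l
    using that j0 by (intro exI[of _ "if l < j0 then l else l - 1"]) (auto simp: \<sigma>_def)
  have sr: "smooth_on (\<phi> ` D) (rho u j0 \<circ> inv_into D \<phi>)"
    using smooth_fun_rho smooth_fun_iff[OF D_open subset_refl] by blast
  define B where "B = \<phi> ` D \<inter> (rho u j0 \<circ> inv_into D \<phi>) -` (- {0})"
  have "open B"
    unfolding B_def by (rule continuous_open_preimage[OF smooth_on_continuous[OF sr] D_image_open]) auto
  define W where "W = {q \<in> D. \<phi> q \<in> B}"
  have W: "openin X W" "p \<in> W" "W \<subseteq> D" using preimage_open[OF \<open>open B\<close>] p j0 by (auto simp: W_def B_def)
  have rW: "rho u j0 q \<noteq> 0" if "q \<in> W" for q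
  proof -
    have "q \<in> D" "(rho u j0 \<circ> inv_into D \<phi>) (\<phi> q) \<noteq> 0" using that unfolding W_def B_def by blast+
    then show ?thesis by simp
  qed
  define z where "z = (\<lambda>j q l. if l = \<sigma> j then 1 else if l = j0 then - rho u (\<sigma> j) q * inverse (rho u j0 q) else 0)"
  have rz: "(\<Sum>l\<le>n. rho u l q * z j q l) = 0" if "q \<in> W" "j < n" for q j
  proof -
    have "(\<Sum>l\<le>n. rho u l q * z j q l) = (\<Sum>l\<in>{\<sigma> j, j0}. rho u l q * z j q l)"
      by (rule sum.mono_neutral_right) (use \<sigma> j0 that in \<open>auto simp: z_def\<close>)
    also have "\<dots> = 0" using \<sigma>(1)[of j] rW[OF that(1)] by (simp add: z_def)
    finally show ?thesis .
  qed
  define E where "E = (\<lambda>j q. lift q (z j q))"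
  have EV: "E j q \<in> V u q" "l \<le> n \<Longrightarrow> E j q (H u l) = z j q l" if "q \<in> W" "j < n" for j q l
    using lift_V[of q "z j q"] rz[OF that] that W by (auto simp: E_def)
  have sz: "smooth_fun A W (\<lambda>q. z j q l)" for j l
  proof -
    have s1: "smooth_fun A W (\<lambda>q. inverse (rho u j0 q))"
      by (rule smooth_fun_compose[OF W(1) _ smooth_on_inverse[of "- {0}"]])
        (use rW smooth_fun_subset[OF smooth_fun_rho W(3)] in auto)
    have s2: "smooth_fun A W (\<lambda>q. - 1 * rho u (\<sigma> j) q)"
      by (rule smooth_fun_cmult[OF W(1) smooth_fun_subset[OF smooth_fun_rho W(3)]])
    have "smooth_fun A W (\<lambda>q. - 1 * rho u (\<sigma> j) q * inverse (rho u j0 q))"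
      by (rule smooth_fun_mult[OF W(1) s2 s1])
    then show ?thesis by (cases "l = \<sigma> j"; cases "l = j0") (simp_all add: z_def)
  qed
  have sE: "smooth_field X A W (E j)" for j
    unfolding smooth_field_iff[OF W(1,3)]
  proof (intro conjI ballI allI)
    show "E j q \<in> ctangent X A q" if "q \<in> W" for q using that W(3) lift_general(1) by (auto simp: E_def)
    fix i
    have "smooth_fun A W (\<lambda>q. (1 / 2) * (\<Sum>l\<le>n. a i l * z j q l))"
      by (intro smooth_fun_cmult smooth_fun_sum W(1) sz)
    then show "smooth_fun A W (\<lambda>q. E j q (xc i))"
      by (rule smooth_fun_cong[OF W(1), rotated]) (use W(3) lift_general(2) in \<open>auto simp: E_def\<close>)
  qed
  have coef: "(\<Sum>j<n. c j * z j q (\<sigma> k)) = c k" if "k < n" for c q k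
  proof -
    have "(\<Sum>j<n. c j * z j q (\<sigma> k)) = (\<Sum>j<n. if j = k then c k else 0)"
      by (intro sum.cong refl) (use \<sigma> in \<open>auto simp: z_def\<close>)
    then show ?thesis using that by simp
  qed
  show "\<exists>W E. openin X W \<and> p \<in> W \<and> W \<subseteq> D \<and> (\<forall>j<n. smooth_field X A W (E j)) \<and>
     (\<forall>q\<in>W. (\<forall>c. (\<lambda>f. \<Sum>j<n. c j * E j q f) = (\<lambda>f. 0) \<longrightarrow> (\<forall>j<n. c j = 0)) \<and>
        V u q = {\<lambda>f. \<Sum>j<n. c j * E j q f |c. True})"
  proof (intro exI[of _ W] exI[of _ E] conjI W ballI allI impI sE)
    fix q c k assume q: "q \<in> W" and c: "(\<lambda>f. \<Sum>j<n. c j * E j q f) = (\<lambda>f. 0)" and k: "k < n"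
    have "(\<Sum>j<n. c j * E j q (H u (\<sigma> k))) = 0" using fun_cong[OF c, of "H u (\<sigma> k)"] by simp
    then show "c k = 0" using EV(2)[OF q _ \<sigma>(2)[OF k]] coef[OF k] by simp
  next
    fix q assume q: "q \<in> W"
    then have qD: "q \<in> D" using W by blast
    show "V u q = {\<lambda>f. \<Sum>j<n. c j * E j q f |c. True}"
    proof (intro equalityI subsetI)
      fix Z assume Z: "Z \<in> V u q"
      let ?Y = "\<lambda>f. \<Sum>j<n. Z (H u (\<sigma> j)) * E j q f"
      have Y: "?Y \<in> V u q" by (rule V_combination) (use EV(1)[OF q] in auto)
      have off: "?Y (H u l) = Z (H u l)" if l: "l \<le> n" "l \<noteq> j0" for l
      proof -
        obtain k where k: "k < n" "l = \<sigma> k" using \<sigma>_surj[OF l] by blast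
        have "?Y (H u l) = (\<Sum>j<n. Z (H u (\<sigma> j)) * z j q (\<sigma> k))"
          by (intro sum.cong refl) (use EV(2)[OF q _ l(1)] k in auto)
        then show ?thesis using coef[OF k(1), of "\<lambda>j. Z (H u (\<sigma> j))" q] k(2) by simp
      qed
      have split: "(\<Sum>l\<le>n. rho u l q * F l) = rho u j0 q * F j0 + (\<Sum>l\<in>{..n} - {j0}. rho u l q * F l)" for F
        by (rule sum.remove) (use j0 in auto)
      \<comment> \<open>All components other than \<open>j0\<close> agree; the hyperplane equation
        satisfied by both vectors then determines the component \<open>j0\<close>.\<close>
      have "(\<Sum>l\<in>{..n} - {j0}. rho u l q * ?Y (H u l)) = (\<Sum>l\<in>{..n} - {j0}. rho u l q * Z (H u l))"
        by (intro sum.cong refl arg_cong2[of _ _ _ _ "(*)"] off) auto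
      then have "rho u j0 q * ?Y (H u j0) = rho u j0 q * Z (H u j0)"
        using V_D(3)[OF Y qD, unfolded split] V_D(3)[OF Z qD, unfolded split] by (simp add: add_eq_0_iff2)
      then have "?Y (H u j0) = Z (H u j0)" using rW[OF q] by simp
      then have "?Y (H u l) = Z (H u l)" if "l \<le> n" for l using off[OF that] by (cases "l = j0") auto
      then have "Z = ?Y" using V_eqI[OF Y Z qD] by simp
      then show "Z \<in> {\<lambda>f. \<Sum>j<n. c j * E j q f |c. True}" by (intro CollectI exI[of _ "\<lambda>j. Z (H u (\<sigma> j))"]) simp
    next
      fix Z assume "Z \<in> {\<lambda>f. \<Sum>j<n. c j * E j q f |c. True}"
      then show "Z \<in> V u q" using V_combination[of "{..<n}" "\<lambda>j. E j q" q] EV(1)[OF q] by auto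
    qed
  qed
qed

text \<open>Fields that annihilate all functions \<open>cnj (H u j y)\<close> have brackets that
  annihilate them too. A vector of the fibre that is also the conjugate of one has vanishing
  components of both types.\<close>

lemma V_cr_structure: "cr_structure X A n D (V u)"
  unfolding cr_structure_def
proof (intro conjI V_subbundle ballI allI impI)
  fix q assume q: "q \<in> D"
  have "Z = (\<lambda>f. 0)" if Z: "Z \<in> V u q" and Y: "Y \<in> V u q" "Z = conj_vec Y" for Z Y
  proof (rule V_eqI[OF Z _ q])
    show "(\<lambda>f. 0) \<in> V u q" by (simp add: V_def zero_ctangent)
    fix j assume "j \<le> n"
    then show "Z (H u j) = 0" using Y by (simp add: V_def conj_vec_def)
  qed
  moreover have "(\<lambda>f. 0) \<in> V u q" "(\<lambda>f. 0) = conj_vec (\<lambda>f. 0)" by (simp_all add: V_def zero_ctangent conj_vec_def)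
  ultimately show "V u q \<inter> conj_vec ` V u q = {\<lambda>f. 0}" by blast
next
  fix W Z Z' q assume A: "openin X W \<and> W \<subseteq> D \<and> smooth_section X A W (V u) Z \<and> smooth_section X A W (V u) Z'" and q: "q \<in> W"
  then have W: "openin X W" "W \<subseteq> D" and Z: "smooth_field X A W Z" "\<And>y. y \<in> W \<Longrightarrow> Z y \<in> V u y"
    and Y: "smooth_field X A W Z'" "\<And>y. y \<in> W \<Longrightarrow> Z' y \<in> V u y" unfolding smooth_section_def by auto
  have qD: "q \<in> D" using W q by blast
  have 0: "F q (\<lambda>y. G y (\<lambda>y. cnj (H u j y))) = 0"
    if "smooth_field X A W F" "smooth_field X A W G" "\<And>y. y \<in> W \<Longrightarrow> G y \<in> V u y" "j \<le> n" for F G j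
  proof -
    have "F q (\<lambda>y. G y (\<lambda>y. cnj (H u j y))) = F q (\<lambda>y. 0)"
      by (rule second_derivative_cong[OF that(1,2) W(1) q W(1) q _ near(3)[OF qD]]) (use that(3,4) in \<open>auto simp: V_def\<close>)
    then show ?thesis using ctangent_const[OF smooth_field_ctangent[OF that(1) q] D_topspace[OF qD]] by simp
  qed
  show "lie_bracket X A Z Z' q \<in> V u q"
    using lie_bracket_ctangent[OF Z(1) Y(1) W(1) q] 0[OF Z(1) Y] 0[OF Y(1) Z]
    by (simp add: V_def) (simp add: lie_bracket_def)
qed

lemma contact_conj:
  assumes Z: "Z \<in> ctangent X A q" and q: "q \<in> D"
  shows "contact u q (conj_vec Z) = cnj (contact u q Z)"
proof -
  have "(\<Sum>j\<le>n. rho u j q * conj_vec Z (H u j)) = cnj (\<Sum>j\<le>n. cnj (rho u j q) * Z (\<lambda>y. cnj (H u j y)))"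
    by (simp add: conj_vec_def)
  also have "\<dots> = cnj (- (\<Sum>j\<le>n. rho u j q * Z (H u j)))"
    using rho_relation[OF assms] by (simp add: add_eq_0_iff2)
  finally show ?thesis by (simp add: contact_def)
qed

lemma contact_V: "Z \<in> V u q \<Longrightarrow> q \<in> D \<Longrightarrow> contact u q Z = 0"
  using V_D(3) by (simp add: contact_def)

lemma contact_form: "real_one_form X A D (contact u)"
  unfolding real_one_form_def
proof (intro conjI ballI allI impI)
  show "ctangent_linear X A q (contact u q)" for q
    unfolding ctangent_linear_def contact_def
    by (simp add: sum_distrib_left sum.distrib algebra_simps)
  show "contact u q (conj_vec Z) = cnj (contact u q Z)" if "q \<in> D" "Z \<in> ctangent X A q" for q Z
    by (rule contact_conj[OF that(2,1)])
  fix W Z assume W: "openin X W \<and> W \<subseteq> D \<and> smooth_field X A W Z"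
  show "smooth_fun A W (\<lambda>q. contact u q (Z q))"
    unfolding contact_def
    by (intro smooth_fun_cmult smooth_fun_sum smooth_fun_mult smooth_field_apply[of W Z]) 
      (use W smooth_fun_subset[OF smooth_fun_rho] smooth_fun_subset[OF smooth_fun_H] in auto)
qed

lemma contact_kernel:
  assumes q: "q \<in> D"
  shows "{Z \<in> rtangent X A q. contact u q Z = 0} = re_part (V u q)"
proof (intro equalityI subsetI)
  fix Z assume "Z \<in> {Z \<in> rtangent X A q. contact u q Z = 0}"
  then have Zr: "Z \<in> rtangent X A q" and c: "(\<Sum>j\<le>n. rho u j q * Z (H u j)) = 0" by (auto simp: contact_def)
  then have Z: "Z \<in> ctangent X A q" by (simp add: rtangent_def)
  \<comment> \<open>The (1,0) part of the real vector: its components \<open>Z (H u j)\<close>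
    satisfy the hyperplane equation because the contact form vanishes.\<close>
  let ?Y = "lift q (\<lambda>j. Z (H u j))"
  have Y: "?Y \<in> V u q" by (rule lift_V(1)[OF q c])
  have Yt: "?Y \<in> ctangent X A q" by (rule V_D(1)[OF Y q])
  have "(\<lambda>f. 1 * ?Y f + 1 * conj_vec ?Y f) \<in> ctangent X A q"
    using ctangent_combination[of "{..<2::nat}" "\<lambda>j. if j = 0 then ?Y else conj_vec ?Y" q "\<lambda>_. 1"] Yt conj_vec_ctangent[OF Yt]
    by (simp add: numeral_2_eq_2 lessThan_Suc add.commute)
  then have Yc: "(\<lambda>f. ?Y f + conj_vec ?Y f) \<in> ctangent X A q" by simp
  have "Z = (\<lambda>f. ?Y f + conj_vec ?Y f)"
  proof (rule ctangent_eqI[OF Z Yc q])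
    fix i
    have S: "(\<Sum>j\<le>n. a i j * Z (H u j)) = 2 * ?Y (xc i)"
      unfolding lift_general(2)[OF q] by simp
    have "2 * Z (xc i) = (\<Sum>j\<le>n. a i j * Z (H u j)) + cnj (\<Sum>j\<le>n. a i j * Z (H u j))"
      using tangent_components(1)[OF Z q, of i] rtangent_real[OF Zr] by simp
    then have "2 * Z (xc i) = 2 * ?Y (xc i) + cnj (2 * ?Y (xc i))" unfolding S .
    then have "2 * Z (xc i) = 2 * (?Y (xc i) + cnj (?Y (xc i)))" by simp
    then have "Z (xc i) = ?Y (xc i) + cnj (?Y (xc i))" by (rule iffD1[OF mult_left_cancel, rotated]) simp
    then show "Z (xc i) = ?Y (xc i) + conj_vec ?Y (xc i)"
      by (simp add: conj_vec_def xc_cnj)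
  qed
  then show "Z \<in> re_part (V u q)" using Y unfolding re_part_def by blast
next
  fix Z assume "Z \<in> re_part (V u q)"
  then obtain Y where Y: "Y \<in> V u q" "Z = (\<lambda>f. Y f + conj_vec Y f)" unfolding re_part_def by blast
  have Yt: "Y \<in> ctangent X A q" by (rule V_D(1)[OF Y(1) q])
  have "(\<lambda>f. 1 * Y f + 1 * conj_vec Y f) \<in> ctangent X A q"
    using ctangent_combination[of "{..<2::nat}" "\<lambda>j. if j = 0 then Y else conj_vec Y" q "\<lambda>_. 1"] Yt conj_vec_ctangent[OF Yt]
    by (simp add: numeral_2_eq_2 lessThan_Suc add.commute)
  moreover have "conj_vec Z = Z" unfolding Y(2) by (simp add: conj_vec_def fun_eq_iff)
  moreover have "contact u q Z = contact u q Y + contact u q (conj_vec Y)"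
    unfolding Y(2) contact_def by (simp add: distrib_left sum.distrib)
  ultimately show "Z \<in> {Z \<in> rtangent X A q. contact u q Z = 0}"
    using contact_V[OF Y(1) q] contact_conj[OF Yt q] Y(2) by (simp add: rtangent_def)
qed

lemma contact_nonzero:
  assumes q: "q \<in> D"
  shows "\<exists>Z\<in>rtangent X A q. contact u q Z \<noteq> 0"
proof -
  \<comment> \<open>The complex normal direction rotated by \<open>\<i>\<close>. The form
    \<open>rho\<close> is purely imaginary on it, so it is a real tangent direction of the graph,
    but nonzero, so it lies outside the complex tangent space.\<close>
  define z where "z = (\<lambda>j. \<i> * cnj (rho u j q))"
  define Z where "Z = cvec q (\<lambda>i. complex_of_real (Re (\<Sum>l\<le>n. a i l * z l)))"
  have Zt: "Z \<in> ctangent X A q" and Zx: "Z (xc i) = complex_of_real (Re (\<Sum>l\<le>n. a i l * z l))" for i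
    using cvec_ctangent[OF q] cvec_xc[OF q] by (auto simp: Z_def)
  have "conj_vec Z = Z"
    by (rule ctangent_eqI[OF conj_vec_ctangent[OF Zt] Zt q]) (simp add: conj_vec_def xc_cnj Zx)
  then have Zr: "Z \<in> rtangent X A q" using Zt by (simp add: rtangent_def)
  have rz: "(\<Sum>j\<le>n. rho u j q * z j) = \<i> * complex_of_real (\<Sum>j\<le>n. (cmod (rho u j q))\<^sup>2)"
    by (simp add: z_def sum_distrib_left complex_norm_square mult.left_commute del: of_real_power)
  have "Re ((\<Sum>i\<in>UNIV. grad u i q * (\<Sum>l\<le>n. a i l * z l)) - (\<Sum>l\<le>n. b l * z l)) = 0"
    using rz unfolding rho_sum by simp
  then have g: "Z (gf u) = complex_of_real (Re (\<Sum>l\<le>n. b l * z l))"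
    unfolding tangent_gf[OF Zt q] Zx by (simp add: grad_def mult.commute flip: of_real_mult of_real_sum)
  have "Z (H u j) = z j" if "j \<le> n" for j
    unfolding tangent_H(1)[OF Zt q] Zx g by (rule real_right_inverse[OF that])
  then have "contact u q Z = complex_of_real (\<Sum>j\<le>n. (cmod (rho u j q))\<^sup>2)"
    using rz by (simp add: contact_def)
  moreover have "(\<Sum>j\<le>n. (cmod (rho u j q))\<^sup>2) \<noteq> 0"
  proof
    assume "(\<Sum>j\<le>n. (cmod (rho u j q))\<^sup>2) = 0"
    then have "\<forall>j\<le>n. rho u j q = 0" by (subst (asm) sum_nonneg_eq_0_iff) auto
    then have "(\<Sum>j\<le>n. rho u j q * nu j) = 0" by (intro sum.neutral) auto
    then show False using Re_rho_nu[of q] by simp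
  qed
  ultimately show ?thesis using Zr by (intro bexI[of _ Z]) (auto simp del: of_real_sum)
qed

lemma tangent_grad:
  assumes Z: "Z \<in> ctangent X A q" and q: "q \<in> D"
  shows "Z (grad u i) = (\<Sum>l\<in>UNIV. Z (xc l) * complex_of_real (ddir (axis l 1) (ddir (axis i 1) u) (\<phi> q)))"
proof -
  have s: "smooth_on (\<phi> ` D) (\<lambda>x. complex_of_real (ddir (axis i 1) u x))"
    by (rule smooth_on_linear_compose[OF D_image_open bounded_linear_of_real smooth_on_ddir[OF u]])
  have "Z (grad u i) = (\<Sum>l\<in>UNIV. Z (xc l) * ddir (axis l 1) (\<lambda>x. complex_of_real (ddir (axis i 1) u x)) (\<phi> q))"
    unfolding grad_def[abs_def] by (rule ctangent_chain(1)[OF Z D_image_open q _ s]) (use q in simp)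
  also have "\<dots> = (\<Sum>l\<in>UNIV. Z (xc l) * complex_of_real (ddir (axis l 1) (ddir (axis i 1) u) (\<phi> q)))"
    by (intro sum.cong refl arg_cong2[of _ _ _ _ "(*)"] bounded_linear_ddir bounded_linear_of_real
        smooth_on_differentiable[OF smooth_on_ddir[OF u]]) (use q in simp)
  finally show ?thesis .
qed


text \<open>Differentiate the equation that \<open>rho\<close> annihilates the components of
  \<open>Z\<close> in the direction of the conjugate field. The derivative of the components is, up
  to sign, the bracket, and the derivative of \<open>rho\<close> involves only the Hessian of
  \<open>u\<close>. Thus the Levi form of a graph is the Hessian of \<open>u\<close> on complexified
  coordinate vectors.\<close>

lemma contact_bracket:
  assumes Z: "smooth_field X A W Z" "\<And>y. y \<in> W \<Longrightarrow> Z y \<in> V u y" and W: "openin X W" "W \<subseteq> D" and q: "q \<in> W"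
  shows "contact u q (lie_bracket X A Z (\<lambda>y. conj_vec (Z y)) q) =
    - 2 * \<i> * (\<Sum>i\<in>UNIV. \<Sum>l\<in>UNIV. complex_of_real (ddir (axis l 1) (ddir (axis i 1) u) (\<phi> q)) * (cnj (Z q (xc l)) * Z q (xc i)))"
proof -
  let ?C = "\<lambda>y. conj_vec (Z y)"
  have qD: "q \<in> D" and qX: "q \<in> topspace X" using q W D_topspace by auto
  have C: "smooth_field X A W ?C" by (rule smooth_field_conj[OF Z(1)])
  note Cq = smooth_field_ctangent[OF C q]
  have zn: "smooth_near X A q (\<lambda>y. Z y (H u j))" for j by (rule smooth_field_near[OF Z(1) W(1) q near(2)[OF qD]])
  have N: "lie_bracket X A Z ?C q (H u j) = - ?C q (\<lambda>y. Z y (H u j))" if "j \<le> n" for j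
  proof -
    have "Z q (\<lambda>y. ?C y (H u j)) = 0"
      by (rule field_zero[OF Z(1) W(1) q]) (use Z(2) that in \<open>auto simp: V_def conj_vec_def\<close>)
    then show ?thesis using near(2)[OF qD] by (simp add: lie_bracket_def)
  qed
  have "0 = ?C q (\<lambda>y. \<Sum>j\<le>n. rho u j y * Z y (H u j))"
    by (rule field_zero[OF C W(1) q, symmetric]) (use Z(2) V_D(3) W in blast)
  also have "\<dots> = (\<Sum>j\<le>n. ?C q (\<lambda>y. rho u j y * Z y (H u j)))"
    by (rule ctangent_sum[OF Cq qX]) (intro smooth_near_mult zn near qD)
  also have "\<dots> = (\<Sum>j\<le>n. ?C q (rho u j) * Z q (H u j) + rho u j q * ?C q (\<lambda>y. Z y (H u j)))"
    by (intro sum.cong refl ctangent_mult[OF Cq] zn near qD)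
  finally have "(\<Sum>j\<le>n. rho u j q * ?C q (\<lambda>y. Z y (H u j))) + (\<Sum>j\<le>n. ?C q (rho u j) * Z q (H u j)) = 0"
    by (simp only: sum.distrib add.commute)
  then have 1: "(\<Sum>j\<le>n. rho u j q * ?C q (\<lambda>y. Z y (H u j))) = - (\<Sum>j\<le>n. ?C q (rho u j) * Z q (H u j))"
    by (simp only: eq_neg_iff_add_eq_0)
  have Cr: "?C q (rho u j) = (\<Sum>i\<in>UNIV. a i j * ?C q (grad u i))" for j
  proof -
    have s: "smooth_near X A q (\<lambda>y. a i j * grad u i y)" for i by (intro smooth_near_cmult near qD)
    have "rho u j = (\<lambda>y. (\<Sum>i\<in>UNIV. a i j * grad u i y) + (- b j))" by (simp add: rho_def[abs_def] mult.commute)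
    then have "?C q (rho u j) = ?C q (\<lambda>y. (\<Sum>i\<in>UNIV. a i j * grad u i y) + (- b j))" by simp
    also have "\<dots> = ?C q (\<lambda>y. \<Sum>i\<in>UNIV. a i j * grad u i y) + ?C q (\<lambda>y. - b j)"
      by (intro ctangent_add[OF Cq] smooth_near_sum[OF qX] s smooth_near_const[OF qX])
    also have "?C q (\<lambda>y. - b j) = 0" by (rule ctangent_const[OF Cq qX])
    also have "?C q (\<lambda>y. \<Sum>i\<in>UNIV. a i j * grad u i y) = (\<Sum>i\<in>UNIV. ?C q (\<lambda>y. a i j * grad u i y))"
      by (rule ctangent_sum[OF Cq qX]) (rule s)
    also have "\<dots> = (\<Sum>i\<in>UNIV. a i j * ?C q (grad u i))"
      by (intro sum.cong refl ctangent_cmult[OF Cq] near qD)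
    finally show ?thesis by simp
  qed
  have "(\<Sum>j\<le>n. ?C q (rho u j) * Z q (H u j)) = (\<Sum>i\<in>UNIV. ?C q (grad u i) * (\<Sum>j\<le>n. a i j * Z q (H u j)))"
    unfolding Cr sum_distrib_right sum_distrib_left by (subst sum.swap) (simp add: mult_ac)
  also have "\<dots> = (\<Sum>i\<in>UNIV. ?C q (grad u i) * (2 * Z q (xc i)))"
    using V_D(2)[OF Z(2)[OF q] qD] by simp
  also have "\<dots> = 2 * (\<Sum>i\<in>UNIV. \<Sum>l\<in>UNIV. complex_of_real (ddir (axis l 1) (ddir (axis i 1) u) (\<phi> q)) * (cnj (Z q (xc l)) * Z q (xc i)))"
    unfolding tangent_grad[OF Cq qD] sum_distrib_left sum_distrib_right
    by (intro sum.cong refl) (simp add: conj_vec_def xc_cnj mult_ac)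
  finally have 2: "(\<Sum>j\<le>n. ?C q (rho u j) * Z q (H u j)) = 
    2 * (\<Sum>i\<in>UNIV. \<Sum>l\<in>UNIV. complex_of_real (ddir (axis l 1) (ddir (axis i 1) u) (\<phi> q)) * (cnj (Z q (xc l)) * Z q (xc i)))" .
  have "(\<Sum>j\<le>n. rho u j q * lie_bracket X A Z ?C q (H u j)) = - (\<Sum>j\<le>n. rho u j q * ?C q (\<lambda>y. Z y (H u j)))"
    unfolding sum_negf[symmetric] by (intro sum.cong refl) (use N in auto)
  then show ?thesis unfolding contact_def 1 2 by simp
qed

lemma V_strictly_pseudoconvex:
  assumes pos: "\<And>x v. x \<in> \<phi> ` D \<Longrightarrow> v \<noteq> 0 \<Longrightarrow>
     (\<Sum>i\<in>UNIV. \<Sum>l\<in>UNIV. ddir (axis l 1) (ddir (axis i 1) u) x * (v $ l * v $ i)) > 0"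
  shows "strictly_pseudoconvex X A D (V u)"
  unfolding strictly_pseudoconvex_def
proof (intro exI[of _ "contact u"] conjI contact_form ballI allI impI contact_nonzero contact_kernel)
  fix W Z q assume A: "openin X W \<and> W \<subseteq> D \<and> smooth_section X A W (V u) Z" and q: "q \<in> W" and nz: "Z q \<noteq> (\<lambda>f. 0)"
  then have W: "openin X W" "W \<subseteq> D" and Z: "smooth_field X A W Z" "\<And>y. y \<in> W \<Longrightarrow> Z y \<in> V u y"
    unfolding smooth_section_def by auto
  let ?C = "\<lambda>y. conj_vec (Z y)" and ?N = "lie_bracket X A Z (\<lambda>y. conj_vec (Z y)) q"
  have qD: "q \<in> D" using q W by auto
  have C: "smooth_field X A W ?C" by (rule smooth_field_conj[OF Z(1)])
  have Zt: "Z q \<in> ctangent X A q" by (rule smooth_field_ctangent[OF Z(1) q])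
  have 0: "contact u y (Z y) = 0" "contact u y (?C y) = 0" if "y \<in> W" for y
    using contact_V[OF Z(2)[OF that]] contact_conj[OF V_D(1)[OF Z(2)[OF that]]] that W by auto
  have "Z q (\<lambda>y. contact u y (?C y)) = 0" by (rule field_zero[OF Z(1) W(1) q 0(2)])
  moreover have "?C q (\<lambda>y. contact u y (Z y)) = 0" by (rule field_zero[OF C W(1) q 0(1)])
  ultimately have ed: "ext_deriv X A (contact u) Z ?C q = - contact u q ?N" by (simp add: ext_deriv_def)
  have Nt: "?N \<in> ctangent X A q" by (rule lie_bracket_ctangent[OF Z(1) C W(1) q])
  define S where "S = (\<Sum>i\<in>UNIV. \<Sum>l\<in>UNIV. complex_of_real (ddir (axis l 1) (ddir (axis i 1) u) (\<phi> q)) * (cnj (Z q (xc l)) * Z q (xc i)))"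
  have cN: "contact u q ?N = - 2 * \<i> * S" unfolding S_def by (rule contact_bracket[OF Z W q])
  then have eS: "ext_deriv X A (contact u) Z ?C q / (2 * \<i>) = S" unfolding ed by simp
  \<comment> \<open>The bracket is imaginary and the contact form is real, which makes the Hermitian
    expression \<open>S\<close> real.\<close>
  have "contact u q (conj_vec ?N) = - contact u q ?N"
    unfolding bracket_conj_imaginary contact_def by (simp add: sum_negf)
  then have "cnj (contact u q ?N) = - contact u q ?N" using contact_conj[OF Nt qD] by simp
  then have "cnj S = S" unfolding cN by simp
  then have "Im S = 0" by (metis Reals_cnj_iff complex_is_Real_iff)
  then have SR: "S = complex_of_real (Re S)" by (simp add: complex_eq_iff)
  \<comment> \<open>Real and imaginary parts of the coordinate vector: the real part of
    \<open>S\<close> splits into the values of the Hessian on \<open>v\<close> and on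
    \<open>w\<close>.\<close>
  define v w :: "real^'m" where "v = (\<chi> i. Re (Z q (xc i)))" and "w = (\<chi> i. Im (Z q (xc i)))"
  let ?Q = "\<lambda>v :: real^'m. \<Sum>i\<in>UNIV. \<Sum>l\<in>UNIV. ddir (axis l 1) (ddir (axis i 1) u) (\<phi> q) * (v $ l * v $ i)"
  have "Re S = ?Q v + ?Q w"
    unfolding S_def v_def w_def sum.distrib[symmetric] Re_sum
    by (intro sum.cong refl) (simp add: distrib_left)
  moreover have "v \<noteq> 0 \<or> w \<noteq> 0"
  proof (rule ccontr)
    assume "\<not> (v \<noteq> 0 \<or> w \<noteq> 0)"
    then have "Z q (xc i) = 0" for i by (auto simp: v_def w_def vec_eq_iff complex_eq_iff)
    then have "Z q = (\<lambda>f. 0)" by (intro ctangent_eqI[OF Zt zero_ctangent qD])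
    then show False using nz by simp
  qed
  moreover have "?Q v \<ge> 0" "?Q w \<ge> 0" "v \<noteq> 0 \<Longrightarrow> ?Q v > 0" "w \<noteq> 0 \<Longrightarrow> ?Q w > 0"
    using pos[of "\<phi> q"] qD by (cases "v = 0"; cases "w = 0"; force simp: less_imp_le)+
  ultimately have "Re S > 0" by linarith
  then show "\<exists>t>0. ext_deriv X A (contact u) Z ?C q / (2 * \<i>) = complex_of_real t"
    unfolding eS using SR by blast
qed

end

end

section \<open>Sphere-valued CR embeddings and convergence\<close>

context graph_chart
begin

lemma tangent_exp:
  assumes Z: "Z \<in> ctangent X A q" and q: "q \<in> D" and f: "smooth_near X A q f"
  shows "Z (\<lambda>y. exp (f y)) = exp (f q) * Z f"
proof -
  have n: "smooth_near X A q (\<lambda>y. exp (f y))"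
    using f smooth_fun_compose[OF _ _ smooth_on_exp[OF open_UNIV]] unfolding smooth_near_def by blast
  have d: "ddir v ((\<lambda>y. exp (f y)) \<circ> inv_into D \<phi>) (\<phi> q) = exp (f q) * ddir v (f \<circ> inv_into D \<phi>) (\<phi> q)" for v
  proof -
    have "((\<lambda>x. exp ((f \<circ> inv_into D \<phi>) x)) has_derivative
       (\<lambda>v. exp ((f \<circ> inv_into D \<phi>) (\<phi> q)) * ddir v (f \<circ> inv_into D \<phi>) (\<phi> q))) (at (\<phi> q))"
      by (rule has_derivative_compose[OF has_derivative_ddir[OF smooth_near_differentiable[OF f q]]
          DERIV_exp[unfolded has_field_derivative_def]])
    from ddir_eqI[OF this] show ?thesis using q by (simp add: o_def)
  qed
  show ?thesis
    unfolding ctangent_expansion[OF Z q n] ctangent_expansion[OF Z q f] d by (simp add: sum_distrib_left mult_ac)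
qed

context
  fixes u :: "real^'m \<Rightarrow> real" assumes u: "smooth_on (\<phi> ` D) u"
begin

lemma tangent_affine:
  assumes Z: "Z \<in> ctangent X A q" and q: "q \<in> D"
  shows "Z (\<lambda>y. (\<Sum>j\<le>n. d j * H u j y) + c) = (\<Sum>j\<le>n. d j * Z (H u j))"
    and "Z (\<lambda>y. cnj ((\<Sum>j\<le>n. d j * H u j y) + c)) = (\<Sum>j\<le>n. cnj (d j) * Z (\<lambda>y. cnj (H u j y)))"
    and "smooth_near X A q (\<lambda>y. (\<Sum>j\<le>n. d j * H u j y) + c)"
proof -
  have qX: "q \<in> topspace X" by (rule D_topspace[OF q])
  have *: "Z (\<lambda>y. (\<Sum>j\<le>n. d j * f j y) + c) = (\<Sum>j\<le>n. d j * Z (f j)) \<and> smooth_near X A q (\<lambda>y. (\<Sum>j\<le>n. d j * f j y) + c)"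
    if f: "\<And>j. smooth_near X A q (f j)" for f c d
  proof
    have s: "smooth_near X A q (\<lambda>y. d j * f j y)" for j by (rule smooth_near_cmult[OF f])
    have ss: "smooth_near X A q (\<lambda>y. \<Sum>j\<le>n. d j * f j y)" by (rule smooth_near_sum[OF qX]) (rule s)
    have "Z (\<lambda>y. (\<Sum>j\<le>n. d j * f j y) + c) = Z (\<lambda>y. \<Sum>j\<le>n. d j * f j y) + Z (\<lambda>y. c)"
      by (rule ctangent_add[OF Z ss smooth_near_const[OF qX]])
    also have "Z (\<lambda>y. c) = 0" by (rule ctangent_const[OF Z qX])
    also have "Z (\<lambda>y. \<Sum>j\<le>n. d j * f j y) = (\<Sum>j\<le>n. Z (\<lambda>y. d j * f j y))"
      by (rule ctangent_sum[OF Z qX]) (rule s)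
    also have "\<dots> = (\<Sum>j\<le>n. d j * Z (f j))"
      by (intro sum.cong refl ctangent_cmult[OF Z f])
    finally show "Z (\<lambda>y. (\<Sum>j\<le>n. d j * f j y) + c) = (\<Sum>j\<le>n. d j * Z (f j))" by simp
    show "smooth_near X A q (\<lambda>y. (\<Sum>j\<le>n. d j * f j y) + c)"
      by (rule smooth_near_add[OF ss smooth_near_const[OF qX]])
  qed
  show "Z (\<lambda>y. (\<Sum>j\<le>n. d j * H u j y) + c) = (\<Sum>j\<le>n. d j * Z (H u j))"
    "smooth_near X A q (\<lambda>y. (\<Sum>j\<le>n. d j * H u j y) + c)"
    using *[of "H u" d c, OF near(2)[OF u q]] by blast+
  have "(\<lambda>y. cnj ((\<Sum>j\<le>n. d j * H u j y) + c)) = (\<lambda>y. (\<Sum>j\<le>n. cnj (d j) * cnj (H u j y)) + cnj c)"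
    by (simp add: fun_eq_iff)
  then show "Z (\<lambda>y. cnj ((\<Sum>j\<le>n. d j * H u j y) + c)) = (\<Sum>j\<le>n. cnj (d j) * Z (\<lambda>y. cnj (H u j y)))"
    using *[of "\<lambda>j y. cnj (H u j y)" "\<lambda>j. cnj (d j)" "cnj c", OF near(3)[OF u q]] by simp
qed

text \<open>Each exponent is an affine holomorphic function of the graph coordinates with doubled
  real part \<open>G k \<bullet> x + c k - lam * u x\<close>, so the squared moduli sum to one by
  the equation in \<open>exp_sum\<close>. Because the linear parts of the exponents span all linear
  forms, \<open>F\<close> induces the same structure as \<open>H\<close> and has injective
  differential.\<close>

theorem sphere_embedding:
  assumes es: "exp_sum lam u"
  shows "\<exists>N F. cr_embedding X A D (V u) N F \<and> F ` D \<subseteq> unit_csphere N"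
proof -
  obtain xs where l: "lam > 0" and xs: "\<And>x. exp (lam * u x) = (\<Sum>(g, c)\<leftarrow>xs. exp (g \<bullet> x + c))"
     "\<exists>c. (0, c) \<in> set xs" "\<And>i. i \<in> Basis \<Longrightarrow> \<exists>c. (lam *\<^sub>R i, c) \<in> set xs"
    using es unfolding exp_sum_def by blast
  define N where "N = length xs"
  define G where "G = (\<lambda>k. fst (xs ! k))"
  define c where "c = (\<lambda>k. snd (xs ! k))"
  \<comment> \<open>Half of the linear exponent, because squared moduli double the real
    part.\<close>
  define d where "d = (\<lambda>k j. ((\<Sum>i\<in>UNIV. complex_of_real (G k $ i) * a i j) - complex_of_real lam * b j) / 2)"
  define h where "h = (\<lambda>k q. (\<Sum>j\<le>n. d k j * H u j q) + complex_of_real (c k / 2))"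
  define F where "F = (\<lambda>q. \<lambda>k\<in>{..<N}. exp (h k q))"
  have esum: "exp (lam * u x) = (\<Sum>k<N. exp (G k \<bullet> x + c k))" for x
    unfolding xs(1) by (simp add: sum_list_sum_nth N_def G_def c_def case_prod_unfold atLeast0LessThan)
  obtain k0 where k0: "k0 < N" "G k0 = 0" using xs(2) by (auto simp: in_set_conv_nth N_def G_def)
  have "\<exists>k<N. G k = lam *\<^sub>R axis i 1" for i :: 'm
  proof -
    obtain c' where "(lam *\<^sub>R axis i 1, c') \<in> set xs" using xs(3)[of "axis i 1"] by auto
    then obtain k where "k < length xs" "xs ! k = (lam *\<^sub>R axis i 1, c')" by (auto simp: in_set_conv_nth)
    then show ?thesis by (intro exI[of _ k]) (simp add: N_def G_def)
  qed
  then obtain ki where ki: "\<And>i. ki i < N" "\<And>i :: 'm. G (ki i) = lam *\<^sub>R axis i 1" by metis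
  have d0: "d k0 j = - (complex_of_real lam * b j) / 2" for j by (simp add: d_def k0)
  have di: "d (ki i) j = (complex_of_real lam * a i j - complex_of_real lam * b j) / 2" for i j
  proof -
    have "(\<Sum>l\<in>UNIV. complex_of_real ((lam *\<^sub>R axis i 1) $ l) * a l j) = (\<Sum>l\<in>UNIV. if l = i then complex_of_real lam * a i j else 0)"
      by (intro sum.cong refl) (auto simp: axis_def)
    then show ?thesis by (simp add: d_def ki)
  qed
  have lc: "complex_of_real lam \<noteq> 0" using l by simp
  \<comment> \<open>The components with exponents \<open>0\<close> and
    \<open>lam *\<^sub>R axis i 1\<close> already determine the forms \<open>b\<close> and
    \<open>a i\<close>; the identities are reused below for tangent vectors and their conjugate
    components.\<close>
  have ba: "b j = - 2 / complex_of_real lam * d k0 j" "a i j = 2 / complex_of_real lam * (d (ki i) j - d k0 j)" for i j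
    unfolding d0 di using lc by (simp_all add: field_simps)
  have dH: "(\<Sum>j\<le>n. d k j * z j) = ((\<Sum>i\<in>UNIV. complex_of_real (G k $ i) * (\<Sum>j\<le>n. a i j * z j)) - complex_of_real lam * (\<Sum>j\<le>n. b j * z j)) / 2" for k z
  proof -
    have "(\<Sum>j\<le>n. d k j * z j) = (\<Sum>j\<le>n. ((\<Sum>i\<in>UNIV. complex_of_real (G k $ i) * a i j * z j) - complex_of_real lam * b j * z j)) / 2"
      by (simp add: d_def sum_divide_distrib left_diff_distrib sum_distrib_right)
    also have "(\<Sum>j\<le>n. ((\<Sum>i\<in>UNIV. complex_of_real (G k $ i) * a i j * z j) - complex_of_real lam * b j * z j)) =
      (\<Sum>i\<in>UNIV. \<Sum>j\<le>n. complex_of_real (G k $ i) * a i j * z j) - (\<Sum>j\<le>n. complex_of_real lam * b j * z j)"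
      unfolding sum_subtractf by (subst sum.swap) simp
    finally show ?thesis by (simp add: sum_distrib_left mult.assoc)
  qed
  have Reh: "Re (h k q) = (G k \<bullet> \<phi> q + c k - lam * u (\<phi> q)) / 2" for k q
  proof -
    have "Re (\<Sum>j\<le>n. d k j * H u j q) = ((\<Sum>i\<in>UNIV. G k $ i * Re (\<Sum>j\<le>n. a i j * H u j q)) - lam * Re (\<Sum>j\<le>n. b j * H u j q)) / 2"
      unfolding dH by (simp only: Re_divide_numeral minus_complex.sel Re_sum Re_complex_of_real times_complex.sel Im_complex_of_real mult_zero_left diff_zero)
    also have "\<dots> = (G k \<bullet> \<phi> q - lam * u (\<phi> q)) / 2"
      unfolding H_components[OF u] by (simp add: inner_vec_def)
    finally show ?thesis by (simp add: h_def add_divide_distrib diff_divide_distrib)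
  qed
  have Fk: "(\<lambda>q. F q k) = (\<lambda>q. exp (h k q))" if "k < N" for k using that by (simp add: F_def fun_eq_iff)
  have Th: "Z (h k) = (\<Sum>j\<le>n. d k j * Z (H u j))" "Z (\<lambda>y. cnj (h k y)) = (\<Sum>j\<le>n. cnj (d k j) * Z (\<lambda>y. cnj (H u j y)))"
    "smooth_near X A q (h k)" if "Z \<in> ctangent X A q" "q \<in> D" for Z q k
    using tangent_affine[OF that, of "d k" "complex_of_real (c k / 2)"] unfolding h_def by blast+
  have ZF: "Z (\<lambda>q. F q k) = exp (h k q) * (\<Sum>j\<le>n. d k j * Z (H u j))"
    "Z (\<lambda>q. cnj (F q k)) = exp (cnj (h k q)) * (\<Sum>j\<le>n. cnj (d k j) * Z (\<lambda>y. cnj (H u j y)))"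
    if Z: "Z \<in> ctangent X A q" and q: "q \<in> D" and k: "k < N" for Z q k
  proof -
    show "Z (\<lambda>q. F q k) = exp (h k q) * (\<Sum>j\<le>n. d k j * Z (H u j))"
      unfolding Fk[OF k] tangent_exp[OF Z q Th(3)[OF Z q]] Th(1)[OF Z q] ..
    have "(\<lambda>q. cnj (F q k)) = (\<lambda>q. exp (cnj (h k q)))" using Fk[OF k] by (simp add: fun_eq_iff exp_cnj)
    then have "Z (\<lambda>q. cnj (F q k)) = Z (\<lambda>q. exp (cnj (h k q)))" by simp
    also have "\<dots> = exp (cnj (h k q)) * Z (\<lambda>q. cnj (h k q))"
      by (rule tangent_exp[OF Z q smooth_near_cnj[OF Th(3)[OF Z q]]])
    finally show "Z (\<lambda>q. cnj (F q k)) = exp (cnj (h k q)) * (\<Sum>j\<le>n. cnj (d k j) * Z (\<lambda>y. cnj (H u j y)))"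
      unfolding Th(2)[OF Z q] .
  qed
  have span: "(\<Sum>j\<le>n. a i j * w j) = 2 / complex_of_real lam * ((\<Sum>j\<le>n. d (ki i) j * w j) - (\<Sum>j\<le>n. d k0 j * w j))"
    "(\<Sum>j\<le>n. b j * w j) = - 2 / complex_of_real lam * (\<Sum>j\<le>n. d k0 j * w j)" for w i
    unfolding ba sum_subtractf[symmetric] sum_distrib_left
    by (intro sum.cong refl, simp only: left_diff_distrib mult.assoc)+
  have span_cnj: "(\<Sum>j\<le>n. cnj (a i j) * w j) = 2 / complex_of_real lam * ((\<Sum>j\<le>n. cnj (d (ki i) j) * w j) - (\<Sum>j\<le>n. cnj (d k0 j) * w j))"
    "(\<Sum>j\<le>n. cnj (b j) * w j) = - 2 / complex_of_real lam * (\<Sum>j\<le>n. cnj (d k0 j) * w j)" for w i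
    using arg_cong[OF span(1)[of i "\<lambda>j. cnj (w j)"], of cnj] arg_cong[OF span(2)[of "\<lambda>j. cnj (w j)"], of cnj]
    by simp_all
  have sphere: "F ` D \<subseteq> unit_csphere N"
  proof
    fix z assume "z \<in> F ` D"
    then obtain q where q: "q \<in> D" "z = F q" by blast
    have "(\<Sum>k<N. (cmod (F q k))\<^sup>2) = (\<Sum>k<N. exp (- (lam * u (\<phi> q))) * exp (G k \<bullet> \<phi> q + c k))"
    proof (intro sum.cong refl)
      fix k assume k: "k \<in> {..<N}"
      have "(cmod (F q k))\<^sup>2 = exp (2 * Re (h k q))" using k by (simp add: F_def norm_exp_eq_Re exp_double)
      also have "2 * Re (h k q) = - (lam * u (\<phi> q)) + (G k \<bullet> \<phi> q + c k)" unfolding Reh by simp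
      finally show "(cmod (F q k))\<^sup>2 = exp (- (lam * u (\<phi> q))) * exp (G k \<bullet> \<phi> q + c k)" by (simp only: exp_add)
    qed
    also have "\<dots> = exp (- (lam * u (\<phi> q))) * exp (lam * u (\<phi> q))" unfolding esum by (simp add: sum_distrib_left)
    also have "\<dots> = 1" by (simp add: exp_minus)
    finally have "L2_set (\<lambda>j. cmod (z j)) {..<N} = 1" using q by (simp add: L2_set_def)
    then show "z \<in> unit_csphere N" using q by (auto simp: unit_csphere_def F_def)
  qed
  have smF: "smooth_fun A D (\<lambda>q. F q k)" if "k < N" for k
  proof -
    have "smooth_fun A D (h k)"
      unfolding h_def by (intro smooth_fun_add smooth_fun_sum smooth_fun_cmult smooth_fun_H[OF u] smooth_fun_const D_open)
    then show ?thesis unfolding Fk[OF that] by (intro smooth_fun_compose[OF D_open _ smooth_on_exp[OF open_UNIV]]) auto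
  qed
  have inj: "inj_on (pushforward N F) (ctangent X A q)" if q: "q \<in> D" for q
  proof (rule inj_onI)
    fix Z Y assume Z: "Z \<in> ctangent X A q" and Y: "Y \<in> ctangent X A q" and eq: "pushforward N F Z = pushforward N F Y"
    have r: "(\<lambda>j\<in>{..<N}. Z (\<lambda>q. F q j)) = (\<lambda>j\<in>{..<N}. Y (\<lambda>q. F q j))"
      "(\<lambda>j\<in>{..<N}. Z (\<lambda>q. cnj (F q j))) = (\<lambda>j\<in>{..<N}. Y (\<lambda>q. cnj (F q j)))"
      using eq by (auto simp: pushforward_def)
    have "Z (\<lambda>q. F q k) = Y (\<lambda>q. F q k)" "Z (\<lambda>q. cnj (F q k)) = Y (\<lambda>q. cnj (F q k))" if "k < N" for k
      using fun_cong[OF r(1), of k] fun_cong[OF r(2), of k] that by simp_all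
    then have e: "(\<Sum>j\<le>n. d k j * Z (H u j)) = (\<Sum>j\<le>n. d k j * Y (H u j))"
      "(\<Sum>j\<le>n. cnj (d k j) * Z (\<lambda>y. cnj (H u j y))) = (\<Sum>j\<le>n. cnj (d k j) * Y (\<lambda>y. cnj (H u j y)))" if "k < N" for k
      using ZF[OF Z q that] ZF[OF Y q that] that by simp_all
    show "Z = Y"
    proof (rule ctangent_eqI[OF Z Y q])
      fix i
      have "2 * Z (xc i) = 2 * Y (xc i)"
        unfolding tangent_components(1)[OF u Z q] tangent_components(1)[OF u Y q] span span_cnj
          e[OF ki(1)] e[OF k0(1)] ..
      then show "Z (xc i) = Y (xc i)" by simp
    qed
  qed
  have cr: "pushforward N F ` V u q = pushforward N F ` ctangent X A q \<inter> T10_cspace N" if q: "q \<in> D" for q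
  proof (intro equalityI subsetI)
    fix p assume "p \<in> pushforward N F ` V u q"
    then obtain Z where Z: "Z \<in> V u q" "p = pushforward N F Z" by blast
    have Zt: "Z \<in> ctangent X A q" by (rule V_D(1)[OF u Z(1) q])
    have "Z (\<lambda>q. cnj (F q k)) = 0" if "k < N" for k
      using ZF(2)[OF Zt q that] Z(1) by (simp add: V_def)
    then have "(\<lambda>j\<in>{..<N}. Z (\<lambda>q. cnj (F q j))) = (\<lambda>j\<in>{..<N}. 0)" by (intro restrict_ext) auto
    then show "p \<in> pushforward N F ` ctangent X A q \<inter> T10_cspace N"
      using Zt Z(2) by (auto simp: T10_cspace_def pushforward_def)
  next
    fix p assume "p \<in> pushforward N F ` ctangent X A q \<inter> T10_cspace N"
    then obtain Z where Z: "Z \<in> ctangent X A q" "p = pushforward N F Z" "p \<in> T10_cspace N" by blast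
    have r: "(\<lambda>j\<in>{..<N}. Z (\<lambda>q. cnj (F q j))) = (\<lambda>j\<in>{..<N}. 0)"
      using Z by (simp add: T10_cspace_def pushforward_def)
    have "Z (\<lambda>q. cnj (F q k)) = 0" if "k < N" for k using fun_cong[OF r, of k] that by simp
    then have z: "(\<Sum>j\<le>n. cnj (d k j) * Z (\<lambda>y. cnj (H u j y))) = 0" if "k < N" for k
      using ZF(2)[OF Z(1) q that] that by simp
    have s: "(\<Sum>j\<le>n. cnj (a i j) * Z (\<lambda>y. cnj (H u j y))) = 0" "(\<Sum>j\<le>n. cnj (b j) * Z (\<lambda>y. cnj (H u j y))) = 0" for i
      unfolding span_cnj z[OF ki(1)] z[OF k0(1)] by simp_all
    \<comment> \<open>By the inverse relations of the frame, the forms \<open>a i\<close> and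
      \<open>b\<close> have no common zero besides the origin; this is applied to the conjugated
      components.\<close>
    have "Z (\<lambda>y. cnj (H u l y)) = 0" if "l \<le> n" for l
    proof -
      have "2 * cnj (Z (\<lambda>y. cnj (H u l y))) =
        (\<Sum>i\<in>UNIV. P i l * (\<Sum>j\<le>n. a i j * cnj (Z (\<lambda>y. cnj (H u j y))))) + nu l * (\<Sum>j\<le>n. b j * cnj (Z (\<lambda>y. cnj (H u j y))))"
        by (rule apply_right_inverse[OF that, symmetric])
      also have "\<dots> = 0"
        using arg_cong[OF s(1), of cnj] arg_cong[OF s(2), of cnj] by simp
      finally show ?thesis by simp
    qed
    then have "Z \<in> V u q" using Z(1) by (simp add: V_def)
    then show "p \<in> pushforward N F ` V u q" using Z(2) by blast
  qed
  have emb: "embedding_map (subtopology X D) (cspace N) F"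
  proof -
    \<comment> \<open>Continuous recovery of the coordinates: \<open>2 * ln (cmod (F q k))\<close>
      is affine in them up to the common term \<open>lam * u (\<phi> q)\<close>, which cancels in
      the difference with component \<open>k0\<close>.\<close>
    define R where "R = (\<lambda>w :: nat \<Rightarrow> complex. \<Sum>i\<in>UNIV. ((2 * ln (cmod (w (ki i))) - 2 * ln (cmod (w k0)) - (c (ki i) - c k0)) / lam) *\<^sub>R axis i (1::real))"
    have RF: "R (F q) = \<phi> q" if "q \<in> D" for q
    proof -
      have "2 * ln (cmod (F q k)) = G k \<bullet> \<phi> q + c k - lam * u (\<phi> q)" if "k < N" for k
        using that by (simp add: F_def norm_exp_eq_Re Reh)
      then have "(2 * ln (cmod (F q (ki i))) - 2 * ln (cmod (F q k0)) - (c (ki i) - c k0)) / lam = \<phi> q $ i" for i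
        using ki k0 l by (simp add: inner_axis')
      then have "R (F q) = (\<Sum>i\<in>UNIV. (\<phi> q $ i) *\<^sub>R axis i 1)" by (simp add: R_def)
      also have "\<dots> = \<phi> q" using basis_expansion[of "\<phi> q"] by (simp add: scalar_mult_eq_scaleR)
      finally show ?thesis .
    qed
    let ?T = "subtopology (cspace N) (F ` D)"
    have topF: "F ` D \<subseteq> topspace (cspace N)"
      unfolding F_def image_subset_iff topspace_product_topology by (intro ballI restrict_PiE_iff[THEN iffD2]) auto
    have topT: "topspace ?T = F ` D" using topF by auto
    have homeo: "homeomorphic_map (subtopology X D) (top_of_set (\<phi> ` D)) \<phi>" using compat unfolding compatible_chart_def by blast
    have topD: "topspace (subtopology X D) = D" using D_open openin_subset by auto
    obtain g where g: "homeomorphic_maps (subtopology X D) (top_of_set (\<phi> ` D)) \<phi> g"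
      using homeo homeomorphic_map_maps by blast
    have contln: "continuous_map ?T euclideanreal (\<lambda>w. ln (cmod (w k)))" if k: "k < N" for k
    proof -
      have p: "continuous_map ?T (top_of_set (- {0})) (\<lambda>w. w k)"
        unfolding continuous_map_in_subtopology
      proof
        show "continuous_map ?T euclidean (\<lambda>w. w k)"
          by (rule continuous_map_from_subtopology) (use k in \<open>auto intro: continuous_map_product_projection\<close>)
        show "(\<lambda>w. w k) \<in> topspace ?T \<rightarrow> - {0}" unfolding topT using k by (auto simp: F_def)
      qed
      have "continuous_map (top_of_set (- {0})) euclideanreal (\<lambda>z :: complex. ln (cmod z))"
        by (auto intro!: continuous_intros)
      from continuous_map_compose[OF p this] show ?thesis by (simp add: o_def)
    qed
    have contsc: "continuous_map ?T euclidean (\<lambda>w. f w *\<^sub>R v)" if f: "continuous_map ?T euclideanreal f" for f and v :: "real^'m"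
    proof -
      have "continuous_map euclideanreal euclidean (\<lambda>t. t *\<^sub>R v)" by (auto intro!: continuous_intros)
      from continuous_map_compose[OF f this] show ?thesis by (simp add: o_def)
    qed
    have "continuous_map ?T euclidean R"
      unfolding R_def
      by (intro continuous_map_sum finite contsc continuous_map_real_divide continuous_map_diff continuous_map_real_mult
        contln ki(1) k0(1) continuous_map_const[THEN iffD2]) (use l in auto)
    then have "continuous_map ?T (top_of_set (\<phi> ` D)) R"
      unfolding continuous_map_in_subtopology topT using RF by auto
    moreover have "continuous_map (top_of_set (\<phi> ` D)) (subtopology X D) g" using g unfolding homeomorphic_maps_def by blast
    ultimately have cg: "continuous_map ?T (subtopology X D) (g \<circ> R)" by (rule continuous_map_compose)
    have gR: "(g \<circ> R) (F q) = q" if "q \<in> D" for q using RF[OF that] g that topD unfolding homeomorphic_maps_def by auto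
    have cF: "continuous_map (subtopology X D) ?T F"
      unfolding continuous_map_in_subtopology continuous_map_componentwise
    proof (intro conjI ballI)
      show "F ` topspace (subtopology X D) \<subseteq> extensional {..<N}"
        unfolding F_def image_subset_iff by (intro ballI restrict_extensional)
      show "F \<in> topspace (subtopology X D) \<rightarrow> F ` D" unfolding topD by blast
      fix k assume k: "k \<in> {..<N}"
      have s: "smooth_on (\<phi> ` D) ((\<lambda>q. F q k) \<circ> inv_into D \<phi>)"
        using smF[of k] k smooth_fun_iff[OF D_open subset_refl] by blast
      have "continuous_map (subtopology X D) euclidean (((\<lambda>q. F q k) \<circ> inv_into D \<phi>) \<circ> \<phi>)"
        by (rule continuous_map_compose[OF homeomorphic_imp_continuous_map[OF homeo]])
          (use smooth_on_continuous[OF s] in simp)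
      then show "continuous_map (subtopology X D) euclidean (\<lambda>q. F q k)"
        by (rule continuous_map_eq) (use topD in auto)
    qed
    have "homeomorphic_maps (subtopology X D) ?T F (g \<circ> R)"
      unfolding homeomorphic_maps_def topT topD using cF cg gR by auto
    then show ?thesis
      unfolding embedding_map_def homeomorphic_map_maps topD by blast
  qed
  show ?thesis
    unfolding cr_embedding_def smooth_embedding_def using smF inj cr emb sphere by blast
qed

text \<open>The antiholomorphic differential of the graph embedding, as a section of homomorphisms
  into the trivial bundle of rank \<open>n + 1\<close>, the rank of the quotient by the CR
  structure. A single trivialization over \<open>D\<close> serves all graphs.\<close>

definition dbar_section :: "'a lin_section" where
  "dbar_section = (\<lambda>W q Z j. Z (\<lambda>y. cnj (H u j y)))"

lemma dbar_section_smooth: "smooth_lin_section X A (n + 1) {D} (\<lambda>W W' q i j. if i = j then 1 else 0) dbar_section"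
  unfolding smooth_lin_section_def
proof (intro conjI ballI allI impI)
  show "ctangent_linear X A q (\<lambda>Z. dbar_section W q Z j)" for W q j
    by (simp add: ctangent_linear_def dbar_section_def)
  show "dbar_section W q Z i = (\<Sum>j<n + 1. (if i = j then 1 else 0) * dbar_section W' q Z j)"
    if "i < n + 1" for W W' q Z i
    using that by (simp add: dbar_section_def if_distrib[of "\<lambda>x. x * _"] cong: if_cong)
  fix W W' Z j assume "W \<in> {D}" and W: "openin X W' \<and> W' \<subseteq> W \<and> smooth_field X A W' Z"
  then show "smooth_fun A W' (\<lambda>q. dbar_section W q (Z q) j)"
    unfolding dbar_section_def
    by (intro smooth_field_apply[of W' Z] smooth_fun_cnj) (auto intro: smooth_fun_subset[OF smooth_fun_H[OF u]])
qed

lemma dbar_section_surjective: "fibrewise_surjective X A (n + 1) {D} dbar_section"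
  unfolding fibrewise_surjective_def
proof (intro ballI allI)
  fix W q and w :: "nat \<Rightarrow> complex" assume "W \<in> {D}" "q \<in> W"
  then have q: "q \<in> D" by simp
  define z where "z = (\<lambda>j. cnj (w j))"
  define \<rho> where "\<rho> = (\<Sum>j\<le>n. rho u j q * nu j)"
  \<comment> \<open>\<open>lift q z'\<close> has components \<open>z' j + nu j * s / 2\<close> if
    \<open>s\<close> is the value of \<open>rho\<close> on \<open>z'\<close>. Solving for
    \<open>z'\<close> leaves a scalar equation for \<open>s\<close>, solvable because
    \<open>1 + \<rho> / 2\<close> has real part \<open>1 / 2\<close>. Conjugating the lift moves the
    components to the (0,1) side.\<close>
  define s where "s = (\<Sum>j\<le>n. rho u j q * z j) / (1 + \<rho> / 2)"
  define z' where "z' = (\<lambda>j. z j - nu j * s / 2)"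
  have "Re (1 + \<rho> / 2) = 1 / 2" using Re_rho_nu[OF u, of q] by (simp add: \<rho>_def)
  then have nz: "1 + \<rho> / 2 \<noteq> 0" by (metis zero_complex.simps(1) zero_neq_one divide_eq_0_iff zero_neq_numeral)
  have "(\<Sum>j\<le>n. rho u j q * z' j) = (\<Sum>j\<le>n. rho u j q * z j) - \<rho> * s / 2"
    by (simp add: z'_def right_diff_distrib sum_subtractf \<rho>_def sum_distrib_right sum_divide_distrib mult.assoc)
  also have "(\<Sum>j\<le>n. rho u j q * z j) = s * (1 + \<rho> / 2)" using nz by (simp add: s_def)
  also have "s * (1 + \<rho> / 2) - \<rho> * s / 2 = s" by (simp add: algebra_simps)
  finally have "lift q z' (H u j) = z j" if "j \<le> n" for j
    using lift_general(3)[OF u q that, of z'] by (simp add: z'_def)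
  then have "conj_vec (lift q z') (\<lambda>y. cnj (H u j y)) = w j" if "j \<le> n" for j
    using that by (simp add: conj_vec_def z_def)
  then show "\<exists>Z\<in>ctangent X A q. \<forall>j<n + 1. dbar_section W q Z j = w j"
    by (intro bexI[of _ "conj_vec (lift q z')"] conj_vec_ctangent lift_general(1)[OF u q])
      (auto simp: dbar_section_def)
qed

lemma dbar_section_kernel: "(\<And>q. q \<in> D \<Longrightarrow> T q = V u q) \<Longrightarrow> has_kernel X A (n + 1) {D} dbar_section T"
  by (auto simp: has_kernel_def V_def dbar_section_def less_Suc_eq_le)

text \<open>In an atlas chart the matrix entry is a first derivative of a function that depends
  affinely on \<open>u\<close>. This reduces convergence of the subbundles to convergence of the
  functions.\<close>

lemma dbar_section_entry:
  assumes E: "(E, \<psi>) \<in> A" and x: "x \<in> \<psi> ` (E \<inter> D)"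
  shows "dbar_section D (inv_into E \<psi> x) (coord_vec X A (E, \<psi>) i (inv_into E \<psi> x)) j =
    ddir (axis i 1) (\<lambda>x. (\<Sum>l\<in>UNIV. cnj (P l j) * complex_of_real ((\<phi> \<circ> inv_into E \<psi>) x $ l)) +
      cnj (nu j) * complex_of_real (u ((\<phi> \<circ> inv_into E \<psi>) x))) x"
proof -
  obtain q where q: "q \<in> E" "q \<in> D" "x = \<psi> q" using x by blast
  have inv: "inv_into E \<psi> x = q" using q chart_inj[OF E] by simp
  have "dbar_section D q (coord_vec X A (E, \<psi>) i q) j = ddir (axis i 1) ((\<lambda>y. cnj (H u j y)) \<circ> inv_into E \<psi>) x"
    using near(3)[OF u q(2)] q(3) by (simp add: dbar_section_def coord_vec_def ddir_def)
  also have "(\<lambda>y. cnj (H u j y)) \<circ> inv_into E \<psi> = (\<lambda>x. (\<Sum>l\<in>UNIV. cnj (P l j) * complex_of_real ((\<phi> \<circ> inv_into E \<psi>) x $ l)) +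
      cnj (nu j) * complex_of_real (u ((\<phi> \<circ> inv_into E \<psi>) x)))"
    by (simp add: H_def xc_def gf_def fun_eq_iff)
  finally show ?thesis unfolding inv .
qed

end

lemma trivial_hermitian_bundle:
  assumes "openin X D"
  shows "hermitian_bundle X A D r {D} (\<lambda>W W' q i j. if i = j then 1 else 0) (\<lambda>W q i j. if i = j then 1 else 0)"
  unfolding hermitian_bundle_def
proof (intro conjI ballI allI impI)
  show "smooth_fun A (W \<inter> W') (\<lambda>q. if i = j then 1 else 0)" for W W' and i j :: nat by (cases "i = j") auto
  show "smooth_fun A W (\<lambda>q. if i = j then 1 else 0)" for W and i j :: nat by (cases "i = j") auto
  show "(\<Sum>k<r. (if i = k then 1 else 0) * (if k = j then 1 else 0 :: complex)) = (if i = j then 1 else 0)"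
    if "i < r" for i j using that by (simp add: if_distrib[of "\<lambda>x. x * _"] cong: if_cong)
  show "(if i = j then 1 else 0) = (\<Sum>k<r. \<Sum>l<r. cnj (if k = i then 1 else 0) * (if k = l then 1 else 0) * (if l = j then 1 else 0 :: complex))"
    if ij: "i < r" "j < r" for i j
  proof -
    have "(\<Sum>l<r. cnj (if k = i then 1 else 0) * (if k = l then 1 else 0) * (if l = j then 1 else 0 :: complex)) = 
      (if k = i then if i = j then 1 else 0 else 0)" if "k < r" for k
    proof -
      have "(\<Sum>l<r. cnj (if k = i then 1 else 0) * (if k = l then 1 else 0) * (if l = j then 1 else 0 :: complex)) =
        (\<Sum>l<r. if l = k then (if k = i then if i = j then 1 else 0 else 0) else 0)"
        by (intro sum.cong refl) auto
      then show ?thesis using that by simp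
    qed
    then show ?thesis using ij by simp
  qed
  show "\<exists>t>0. (\<Sum>i<r. \<Sum>j<r. cnj (v i) * (if i = j then 1 else 0) * v j) = complex_of_real t"
    if v: "\<exists>i<r. v i \<noteq> 0" for v
  proof (intro exI conjI)
    have "(\<Sum>j<r. cnj (v i) * (if i = j then 1 else 0) * v j) = complex_of_real ((cmod (v i))\<^sup>2)" if "i < r" for i
    proof -
      have "(\<Sum>j<r. cnj (v i) * (if i = j then 1 else 0) * v j) = (\<Sum>j<r. if j = i then cnj (v i) * v i else 0)"
        by (intro sum.cong refl) auto
      then show ?thesis using that by (simp add: complex_norm_square mult.commute del: of_real_power)
    qed
    then show "(\<Sum>i<r. \<Sum>j<r. cnj (v i) * (if i = j then 1 else 0) * v j) = complex_of_real (\<Sum>i<r. (cmod (v i))\<^sup>2)"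
      by (simp del: of_real_power)
    obtain i where "i < r" "v i \<noteq> 0" using v by blast
    then show "(\<Sum>i<r. (cmod (v i))\<^sup>2) > 0" by (intro sum_pos2[of _ i]) auto
  qed
qed (use assms in auto)

text \<open>Bundle, trivialization and chart are common to all graphs and only the function varies.
  The limit \<open>T\<close> has to agree with \<open>V u\<close> on \<open>D\<close> only, since
  values of a subbundle elsewhere are irrelevant.\<close>

theorem V_tendsto:
  assumes u: "smooth_on (\<phi> ` D) u" and us: "\<And>k. smooth_on (\<phi> ` D) (us k)" and lim: "cinf_tendsto (\<phi> ` D) us u"
    and T: "\<And>q. q \<in> D \<Longrightarrow> T q = V u q"
  shows "subbundles_tendsto X A D (\<lambda>k. V (us k)) T"
proof -
  have "lin_section_tendsto X A (n + 1) {D} (\<lambda>k. dbar_section (us k)) (dbar_section u)"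
    unfolding lin_section_tendsto_def Let_def
  proof (clarify)
    fix E \<psi> i j assume E: "(E, \<psi>) \<in> A"
    let ?S = "\<psi> ` (E \<inter> D)" and ?\<tau> = "\<phi> \<circ> inv_into E \<psi>"
    let ?a = "\<lambda>x. \<Sum>l\<in>UNIV. cnj (P l j) * complex_of_real (?\<tau> x $ l)"
    let ?L = "\<lambda>t. cnj (nu j) * complex_of_real t"
    have S: "open ?S" by (rule chart_image_open[OF E D_open])
    have \<tau>: "smooth_on ?S ?\<tau>" using compat E unfolding compatible_chart_def by blast
    have im: "?\<tau> ` ?S \<subseteq> \<phi> ` D" using chart_inj[OF E] by auto
    have L: "bounded_linear ?L"
      by (rule bounded_linear_compose[OF bounded_linear_mult_right bounded_linear_of_real])
    have a: "smooth_on ?S ?a"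
    proof (rule smooth_on_sum[OF S])
      fix l :: 'm
      have "smooth_on ?S (\<lambda>x. ?\<tau> x $ l)" by (rule smooth_on_linear_compose[OF S bounded_linear_vec_nth \<tau>])
      then show "smooth_on ?S (\<lambda>x. cnj (P l j) * complex_of_real (?\<tau> x $ l))"
        by (rule smooth_on_linear_compose[OF S bounded_linear_compose[OF bounded_linear_mult_right bounded_linear_of_real]])
    qed
    have c: "smooth_on ?S (\<lambda>x. v (?\<tau> x))" if "smooth_on (\<phi> ` D) v" for v :: "real^'m \<Rightarrow> real"
      by (rule smooth_on_compose[OF S \<tau> im that])
    have "cinf_tendsto ?S (\<lambda>k x. us k (?\<tau> x)) (\<lambda>x. u (?\<tau> x))"
      by (rule cinf_tendsto_compose[OF S \<tau> im u us lim])
    then have "cinf_tendsto ?S (\<lambda>k x. ?L (us k (?\<tau> x))) (\<lambda>x. ?L (u (?\<tau> x)))"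
      by (rule cinf_tendsto_linear[OF S L c[OF u] c[OF us]])
    from cinf_tendsto_add[OF S a a cinf_tendsto_const smooth_on_linear_compose[OF S L c[OF u]] smooth_on_linear_compose[OF S L c[OF us]] this]
    have "cinf_tendsto ?S (\<lambda>k x. ?a x + ?L (us k (?\<tau> x))) (\<lambda>x. ?a x + ?L (u (?\<tau> x)))" .
    from cinf_tendsto_ddir[OF this, of "axis i 1"]
    have cd: "cinf_tendsto ?S (\<lambda>k x. ddir (axis i 1) (\<lambda>x. ?a x + ?L (us k (?\<tau> x))) x) (\<lambda>x. ddir (axis i 1) (\<lambda>x. ?a x + ?L (u (?\<tau> x))) x)" .
    show "cinf_tendsto ?S (\<lambda>k x. dbar_section (us k) D (inv_into E \<psi> x) (coord_vec X A (E, \<psi>) i (inv_into E \<psi> x)) j)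
       (\<lambda>x. dbar_section u D (inv_into E \<psi> x) (coord_vec X A (E, \<psi>) i (inv_into E \<psi> x)) j)"
      by (rule cinf_tendsto_cong[OF S _ _ cd]) (simp_all only: dbar_section_entry[OF u E] dbar_section_entry[OF us E])
  qed
  then show ?thesis
    unfolding subbundles_tendsto_def
    by (intro exI[of _ "n + 1"] exI[of _ "{D}"] exI[of _ "\<lambda>W W' q i j. if i = j then 1 else 0"]
        exI[of _ "\<lambda>W q i j. if i = j then 1 else 0"] exI[of _ "dbar_section u"] exI[of _ "\<lambda>k. dbar_section (us k)"]
        conjI allI trivial_hermitian_bundle D_open dbar_section_smooth dbar_section_surjective dbar_section_kernel u us T refl)
qed

end

section \<open>Local normal form\<close>

text \<open>New coordinates from a diffeomorphism \<open>\<tau>\<close> of a part of the coordinate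
  range: the transition maps in both directions are the old ones composed with \<open>\<tau>\<close>
  or with its inverse \<open>\<gamma>\<close>.\<close>

lemma compatible_chart_compose:
  fixes \<phi> :: "'a \<Rightarrow> real^'m::finite"
  assumes A: "smooth_atlas X A" and c: "compatible_chart X A D \<phi>"
    and B: "open B" "B \<subseteq> \<phi> ` D" and C: "open C" and hom: "homeomorphism B C \<tau> \<gamma>"
    and sm: "smooth_on B \<tau>" "smooth_on C \<gamma>"
  shows "compatible_chart X A {q \<in> D. \<phi> q \<in> B} (\<tau> \<circ> \<phi>)" "(\<tau> \<circ> \<phi>) ` {q \<in> D. \<phi> q \<in> B} = C"
proof -
  interpret coordinate_chart X A D \<phi> by unfold_locales (use A c in auto)
  let ?D = "{q \<in> D. \<phi> q \<in> B}"
  have Do: "openin X ?D" by (rule preimage_open[OF B(1)])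
  have im: "\<phi> ` ?D = B" using B by auto
  have \<tau>B: "\<tau> ` B = C" and \<gamma>: "\<And>x. x \<in> B \<Longrightarrow> \<gamma> (\<tau> x) = x" "\<And>y. y \<in> C \<Longrightarrow> \<tau> (\<gamma> y) = y" "\<And>y. y \<in> C \<Longrightarrow> \<gamma> y \<in> B"
    using hom unfolding homeomorphism_def by auto
  show img: "(\<tau> \<circ> \<phi>) ` ?D = C" using im \<tau>B by (metis image_comp)
  have injD: "inj_on (\<tau> \<circ> \<phi>) ?D"
  proof (rule inj_onI)
    fix x y assume xy: "x \<in> ?D" "y \<in> ?D" "(\<tau> \<circ> \<phi>) x = (\<tau> \<circ> \<phi>) y"
    then have "\<phi> x = \<phi> y" using \<gamma>(1) by (metis (no_types, lifting) comp_apply mem_Collect_eq)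
    then show "x = y" using xy phi_inj by (auto simp: inj_on_def)
  qed
  have inv: "inv_into ?D (\<tau> \<circ> \<phi>) y = inv_into D \<phi> (\<gamma> y)" if yC: "y \<in> C" for y
  proof -
    obtain q where q: "q \<in> ?D" "y = (\<tau> \<circ> \<phi>) q" using yC img by blast
    then show ?thesis using inv_into_f_f[OF injD q(1)] \<gamma>(1) by auto
  qed
  have h1: "homeomorphic_map (subtopology X ?D) (top_of_set B) \<phi>"
  proof -
    have "homeomorphic_map (subtopology (subtopology X D) ?D) (subtopology (top_of_set (\<phi> ` D)) B) \<phi>"
      using homeomorphic_map_subtopologies[of "subtopology X D" "top_of_set (\<phi> ` D)" \<phi> ?D B]
        compat B D_topspace unfolding compatible_chart_def by (auto simp: topspace_subtopology)
    then show ?thesis using B by (simp add: subtopology_subtopology Int_absorb1 Int_absorb2 Collect_conj_eq inf.absorb2)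
  qed
  have h2: "homeomorphic_map (top_of_set B) (top_of_set C) \<tau>"
    unfolding homeomorphic_map_maps homeomorphic_maps_def
    by (intro exI[of _ \<gamma>]) (use hom in \<open>auto simp: homeomorphism_def\<close>)
  show "compatible_chart X A ?D (\<tau> \<circ> \<phi>)"
    unfolding compatible_chart_def
  proof (intro conjI Do)
    show "open ((\<tau> \<circ> \<phi>) ` ?D)" unfolding img by (rule C)
    show "homeomorphic_map (subtopology X ?D) (top_of_set ((\<tau> \<circ> \<phi>) ` ?D)) (\<tau> \<circ> \<phi>)"
      unfolding img by (rule homeomorphic_map_compose[OF h1 h2])
    show "\<forall>(E, \<psi>)\<in>A. smooth_on ((\<tau> \<circ> \<phi>) ` (?D \<inter> E)) (\<psi> \<circ> inv_into ?D (\<tau> \<circ> \<phi>)) \<and>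
       smooth_on (\<psi> ` (E \<inter> ?D)) ((\<tau> \<circ> \<phi>) \<circ> inv_into E \<psi>)"
    proof (clarify, intro conjI)
      fix E \<psi> assume E: "(E, \<psi>) \<in> A"
      have oE: "openin X E" using E A unfolding smooth_atlas_def by blast
      have t: "smooth_on (\<phi> ` (D \<inter> E)) (\<psi> \<circ> inv_into D \<phi>)" "smooth_on (\<psi> ` (E \<inter> D)) (\<phi> \<circ> inv_into E \<psi>)"
        using c E unfolding compatible_chart_def by blast+
      have o1: "open (\<phi> ` (?D \<inter> E))" by (rule image_open) (use Do oE in auto)
      let ?O = "(\<tau> \<circ> \<phi>) ` (?D \<inter> E)"
      have OC: "?O \<subseteq> C" using img by blast
      have "?O = C \<inter> \<gamma> -` (\<phi> ` (?D \<inter> E))"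
      proof (intro equalityI subsetI)
        fix y assume "y \<in> ?O" then show "y \<in> C \<inter> \<gamma> -` (\<phi> ` (?D \<inter> E))" using \<gamma>(1) OC by auto
      next
        fix y assume y: "y \<in> C \<inter> \<gamma> -` (\<phi> ` (?D \<inter> E))"
        then obtain q where q: "q \<in> ?D \<inter> E" "\<gamma> y = \<phi> q" by auto
        then have "y = (\<tau> \<circ> \<phi>) q" using \<gamma>(2)[of y] y by simp
        then show "y \<in> ?O" using q by blast
      qed
      then have o2: "open ?O"
        using continuous_open_preimage[OF smooth_on_continuous[OF sm(2)] C o1] by simp
      have "smooth_on ?O (\<lambda>y. (\<psi> \<circ> inv_into D \<phi>) (\<gamma> y))"
        by (rule smooth_on_compose[OF o2 smooth_on_subset[OF sm(2) OC] _ t(1)]) (use \<gamma>(1) in auto)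
      then show "smooth_on ?O (\<psi> \<circ> inv_into ?D (\<tau> \<circ> \<phi>))"
        by (rule iffD1[OF smooth_on_cong[OF o2], rotated]) (use inv OC in auto)
      have o3: "open (\<psi> ` (E \<inter> ?D))" by (rule chart_image_open[OF E Do])
      have "smooth_on (\<psi> ` (E \<inter> ?D)) (\<lambda>y. \<tau> ((\<phi> \<circ> inv_into E \<psi>) y))"
        by (rule smooth_on_compose[OF o3 smooth_on_subset[OF t(2)] _ sm(1)]) (use chart_inj[OF E] in auto)
      then show "smooth_on (\<psi> ` (E \<inter> ?D)) ((\<tau> \<circ> \<phi>) \<circ> inv_into E \<psi>)" by (simp add: o_def)
    qed
  qed
qed

text \<open>By the dimension count, the ambient complex space has one real dimension more than the
  range of \<open>P\<close>. A real normal vector to that range completes it to a real basis; the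
  rows of the inverse matrix are the real forms \<open>x\<close> and \<open>y\<close>, and every
  real form is the real part of a complex linear one.\<close>

lemma real_frame_exists:
  fixes P :: "'m::finite \<Rightarrow> nat \<Rightarrow> complex"
  assumes card: "CARD('m) = 2 * n + 1"
    and inj: "\<And>v. (\<And>j. j \<le> n \<Longrightarrow> (\<Sum>i\<in>UNIV. P i j * complex_of_real (v i)) = 0) \<Longrightarrow> v = (\<lambda>i. 0)"
  shows "\<exists>nu a b. real_frame n P nu a b"
proof -
  have "card (UNIV :: 'm option set) = card ({..n} \<times> (UNIV :: bool set))"
    using card by (simp add: card_cartesian_product card_UNIV_option)
  \<comment> \<open>A square matrix with a single index type: the real and imaginary parts of the
    \<open>n + 1\<close> complex coordinates, which label the rows, are numbered by the type
    \<open>'m option\<close> that labels the columns. \<open>True\<close> marks real parts.\<close>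
  then obtain \<beta> :: "'m option \<Rightarrow> nat \<times> bool" where \<beta>: "bij_betw \<beta> UNIV ({..n} \<times> UNIV)"
    using finite_same_card_bij[of "UNIV :: 'm option set" "{..n} \<times> (UNIV :: bool set)"] by auto
  define \<kappa> where "\<kappa> = inv_into UNIV \<beta>"
  have \<beta>\<kappa>: "\<beta> (\<kappa> (j, s)) = (j, s)" if "j \<le> n" for j s
    using \<beta> that unfolding \<kappa>_def by (simp add: bij_betw_inv_into_right)
  have \<beta>n: "fst (\<beta> k) \<le> n" for k using bij_betw_apply[OF \<beta>, of k] by (auto simp: mem_Times_iff)
  define cp where "cp = (\<lambda>(z :: nat \<Rightarrow> complex) k. if snd (\<beta> k) then Re (z (fst (\<beta> k))) else Im (z (fst (\<beta> k))))"
  have cpeq: "z j = w j" if "\<And>k. cp z k = cp w k" "j \<le> n" for z w j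
    using that(1)[of "\<kappa> (j, True)"] that(1)[of "\<kappa> (j, False)"] \<beta>\<kappa>[OF that(2)] by (simp add: cp_def complex_eq_iff)
  define cv :: "'m \<Rightarrow> real^'m option" where "cv = (\<lambda>i. \<chi> k. cp (P i) k)"
  \<comment> \<open>At most \<open>CARD('m)\<close> vectors in a space of dimension one more leave a
    nonzero orthogonal vector, which becomes \<open>nu\<close>.\<close>
  have "dim (range cv) \<le> card (range cv)" by (rule dim_le_card') simp
  also have "\<dots> \<le> CARD('m)" by (rule card_image_le) simp
  also have "\<dots> < DIM(real^'m option)" by (simp add: card_UNIV_option)
  finally obtain d where d: "d \<noteq> 0" "\<And>y. y \<in> span (range cv) \<Longrightarrow> orthogonal d y"
    using orthogonal_to_subspace_exists by blast
  then have dcv: "d \<bullet> cv i = 0" for i using span_base[of "cv i" "range cv"] by (auto simp: orthogonal_def)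
  define nu where "nu = (\<lambda>j. Complex (d $ \<kappa> (j, True)) (d $ \<kappa> (j, False)))"
  have cpnu: "cp nu k = d $ k" for k
  proof -
    have "\<kappa> (\<beta> k) = k" unfolding \<kappa>_def by (rule bij_betw_inv_into_left[OF \<beta>]) simp
    then show ?thesis by (cases "\<beta> k") (auto simp: cp_def nu_def)
  qed
  have sum_option: "(\<Sum>k\<in>UNIV. f k) = (\<Sum>i\<in>UNIV. f (Some i)) + f None" for f :: "'m option \<Rightarrow> real"
    by (simp add: UNIV_option_conv sum.reindex add.commute)
  define M :: "real^'m option^'m option" where "M = (\<chi> k e. case e of Some i \<Rightarrow> cv i $ k | None \<Rightarrow> d $ k)"
  have Mv: "M *v e = (\<Sum>i\<in>UNIV. (e $ Some i) *\<^sub>R cv i) + (e $ None) *\<^sub>R d" for e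
    by (simp add: vec_eq_iff matrix_vector_mult_def M_def sum_option mult.commute)
  have cplin: "cp (\<lambda>j. (\<Sum>i\<in>UNIV. P i j * complex_of_real (x i)) + nu j * complex_of_real y) k =
      (M *v (\<chi> e. case e of Some i \<Rightarrow> x i | None \<Rightarrow> y)) $ k" for x y k
    unfolding Mv using cpnu[of k] by (auto simp: cp_def cv_def mult.commute)
  have "M *v e = 0 \<Longrightarrow> e = 0" for e
  proof -
    assume e: "M *v e = 0"
    have "d \<bullet> (M *v e) = (e $ None) * (d \<bullet> d)"
      unfolding Mv by (simp add: inner_add_right inner_sum_right dcv)
    then have e0: "e $ None = 0" using e d(1) by simp
    have eta: "(\<chi> e'. case e' of Some i \<Rightarrow> e $ Some i | None \<Rightarrow> 0) = e"
      using e0 by (simp add: vec_eq_iff split: option.split)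
    have "(\<Sum>i\<in>UNIV. P i j * complex_of_real (e $ Some i)) + nu j * complex_of_real 0 = 0" if "j \<le> n" for j
      using cpeq[of "\<lambda>j. (\<Sum>i\<in>UNIV. P i j * complex_of_real (e $ Some i)) + nu j * complex_of_real 0" "\<lambda>j. 0" j]
        cplin[of "\<lambda>i. e $ Some i" 0] that e unfolding eta by (simp add: cp_def)
    then have "(\<lambda>i. e $ Some i) = (\<lambda>i. 0)" by (intro inj) simp
    then have "e $ k = 0" for k using e0 by (cases k) (auto dest: fun_cong)
    then show "e = 0" by (simp add: vec_eq_iff)
  qed
  then obtain B where B: "B ** M = mat 1" using matrix_left_invertible_ker[of M] by blast
  then have MB: "M ** B = mat 1" using matrix_left_right_inverse by blast
  \<comment> \<open>The complex linear form whose real part is row \<open>e\<close> of the inverse;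
    the minus sign compensates the one in the real part of a product.\<close>
  define ab where "ab = (\<lambda>e j. Complex (B $ e $ \<kappa> (j, True)) (- B $ e $ \<kappa> (j, False)))"
  have Reab: "Re (\<Sum>j\<le>n. ab e j * z j) = (B *v (\<chi> k. cp z k)) $ e" for e z
  proof -
    have "(B *v (\<chi> k. cp z k)) $ e = (\<Sum>k\<in>UNIV. B $ e $ k * cp z k)"
      by (simp add: matrix_vector_mult_def)
    also have "\<dots> = (\<Sum>p\<in>{..n} \<times> UNIV. B $ e $ \<kappa> p * cp z (\<kappa> p))"
      using sum.reindex_bij_betw[OF bij_betw_inv_into[OF \<beta>], of "\<lambda>k. B $ e $ k * cp z k"] by (simp add: \<kappa>_def)
    also have "\<dots> = (\<Sum>j\<le>n. \<Sum>s\<in>UNIV. B $ e $ \<kappa> (j, s) * cp z (\<kappa> (j, s)))"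
      by (simp add: sum.cartesian_product)
    also have "\<dots> = (\<Sum>j\<le>n. Re (ab e j * z j))"
      by (intro sum.cong refl) (simp add: UNIV_bool cp_def \<beta>\<kappa> ab_def)
    finally show ?thesis by simp
  qed
  have right: "(\<Sum>i\<in>UNIV. P i j * complex_of_real (Re (\<Sum>l\<le>n. ab (Some i) l * z l))) + nu j * complex_of_real (Re (\<Sum>l\<le>n. ab None l * z l)) = z j"
    if "j \<le> n" for j z
  proof (rule cpeq[OF _ that])
    fix k
    have e: "(\<chi> e. case e of Some i \<Rightarrow> Re (\<Sum>l\<le>n. ab (Some i) l * z l) | None \<Rightarrow> Re (\<Sum>l\<le>n. ab None l * z l)) = B *v (\<chi> k. cp z k)"
      unfolding Reab by (simp add: vec_eq_iff split: option.split)
    show "cp (\<lambda>j. (\<Sum>i\<in>UNIV. P i j * complex_of_real (Re (\<Sum>l\<le>n. ab (Some i) l * z l))) + nu j * complex_of_real (Re (\<Sum>l\<le>n. ab None l * z l))) k = cp z k"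
      unfolding cplin e matrix_vector_mul_assoc MB by simp
  qed
  \<comment> \<open>The real linear identity tested on a vector with a single entry
    \<open>w\<close>. The values 1 and \<open>\<i>\<close> are combined through \<open>cx\<close> to
    separate the complex linear from the antilinear part.\<close>
  have unit: "(\<Sum>i\<in>UNIV. P i j * complex_of_real (Re (ab (Some i) l * w))) + nu j * complex_of_real (Re (ab None l * w)) = (if j = l then w else 0)"
    if "j \<le> n" "l \<le> n" for j l w
  proof -
    have "(\<Sum>l'\<le>n. ab e l' * (if l' = l then w else 0)) = ab e l * w" for e
      using that by (simp add: if_distrib cong: if_cong)
    then show ?thesis using right[OF that(1), of "\<lambda>l'. if l' = l then w else 0"] by simp
  qed
  have cx: "complex_of_real (Re z) - \<i> * complex_of_real (Re (z * \<i>)) = z" "complex_of_real (Re z) + \<i> * complex_of_real (Re (z * \<i>)) = cnj z" for z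
    by (simp_all add: complex_eq_iff)
  have "real_frame n P nu (\<lambda>i. ab (Some i)) (ab None)"
  proof
    fix j l assume jl: "j \<le> n" "l \<le> n"
    have u1: "(\<Sum>i\<in>UNIV. P i j * complex_of_real (Re (ab (Some i) l))) + nu j * complex_of_real (Re (ab None l)) = (if j = l then 1 else 0)"
      using unit[OF jl, of 1] by simp
    note ui = unit[OF jl, of \<i>]
    have "(\<Sum>i\<in>UNIV. P i j * ab (Some i) l) + nu j * ab None l =
      ((\<Sum>i\<in>UNIV. P i j * complex_of_real (Re (ab (Some i) l))) + nu j * complex_of_real (Re (ab None l))) -
      \<i> * ((\<Sum>i\<in>UNIV. P i j * complex_of_real (Re (ab (Some i) l * \<i>))) + nu j * complex_of_real (Re (ab None l * \<i>)))"
      by (subst cx(1)[symmetric, of "ab (Some _) l"], subst cx(1)[symmetric, of "ab None l"])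
        (simp only: right_diff_distrib distrib_left sum_subtractf sum_distrib_left mult.left_commute[of \<i>] diff_add_eq add_diff_eq diff_diff_eq add_ac)
    then show "(\<Sum>i\<in>UNIV. P i j * ab (Some i) l) + nu j * ab None l = (if j = l then 2 else 0)"
      unfolding u1 ui by simp
    have "(\<Sum>i\<in>UNIV. P i j * cnj (ab (Some i) l)) + nu j * cnj (ab None l) =
      ((\<Sum>i\<in>UNIV. P i j * complex_of_real (Re (ab (Some i) l))) + nu j * complex_of_real (Re (ab None l))) +
      \<i> * ((\<Sum>i\<in>UNIV. P i j * complex_of_real (Re (ab (Some i) l * \<i>))) + nu j * complex_of_real (Re (ab None l * \<i>)))"
      by (subst cx(2)[symmetric, of "ab (Some _) l"], subst cx(2)[symmetric, of "ab None l"])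
        (simp only: distrib_left sum.distrib sum_distrib_left mult.left_commute[of \<i>] add_ac)
    then have "cnj ((\<Sum>i\<in>UNIV. P i j * cnj (ab (Some i) l)) + nu j * cnj (ab None l)) = 0"
      unfolding u1 ui by simp
    then show "(\<Sum>i\<in>UNIV. cnj (P i j) * ab (Some i) l) + cnj (nu j) * ab None l = 0"
      by (simp only: complex_cnj_add cnj_sum complex_cnj_mult complex_cnj_cnj)
  next
    fix x :: "'m \<Rightarrow> real" and y :: real
    let ?e = "(\<chi> e. case e of Some i \<Rightarrow> x i | None \<Rightarrow> y) :: real^'m option"
    have "(\<chi> k. cp (\<lambda>j. (\<Sum>k\<in>UNIV. P k j * complex_of_real (x k)) + nu j * complex_of_real y) k) = M *v ?e"
      unfolding cplin by simp
    then have *: "Re (\<Sum>j\<le>n. ab e j * ((\<Sum>k\<in>UNIV. P k j * complex_of_real (x k)) + nu j * complex_of_real y)) = ?e $ e" for e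
      unfolding Reab by (simp only: matrix_vector_mul_assoc B matrix_vector_mul_lid)
    show "Re (\<Sum>j\<le>n. ab (Some i) j * ((\<Sum>k\<in>UNIV. P k j * complex_of_real (x k)) + nu j * complex_of_real y)) = x i" for i
      unfolding * by simp
    show "Re (\<Sum>j\<le>n. ab None j * ((\<Sum>k\<in>UNIV. P k j * complex_of_real (x k)) + nu j * complex_of_real y)) = y"
      unfolding * by simp
  qed
  then show ?thesis by blast
qed

text \<open>Reversal of the normal direction: \<open>y\<close>, \<open>b\<close> and
  \<open>nu\<close> change sign while \<open>x\<close> and \<open>a\<close> are kept. It serves to
  correct the sign of the Levi form.\<close>

lemma real_frame_flip:
  assumes "real_frame n P nu a b" shows "real_frame n P (\<lambda>j. - nu j) a (\<lambda>j. - b j)"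
proof -
  interpret real_frame n P nu a b by fact
  show ?thesis
  proof
    show "(\<Sum>i\<in>UNIV. P i j * a i l) + - nu j * - b l = (if j = l then 2 else 0)" if "j \<le> n" "l \<le> n" for j l
      using right_inverse[OF that] by simp
    show "(\<Sum>i\<in>UNIV. cnj (P i j) * a i l) + cnj (- nu j) * - b l = 0" if "j \<le> n" "l \<le> n" for j l
      using right_inverse_cnj[OF that] by simp
    show "Re (\<Sum>j\<le>n. a i j * ((\<Sum>k\<in>UNIV. P k j * complex_of_real (x k)) + - nu j * complex_of_real y)) = x i" for i x y
      using left_inverse_x[of i x "- y"] by simp
    show "Re (\<Sum>j\<le>n. - b j * ((\<Sum>k\<in>UNIV. P k j * complex_of_real (x k)) + - nu j * complex_of_real y)) = y" for x y
      using left_inverse_y[of x "- y"] by (simp add: sum_negf)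
  qed
qed

subsection \<open>Real Hessians\<close>

definition hess :: "(real^'m \<Rightarrow> real) \<Rightarrow> real^'m \<Rightarrow> real^'m \<Rightarrow> real" where
  "hess f x v = (\<Sum>i\<in>UNIV. \<Sum>l\<in>UNIV. ddir (axis l 1) (ddir (axis i 1) f) x * (v $ l * v $ i))"

lemma ddir_axis:
  fixes f :: "real^'m \<Rightarrow> 'c::real_normed_vector"
  assumes "f differentiable (at x)"
  shows "ddir v f x = (\<Sum>i\<in>UNIV. (v $ i) *\<^sub>R ddir (axis i 1) f x)"
proof -
  have l: "linear (\<lambda>v. ddir v f x)" using linear_frechet_derivative[OF assms] by (simp add: ddir_def)
  have "v = (\<Sum>i\<in>UNIV. (v $ i) *\<^sub>R axis i 1)" using basis_expansion[of v] by (simp add: scalar_mult_eq_scaleR)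
  then have "ddir v f x = ddir (\<Sum>i\<in>UNIV. (v $ i) *\<^sub>R axis i 1) f x" by (rule arg_cong)
  also have "\<dots> = (\<Sum>i\<in>UNIV. (v $ i) *\<^sub>R ddir (axis i 1) f x)"
    by (simp only: linear_sum[OF l] linear_scale[OF l])
  finally show ?thesis .
qed

lemma hess_eq:
  assumes S: "open S" "x \<in> S" and f: "smooth_on S f"
  shows "hess f x v = ddir v (ddir v f) x"
proof -
  have d: "ddir w f differentiable (at y)" if "y \<in> S" for w y
    by (rule smooth_on_differentiable[OF smooth_on_ddir[OF f] that])
  have s: "smooth_on S (\<lambda>y. (v $ i) *\<^sub>R ddir (axis i 1) f y)" for i
    by (rule smooth_on_linear_compose[OF S(1) bounded_linear_scaleR_right smooth_on_ddir[OF f]])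
  have "ddir v (ddir v f) x = ddir v (\<lambda>y. \<Sum>i\<in>UNIV. (v $ i) *\<^sub>R ddir (axis i 1) f y) x"
    by (rule ddir_cong[OF S]) (rule ddir_axis[OF smooth_on_differentiable[OF f]])
  also have "\<dots> = (\<Sum>i\<in>UNIV. ddir v (\<lambda>y. (v $ i) *\<^sub>R ddir (axis i 1) f y) x)"
    using iter_deriv_sum[OF S s, where I = UNIV and vs = "[v]"] by (simp add: ddir_def)
  also have "\<dots> = (\<Sum>i\<in>UNIV. (v $ i) *\<^sub>R ddir v (ddir (axis i 1) f) x)"
    by (intro sum.cong refl bounded_linear_ddir bounded_linear_scaleR_right d S)
  also have "\<dots> = (\<Sum>i\<in>UNIV. (v $ i) *\<^sub>R (\<Sum>l\<in>UNIV. (v $ l) *\<^sub>R ddir (axis l 1) (ddir (axis i 1) f) x))"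
    by (intro sum.cong refl arg_cong2[of _ _ _ _ "(*\<^sub>R)"] ddir_axis d S)
  also have "\<dots> = hess f x v" by (simp add: hess_def sum_distrib_left mult_ac)
  finally show ?thesis by simp
qed

text \<open>The constant counts the matrix entries; each product of two components of
  \<open>v\<close> is at most \<open>(norm v)\<^sup>2\<close>.\<close>

lemma hess_perturb:
  fixes f g :: "real^'m \<Rightarrow> real"
  assumes "\<And>i l. \<bar>ddir (axis l 1) (ddir (axis i 1) f) x - ddir (axis l 1) (ddir (axis i 1) g) y\<bar> \<le> e"
  shows "\<bar>hess f x v - hess g y v\<bar> \<le> e * (real CARD('m))\<^sup>2 * (norm v)\<^sup>2"
proof -
  have e: "e \<ge> 0" using assms[of undefined undefined] by linarith
  have "\<bar>ddir (axis l 1) (ddir (axis i 1) f) x * (v $ l * v $ i) - ddir (axis l 1) (ddir (axis i 1) g) y * (v $ l * v $ i)\<bar> \<le> e * (norm v)\<^sup>2" for i l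
  proof -
    have "\<bar>v $ l * v $ i\<bar> \<le> norm v * norm v"
      unfolding abs_mult by (intro mult_mono component_le_norm_cart) auto
    then show ?thesis
      unfolding left_diff_distrib[symmetric] abs_mult[of "_ - _"] power2_eq_square
      using assms e by (intro mult_mono) auto
  qed
  then have "\<bar>hess f x v - hess g y v\<bar> \<le> (\<Sum>i\<in>(UNIV::'m set). \<Sum>l\<in>(UNIV::'m set). e * (norm v)\<^sup>2)"
    unfolding hess_def sum_subtractf[symmetric]
    by (intro order_trans[OF sum_abs] sum_mono) auto
  then show ?thesis by (simp add: power2_eq_square mult_ac)
qed

lemma hess_scaleR: "hess f x (t *\<^sub>R v) = t\<^sup>2 * hess f x v"
  by (simp add: hess_def sum_distrib_left power2_eq_square mult_ac)

lemma continuous_hess: "continuous_on UNIV (hess f x)"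
  unfolding hess_def[abs_def] by (intro continuous_intros)

text \<open>The minimum \<open>2 * m\<close> of the quadratic form on the unit sphere at
  \<open>c\<close> survives up to one half, by continuity of the finitely many second derivatives.
  The bound is uniform in \<open>x\<close>, as needed for passing to approximating
  functions.\<close>

lemma hess_positive_near:
  fixes u :: "real^'m \<Rightarrow> real"
  assumes S: "open S" "c \<in> S" and u: "smooth_on S u" and pos: "\<And>v. v \<noteq> 0 \<Longrightarrow> hess u c v > 0"
  obtains R m where "R > 0" "m > 0" "ball c R \<subseteq> S" "\<And>x v. x \<in> ball c R \<Longrightarrow> hess u x v \<ge> m * (norm v)\<^sup>2"
proof -
  let ?K = "(real CARD('m))\<^sup>2"
  have "sphere (0::real^'m) 1 \<noteq> {}" by simp
  then obtain v0 where v0: "v0 \<in> sphere (0::real^'m) 1" "\<And>v. v \<in> sphere 0 1 \<Longrightarrow> hess u c v0 \<le> hess u c v"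
    using continuous_attains_inf[OF compact_sphere _ continuous_on_subset[OF continuous_hess]] by blast
  define m where "m = hess u c v0 / 2"
  have "v0 \<noteq> 0" using v0(1) by (metis mem_sphere_0 norm_zero zero_neq_one)
  then have m: "m > 0" using pos[of v0] by (simp add: m_def)
  have lower: "hess u c v \<ge> 2 * m * (norm v)\<^sup>2" for v
  proof (cases "v = 0")
    case False
    have "hess u c (inverse (norm v) *\<^sub>R v) \<ge> 2 * m" using v0(2)[of "inverse (norm v) *\<^sub>R v"] False by (simp add: m_def)
    then show ?thesis using False by (simp add: hess_scaleR power_inverse field_simps)
  qed (simp add: hess_def)
  have "\<exists>d>0. \<forall>x\<in>ball c d. \<bar>ddir (axis l 1) (ddir (axis i 1) u) x - ddir (axis l 1) (ddir (axis i 1) u) c\<bar> \<le> m / ?K" for i l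
  proof -
    have "isCont (ddir (axis l 1) (ddir (axis i 1) u)) c"
      using smooth_on_continuous[OF smooth_on_ddir[OF smooth_on_ddir[OF u]]] S continuous_on_eq_continuous_at by blast
    moreover have "m / ?K > 0" using m by simp
    ultimately obtain d where "d > 0" "\<forall>x. dist x c < d \<longrightarrow> dist (ddir (axis l 1) (ddir (axis i 1) u) x) (ddir (axis l 1) (ddir (axis i 1) u) c) < m / ?K"
      unfolding continuous_at_eps_delta by blast
    then show ?thesis by (intro exI[of _ d]) (auto simp: dist_real_def dist_commute less_imp_le)
  qed
  then have "\<forall>i l. \<exists>d. d > 0 \<and> (\<forall>x\<in>ball c d.
     \<bar>ddir (axis l 1) (ddir (axis i 1) u) x - ddir (axis l 1) (ddir (axis i 1) u) c\<bar> \<le> m / ?K)" by blast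
  from this[unfolded choice_iff] obtain d where d': "\<forall>i l. d i l > 0 \<and> (\<forall>x\<in>ball c (d i l).
     \<bar>ddir (axis l 1) (ddir (axis i 1) u) x - ddir (axis l 1) (ddir (axis i 1) u) c\<bar> \<le> m / ?K)" by blast
  then have d: "\<And>i l. d i l > 0" "\<And>i l x. x \<in> ball c (d i l) \<Longrightarrow>
     \<bar>ddir (axis l 1) (ddir (axis i 1) u) x - ddir (axis l 1) (ddir (axis i 1) u) c\<bar> \<le> m / ?K" by blast+
  obtain R0 where R0: "R0 > 0" "ball c R0 \<subseteq> S" using S openE by blast
  define R where "R = min R0 (Min (range (\<lambda>(i, l). d i l)))"
  have Rd: "R \<le> d i l" for i l
    unfolding R_def by (rule min.coboundedI2, rule Min_le) (auto intro: range_eqI[of _ _ "(i, l)"])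
  have "R > 0" unfolding R_def using R0 d(1) by (auto simp: Min_gr_iff)
  moreover have "ball c R \<subseteq> S" using R0 by (auto simp: R_def)
  moreover have "hess u x v \<ge> m * (norm v)\<^sup>2" if x: "x \<in> ball c R" for x v
  proof -
    have "\<bar>hess u x v - hess u c v\<bar> \<le> m / ?K * ?K * (norm v)\<^sup>2"
    proof (rule hess_perturb)
      fix i l
      have "x \<in> ball c (d i l)" using x Rd[of i l] by simp
      then show "\<bar>ddir (axis l 1) (ddir (axis i 1) u) x - ddir (axis l 1) (ddir (axis i 1) u) c\<bar> \<le> m / ?K" by (rule d(2))
    qed
    then show ?thesis using lower[of v] by simp
  qed
  ultimately show ?thesis using that m by blast
qed

text \<open>Restrict to the segment from \<open>y\<close> to \<open>x\<close>: the mean value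
  theorem gives a slope at an intermediate point, and a second application shows that this slope is
  at least the one at \<open>y\<close>.\<close>

lemma tangent_below_graph:
  fixes u :: "real^'m \<Rightarrow> real"
  assumes u: "smooth_on (ball c R) u" and pos: "\<And>x v. x \<in> ball c R \<Longrightarrow> hess u x v \<ge> 0"
    and xy: "x \<in> ball c R" "y \<in> ball c R"
  shows "u y + ddir (x - y) u y \<le> u x"
proof -
  let ?h = "x - y"
  have inB: "y + t *\<^sub>R ?h \<in> ball c R" if "0 \<le> t" "t \<le> 1" for t
  proof -
    have "(1 - t) *\<^sub>R y + t *\<^sub>R x \<in> ball c R" using xy that convexD_alt[OF convex_ball] by blast
    then show ?thesis by (simp add: algebra_simps)
  qed
  have d1: "((\<lambda>t. u (y + t *\<^sub>R ?h)) has_real_derivative ddir ?h u (y + t *\<^sub>R ?h)) (at t)" if "0 \<le> t" "t \<le> 1" for t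
    by (rule has_real_derivative_line[OF smooth_on_differentiable[OF u inB[OF that]]])
  have d2: "((\<lambda>t. ddir ?h u (y + t *\<^sub>R ?h)) has_real_derivative ddir ?h (ddir ?h u) (y + t *\<^sub>R ?h)) (at t)" if "0 \<le> t" "t \<le> 1" for t
    by (rule has_real_derivative_line[OF smooth_on_differentiable[OF smooth_on_ddir[OF u] inB[OF that]]])
  obtain s where s: "0 < s" "s < 1" "u (y + 1 *\<^sub>R ?h) - u (y + 0 *\<^sub>R ?h) = (1 - 0) * ddir ?h u (y + s *\<^sub>R ?h)"
    using MVT2[of 0 1 "\<lambda>t. u (y + t *\<^sub>R ?h)" "\<lambda>t. ddir ?h u (y + t *\<^sub>R ?h)"] d1 by auto
  have "\<exists>z>0. z < s \<and> ddir ?h u (y + s *\<^sub>R ?h) - ddir ?h u (y + 0 *\<^sub>R ?h) = (s - 0) * ddir ?h (ddir ?h u) (y + z *\<^sub>R ?h)"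
    by (rule MVT2[OF s(1)]) (use d2 s in auto)
  then obtain z where z: "0 < z" "z < s" "ddir ?h u (y + s *\<^sub>R ?h) - ddir ?h u (y + 0 *\<^sub>R ?h) = (s - 0) * ddir ?h (ddir ?h u) (y + z *\<^sub>R ?h)"
    by blast
  have "ddir ?h (ddir ?h u) (y + z *\<^sub>R ?h) \<ge> 0"
    using pos[OF inB, of z ?h] hess_eq[OF open_ball inB u, of z ?h] z s by simp
  then have "(s - 0) * ddir ?h (ddir ?h u) (y + z *\<^sub>R ?h) \<ge> 0" using s(1) by (intro mult_nonneg_nonneg) auto
  then have "ddir ?h u (y + 0 *\<^sub>R ?h) \<le> ddir ?h u (y + s *\<^sub>R ?h)" using z(3) by linarith
  then show ?thesis using s(3) by simp
qed

text \<open>Finsler's lemma, by compactness of the unit sphere: where \<open>g\<close> vanishes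
  \<open>f\<close> is already positive, and elsewhere a large multiple of \<open>g\<close> wins.
  Homogeneity of degree two extends the result from the sphere.\<close>

lemma positive_combination:
  fixes f g :: "real^'m \<Rightarrow> real"
  assumes f: "continuous_on UNIV f" "\<And>t v. f (t *\<^sub>R v) = t\<^sup>2 * f v" and g: "continuous_on UNIV g" "\<And>t v. g (t *\<^sub>R v) = t\<^sup>2 * g v"
    and nn: "\<And>v. g v \<ge> 0" and pos: "\<And>v. v \<noteq> 0 \<Longrightarrow> g v = 0 \<Longrightarrow> f v > 0"
  obtains C where "C \<ge> 0" "\<And>v. v \<noteq> 0 \<Longrightarrow> f v + C * g v > 0"
proof -
  let ?U = "\<lambda>k::nat. {v. f v + real k * g v > 0}"
  have op: "open (?U k)" for k by (intro open_Collect_less continuous_intros f g)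
  have cov: "sphere 0 1 \<subseteq> (\<Union>k\<in>UNIV. ?U k)"
  proof
    fix v :: "real^'m" assume v: "v \<in> sphere 0 1"
    show "v \<in> (\<Union>k\<in>UNIV. ?U k)"
    proof (cases "g v = 0")
      case True
      moreover have "v \<noteq> 0" using v by (metis mem_sphere_0 norm_zero zero_neq_one)
      ultimately show ?thesis using pos[of v] by auto
    next
      case False
      then have "g v > 0" using nn[of v] by simp
      then obtain k where "- f v < real k * g v" using reals_Archimedean3 by blast
      then show ?thesis by (auto intro!: exI[of _ k])
    qed
  qed
  obtain K where K: "finite K" "sphere 0 1 \<subseteq> (\<Union>k\<in>K. ?U k)"
    using compactE_image[OF compact_sphere, of UNIV ?U 0 1] op cov by (metis (no_types, lifting))
  define C where "C = real (Max (insert 0 K))"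
  have S: "f v + C * g v > 0" if v: "v \<in> sphere 0 1" for v
  proof -
    obtain k where k: "k \<in> K" "f v + real k * g v > 0" using K(2) v by blast
    have "k \<le> Max (insert 0 K)" using k K by (intro Max_ge) auto
    then have "real k \<le> C" by (simp add: C_def)
    then have "real k * g v \<le> C * g v" by (rule mult_right_mono[OF _ nn])
    then show ?thesis using k(2) by linarith
  qed
  have "f v + C * g v > 0" if "v \<noteq> 0" for v
  proof -
    have "f (inverse (norm v) *\<^sub>R v) + C * g (inverse (norm v) *\<^sub>R v) > 0" using that by (intro S) simp
    then have "(inverse (norm v))\<^sup>2 * (f v + C * g v) > 0" unfolding f(2) g(2) by (simp add: algebra_simps)
    then show ?thesis using that by (simp add: zero_less_mult_iff)
  qed
  then show ?thesis using that[of C] by (simp add: C_def)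
qed

subsection \<open>The Levi form of an embedded strictly pseudoconvex structure\<close>

text \<open>The functions \<open>G j\<close> are components of a given embedding, normalised to
  vanish at \<open>p\<close>, and \<open>P\<close> is its differential at \<open>p\<close>. Hence
  the real frame is adapted to the actual tangent space at \<open>p\<close>, while the chart \<phi>
  is still arbitrary.\<close>

locale embedded_point = graph_chart X A D \<phi> n P nu a b
  for X :: "'a topology" and A :: "('a, 'm::finite) chart set" and D and \<phi> :: "'a \<Rightarrow> real^'m"
    and n :: nat and P :: "'m \<Rightarrow> nat \<Rightarrow> complex" and nu and a :: "'m \<Rightarrow> nat \<Rightarrow> complex" and b +
  fixes p :: 'a and G :: "nat \<Rightarrow> 'a \<Rightarrow> complex" and T10 :: "'a \<Rightarrow> 'a cvector set"
  assumes pD: "p \<in> D"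
    and G_smooth: "\<And>j. j \<le> n \<Longrightarrow> smooth_fun A D (G j)"
    and G_zero: "\<And>j. j \<le> n \<Longrightarrow> G j p = 0"
    and G_deriv: "\<And>i j. j \<le> n \<Longrightarrow> ddir (axis i 1) (G j \<circ> inv_into D \<phi>) (\<phi> p) = P i j"
    and T10_eq: "\<And>q. q \<in> D \<Longrightarrow> T10 q = {Z \<in> ctangent X A q. \<forall>j\<le>n. Z (\<lambda>y. cnj (G j y)) = 0}"
    and T10_bundle: "complex_subbundle X A n D T10"
begin

text \<open>The coordinate \<open>y\<close> of the embedding, as a function on the chart. Its
  differential vanishes at \<open>p\<close> by the choice of the frame, so its Hessian at
  \<open>p\<close> behaves like a tensor under coordinate changes.\<close>

definition gy :: "real^'m \<Rightarrow> real" where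
  "gy x = Re (\<Sum>j\<le>n. b j * (G j \<circ> inv_into D \<phi>) x)"

text \<open>The Hermitian extension of the Hessian of \<open>gy\<close> at \<open>p\<close>, in
  terms of ambient components \<open>z\<close>. On the complex tangent space, where \<open>b\<close>
  annihilates \<open>z\<close>, it is the Levi form up to a constant factor.\<close>

definition levi :: "(nat \<Rightarrow> complex) \<Rightarrow> complex" where
  "levi z = (\<Sum>i\<in>UNIV. \<Sum>l\<in>UNIV. complex_of_real (ddir (axis l 1) (ddir (axis i 1) gy) (\<phi> p)) *
     (cnj (\<Sum>j\<le>n. a l j * z j) * (\<Sum>j\<le>n. a i j * z j)))"

lemma G_chart_smooth: "j \<le> n \<Longrightarrow> smooth_on (\<phi> ` D) (G j \<circ> inv_into D \<phi>)"
  using G_smooth smooth_fun_iff[OF D_open subset_refl] by blast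

lemma G_near: "j \<le> n \<Longrightarrow> q \<in> D \<Longrightarrow> smooth_near X A q (G j)"
  using smooth_nearI[OF D_open _ G_smooth] by blast

lemma G_deriv_dir:
  assumes "j \<le> n"
  shows "ddir v (G j \<circ> inv_into D \<phi>) (\<phi> p) = (\<Sum>i\<in>UNIV. P i j * complex_of_real (v $ i))"
  using ddir_axis[OF smooth_on_differentiable[OF G_chart_smooth[OF assms]], of "\<phi> p" v] pD G_deriv[OF assms]
  by (simp add: scaleR_conv_of_real mult.commute)

lemma Re_combination_smooth:
  assumes S: "open S" and f: "\<And>j. j \<le> n \<Longrightarrow> smooth_on S (f j)"
  shows "smooth_on S (\<lambda>x. Re (\<Sum>j\<le>n. c j * f j x))"
    and "x \<in> S \<Longrightarrow> ddir v (\<lambda>x. Re (\<Sum>j\<le>n. c j * f j x)) x = Re (\<Sum>j\<le>n. c j * ddir v (f j) x)"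
proof -
  have s: "smooth_on S (\<lambda>x. c j * f j x)" if "j \<in> {..n}" for j
    by (rule smooth_on_linear_compose[OF S bounded_linear_mult_right f]) (use that in simp)
  have ss: "smooth_on S (\<lambda>x. \<Sum>j\<le>n. c j * f j x)" by (rule smooth_on_sum[OF S s])
  show "smooth_on S (\<lambda>x. Re (\<Sum>j\<le>n. c j * f j x))"
    by (rule smooth_on_linear_compose[OF S bounded_linear_Re ss])
  assume x: "x \<in> S"
  have "ddir v (\<lambda>x. Re (\<Sum>j\<le>n. c j * f j x)) x = Re (ddir v (\<lambda>x. \<Sum>j\<le>n. c j * f j x) x)"
    by (rule bounded_linear_ddir[OF bounded_linear_Re smooth_on_differentiable[OF ss x]])
  also have "ddir v (\<lambda>x. \<Sum>j\<le>n. c j * f j x) x = (\<Sum>j\<le>n. ddir v (\<lambda>x. c j * f j x) x)"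
    using iter_deriv_sum[where I = "{..n}" and f = "\<lambda>j x. c j * f j x" and vs = "[v]", OF S x s] by (simp add: ddir_def)
  also have "\<dots> = (\<Sum>j\<le>n. c j * ddir v (f j) x)"
    by (intro sum.cong refl bounded_linear_ddir[OF bounded_linear_mult_right] smooth_on_differentiable[OF f x]) simp
  finally show "ddir v (\<lambda>x. Re (\<Sum>j\<le>n. c j * f j x)) x = Re (\<Sum>j\<le>n. c j * ddir v (f j) x)" .
qed

lemma gy_smooth: "smooth_on (\<phi> ` D) gy"
  unfolding gy_def[abs_def] by (rule Re_combination_smooth(1)[OF D_image_open G_chart_smooth])

lemma b_P: "Re (\<Sum>j\<le>n. b j * (\<Sum>i\<in>UNIV. P i j * complex_of_real (v i))) = 0"
  and a_P: "Re (\<Sum>j\<le>n. a k j * (\<Sum>i\<in>UNIV. P i j * complex_of_real (v i))) = v k"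
  using left_inverse_y[of v 0] left_inverse_x[of k v 0] by simp_all

lemma gy_critical: "ddir v gy (\<phi> p) = 0"
proof -
  have "ddir v gy (\<phi> p) = Re (\<Sum>j\<le>n. b j * ddir v (G j \<circ> inv_into D \<phi>) (\<phi> p))"
    unfolding gy_def[abs_def] by (rule Re_combination_smooth(2)[OF D_image_open G_chart_smooth]) (use pD in auto)
  also have "\<dots> = Re (\<Sum>j\<le>n. b j * (\<Sum>i\<in>UNIV. P i j * complex_of_real (v $ i)))"
    using G_deriv_dir by simp
  finally show ?thesis using b_P by simp
qed

lemma tangent_G:
  assumes Z: "Z \<in> ctangent X A p" and j: "j \<le> n"
  shows "Z (G j) = (\<Sum>i\<in>UNIV. P i j * Z (xc i))" "Z (\<lambda>y. cnj (G j y)) = (\<Sum>i\<in>UNIV. cnj (P i j) * Z (xc i))"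
proof -
  show "Z (G j) = (\<Sum>i\<in>UNIV. P i j * Z (xc i))"
    using ctangent_expansion[OF Z pD G_near[OF j pD]] G_deriv[OF j] by (simp add: mult.commute)
  have "ddir v ((\<lambda>y. cnj (G j y)) \<circ> inv_into D \<phi>) (\<phi> p) = cnj (ddir v (G j \<circ> inv_into D \<phi>) (\<phi> p))" for v
    using bounded_linear_ddir[OF bounded_linear_cnj smooth_on_differentiable[OF G_chart_smooth[OF j]], of "\<phi> p" v] pD
    by (simp add: o_def)
  then show "Z (\<lambda>y. cnj (G j y)) = (\<Sum>i\<in>UNIV. cnj (P i j) * Z (xc i))"
    using ctangent_expansion[OF Z pD smooth_near_cnj[OF G_near[OF j pD]]] G_deriv[OF j] by (simp add: mult.commute)
qed

definition tlift :: "(nat \<Rightarrow> complex) \<Rightarrow> 'a cvector" where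
  "tlift z = cvec p (\<lambda>i. (\<Sum>j\<le>n. a i j * z j) / 2)"

lemma tlift:
  assumes z: "(\<Sum>j\<le>n. b j * z j) = 0"
  shows "tlift z \<in> T10 p" "tlift z \<in> ctangent X A p" "tlift z (xc i) = (\<Sum>j\<le>n. a i j * z j) / 2"
    "j \<le> n \<Longrightarrow> tlift z (G j) = z j"
proof -
  show t: "tlift z \<in> ctangent X A p" by (simp add: tlift_def cvec_ctangent[OF pD])
  show x: "tlift z (xc i) = (\<Sum>j\<le>n. a i j * z j) / 2" for i by (simp add: tlift_def cvec_xc[OF pD])
  show "tlift z (G j) = z j" if "j \<le> n" for j
    using apply_right_inverse[OF that, of z] z unfolding tangent_G(1)[OF t that] x sum_half by simp
  have "tlift z (\<lambda>y. cnj (G j y)) = 0" if "j \<le> n" for j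
    using apply_right_inverse_cnj[OF that, of z] z unfolding tangent_G(2)[OF t that] x sum_half by simp
  then show "tlift z \<in> T10 p" using t T10_eq[OF pD] by simp
qed

text \<open>The coefficients in a local frame at \<open>p\<close> are kept constant.\<close>

lemma T10_extend:
  assumes "Z0 \<in> T10 p"
  obtains W Z where "openin X W" "p \<in> W" "W \<subseteq> D" "smooth_section X A W T10 Z" "Z p = Z0"
proof -
  from bspec[OF T10_bundle[unfolded complex_subbundle_def] pD]
  obtain W E where W': "openin X W \<and> p \<in> W \<and> W \<subseteq> D \<and> (\<forall>j<n. smooth_field X A W (E j)) \<and>
      (\<forall>q\<in>W. (\<forall>c. (\<lambda>f. \<Sum>j<n. c j * E j q f) = (\<lambda>f. 0) \<longrightarrow> (\<forall>j<n. c j = 0)) \<and>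
         T10 q = {\<lambda>f. \<Sum>j<n. c j * E j q f |c. True})"
    by (elim exE) (rule that)
  then have W: "openin X W" "p \<in> W" "W \<subseteq> D" "\<And>j. j < n \<Longrightarrow> smooth_field X A W (E j)"
     "\<And>q. q \<in> W \<Longrightarrow> T10 q = {\<lambda>f. \<Sum>j<n. c j * E j q f |c. True}"
    by simp_all
  obtain c where c: "Z0 = (\<lambda>f. \<Sum>j<n. c j * E j p f)" using assms W(5)[OF W(2)] by blast
  let ?Z = "\<lambda>q f. \<Sum>j<n. c j * E j q f"
  have "smooth_field X A W ?Z"
    unfolding smooth_field_def
  proof (intro conjI ballI allI impI)
    show "?Z q \<in> ctangent X A q" if "q \<in> W" for q
      by (rule ctangent_combination) (use W(4) that smooth_field_ctangent in blast)
    fix W' f assume W': "openin X W' \<and> W' \<subseteq> W \<and> smooth_fun A W' f"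
    then show "smooth_fun A W' (\<lambda>q. ?Z q f)"
      by (intro smooth_fun_sum smooth_fun_cmult smooth_field_apply[OF W(4)]) auto
  qed
  then have "smooth_section X A W T10 ?Z" unfolding smooth_section_def using W(5) by blast
  then show ?thesis by (rule that[OF W(1-3)]) (rule c[symmetric])
qed

text \<open>The kernel condition concerns real vectors only. Applied to the real vectors made from
  \<open>Y\<close> and from \<open>\<i>\<close> times \<open>Y\<close>, it yields both the sum and
  the difference of the values on \<open>Y\<close> and on its conjugate.\<close>

lemma T10_contact_zero:
  assumes \<alpha>: "ctangent_linear X A q (\<alpha> q)" "{Z \<in> rtangent X A q. \<alpha> q Z = 0} = re_part (T10 q)"
    and q: "q \<in> D" and Y: "Y \<in> T10 q"
  shows "\<alpha> q Y = 0" "\<alpha> q (conj_vec Y) = 0"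
proof -
  have Yt: "Y \<in> ctangent X A q" using Y T10_eq[OF q] by simp
  have iY: "(\<lambda>f. \<i> * Y f) \<in> T10 q"
    using Y T10_eq[OF q] ctangent_combination[of "{0::nat}" "\<lambda>_. Y" q "\<lambda>_. \<i>"] by simp
  have "(\<lambda>f. Y f + conj_vec Y f) \<in> re_part (T10 q)" unfolding re_part_def using Y by blast
  then have "\<alpha> q (\<lambda>f. 1 * Y f + 1 * conj_vec Y f) = 0" using \<alpha>(2) by auto
  then have 1: "\<alpha> q Y + \<alpha> q (conj_vec Y) = 0"
    using \<alpha>(1) Yt conj_vec_ctangent[OF Yt] unfolding ctangent_linear_def by (metis mult_1)
  have "(\<lambda>f. \<i> * Y f + conj_vec (\<lambda>f. \<i> * Y f) f) \<in> re_part (T10 q)" 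
    unfolding re_part_def by (intro CollectI exI[of _ "\<lambda>f. \<i> * Y f"] conjI refl iY)
  moreover have "(\<lambda>f. \<i> * Y f + conj_vec (\<lambda>f. \<i> * Y f) f) = (\<lambda>f. \<i> * Y f + (- \<i>) * conj_vec Y f)"
    by (simp add: conj_vec_def)
  ultimately have "\<alpha> q (\<lambda>f. \<i> * Y f + (- \<i>) * conj_vec Y f) = 0" using \<alpha>(2) by auto
  then have "\<i> * \<alpha> q Y + (- \<i>) * \<alpha> q (conj_vec Y) = 0"
    using \<alpha>(1) Yt conj_vec_ctangent[OF Yt] unfolding ctangent_linear_def by metis
  then have "\<i> * (\<alpha> q Y - \<alpha> q (conj_vec Y)) = 0" by (simp add: algebra_simps)
  then have "\<alpha> q Y = \<alpha> q (conj_vec Y)" by simp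
  with 1 show "\<alpha> q Y = 0" "\<alpha> q (conj_vec Y) = 0" by simp_all
qed

text \<open>Since \<open>Z\<close> annihilates the conjugates of the \<open>G j\<close>, its value
  on \<open>gy\<close> is half of \<open>b\<close> applied to the components \<open>Z (G j)\<close>.
  Differentiate this along the conjugate field at \<open>p\<close>: the gradient of
  \<open>gy\<close> vanishes there, so only second derivatives remain. The two factors
  \<open>1 / 2\<close> come from \<open>Z p (xc i)\<close> and its conjugate.\<close>

lemma bracket_levi:
  assumes W: "openin X W" "p \<in> W" "W \<subseteq> D" and Z: "smooth_section X A W T10 Z"
    and z: "\<And>j. j \<le> n \<Longrightarrow> Z p (G j) = z j" "\<And>i. Z p (xc i) = (\<Sum>j\<le>n. a i j * z j) / 2"
  shows "(\<Sum>j\<le>n. b j * lie_bracket X A Z (\<lambda>y. conj_vec (Z y)) p (G j)) = - levi z / 2"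
proof -
  let ?C = "\<lambda>y. conj_vec (Z y)"
  have Zf: "smooth_field X A W Z" and ZT: "\<And>q. q \<in> W \<Longrightarrow> Z q \<in> T10 q" using Z unfolding smooth_section_def by auto
  have C: "smooth_field X A W ?C" by (rule smooth_field_conj[OF Zf])
  note Cp = smooth_field_ctangent[OF C W(2)]
  have pX: "p \<in> topspace X" using D_topspace pD by blast
  have Z0: "Z q (\<lambda>y. cnj (G j y)) = 0" if "q \<in> W" "j \<le> n" for q j using ZT[OF that(1)] T10_eq W(3) that by blast
  have zn: "smooth_near X A p (\<lambda>y. Z y (G j))" if "j \<le> n" for j by (rule smooth_field_near[OF Zf W(1,2) G_near[OF that pD]])
  have zx: "smooth_near X A p (\<lambda>y. Z y (xc i))" for i by (rule smooth_field_near[OF Zf W(1,2) smooth_near_xc[OF pD]])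
  note gn = near(5)[OF gy_smooth pD]
  have N: "lie_bracket X A Z ?C p (G j) = - ?C p (\<lambda>y. Z y (G j))" if j: "j \<le> n" for j
  proof -
    have "Z p (\<lambda>y. ?C y (G j)) = 0"
      by (rule field_zero[OF Zf W(1,2)]) (use Z0 j in \<open>simp add: conj_vec_def\<close>)
    then show ?thesis using G_near[OF j pD] by (simp add: lie_bracket_def)
  qed
  have Zg: "(\<Sum>j\<le>n. b j * Z q (G j)) = 2 * (\<Sum>i\<in>UNIV. Z q (xc i) * grad gy i q)" if q: "q \<in> W" for q
  proof -
    have qD: "q \<in> D" and qX: "q \<in> topspace X" using q W D_topspace by auto
    note Zq = smooth_field_ctangent[OF Zf q]
    have s: "smooth_near X A q (\<lambda>y. b j * G j y)" "smooth_near X A q (\<lambda>y. cnj (b j) * cnj (G j y))" if "j \<in> {..n}" for j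
      using that by (auto intro!: smooth_near_cmult smooth_near_cnj G_near qD)
    have eq: "2 * gf gy y = (\<Sum>j\<le>n. b j * G j y) + (\<Sum>j\<le>n. cnj (b j) * cnj (G j y))" if "y \<in> W" for y
    proof -
      have "(\<Sum>j\<le>n. b j * G j y) + cnj (\<Sum>j\<le>n. b j * G j y) = 2 * gf gy y"
        using that W(3) unfolding complex_add_cnj by (auto simp: gf_def gy_def)
      then show ?thesis by simp
    qed
    have "2 * Z q (gf gy) = Z q (\<lambda>y. 2 * gf gy y)" by (rule ctangent_cmult[OF Zq near(1)[OF gy_smooth qD], symmetric])
    also have "\<dots> = Z q (\<lambda>y. (\<Sum>j\<le>n. b j * G j y) + (\<Sum>j\<le>n. cnj (b j) * cnj (G j y)))"
      by (rule ctangent_cong[OF Zq W(1) q eq smooth_near_cmult[OF near(1)[OF gy_smooth qD]]])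
    also have "\<dots> = Z q (\<lambda>y. \<Sum>j\<le>n. b j * G j y) + Z q (\<lambda>y. \<Sum>j\<le>n. cnj (b j) * cnj (G j y))"
      by (intro ctangent_add[OF Zq] smooth_near_sum[OF qX] s)
    also have "Z q (\<lambda>y. \<Sum>j\<le>n. b j * G j y) = (\<Sum>j\<le>n. Z q (\<lambda>y. b j * G j y))" by (rule ctangent_sum[OF Zq qX s(1)])
    also have "\<dots> = (\<Sum>j\<le>n. b j * Z q (G j))" by (intro sum.cong refl ctangent_cmult[OF Zq] G_near qD) simp
    also have "Z q (\<lambda>y. \<Sum>j\<le>n. cnj (b j) * cnj (G j y)) = (\<Sum>j\<le>n. Z q (\<lambda>y. cnj (b j) * cnj (G j y)))" by (rule ctangent_sum[OF Zq qX s(2)])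
    also have "\<dots> = (\<Sum>j\<le>n. cnj (b j) * Z q (\<lambda>y. cnj (G j y)))"
      by (intro sum.cong refl ctangent_cmult[OF Zq] smooth_near_cnj G_near qD) simp
    also have "\<dots> = 0" using Z0[OF q] by simp
    finally show ?thesis using tangent_gf[OF gy_smooth Zq qD] by simp
  qed
  have sb: "smooth_near X A p (\<lambda>y. b j * Z y (G j))" if "j \<in> {..n}" for j using zn that by (intro smooth_near_cmult) auto
  have sg: "smooth_near X A p (\<lambda>y. Z y (xc i) * grad gy i y)" for i by (intro smooth_near_mult zx gn)
  have "(\<Sum>j\<le>n. b j * ?C p (\<lambda>y. Z y (G j))) = (\<Sum>j\<le>n. ?C p (\<lambda>y. b j * Z y (G j)))"
    by (intro sum.cong refl ctangent_cmult[OF Cp, symmetric] zn) simp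
  also have "\<dots> = ?C p (\<lambda>y. \<Sum>j\<le>n. b j * Z y (G j))" by (rule ctangent_sum[OF Cp pX sb, symmetric])
  also have "\<dots> = ?C p (\<lambda>y. 2 * (\<Sum>i\<in>UNIV. Z y (xc i) * grad gy i y))"
    by (rule ctangent_cong[OF Cp W(1,2) Zg smooth_near_sum[OF pX sb]])
  also have "\<dots> = 2 * ?C p (\<lambda>y. \<Sum>i\<in>UNIV. Z y (xc i) * grad gy i y)"
    by (rule ctangent_cmult[OF Cp smooth_near_sum[OF pX sg]])
  also have "?C p (\<lambda>y. \<Sum>i\<in>UNIV. Z y (xc i) * grad gy i y) = (\<Sum>i\<in>UNIV. ?C p (\<lambda>y. Z y (xc i) * grad gy i y))"
    by (rule ctangent_sum[OF Cp pX sg])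
  also have "\<dots> = (\<Sum>i\<in>UNIV. Z p (xc i) * ?C p (grad gy i))"
  proof (intro sum.cong refl)
    fix i show "?C p (\<lambda>y. Z y (xc i) * grad gy i y) = Z p (xc i) * ?C p (grad gy i)"
      using ctangent_mult[OF Cp zx gn, of i i] gy_critical by (simp add: grad_def)
  qed
  also have "\<dots> = levi z / 4"
  proof -
    have 4: "(\<Sum>i\<in>UNIV. A i / 2 * (\<Sum>l\<in>UNIV. cnj (A l) / 2 * Q i l)) = (\<Sum>i\<in>UNIV. \<Sum>l\<in>UNIV. Q i l * (cnj (A l) * A i)) / 4"
      for A :: "'m \<Rightarrow> complex" and Q
      by (simp add: sum_distrib_left sum_divide_distrib mult_ac)
    have C': "?C p (xc l) = cnj (\<Sum>j\<le>n. a l j * z j) / 2" for l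
      unfolding conj_vec_def xc_cnj z(2) by (rule complex_cnj_divide[THEN trans]) simp
    show ?thesis unfolding tangent_grad[OF gy_smooth Cp pD] levi_def C' z(2) by (rule 4)
  qed
  finally have "(\<Sum>j\<le>n. b j * ?C p (\<lambda>y. Z y (G j))) = levi z / 2" by simp
  moreover have "(\<Sum>j\<le>n. b j * lie_bracket X A Z ?C p (G j)) = - (\<Sum>j\<le>n. b j * ?C p (\<lambda>y. Z y (G j)))"
    unfolding sum_negf[symmetric] by (intro sum.cong refl) (use N in auto)
  ultimately show ?thesis by simp
qed

text \<open>At \<open>p\<close> the given contact form vanishes on all real tangent vectors on which
  \<open>e\<close>, the imaginary part of \<open>b\<close> applied to the differential of
  \<open>G\<close>, vanishes; so it is a real multiple \<kappa> of \<open>e\<close>. Evaluating both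
  on \<open>- \<i>\<close> times the bracket of a section with its conjugate relates positivity to
  \<open>levi\<close>. The sign of \<kappa> is beyond control.\<close>

lemma levi_sign:
  assumes spc: "strictly_pseudoconvex X A D T10"
  shows "\<exists>s. (s = 1 \<or> s = - 1) \<and> (\<forall>z. (\<Sum>j\<le>n. b j * z j) = 0 \<longrightarrow> (\<exists>j\<le>n. z j \<noteq> 0) \<longrightarrow> s * Re (levi z) > 0)"
proof -
  from spc[unfolded strictly_pseudoconvex_def]
  obtain \<alpha> where \<alpha>0: "real_one_form X A D \<alpha> \<and> (\<forall>p\<in>D. \<exists>Z\<in>rtangent X A p. \<alpha> p Z \<noteq> 0) \<and>
        (\<forall>p\<in>D. {Z \<in> rtangent X A p. \<alpha> p Z = 0} = re_part (T10 p)) \<and>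
        (\<forall>W Z. openin X W \<and> W \<subseteq> D \<and> smooth_section X A W T10 Z \<longrightarrow>
           (\<forall>p\<in>W. Z p \<noteq> (\<lambda>f. 0) \<longrightarrow>
              (\<exists>t>0. ext_deriv X A \<alpha> Z (\<lambda>q. conj_vec (Z q)) p / (2 * \<i>) = complex_of_real t)))"
    by (elim exE) (rule that)
  have \<alpha>: "real_one_form X A D \<alpha>" "\<exists>Z\<in>rtangent X A p. \<alpha> p Z \<noteq> 0"
    "\<And>q. q \<in> D \<Longrightarrow> {Z \<in> rtangent X A q. \<alpha> q Z = 0} = re_part (T10 q)"
    by (fact conjunct1[OF \<alpha>0], fact bspec[OF conjunct1[OF conjunct2[OF \<alpha>0]] pD],
      fact bspec[OF conjunct1[OF conjunct2[OF conjunct2[OF \<alpha>0]]]])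
  have pos: "\<exists>t>0. ext_deriv X A \<alpha> Z (\<lambda>q. conj_vec (Z q)) q / (2 * \<i>) = complex_of_real t"
    if "openin X W" "W \<subseteq> D" "smooth_section X A W T10 Z" "q \<in> W" "Z q \<noteq> (\<lambda>f. 0)" for W Z q
    by (rule conjunct2[OF conjunct2[OF conjunct2[OF \<alpha>0]], rule_format, of W Z q]) (simp_all only: that simp_thms)
  have lin: "ctangent_linear X A q (\<alpha> q)" if "q \<in> D" for q using \<alpha>(1) that unfolding real_one_form_def by blast
  have lin2: "\<alpha> p (\<lambda>f. c * Z f + d * Y f) = c * \<alpha> p Z + d * \<alpha> p Y" if "Z \<in> ctangent X A p" "Y \<in> ctangent X A p" for Z Y c d
    using lin[OF pD] that unfolding ctangent_linear_def by blast
  have comb: "(\<lambda>f. c * Z f + d * Y f) \<in> ctangent X A p" if "Z \<in> ctangent X A p" "Y \<in> ctangent X A p" for Z Y c d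
    using ctangent_combination[of "{..<2::nat}" "\<lambda>j. if j = 0 then Z else Y" p "\<lambda>j. if j = 0 then c else d"] that
    by (simp add: numeral_2_eq_2 lessThan_Suc add.commute)
  define e where "e = (\<lambda>Z :: 'a cvector. Im (\<Sum>j\<le>n. b j * Z (G j)))"
  \<comment> \<open>On real vectors the real part of \<open>b\<close> vanishes by the choice of the
    frame. If \<open>e\<close> vanishes too, \<open>b\<close> annihilates the components, and the
    vector is the real part of one of type (1,0).\<close>
  have kernel: "\<alpha> p Z = 0" if Zr: "Z \<in> rtangent X A p" and e0: "e Z = 0" for Z
  proof -
    have Zt: "Z \<in> ctangent X A p" using Zr by (simp add: rtangent_def)
    have "Z (xc i) = cnj (Z (xc i))" for i using rtangent_real[OF Zr, of "xc i"] xc_cnj by simp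
    then have "Im (Z (xc i)) = 0" for i by (metis Reals_cnj_iff complex_is_Real_iff)
    then have Zx: "Z (xc i) = complex_of_real (Re (Z (xc i)))" for i by (simp add: complex_eq_iff)
    have ZG: "Z (G j) = (\<Sum>i\<in>UNIV. P i j * complex_of_real (Re (Z (xc i))))" if "j \<le> n" for j
      using tangent_G(1)[OF Zt that] Zx by simp
    have "Re (\<Sum>j\<le>n. b j * Z (G j)) = 0" using b_P[of "\<lambda>i. Re (Z (xc i))"] ZG by simp
    then have bz: "(\<Sum>j\<le>n. b j * Z (G j)) = 0" using e0 by (simp add: e_def complex_eq_iff)
    have aR: "Re (\<Sum>j\<le>n. a i j * Z (G j)) = Re (Z (xc i))" for i using a_P[of i "\<lambda>i. Re (Z (xc i))"] ZG by simp
    let ?Y = "tlift (\<lambda>j. Z (G j))"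
    have "Z = (\<lambda>f. 1 * ?Y f + 1 * conj_vec ?Y f)"
    proof (rule ctangent_eqI[OF Zt comb[OF tlift(2)[OF bz] conj_vec_ctangent[OF tlift(2)[OF bz]]] pD])
      fix i
      have "?Y (xc i) + cnj (?Y (xc i)) = complex_of_real (Re (Z (xc i)))"
        unfolding complex_add_cnj tlift(3)[OF bz] using aR[of i] by simp
      then show "Z (xc i) = 1 * ?Y (xc i) + 1 * conj_vec ?Y (xc i)" using Zx[of i] by (simp add: conj_vec_def xc_cnj)
    qed
    then have "Z \<in> re_part (T10 p)" using tlift(1)[OF bz] unfolding re_part_def by auto
    then show ?thesis using \<alpha>(3)[OF pD] by blast
  qed
  obtain T where T: "T \<in> rtangent X A p" "\<alpha> p T \<noteq> 0" using \<alpha>(2) by blast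
  then have eT: "e T \<noteq> 0" using kernel by blast
  have Tt: "T \<in> ctangent X A p" "conj_vec T = T" using T(1) by (auto simp: rtangent_def)
  have "cnj (\<alpha> p T) = \<alpha> p T" using \<alpha>(1) pD Tt unfolding real_one_form_def by metis
  then have "Im (\<alpha> p T) = 0" by (metis Reals_cnj_iff complex_is_Real_iff)
  then have aT: "\<alpha> p T = complex_of_real (Re (\<alpha> p T))" by (simp add: complex_eq_iff)
  define \<kappa> where "\<kappa> = Re (\<alpha> p T) / e T"
  have \<kappa>: "\<kappa> \<noteq> 0" using T(2) eT aT by (auto simp: \<kappa>_def)
  have multiple: "\<alpha> p Z = complex_of_real (\<kappa> * e Z)" if Zr: "Z \<in> rtangent X A p" for Z
  proof -
    let ?c = "complex_of_real (- e Z / e T)"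
    \<comment> \<open>Subtracting the multiple of the reference vector \<open>T\<close> that cancels
      \<open>e\<close> leaves a vector in the kernel.\<close>
    let ?R = "\<lambda>f. 1 * Z f + ?c * T f"
    have Zt: "Z \<in> ctangent X A p" "conj_vec Z = Z" using Zr by (auto simp: rtangent_def)
    have "conj_vec ?R f = conj_vec Z f + ?c * conj_vec T f" for f by (simp add: conj_vec_def)
    then have "conj_vec ?R = ?R" using Zt(2) Tt(2) by (simp add: fun_eq_iff)
    then have Rr: "?R \<in> rtangent X A p"
      unfolding rtangent_def by (intro CollectI conjI comb[OF Zt(1) Tt(1)])
    have "(\<Sum>j\<le>n. b j * ?R (G j)) = (\<Sum>j\<le>n. b j * Z (G j)) + ?c * (\<Sum>j\<le>n. b j * T (G j))"
      by (simp only: distrib_left sum.distrib sum_distrib_left mult_1 mult.left_commute[of "b _" ?c])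
    then have "e ?R = e Z + (- e Z / e T) * e T" unfolding e_def by (simp only: Im_complex_of_real times_complex.sel plus_complex.sel Re_complex_of_real mult_zero_left add_0_right diff_zero minus_zero)
    then have "e ?R = 0" using eT by simp
    from kernel[OF Rr this] have "1 * \<alpha> p Z + ?c * \<alpha> p T = 0" unfolding lin2[OF Zt(1) Tt(1)] .
    then have "\<alpha> p Z = - ?c * complex_of_real (Re (\<alpha> p T))" unfolding aT[symmetric] by (simp add: add_eq_0_iff2)
    then show ?thesis using eT by (simp add: \<kappa>_def)
  qed
  have main: "- \<kappa> * Re (levi z) > 0" if bz: "(\<Sum>j\<le>n. b j * z j) = 0" and nz: "\<exists>j\<le>n. z j \<noteq> 0" for z
  proof -
    obtain W Z where W: "openin X W" "p \<in> W" "W \<subseteq> D" "smooth_section X A W T10 Z" "Z p = tlift z"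
      using T10_extend[OF tlift(1)[OF bz]] by blast
    let ?C = "\<lambda>y. conj_vec (Z y)" and ?N = "lie_bracket X A Z (\<lambda>y. conj_vec (Z y)) p"
    have Zf: "smooth_field X A W Z" and ZT: "\<And>q. q \<in> W \<Longrightarrow> Z q \<in> T10 q" using W(4) unfolding smooth_section_def by auto
    have C: "smooth_field X A W ?C" by (rule smooth_field_conj[OF Zf])
    have "Z p \<noteq> (\<lambda>f. 0)" using nz tlift(4)[OF bz] W(5) by auto
    then obtain t where t: "t > 0" "ext_deriv X A \<alpha> Z ?C p / (2 * \<i>) = complex_of_real t"
      using pos[OF W(1,3,4,2)] by blast
    have 0: "\<alpha> q (Z q) = 0" "\<alpha> q (?C q) = 0" if q: "q \<in> W" for q
    proof -
      have qD: "q \<in> D" using q W(3) by blast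
      note zero = T10_contact_zero[where q = q and Y = "Z q" and \<alpha> = \<alpha>, OF lin[OF qD] \<alpha>(3)[OF qD] qD ZT[OF q]]
      show "\<alpha> q (Z q) = 0" "\<alpha> q (?C q) = 0" by (fact zero(1), fact zero(2))
    qed
    have "Z p (\<lambda>y. \<alpha> y (?C y)) = 0" by (rule field_zero[OF Zf W(1,2) 0(2)])
    moreover have "?C p (\<lambda>y. \<alpha> y (Z y)) = 0" by (rule field_zero[OF C W(1,2) 0(1)])
    ultimately have ed: "ext_deriv X A \<alpha> Z ?C p = - \<alpha> p ?N" by (simp add: ext_deriv_def)
    have Nt: "?N \<in> ctangent X A p" by (rule lie_bracket_ctangent[OF Zf C W(1,2)])
    \<comment> \<open>The bracket is imaginary, hence \<open>- \<i>\<close> times it is a real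
      vector. The zero summand only brings it into the two-term form of \<open>lin2\<close>.\<close>
    let ?R = "\<lambda>f. (- \<i>) * ?N f + 0 * ?N f"
    have Rr: "?R \<in> rtangent X A p"
    proof -
      have "conj_vec ?R f = \<i> * conj_vec ?N f" for f by (simp add: conj_vec_def)
      then have "conj_vec ?R = ?R" unfolding bracket_conj_imaginary by (simp add: fun_eq_iff)
      then show ?thesis unfolding rtangent_def by (intro CollectI conjI comb[OF Nt Nt])
    qed
    have "(\<Sum>j\<le>n. b j * ?N (G j)) = - levi z / 2"
      by (rule bracket_levi[OF W(1-4)]) (use tlift[OF bz] W(5) in auto)
    then have eR: "(\<Sum>j\<le>n. b j * ?R (G j)) = \<i> * levi z / 2"
      by (simp add: mult.left_commute[of "b _" \<i>] sum_negf flip: sum_distrib_left)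
    have eR': "e ?R = Re (levi z) / 2" unfolding e_def eR by simp
    have "- \<i> * \<alpha> p ?N = - \<i> * \<alpha> p ?N + 0 * \<alpha> p ?N" by simp
    also have "\<dots> = \<alpha> p ?R" by (rule lin2[OF Nt Nt, symmetric])
    also have "\<dots> = complex_of_real (\<kappa> * (Re (levi z) / 2))" unfolding multiple[OF Rr] eR' by (rule refl)
    finally have "- \<i> * \<alpha> p ?N = complex_of_real (\<kappa> * (Re (levi z) / 2))" .
    moreover have "- \<alpha> p ?N = 2 * \<i> * complex_of_real t" using t(2) unfolding ed by (simp add: field_simps)
    then have "\<alpha> p ?N = - (2 * \<i> * complex_of_real t)" by (metis minus_minus)
    ultimately have "complex_of_real (\<kappa> * (Re (levi z) / 2)) = - \<i> * - (2 * \<i> * complex_of_real t)" by simp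
    also have "\<dots> = - 2 * complex_of_real t" by (simp add: mult.left_commute[of \<i> 2])
    finally have "complex_of_real (\<kappa> * (Re (levi z) / 2)) = - 2 * complex_of_real t" .
    then have "\<kappa> * (Re (levi z) / 2) = - 2 * t"
      by (metis (mono_tags, opaque_lifting) of_real_eq_iff of_real_minus of_real_mult of_real_numeral)
    then show ?thesis using t(1) by simp
  qed
  show ?thesis
  proof (cases "\<kappa> < 0")
    case True
    then show ?thesis using main by (intro exI[of _ 1]) (auto simp: mult_less_0_iff)
  next
    case False
    then show ?thesis using main \<kappa> by (intro exI[of _ "-1"]) (auto simp: mult_less_0_iff)
  qed
qed

end

subsection \<open>Convex graph coordinates\<close>

lemma compatible_chart_subset:
  fixes \<phi> :: "'a \<Rightarrow> real^'m::finite"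
  assumes A: "smooth_atlas X A" and c: "compatible_chart X A D \<phi>" and W: "openin X W" "W \<subseteq> D"
  shows "compatible_chart X A W \<phi>"
proof -
  interpret coordinate_chart X A D \<phi> by unfold_locales (use A c in auto)
  have o: "open (\<phi> ` W)" by (rule image_open[OF W])
  have s: "smooth_on (\<phi> ` W) (\<lambda>x. x)" by (rule smooth_on_linear[OF bounded_linear_ident o])
  have h: "homeomorphism (\<phi> ` W) (\<phi> ` W) (\<lambda>x. x) (\<lambda>x. x)" by (simp add: homeomorphism_def)
  have "{q \<in> D. \<phi> q \<in> \<phi> ` W} = W" using W(2) phi_inj by (auto simp: inj_on_def)
  with compatible_chart_compose(1)[OF A c o image_mono[OF W(2)] o h s s] show ?thesis by (simp add: comp_def)
qed

lemma smooth_field_subset: "smooth_field X A W Z \<Longrightarrow> W' \<subseteq> W \<Longrightarrow> smooth_field X A W' Z"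
  unfolding smooth_field_def by (meson order_trans subsetD)

lemma complex_subbundle_subset:
  assumes V: "complex_subbundle X A r U V" and W: "openin X W" "W \<subseteq> U"
  shows "complex_subbundle X A r W V"
proof -
  let ?B = "\<lambda>E q. (\<forall>c. (\<lambda>f. \<Sum>j<r. c j * E j q f) = (\<lambda>f. 0) \<longrightarrow> (\<forall>j<r. c j = 0)) \<and>
         V q = {\<lambda>f. \<Sum>j<r. c j * E j q f |c. True}"
  have "\<exists>W' E. openin X W' \<and> p \<in> W' \<and> W' \<subseteq> W \<and> (\<forall>j<r. smooth_field X A W' (E j)) \<and> (\<forall>q\<in>W'. ?B E q)" if p: "p \<in> W" for p
  proof -
    have pU: "p \<in> U" using p W(2) by blast
    from bspec[OF V[unfolded complex_subbundle_def] pU]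
    obtain W0 E where W0: "openin X W0 \<and> p \<in> W0 \<and> W0 \<subseteq> U \<and> (\<forall>j<r. smooth_field X A W0 (E j)) \<and> (\<forall>q\<in>W0. ?B E q)"
      by (elim exE) (rule that)
    have 1: "openin X (W0 \<inter> W)" using W0 W(1) by (intro openin_Int) simp_all
    have 2: "p \<in> W0 \<inter> W" using W0 p by simp
    have 3: "W0 \<inter> W \<subseteq> W" by simp
    have 4: "\<forall>j<r. smooth_field X A (W0 \<inter> W) (E j)"
      using W0 smooth_field_subset[of X A W0 _ "W0 \<inter> W"] by simp
    have 5: "\<forall>q\<in>W0 \<inter> W. ?B E q"
      by (rule ballI, rule bspec[OF conjunct2[OF conjunct2[OF conjunct2[OF conjunct2[OF W0]]]]]) simp
    show ?thesis
      by (rule exI[of _ "W0 \<inter> W"], rule exI[of _ E]) (rule conjI[OF 1 conjI[OF 2 conjI[OF 3 conjI[OF 4 5]]]])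
  qed
  then show ?thesis unfolding complex_subbundle_def by (rule ballI)
qed

lemma strictly_pseudoconvex_subset:
  assumes V: "strictly_pseudoconvex X A U V" and W: "W \<subseteq> U"
  shows "strictly_pseudoconvex X A W V"
proof -
  let ?P = "\<lambda>\<alpha> Z p. \<exists>t>0. ext_deriv X A \<alpha> Z (\<lambda>q. conj_vec (Z q)) p / (2 * \<i>) = complex_of_real t"
  from V[unfolded strictly_pseudoconvex_def]
  obtain \<alpha> where \<alpha>: "real_one_form X A U \<alpha> \<and> (\<forall>p\<in>U. \<exists>Z\<in>rtangent X A p. \<alpha> p Z \<noteq> 0) \<and>
        (\<forall>p\<in>U. {Z \<in> rtangent X A p. \<alpha> p Z = 0} = re_part (V p)) \<and>
        (\<forall>W Z. openin X W \<and> W \<subseteq> U \<and> smooth_section X A W V Z \<longrightarrow> (\<forall>p\<in>W. Z p \<noteq> (\<lambda>f. 0) \<longrightarrow> ?P \<alpha> Z p))"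
    by (elim exE) (rule that)
  note 1 = conjunct1[OF \<alpha>] and 2 = conjunct1[OF conjunct2[OF \<alpha>]]
    and 3 = conjunct1[OF conjunct2[OF conjunct2[OF \<alpha>]]] and 4 = conjunct2[OF conjunct2[OF conjunct2[OF \<alpha>]]]
  have "real_one_form X A W \<alpha>"
    using 1 W unfolding real_one_form_def by (meson order_trans subsetD)
  moreover have "\<forall>p\<in>W. \<exists>Z\<in>rtangent X A p. \<alpha> p Z \<noteq> 0" by (rule ballI) (use 2 W in blast)
  moreover have "\<forall>p\<in>W. {Z \<in> rtangent X A p. \<alpha> p Z = 0} = re_part (V p)"
    by (rule ballI, rule bspec[OF 3]) (use W in blast)
  moreover have "\<forall>W' Z. openin X W' \<and> W' \<subseteq> W \<and> smooth_section X A W' V Z \<longrightarrow> (\<forall>p\<in>W'. Z p \<noteq> (\<lambda>f. 0) \<longrightarrow> ?P \<alpha> Z p)"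
  proof (intro allI impI)
    fix W' Z assume W': "openin X W' \<and> W' \<subseteq> W \<and> smooth_section X A W' V Z"
    show "\<forall>p\<in>W'. Z p \<noteq> (\<lambda>f. 0) \<longrightarrow> ?P \<alpha> Z p"
      by (rule 4[rule_format, THEN ballI[OF impI]]) (use W' W in auto)
  qed
  ultimately show ?thesis unfolding strictly_pseudoconvex_def by (intro exI[of _ \<alpha>] conjI)
qed

lemma smooth_on_sum_mult:
  fixes f g :: "'i \<Rightarrow> 'b::real_normed_vector \<Rightarrow> 'c::real_normed_algebra"
  assumes S: "open S" and f: "\<And>i. i \<in> I \<Longrightarrow> smooth_on S (f i)" and g: "\<And>i. i \<in> I \<Longrightarrow> smooth_on S (g i)"
  shows "smooth_on S (\<lambda>x. \<Sum>i\<in>I. f i x * g i x)"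
    and "x \<in> S \<Longrightarrow> ddir v (\<lambda>x. \<Sum>i\<in>I. f i x * g i x) x = (\<Sum>i\<in>I. ddir v (f i) x * g i x + f i x * ddir v (g i) x)"
proof -
  show "smooth_on S (\<lambda>x. \<Sum>i\<in>I. f i x * g i x)" by (intro smooth_on_sum smooth_on_mult S f g)
  assume x: "x \<in> S"
  have "((\<lambda>x. \<Sum>i\<in>I. f i x * g i x) has_derivative (\<lambda>v. \<Sum>i\<in>I. f i x * ddir v (g i) x + ddir v (f i) x * g i x)) (at x)"
    by (intro has_derivative_sum has_derivative_mult has_derivative_ddir smooth_on_differentiable[OF f x] smooth_on_differentiable[OF g x])
  from ddir_eqI[OF this] show "ddir v (\<lambda>x. \<Sum>i\<in>I. f i x * g i x) x = (\<Sum>i\<in>I. ddir v (f i) x * g i x + f i x * ddir v (g i) x)"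
    by (simp add: add.commute)
qed

lemma ddir_compose:
  assumes "f differentiable (at x)" "h differentiable (at (f x))"
  shows "ddir v (\<lambda>x. h (f x)) x = ddir (ddir v f x) h (f x)"
  by (rule ddir_eqI[OF has_derivative_compose[OF has_derivative_ddir[OF assms(1)] has_derivative_ddir[OF assms(2)]]])

lemma smooth_on_linear_form:
  fixes h :: "nat \<Rightarrow> real^'m \<Rightarrow> complex"
  assumes S: "open S" and h: "\<And>j. j \<le> n \<Longrightarrow> smooth_on S (h j)"
  shows "smooth_on S (\<lambda>x. \<Sum>j\<le>n. c j * h j x)"
    and "x \<in> S \<Longrightarrow> ddir v (\<lambda>x. \<Sum>j\<le>n. c j * h j x) x = (\<Sum>j\<le>n. c j * ddir v (h j) x)"
proof -
  have c: "ddir v (\<lambda>x. c j) x = 0" for j x by (rule ddir_eqI[OF has_derivative_const])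
  show "smooth_on S (\<lambda>x. \<Sum>j\<le>n. c j * h j x)"
    by (rule smooth_on_sum_mult(1)[OF S smooth_on_const h]) simp
  show "ddir v (\<lambda>x. \<Sum>j\<le>n. c j * h j x) x = (\<Sum>j\<le>n. c j * ddir v (h j) x)" if "x \<in> S"
    using smooth_on_sum_mult(2)[where I = "{..n}" and f = "\<lambda>j x. c j" and g = h, OF S smooth_on_const h that] c by simp
qed

context embedded_point
begin

definition Pv :: "real^'m \<Rightarrow> nat \<Rightarrow> complex" where
  "Pv v j = (\<Sum>i\<in>UNIV. P i j * complex_of_real (v $ i))"

lemma G_deriv_Pv: "j \<le> n \<Longrightarrow> ddir v (G j \<circ> inv_into D \<phi>) (\<phi> p) = Pv v j"
  unfolding Pv_def by (rule G_deriv_dir)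

lemma Re_Pv: "Re (\<Sum>j\<le>n. b j * Pv v j) = 0" "Re (\<Sum>j\<le>n. a k j * Pv v j) = v $ k"
  unfolding Pv_def by (rule b_P, rule a_P)

text \<open>The Levi form is known to be positive only on the hyperplane where \<open>b\<close>
  vanishes. The squared modulus of \<open>b\<close> is an admissible correction because a
  holomorphic quadratic term can realise it on tangent vectors.\<close>

lemma Pv_positive:
  assumes pos: "\<And>z. (\<Sum>j\<le>n. b j * z j) = 0 \<Longrightarrow> (\<exists>j\<le>n. z j \<noteq> 0) \<Longrightarrow> Re (levi z) > 0"
  obtains C where "\<And>v. v \<noteq> 0 \<Longrightarrow> Re (levi (Pv v)) + C * (cmod (\<Sum>j\<le>n. b j * Pv v j))\<^sup>2 > 0"
proof -
  have hom: "Pv (t *\<^sub>R v) j = complex_of_real t * Pv v j" for t v j by (simp add: Pv_def sum_distrib_left mult_ac)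
  have hs: "(\<Sum>j\<le>n. c j * Pv (t *\<^sub>R v) j) = complex_of_real t * (\<Sum>j\<le>n. c j * Pv v j)" for c t v
    by (simp add: hom sum_distrib_left mult_ac)
  have hl: "levi (Pv (t *\<^sub>R v)) = complex_of_real (t\<^sup>2) * levi (Pv v)" for t v
    unfolding levi_def hs by (simp add: sum_distrib_left power2_eq_square mult_ac)
  have cont: "continuous_on UNIV (\<lambda>v. \<Sum>j\<le>n. c j * Pv v j)" for c
    unfolding Pv_def by (intro continuous_intros)
  show ?thesis
  proof (rule positive_combination[of "\<lambda>v. Re (levi (Pv v))" "\<lambda>v. (cmod (\<Sum>j\<le>n. b j * Pv v j))\<^sup>2"])
    show "continuous_on UNIV (\<lambda>v. Re (levi (Pv v)))" unfolding levi_def by (intro continuous_intros cont)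
    show "continuous_on UNIV (\<lambda>v. (cmod (\<Sum>j\<le>n. b j * Pv v j))\<^sup>2)" by (intro continuous_intros cont)
    show "Re (levi (Pv (t *\<^sub>R v))) = t\<^sup>2 * Re (levi (Pv v))" for t v
      unfolding hl by (simp only: Re_complex_of_real Im_complex_of_real times_complex.sel mult_zero_left diff_zero)
    show "(cmod (\<Sum>j\<le>n. b j * Pv (t *\<^sub>R v) j))\<^sup>2 = t\<^sup>2 * (cmod (\<Sum>j\<le>n. b j * Pv v j))\<^sup>2" for t v
      unfolding hs by (simp add: norm_mult power_mult_distrib)
    show "(cmod (\<Sum>j\<le>n. b j * Pv v j))\<^sup>2 \<ge> 0" for v by simp
    show "Re (levi (Pv v)) > 0" if v: "v \<noteq> 0" and 0: "(cmod (\<Sum>j\<le>n. b j * Pv v j))\<^sup>2 = 0" for v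
    proof (rule pos)
      show "(\<Sum>j\<le>n. b j * Pv v j) = 0" using 0 by simp
      show "\<exists>j\<le>n. Pv v j \<noteq> 0"
      proof (rule ccontr)
        assume "\<not> ?thesis"
        then have "v $ k = 0" for k using Re_Pv(2)[of k v] by simp
        then show False using v by (simp add: vec_eq_iff)
      qed
    qed
  qed (use that in blast)
qed

text \<open>\<open>G'\<close> is \<open>G\<close> followed by the local biholomorphism \<open>z \<mapsto> z + q(z) \<kappa>\<close>, where \<open>b \<cdot> \<kappa> = 1\<close> and \<open>q\<close>
  is the quadratic form given as a sum of products of linear forms \<open>l s\<close> and \<open>r s\<close>.\<close>

lemma quadratic_change:
  fixes l r :: "'s::finite \<Rightarrow> nat \<Rightarrow> complex"
  obtains D' G' where "embedded_point X A D' \<phi> n P nu a b p G' T10" "D' \<subseteq> D"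
    "\<And>v. hess (\<lambda>x. Re (\<Sum>j\<le>n. b j * (G' j \<circ> inv_into D' \<phi>) x)) (\<phi> p) v =
       hess gy (\<phi> p) v + 2 * Re (\<Sum>s\<in>UNIV. (\<Sum>j\<le>n. l s j * Pv v j) * (\<Sum>j\<le>n. r s j * Pv v j))"
proof -
  \<comment> \<open>\<open>b\<close> has real part one on \<open>nu\<close>, so it can be normalised
    to take the value one; the quadratic term then enters the coordinate \<open>y\<close> with
    coefficient one.\<close>
  define bn where "bn = (\<Sum>j\<le>n. b j * nu j)"
  have bn: "bn \<noteq> 0" using Re_b_nu unfolding bn_def by (metis zero_complex.sel(1) zero_neq_one)
  define \<kappa> where "\<kappa> = (\<lambda>j. nu j / bn)"
  have b\<kappa>: "(\<Sum>j\<le>n. b j * \<kappa> j) = 1" using bn by (simp add: \<kappa>_def bn_def flip: sum_divide_distrib)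
  define L where "L = (\<lambda>s z. \<Sum>j\<le>n. l s j * z j)"
  define R where "R = (\<lambda>s z. \<Sum>j\<le>n. r s j * z j)"
  define h where "h = (\<lambda>j. G j \<circ> inv_into D \<phi>)"
  define S where "S = \<phi> ` D"
  have S: "open S" "\<phi> p \<in> S" using D_image_open pD by (auto simp: S_def)
  have hS: "smooth_on S (h j)" if "j \<le> n" for j using G_chart_smooth[OF that] by (simp add: h_def S_def)
  have h0: "h j (\<phi> p) = 0" if "j \<le> n" for j using G_zero[OF that] pD by (simp add: h_def)
  have hG: "h j (\<phi> y) = G j y" if "y \<in> D" for j y using that by (simp add: h_def)
  have hv: "ddir v (h j) (\<phi> p) = Pv v j" if "j \<le> n" for v j using G_deriv_Pv[OF that] by (simp add: h_def)
  define Lh where "Lh = (\<lambda>s x. L s (\<lambda>j. h j x))"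
  define Rh where "Rh = (\<lambda>s x. R s (\<lambda>j. h j x))"
  have Ls: "smooth_on S (Lh s)" and Rs: "smooth_on S (Rh s)" for s
    unfolding Lh_def L_def Rh_def R_def by (rule smooth_on_linear_form(1)[OF S(1) hS], assumption)+
  have L0: "Lh s (\<phi> p) = 0" and R0: "Rh s (\<phi> p) = 0" for s
    using h0 by (simp_all add: Lh_def L_def Rh_def R_def)
  have Lv: "ddir v (Lh s) (\<phi> p) = L s (Pv v)" and Rv: "ddir v (Rh s) (\<phi> p) = R s (Pv v)" for s v
    unfolding Lh_def L_def Rh_def R_def using smooth_on_linear_form(2)[OF S(1) hS S(2)] hv by simp_all
  define Q where "Q = (\<lambda>x. \<Sum>s\<in>UNIV. Lh s x * Rh s x)"
  have Qs: "smooth_on S Q" unfolding Q_def by (rule smooth_on_sum_mult(1)[OF S(1) Ls Rs])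
  have dQ: "ddir v Q x = (\<Sum>s\<in>UNIV. ddir v (Lh s) x * Rh s x) + (\<Sum>s\<in>UNIV. Lh s x * ddir v (Rh s) x)" if "x \<in> S" for v x
    unfolding Q_def sum.distrib[symmetric] by (rule smooth_on_sum_mult(2)[OF S(1) Ls Rs that])
  \<comment> \<open>\<open>Q\<close> vanishes to second order at \<open>p\<close>, so the values and
    first derivatives prescribed there are the same for \<open>G'\<close> as for
    \<open>G\<close>.\<close>
  have dQ0: "ddir v Q (\<phi> p) = 0" for v unfolding dQ[OF S(2)] by (simp add: L0 R0)
  have ddQ: "ddir v (ddir v Q) (\<phi> p) = 2 * (\<Sum>s\<in>UNIV. L s (Pv v) * R s (Pv v))" for v
  proof -
    let ?f1 = "\<lambda>x. \<Sum>s\<in>UNIV. ddir v (Lh s) x * Rh s x" and ?f2 = "\<lambda>x. \<Sum>s\<in>UNIV. Lh s x * ddir v (Rh s) x"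
    have s1: "smooth_on S ?f1" and s2: "smooth_on S ?f2"
      by (rule smooth_on_sum_mult(1)[OF S(1) smooth_on_ddir[OF Ls] Rs], rule smooth_on_sum_mult(1)[OF S(1) Ls smooth_on_ddir[OF Rs]])
    have "ddir v (ddir v Q) (\<phi> p) = ddir v (\<lambda>x. ?f1 x + ?f2 x) (\<phi> p)" by (rule ddir_cong[OF S dQ])
    also have "\<dots> = ddir v ?f1 (\<phi> p) + ddir v ?f2 (\<phi> p)"
      by (rule ddir_add[OF smooth_on_differentiable[OF s1 S(2)] smooth_on_differentiable[OF s2 S(2)]])
    also have "ddir v ?f1 (\<phi> p) = (\<Sum>s\<in>UNIV. L s (Pv v) * R s (Pv v))"
      unfolding smooth_on_sum_mult(2)[OF S(1) smooth_on_ddir[OF Ls] Rs S(2)] by (simp add: R0 Lv Rv)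
    also have "ddir v ?f2 (\<phi> p) = (\<Sum>s\<in>UNIV. L s (Pv v) * R s (Pv v))"
      unfolding smooth_on_sum_mult(2)[OF S(1) Ls smooth_on_ddir[OF Rs] S(2)] by (simp add: L0 Lv Rv)
    finally show ?thesis by simp
  qed
  \<comment> \<open>The Jacobian determinant of the quadratic map: its differential is the identity
    plus a rank-one map, with determinant one plus the derivative of the quadratic form in direction
    \<kappa>. Off the zeros of \<open>m\<close> the map does not change which vectors are of type
    (1,0).\<close>
  define m where "m = (\<lambda>x. 1 + (\<Sum>s\<in>UNIV. L s \<kappa> * Rh s x + Lh s x * R s \<kappa>))"
  have mc: "continuous_on S m" unfolding m_def
    by (intro continuous_intros smooth_on_continuous Ls Rs)
  define M where "M = S \<inter> m -` (- {0})"
  have M: "open M" "M \<subseteq> S" "\<phi> p \<in> M"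
    using continuous_open_preimage[OF mc S(1), of "- {0}"] S(2) by (auto simp: M_def m_def L0 R0 open_Compl)
  define D' where "D' = {q \<in> D. \<phi> q \<in> M}"
  have D': "openin X D'" "D' \<subseteq> D" "p \<in> D'" using preimage_open[OF M(1)] pD M(3) by (auto simp: D'_def)
  have iD': "\<phi> ` D' = M" using M(2) by (auto simp: D'_def S_def)
  have inv': "inv_into D' \<phi> (\<phi> y) = y" if "y \<in> D'" for y
    using inj_on_subset[OF phi_inj D'(2)] that by simp
  define G' where "G' = (\<lambda>j y. G j y + \<kappa> j * (\<Sum>s\<in>UNIV. L s (\<lambda>j. G j y) * R s (\<lambda>j. G j y)))"
  have G'h: "(G' j \<circ> inv_into D' \<phi>) x = h j x + \<kappa> j * Q x" if x: "x \<in> M" for j x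
  proof -
    obtain y where y: "y \<in> D'" "x = \<phi> y" using x iD' by blast
    then have "y \<in> D" using D'(2) by blast
    then show ?thesis using inv'[OF y(1)] y(2) by (simp add: G'_def Q_def Lh_def Rh_def hG)
  qed
  have LG: "smooth_fun A D (\<lambda>y. L s (\<lambda>j. G j y))" and RG: "smooth_fun A D (\<lambda>y. R s (\<lambda>j. G j y))" for s
    unfolding L_def R_def by (intro smooth_fun_sum smooth_fun_cmult D_open G_smooth; simp)+
  have QG: "smooth_fun A D (\<lambda>y. \<Sum>s\<in>UNIV. L s (\<lambda>j. G j y) * R s (\<lambda>j. G j y))"
    by (intro smooth_fun_sum smooth_fun_mult D_open LG RG)
  have G'D: "smooth_fun A D (G' j)" if "j \<le> n" for j
    unfolding G'_def by (intro smooth_fun_add smooth_fun_cmult D_open G_smooth that QG)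
  have T: "T10 q = {Z \<in> ctangent X A q. \<forall>j\<le>n. Z (\<lambda>y. cnj (G' j y)) = 0}" if q: "q \<in> D'" for q
  proof -
    have qD: "q \<in> D" and qX: "q \<in> topspace X" and mq: "m (\<phi> q) \<noteq> 0"
      using q D'(2) D_topspace by (auto simp: D'_def M_def)
    have near: "smooth_near X A q f" if "smooth_fun A D f" for f by (rule smooth_nearI[OF D_open qD that])
    have Y: "Y (G' j) = Y (G j) + \<kappa> j * (\<Sum>s\<in>UNIV. L s (\<lambda>j. Y (G j)) * Rh s (\<phi> q) + Lh s (\<phi> q) * R s (\<lambda>j. Y (G j)))"
      if Yt: "Y \<in> ctangent X A q" and j: "j \<le> n" for Y j
    proof -
      have lin: "Y (\<lambda>y. \<Sum>j\<le>n. c j * G j y) = (\<Sum>j\<le>n. c j * Y (G j))" for c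
      proof -
        have "Y (\<lambda>y. \<Sum>j\<le>n. c j * G j y) = (\<Sum>j\<le>n. Y (\<lambda>y. c j * G j y))"
          by (rule ctangent_sum[OF Yt qX]) (intro smooth_near_cmult near G_smooth, simp)
        also have "\<dots> = (\<Sum>j\<le>n. c j * Y (G j))"
          by (intro sum.cong refl ctangent_cmult[OF Yt] near G_smooth) simp
        finally show ?thesis .
      qed
      have "Y (G' j) = Y (G j) + Y (\<lambda>y. \<kappa> j * (\<Sum>s\<in>UNIV. L s (\<lambda>j. G j y) * R s (\<lambda>j. G j y)))"
        unfolding G'_def by (intro ctangent_add[OF Yt] near smooth_fun_cmult D_open G_smooth j QG)
      also have "Y (\<lambda>y. \<kappa> j * (\<Sum>s\<in>UNIV. L s (\<lambda>j. G j y) * R s (\<lambda>j. G j y))) = \<kappa> j * Y (\<lambda>y. \<Sum>s\<in>UNIV. L s (\<lambda>j. G j y) * R s (\<lambda>j. G j y))"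
        by (rule ctangent_cmult[OF Yt near[OF QG]])
      also have "Y (\<lambda>y. \<Sum>s\<in>UNIV. L s (\<lambda>j. G j y) * R s (\<lambda>j. G j y)) = (\<Sum>s\<in>UNIV. Y (\<lambda>y. L s (\<lambda>j. G j y) * R s (\<lambda>j. G j y)))"
        by (rule ctangent_sum[OF Yt qX near[OF smooth_fun_mult[OF D_open LG RG]]])
      also have "\<dots> = (\<Sum>s\<in>UNIV. L s (\<lambda>j. Y (G j)) * Rh s (\<phi> q) + Lh s (\<phi> q) * R s (\<lambda>j. Y (G j)))"
        unfolding ctangent_mult[OF Yt near[OF LG] near[OF RG]] Lh_def Rh_def hG[OF qD]
        unfolding L_def R_def lin by simp
      finally show ?thesis .
    qed
    have c: "Z (\<lambda>y. cnj (f y)) = cnj (conj_vec Z f)" for Z :: "'a cvector" and f by (simp add: conj_vec_def)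
    have "(\<forall>j\<le>n. Y (G j) = 0) \<longleftrightarrow> (\<forall>j\<le>n. Y (G' j) = 0)" if Yt: "Y \<in> ctangent X A q" for Y
    proof
      assume "\<forall>j\<le>n. Y (G j) = 0"
      then show "\<forall>j\<le>n. Y (G' j) = 0" using Y[OF Yt] by (simp add: L_def R_def)
    next
      assume 0: "\<forall>j\<le>n. Y (G' j) = 0"
      \<comment> \<open>\<open>w\<close> is the derivative of the quadratic form along
        \<open>Y\<close>. Vanishing of all \<open>Y (G' j)\<close> makes the \<open>Y (G j)\<close>
        proportional to \<kappa>, and inserting this gives
        \<open>w * m (\<phi> q) = 0\<close>.\<close>
      define w where "w = (\<Sum>s\<in>UNIV. L s (\<lambda>j. Y (G j)) * Rh s (\<phi> q) + Lh s (\<phi> q) * R s (\<lambda>j. Y (G j)))"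
      have Yw: "Y (G j) = - w * \<kappa> j" if "j \<le> n" for j
        using Y[OF Yt that] 0 that by (simp add: w_def eq_neg_iff_add_eq_0 mult.commute)
      have LR: "L s (\<lambda>j. Y (G j)) = - w * L s \<kappa>" "R s (\<lambda>j. Y (G j)) = - w * R s \<kappa>" for s
        unfolding L_def R_def sum_distrib_left by (intro sum.cong refl; simp add: Yw)+
      have "w = (\<Sum>s\<in>UNIV. L s (\<lambda>j. Y (G j)) * Rh s (\<phi> q) + Lh s (\<phi> q) * R s (\<lambda>j. Y (G j)))" by (rule w_def)
      also have "\<dots> = (\<Sum>s\<in>UNIV. (- w) * (L s \<kappa> * Rh s (\<phi> q) + Lh s (\<phi> q) * R s \<kappa>))"
        unfolding LR by (intro sum.cong refl) (simp add: algebra_simps)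
      also have "\<dots> = (- w) * (m (\<phi> q) - 1)" by (simp only: m_def sum_distrib_left add_diff_cancel_left')
      finally have "w * m (\<phi> q) = 0" by (simp add: algebra_simps)
      then have "w = 0" using mq by simp
      then show "\<forall>j\<le>n. Y (G j) = 0" using Yw by simp
    qed
    then show ?thesis unfolding T10_eq[OF qD] c complex_cnj_zero_iff using conj_vec_ctangent by blast
  qed
  have M': "smooth_on M (\<lambda>x. h j x + \<kappa> j * Q x)" if "j \<le> n" for j
    by (intro smooth_on_add M smooth_on_linear_compose[OF M(1) bounded_linear_mult_right] smooth_on_subset[OF Qs] smooth_on_subset[OF hS] that)
  have "embedded_point X A D' \<phi> n P nu a b p G' T10"
  proof unfold_locales
    show "compatible_chart X A D' \<phi>" by (rule compatible_chart_subset[OF atlas compat D'(1,2)])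
    show "p \<in> D'" by (rule D'(3))
    show "smooth_fun A D' (G' j)" if "j \<le> n" for j by (rule smooth_fun_subset[OF G'D[OF that] D'(2)])
    show "G' j p = 0" if "j \<le> n" for j using G_zero[OF that] G_zero by (simp add: G'_def L_def)
    show "ddir (axis i 1) (G' j \<circ> inv_into D' \<phi>) (\<phi> p) = P i j" if j: "j \<le> n" for i j
    proof -
      have "ddir (axis i 1) (G' j \<circ> inv_into D' \<phi>) (\<phi> p) = ddir (axis i 1) (\<lambda>x. h j x + \<kappa> j * Q x) (\<phi> p)"
        by (rule ddir_cong[OF M(1,3) G'h])
      also have "\<dots> = ddir (axis i 1) (h j) (\<phi> p) + ddir (axis i 1) (\<lambda>x. \<kappa> j * Q x) (\<phi> p)"
        by (intro ddir_add smooth_on_differentiable[OF hS[OF j] S(2)]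
          smooth_on_differentiable[OF smooth_on_linear_compose[OF S(1) bounded_linear_mult_right Qs] S(2)])
      also have "ddir (axis i 1) (\<lambda>x. \<kappa> j * Q x) (\<phi> p) = \<kappa> j * ddir (axis i 1) Q (\<phi> p)"
        by (rule bounded_linear_ddir[OF bounded_linear_mult_right smooth_on_differentiable[OF Qs S(2)]])
      finally show ?thesis unfolding dQ0 h_def G_deriv[OF j] mult_zero_right add_0_right .
    qed
    show "T10 q = {Z \<in> ctangent X A q. \<forall>j\<le>n. Z (\<lambda>y. cnj (G' j y)) = 0}" if "q \<in> D'" for q by (rule T[OF that])
    show "complex_subbundle X A n D' T10" by (rule complex_subbundle_subset[OF T10_bundle D'(1,2)])
  qed
  moreover have "hess (\<lambda>x. Re (\<Sum>j\<le>n. b j * (G' j \<circ> inv_into D' \<phi>) x)) (\<phi> p) v =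
       hess gy (\<phi> p) v + 2 * Re (\<Sum>s\<in>UNIV. (\<Sum>j\<le>n. l s j * Pv v j) * (\<Sum>j\<le>n. r s j * Pv v j))" (is "hess ?f _ _ = _") for v
  proof -
    have f: "?f x = gy x + Re (Q x)" if "x \<in> M" for x
    proof -
      have "(\<Sum>j\<le>n. b j * (G' j \<circ> inv_into D' \<phi>) x) = (\<Sum>j\<le>n. b j * h j x) + (\<Sum>j\<le>n. b j * \<kappa> j) * Q x"
        unfolding G'h[OF that] by (simp add: distrib_left sum.distrib sum_distrib_right mult.assoc)
      then show ?thesis unfolding b\<kappa> by (simp add: gy_def h_def)
    qed
    have gs: "smooth_on S gy" using gy_smooth by (simp add: S_def)
    have RQ: "smooth_on S (\<lambda>x. Re (Q x))" by (rule smooth_on_linear_compose[OF S(1) bounded_linear_Re Qs])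
    have RdQ: "smooth_on S (\<lambda>x. Re (ddir v Q x))" by (rule smooth_on_linear_compose[OF S(1) bounded_linear_Re smooth_on_ddir[OF Qs]])
    have fs: "smooth_on M ?f"
      by (rule iffD2[OF smooth_on_cong[OF M(1) f] smooth_on_subset[OF smooth_on_add[OF S(1) gs RQ] M(2)]])
    have d1: "ddir v ?f x = ddir v gy x + Re (ddir v Q x)" if x: "x \<in> M" for x
    proof -
      have xS: "x \<in> S" using x M(2) by blast
      have "ddir v ?f x = ddir v (\<lambda>x. gy x + Re (Q x)) x" by (rule ddir_cong[OF M(1) x f])
      also have "\<dots> = ddir v gy x + ddir v (\<lambda>x. Re (Q x)) x"
        by (intro ddir_add smooth_on_differentiable[OF gs xS] smooth_on_differentiable[OF RQ xS])
      also have "ddir v (\<lambda>x. Re (Q x)) x = Re (ddir v Q x)"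
        by (rule bounded_linear_ddir[OF bounded_linear_Re smooth_on_differentiable[OF Qs xS]])
      finally show ?thesis .
    qed
    have "hess ?f (\<phi> p) v = ddir v (ddir v ?f) (\<phi> p)" by (rule hess_eq[OF M(1,3) fs])
    also have "\<dots> = ddir v (\<lambda>x. ddir v gy x + Re (ddir v Q x)) (\<phi> p)" by (rule ddir_cong[OF M(1,3) d1])
    also have "\<dots> = ddir v (ddir v gy) (\<phi> p) + ddir v (\<lambda>x. Re (ddir v Q x)) (\<phi> p)"
      by (intro ddir_add smooth_on_differentiable[OF smooth_on_ddir[OF gs] S(2)] smooth_on_differentiable[OF RdQ S(2)])
    also have "ddir v (\<lambda>x. Re (ddir v Q x)) (\<phi> p) = Re (ddir v (ddir v Q) (\<phi> p))"
      by (rule bounded_linear_ddir[OF bounded_linear_Re smooth_on_differentiable[OF smooth_on_ddir[OF Qs] S(2)]])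
    also have "ddir v (ddir v gy) (\<phi> p) = hess gy (\<phi> p) v" by (rule hess_eq[OF S gs, symmetric])
    finally show ?thesis unfolding ddQ by (simp add: L_def R_def)
  qed
  ultimately show ?thesis using that D'(2) by blast
qed

text \<open>Write the \<open>a\<close>-components of a tangent vector as \<open>v + \<i> w\<close>.
  The Hessian of \<open>gy\<close> sees only \<open>v\<close>, the Levi form sees \<open>v\<close>
  and \<open>w\<close> with equal signs, and the real part of a holomorphic quadratic form sees them
  with opposite signs. Subtracting half of the latter turns the Hessian into half the Levi form. The
  \<open>b\<close>-component is imaginary, so minus its square is its squared modulus.\<close>

lemma convexify:
  assumes pos: "\<And>z. (\<Sum>j\<le>n. b j * z j) = 0 \<Longrightarrow> (\<exists>j\<le>n. z j \<noteq> 0) \<Longrightarrow> Re (levi z) > 0"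
  obtains D' G' where "embedded_point X A D' \<phi> n P nu a b p G' T10" "D' \<subseteq> D"
    "\<And>v. v \<noteq> 0 \<Longrightarrow> hess (\<lambda>x. Re (\<Sum>j\<le>n. b j * (G' j \<circ> inv_into D' \<phi>) x)) (\<phi> p) v > 0"
proof -
  obtain C where C: "\<And>v. v \<noteq> 0 \<Longrightarrow> Re (levi (Pv v)) + C * (cmod (\<Sum>j\<le>n. b j * Pv v j))\<^sup>2 > 0"
    using Pv_positive[OF pos] by blast
  define Q where "Q = (\<lambda>i l. ddir (axis l 1) (ddir (axis i 1) gy) (\<phi> p))"
  \<comment> \<open>\<open>None\<close> indexes the square of \<open>b\<close>, and
    \<open>Some (i, k)\<close> the product of \<open>a i\<close> and \<open>a k\<close>. The
    quarters in the coefficients become halves through the factor 2 in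
    \<open>quadratic_change\<close>.\<close>
  define l where "l = (\<lambda>s::('m \<times> 'm) option. case s of None \<Rightarrow> b | Some (i, k) \<Rightarrow> a i)"
  define r where "r = (\<lambda>s::('m \<times> 'm) option. case s of None \<Rightarrow> (\<lambda>j. complex_of_real (- C / 4) * b j)
      | Some (i, k) \<Rightarrow> (\<lambda>j. complex_of_real (- Q i k / 4) * a k j))"
  obtain D' G' where D': "embedded_point X A D' \<phi> n P nu a b p G' T10" "D' \<subseteq> D"
    "\<And>v. hess (\<lambda>x. Re (\<Sum>j\<le>n. b j * (G' j \<circ> inv_into D' \<phi>) x)) (\<phi> p) v =
       hess gy (\<phi> p) v + 2 * Re (\<Sum>s\<in>UNIV. (\<Sum>j\<le>n. l s j * Pv v j) * (\<Sum>j\<le>n. r s j * Pv v j))"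
    using quadratic_change[of l r] by blast
  have "hess gy (\<phi> p) v + 2 * Re (\<Sum>s\<in>UNIV. (\<Sum>j\<le>n. l s j * Pv v j) * (\<Sum>j\<le>n. r s j * Pv v j)) > 0" if v: "v \<noteq> 0" for v
  proof -
    define \<alpha> where "\<alpha> = (\<lambda>i. \<Sum>j\<le>n. a i j * Pv v j)"
    define \<beta> where "\<beta> = (\<Sum>j\<le>n. b j * Pv v j)"
    have R: "Re (\<alpha> i) = v $ i" "Re \<beta> = 0" for i using Re_Pv by (simp_all add: \<alpha>_def \<beta>_def)
    have opt: "(\<Sum>s\<in>UNIV. f s) = f None + (\<Sum>i\<in>UNIV. \<Sum>k\<in>UNIV. f (Some (i, k)))" for f :: "('m \<times> 'm) option \<Rightarrow> complex"
      by (simp add: UNIV_option_conv sum.reindex sum.cartesian_product)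
    have hl: "(\<Sum>j\<le>n. l None j * Pv v j) = \<beta>" "(\<Sum>j\<le>n. l (Some (i, k)) j * Pv v j) = \<alpha> i" for i k
      by (simp_all add: l_def \<alpha>_def \<beta>_def)
    have hr: "(\<Sum>j\<le>n. r None j * Pv v j) = complex_of_real (- C / 4) * \<beta>"
      "(\<Sum>j\<le>n. r (Some (i, k)) j * Pv v j) = complex_of_real (- Q i k / 4) * \<alpha> k" for i k
      by (simp_all only: r_def option.case prod.case mult.assoc sum_distrib_left \<alpha>_def \<beta>_def)
    have e1: "(\<Sum>s\<in>UNIV. (\<Sum>j\<le>n. l s j * Pv v j) * (\<Sum>j\<le>n. r s j * Pv v j)) =
        \<beta> * (complex_of_real (- C / 4) * \<beta>) + (\<Sum>i\<in>UNIV. \<Sum>k\<in>UNIV. \<alpha> i * (complex_of_real (- Q i k / 4) * \<alpha> k))"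
      unfolding opt hl hr by (rule refl)
    have e2: "Re (\<beta> * (complex_of_real (- C / 4) * \<beta>)) = C / 4 * (cmod \<beta>)\<^sup>2"
      unfolding cmod_power2 by (simp add: R power2_eq_square)
    have e3: "Re (\<Sum>i\<in>UNIV. \<Sum>k\<in>UNIV. \<alpha> i * (complex_of_real (- Q i k / 4) * \<alpha> k)) =
        (\<Sum>i\<in>UNIV. \<Sum>k\<in>UNIV. - Q i k / 4 * (v $ i * v $ k - Im (\<alpha> i) * Im (\<alpha> k)))"
      unfolding Re_sum by (intro sum.cong refl) (simp add: R field_simps)
    have e4: "Re (levi (Pv v)) = (\<Sum>i\<in>UNIV. \<Sum>k\<in>UNIV. Q i k * (v $ i * v $ k + Im (\<alpha> i) * Im (\<alpha> k)))"
    proof -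
      have "levi (Pv v) = (\<Sum>i\<in>UNIV. \<Sum>k\<in>UNIV. complex_of_real (Q i k) * (cnj (\<alpha> k) * \<alpha> i))"
        by (simp only: levi_def Q_def \<alpha>_def)
      then show ?thesis unfolding Re_sum by (simp add: R algebra_simps)
    qed
    have e5: "hess gy (\<phi> p) v = (\<Sum>i\<in>UNIV. \<Sum>k\<in>UNIV. Q i k * (v $ k * v $ i))" by (simp add: hess_def Q_def)
    have e6: "(\<Sum>i\<in>UNIV. \<Sum>k\<in>UNIV. Q i k * (v $ k * v $ i)) +
        2 * (\<Sum>i\<in>UNIV. \<Sum>k\<in>UNIV. - Q i k / 4 * (v $ i * v $ k - Im (\<alpha> i) * Im (\<alpha> k))) =
        (\<Sum>i\<in>UNIV. \<Sum>k\<in>UNIV. Q i k * (v $ i * v $ k + Im (\<alpha> i) * Im (\<alpha> k))) / 2"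
      unfolding sum_distrib_left sum_divide_distrib sum.distrib[symmetric] by (intro sum.cong refl) (simp add: field_simps)
    show ?thesis
      using C[OF v] e6 unfolding \<beta>_def[symmetric] e4 e5 e1 plus_complex.sel e2 e3 distrib_left by linarith
  qed
  then show ?thesis using that[OF D'(1,2)] unfolding D'(3) by blast
qed

text \<open>The real parts of the forms \<open>a i\<close> applied to the embedding have the
  identity as differential at \<open>p\<close>, so they are coordinates nearby, and in them the
  embedding is a graph. Since \<open>gy\<close> is critical at \<open>p\<close> and the coordinate
  change is the identity to first order, the Hessian at \<open>p\<close> carries over to
  \<open>u\<close>.\<close>

lemma graph_coordinates:
  assumes pos: "\<And>v. v \<noteq> 0 \<Longrightarrow> hess gy (\<phi> p) v > 0"
  obtains D' \<xi> c R m u where "compatible_chart X A D' \<xi>" "p \<in> D'" "\<xi> p = c" "\<xi> ` D' = ball c R" "R > 0" "m > 0"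
    "smooth_on (ball c R) u" "\<And>x v. x \<in> ball c R \<Longrightarrow> hess u x v \<ge> m * (norm v)\<^sup>2"
    "\<And>q. q \<in> D' \<Longrightarrow> T10 q = {Z \<in> ctangent X A q. \<forall>j\<le>n.
       Z (\<lambda>y. cnj ((\<Sum>i\<in>UNIV. P i j * complex_of_real (\<xi> y $ i)) + nu j * complex_of_real (u (\<xi> y)))) = 0}"
proof -
  have pS: "\<phi> p \<in> \<phi> ` D" using pD by blast
  define \<tau> :: "real^'m \<Rightarrow> real^'m" where "\<tau> = (\<lambda>x. \<chi> i. Re (\<Sum>j\<le>n. a i j * (G j \<circ> inv_into D \<phi>) x))"
  have \<tau>i: "(\<lambda>x. \<tau> x $ i) = (\<lambda>x. Re (\<Sum>j\<le>n. a i j * (G j \<circ> inv_into D \<phi>) x))" for i by (simp add: \<tau>_def)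
  have \<tau>s: "smooth_on (\<phi> ` D) \<tau>"
    by (rule smooth_on_vecI[OF D_image_open]) (unfold \<tau>i, rule Re_combination_smooth(1)[OF D_image_open G_chart_smooth])
  have \<tau>d: "ddir v \<tau> (\<phi> p) = v" for v
  proof -
    have "ddir v \<tau> (\<phi> p) $ i = ddir v (\<lambda>x. \<tau> x $ i) (\<phi> p)" for i
      by (rule bounded_linear_ddir[OF bounded_linear_vec_nth smooth_on_differentiable[OF \<tau>s pS], symmetric])
    also have "ddir v (\<lambda>x. \<tau> x $ i) (\<phi> p) = Re (\<Sum>j\<le>n. a i j * ddir v (G j \<circ> inv_into D \<phi>) (\<phi> p))" for i
      unfolding \<tau>i by (rule Re_combination_smooth(2)[OF D_image_open G_chart_smooth pS])
    also have "\<dots> i = v $ i" for i using G_deriv_Pv Re_Pv(2)[of i v] by simp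
    finally show ?thesis by (simp add: vec_eq_iff)
  qed
  obtain U V \<gamma> where U: "open U" "U \<subseteq> \<phi> ` D" "\<phi> p \<in> U" and V: "open V" and hom: "homeomorphism U V \<tau> \<gamma>" and \<gamma>s: "smooth_on V \<gamma>"
    using smooth_inverse_function[OF D_image_open \<tau>s pS \<tau>d] by blast
  have \<gamma>: "\<And>x. x \<in> U \<Longrightarrow> \<gamma> (\<tau> x) = x" "\<And>y. y \<in> V \<Longrightarrow> \<tau> (\<gamma> y) = y" "\<gamma> ` V = U" "\<tau> ` U = V"
    using hom unfolding homeomorphism_def by auto
  define c where "c = \<tau> (\<phi> p)"
  have cV: "c \<in> V" using \<gamma>(4) U(3) by (auto simp: c_def)
  define u where "u = (\<lambda>y. gy (\<gamma> y))"
  have us: "smooth_on V u" unfolding u_def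
    by (rule smooth_on_compose[OF V \<gamma>s _ gy_smooth]) (use \<gamma>(3) U(2) in auto)
  have \<tau>U: "smooth_on U \<tau>" by (rule smooth_on_subset[OF \<tau>s U(2)])
  have hess: "hess u c v = hess gy (\<phi> p) v" for v
  proof -
    let ?f = "\<lambda>i x. ddir v \<tau> x $ i" and ?g = "\<lambda>i x. ddir (axis i 1) u (\<tau> x)"
    have fs: "smooth_on U (?f i)" for i by (rule smooth_on_linear_compose[OF U(1) bounded_linear_vec_nth smooth_on_ddir[OF \<tau>U]])
    have gs: "smooth_on U (?g i)" for i by (rule smooth_on_compose[OF U(1) \<tau>U _ smooth_on_ddir[OF us]]) (use \<gamma>(4) in auto)
    have ud: "u differentiable (at (\<tau> x))" if "x \<in> U" for x by (rule smooth_on_differentiable[OF us]) (use \<gamma>(4) that in auto)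
    have D1: "ddir w gy x = (\<Sum>i\<in>UNIV. ddir w \<tau> x $ i * ?g i x)" if x: "x \<in> U" for w x
    proof -
      have "ddir w gy x = ddir w (\<lambda>x. u (\<tau> x)) x" by (rule ddir_cong[OF U(1) x]) (simp add: u_def \<gamma>(1))
      also have "\<dots> = ddir (ddir w \<tau> x) u (\<tau> x)" by (rule ddir_compose[OF smooth_on_differentiable[OF \<tau>U x] ud[OF x]])
      finally show ?thesis unfolding ddir_axis[OF ud[OF x], of "ddir w \<tau> x"] by simp
    qed
    \<comment> \<open>\<open>u\<close> is critical at \<open>c\<close>, which removes the second
      derivatives of the coordinate change from the Hessian.\<close>
    have g0: "?g k (\<phi> p) = 0" for k
    proof -
      have "0 = (\<Sum>i\<in>UNIV. ddir (axis k 1) \<tau> (\<phi> p) $ i * ?g i (\<phi> p))" using D1[OF U(3), of "axis k 1"] gy_critical by simp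
      also have "\<dots> = (\<Sum>i\<in>UNIV. if i = k then ?g i (\<phi> p) else 0)" unfolding \<tau>d by (intro sum.cong refl) (simp add: axis_def)
      finally show ?thesis by simp
    qed
    have gd: "ddir v (?g i) (\<phi> p) = (\<Sum>l\<in>UNIV. v $ l * ddir (axis l 1) (ddir (axis i 1) u) c)" for i
    proof -
      have dd: "ddir (axis i 1) u differentiable (at (\<tau> (\<phi> p)))"
        using smooth_on_differentiable[OF smooth_on_ddir[OF us] cV] by (simp add: c_def)
      have "ddir v (?g i) (\<phi> p) = ddir v (ddir (axis i 1) u) c"
        using ddir_compose[OF smooth_on_differentiable[OF \<tau>U U(3)] dd, of v] \<tau>d by (simp add: c_def)
      then show ?thesis using ddir_axis[OF dd, of v] by (simp add: c_def)
    qed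
    have "hess gy (\<phi> p) v = ddir v (ddir v gy) (\<phi> p)" by (rule hess_eq[OF D_image_open pS gy_smooth])
    also have "\<dots> = ddir v (\<lambda>x. \<Sum>i\<in>UNIV. ?f i x * ?g i x) (\<phi> p)" by (rule ddir_cong[OF U(1,3) D1])
    also have "\<dots> = (\<Sum>i\<in>UNIV. ddir v (?f i) (\<phi> p) * ?g i (\<phi> p) + ?f i (\<phi> p) * ddir v (?g i) (\<phi> p))"
      by (rule smooth_on_sum_mult(2)[OF U(1) fs gs U(3)])
    also have "\<dots> = hess u c v" unfolding g0 gd \<tau>d hess_def by (simp add: sum_distrib_left mult_ac)
    finally show ?thesis by simp
  qed
  obtain R m where R: "R > 0" "m > 0" "ball c R \<subseteq> V" "\<And>x v. x \<in> ball c R \<Longrightarrow> hess u x v \<ge> m * (norm v)\<^sup>2"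
    using hess_positive_near[OF V cV us] hess pos by (metis (no_types, lifting))
  \<comment> \<open>Shrunk so that the image of the new chart is a ball, a convex domain on which
    tangent planes lie below the graph.\<close>
  define B where "B = U \<inter> \<tau> -` ball c R"
  have B: "open B" "B \<subseteq> U" "\<phi> p \<in> B"
    using continuous_open_preimage[OF smooth_on_continuous[OF \<tau>U] U(1) open_ball] U(3) R(1) by (auto simp: B_def c_def)
  have Bim: "\<tau> ` B = ball c R" "\<gamma> ` ball c R = B"
  proof -
    have "\<gamma> y \<in> B" "\<tau> (\<gamma> y) = y" if "y \<in> ball c R" for y using that R(3) \<gamma>(2,3) by (auto simp: B_def)
    then show "\<tau> ` B = ball c R" "\<gamma> ` ball c R = B" using \<gamma>(1) by (force simp: B_def)+
  qed
  have hB: "homeomorphism B (ball c R) \<tau> \<gamma>"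
    by (rule homeomorphism_of_subsets[OF hom B(2) R(3) Bim(1)])
  have BS: "B \<subseteq> \<phi> ` D" using B(2) U(2) by blast
  define D' where "D' = {q \<in> D. \<phi> q \<in> B}"
  note cc = compatible_chart_compose[OF atlas compat B(1) BS open_ball hB smooth_on_subset[OF \<tau>U B(2)] smooth_on_subset[OF \<gamma>s R(3)]]
  have D': "openin X D'" unfolding D'_def by (rule preimage_open[OF B(1)])
  have G: "G j y = (\<Sum>i\<in>UNIV. P i j * complex_of_real ((\<tau> \<circ> \<phi>) y $ i)) + nu j * complex_of_real (u ((\<tau> \<circ> \<phi>) y))"
    if "y \<in> D'" "j \<le> n" for y j
  proof -
    have y: "y \<in> D" "\<phi> y \<in> U" using that B(2) by (auto simp: D'_def)
    have "(\<tau> \<circ> \<phi>) y $ i = Re (\<Sum>j\<le>n. a i j * G j y)" for i using y(1) by (simp add: \<tau>_def)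
    moreover have "u ((\<tau> \<circ> \<phi>) y) = Re (\<Sum>j\<le>n. b j * G j y)" using y \<gamma>(1) by (simp add: u_def gy_def)
    ultimately show ?thesis using real_right_inverse[OF that(2), of "\<lambda>j. G j y"] by simp
  qed
  show ?thesis
  proof (rule that[of D' "\<tau> \<circ> \<phi>" c R m u])
    show "compatible_chart X A D' (\<tau> \<circ> \<phi>)" "(\<tau> \<circ> \<phi>) ` D' = ball c R" using cc by (simp_all add: D'_def)
    show "p \<in> D'" "(\<tau> \<circ> \<phi>) p = c" using pD B(3) by (simp_all add: D'_def c_def)
    show "R > 0" "m > 0" by (fact R(1), fact R(2))
    show "smooth_on (ball c R) u" by (rule smooth_on_subset[OF us R(3)])
    show "hess u x v \<ge> m * (norm v)\<^sup>2" if "x \<in> ball c R" for x v by (rule R(4)[OF that])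
    fix q assume q: "q \<in> D'"
    then have qD: "q \<in> D" by (simp add: D'_def)
    let ?K = "\<lambda>j y. (\<Sum>i\<in>UNIV. P i j * complex_of_real ((\<tau> \<circ> \<phi>) y $ i)) + nu j * complex_of_real (u ((\<tau> \<circ> \<phi>) y))"
    have K: "Z (\<lambda>y. cnj (G j y)) = Z (\<lambda>y. cnj (?K j y))" if "Z \<in> ctangent X A q" "j \<le> n" for Z j
      by (rule ctangent_cong[OF that(1) D' q _ smooth_near_cnj[OF G_near[OF that(2) qD]]]) (use G that(2) in simp)
    show "T10 q = {Z \<in> ctangent X A q. \<forall>j\<le>n. Z (\<lambda>y. cnj (?K j y)) = 0}"
      unfolding T10_eq[OF qD] by (intro Collect_cong conj_cong refl all_cong1 imp_cong) (simp only: K)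
  qed
qed

end

subsection \<open>Spherical approximation\<close>

text \<open>Only second derivatives enter. The entrywise error \<open>e\<close> is chosen so that
  the whole perturbation costs at most half of the lower bound.\<close>

lemma eventually_hess_positive:
  fixes u :: "real^'m \<Rightarrow> real"
  assumes lim: "cinf_tendsto S F u" and K: "compact K" "K \<subseteq> S" and m: "m > 0"
    and low: "\<And>x v. x \<in> K \<Longrightarrow> hess u x v \<ge> m * (norm v)\<^sup>2"
  shows "\<forall>\<^sub>F k in sequentially. \<forall>x\<in>K. \<forall>v. v \<noteq> 0 \<longrightarrow> hess (F k) x v > 0"
proof -
  let ?n = "(real CARD('m))\<^sup>2"
  define e where "e = m / (2 * ?n)"
  have e: "e > 0" using m by (simp add: e_def)
  have "\<forall>\<^sub>F k in sequentially. \<forall>i l. \<forall>x\<in>K.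
      \<bar>ddir (axis l 1) (ddir (axis i 1) (F k)) x - ddir (axis l 1) (ddir (axis i 1) u) x\<bar> < e"
  proof (intro eventually_all_finite)
    fix i l :: 'm
    have "uniform_limit K (\<lambda>k. iter_deriv [axis l 1, axis i 1] (F k)) (iter_deriv [axis l 1, axis i 1] u) sequentially"
      using lim K unfolding cinf_tendsto_def by blast
    then show "\<forall>\<^sub>F k in sequentially. \<forall>x\<in>K.
      \<bar>ddir (axis l 1) (ddir (axis i 1) (F k)) x - ddir (axis l 1) (ddir (axis i 1) u) x\<bar> < e"
      unfolding uniform_limit_iff using e by (simp add: iter_deriv_Cons_ddir dist_real_def del: iter_deriv.simps(2))
  qed
  then show ?thesis
  proof (rule eventually_mono)
    fix k assume k: "\<forall>i l. \<forall>x\<in>K. \<bar>ddir (axis l 1) (ddir (axis i 1) (F k)) x - ddir (axis l 1) (ddir (axis i 1) u) x\<bar> < e"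
    show "\<forall>x\<in>K. \<forall>v. v \<noteq> 0 \<longrightarrow> hess (F k) x v > 0"
    proof (intro ballI allI impI)
      fix x and v :: "real^'m" assume x: "x \<in> K" and v: "v \<noteq> 0"
      have "\<bar>hess (F k) x v - hess u x v\<bar> \<le> e * ?n * (norm v)\<^sup>2"
        by (rule hess_perturb) (use k x in \<open>simp add: less_imp_le\<close>)
      also have "\<dots> = m * (norm v)\<^sup>2 / 2" by (simp add: e_def)
      finally have "\<bar>hess (F k) x v - hess u x v\<bar> \<le> m * (norm v)\<^sup>2 / 2" .
      moreover have "m * (norm v)\<^sup>2 > 0" using m v by simp
      ultimately show "hess (F k) x v > 0" using low[OF x, of v] by linarith
    qed
  qed
qed

lemma cinf_tendsto_shift:
  assumes "cinf_tendsto S F f" shows "cinf_tendsto S (\<lambda>k. F (k + k0)) f"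
  unfolding cinf_tendsto_def uniform_limit_iff
proof (intro allI impI)
  fix vs K and e :: real assume "compact K \<and> K \<subseteq> S" "0 < e"
  then have "\<forall>\<^sub>F n in sequentially. \<forall>x\<in>K. dist (iter_deriv vs (F n) x) (iter_deriv vs f x) < e"
    using assms unfolding cinf_tendsto_def uniform_limit_iff by blast
  then show "\<forall>\<^sub>F n in sequentially. \<forall>x\<in>K. dist (iter_deriv vs (F (n + k0)) x) (iter_deriv vs f x) < e"
    by (rule iffD2[OF eventually_sequentially_seg[where P = "\<lambda>n. \<forall>x\<in>K. dist (iter_deriv vs (F n) x) (iter_deriv vs f x) < e"]])
qed

lemma spherical_approximation_graph:
  fixes \<xi> :: "'a \<Rightarrow> real^'m::finite"
  assumes A: "smooth_atlas X A" and fr: "real_frame n P nu a b" and ch: "compatible_chart X A D \<xi>"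
    and D: "p \<in> D" "\<xi> p = c" "\<xi> ` D = ball c R" and R: "R > 0" and m: "m > 0"
    and u: "smooth_on (ball c R) u" and hess: "\<And>x v. x \<in> ball c R \<Longrightarrow> hess u x v \<ge> m * (norm v)\<^sup>2"
    and T: "\<And>q. q \<in> D \<Longrightarrow> T10 q = {Z \<in> ctangent X A q. \<forall>j\<le>n.
       Z (\<lambda>y. cnj ((\<Sum>i\<in>UNIV. P i j * complex_of_real (\<xi> y $ i)) + nu j * complex_of_real (u (\<xi> y)))) = 0}"
  shows "\<exists>U. openin X U \<and> p \<in> U \<and>
           (\<exists>V :: nat \<Rightarrow> 'a \<Rightarrow> 'a cvector set.
              (\<forall>k. cr_structure X A n U (V k) \<and> strictly_pseudoconvex X A U (V k)) \<and>
              subbundles_tendsto X A U V T10 \<and>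
              (\<forall>k. \<exists>N F. cr_embedding X A U (V k) N F \<and> F ` U \<subseteq> unit_csphere N))"
proof -
  have "u y + ddir (x - y) u y \<le> u x" if "x \<in> ball c R" "y \<in> ball c R" for x y
  proof (rule tangent_below_graph[OF u _ that])
    fix x v :: "real^'m" assume "x \<in> ball c R"
    have "0 \<le> m * (norm v)\<^sup>2" using m by simp
    also have "\<dots> \<le> hess u x v" by (rule hess) fact
    finally show "hess u x v \<ge> 0" .
  qed
  then obtain F where F: "\<And>k. \<exists>lam. exp_sum lam (F k)" "cinf_tendsto (ball c (R/2)) F u"
    using convex_cinf_approx[OF u, of "R/2"] R by auto
  \<comment> \<open>The approximants converge smoothly on the ball of radius \<open>R / 2\<close>.
    Radius \<open>R / 4\<close> leaves a closed ball inside it, on which second derivatives converge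
    uniformly.\<close>
  have K: "cball c (R/4) \<subseteq> ball c (R/2)" "cball c (R/4) \<subseteq> ball c R" using R by (auto simp: subset_iff)
  have "\<forall>\<^sub>F k in sequentially. \<forall>x\<in>cball c (R/4). \<forall>v. v \<noteq> 0 \<longrightarrow> hess (F k) x v > 0"
    by (rule eventually_hess_positive[OF F(2) compact_cball K(1) m hess]) (use K(2) in blast)
  then obtain k0 where k0: "\<And>k x v. k \<ge> k0 \<Longrightarrow> x \<in> cball c (R/4) \<Longrightarrow> v \<noteq> 0 \<Longrightarrow> hess (F k) x v > 0"
    unfolding eventually_sequentially by blast
  \<comment> \<open>The first \<open>k0\<close> approximants, whose Hessian might degenerate, are
    dropped.\<close>
  define us where "us = (\<lambda>k. F (k + k0))"
  define U where "U = {q \<in> D. \<xi> q \<in> ball c (R/4)}"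
  have U: "openin X U" "U \<subseteq> D" "p \<in> U"
    unfolding U_def by (rule compatible_chart_open_preimage[OF ch open_ball]) (use D(1,2) R in auto)
  have im: "\<xi> ` U = ball c (R/4)"
  proof
    show "ball c (R/4) \<subseteq> \<xi> ` U"
    proof
      fix x assume x: "x \<in> ball c (R/4)"
      then have "x \<in> \<xi> ` D" using D(3) R by auto
      then show "x \<in> \<xi> ` U" using x by (auto simp: U_def)
    qed
  qed (auto simp: U_def)
  interpret graph_chart X A U \<xi> n P nu a b
    by (intro graph_chart.intro fr coordinate_chart.intro smooth_atlas_on.intro A coordinate_chart_axioms.intro
        compatible_chart_subset[OF A ch U(1,2)])
  have uU: "smooth_on (\<xi> ` U) u" unfolding im by (rule smooth_on_subset[OF u]) (use R in auto)
  have usU: "smooth_on (\<xi> ` U) (us k)" for k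
    using F(1)[of "k + k0"] exp_sum_smooth smooth_on_subset[OF _ subset_UNIV] by (auto simp: us_def)
  have lim: "cinf_tendsto (\<xi> ` U) us u"
    unfolding us_def im by (rule cinf_tendsto_shift[OF cinf_tendsto_subset[OF F(2)]]) (use R in auto)
  have TU: "T10 q = V u q" if q: "q \<in> U" for q
  proof -
    have qD: "q \<in> D" using q U(2) by blast
    show ?thesis unfolding T[OF qD] V_def H_def gf_def xc_def by (rule refl)
  qed
  have 1: "cr_structure X A n U (V (us k))" for k by (rule V_cr_structure[OF usU])
  have 2: "strictly_pseudoconvex X A U (V (us k))" for k
  proof (rule V_strictly_pseudoconvex[OF usU])
    fix x and v :: "real^'m" assume x: "x \<in> \<xi> ` U" and v: "v \<noteq> 0"
    have "hess (us k) x v > 0" unfolding us_def by (rule k0) (use x v im in auto)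
    then show "(\<Sum>i\<in>UNIV. \<Sum>l\<in>UNIV. ddir (axis l 1) (ddir (axis i 1) (us k)) x * (v $ l * v $ i)) > 0"
      unfolding hess_def .
  qed
  have 3: "subbundles_tendsto X A U (\<lambda>k. V (us k)) T10" by (rule V_tendsto[OF uU usU lim TU])
  have 4: "\<exists>N F. cr_embedding X A U (V (us k)) N F \<and> F ` U \<subseteq> unit_csphere N" for k
  proof -
    obtain lam where "exp_sum lam (us k)" using F(1) by (auto simp: us_def)
    then show ?thesis by (rule sphere_embedding[OF usU])
  qed
  show ?thesis
    by (intro exI[of _ U] conjI U exI[of _ "\<lambda>k. V (us k)"] allI 1 2 3 4)
qed

lemma (in embedded_point) spherical_approximation:
  assumes pos: "\<And>z. (\<Sum>j\<le>n. b j * z j) = 0 \<Longrightarrow> (\<exists>j\<le>n. z j \<noteq> 0) \<Longrightarrow> Re (levi z) > 0"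
  shows "\<exists>U. openin X U \<and> p \<in> U \<and>
           (\<exists>V :: nat \<Rightarrow> 'a \<Rightarrow> 'a cvector set.
              (\<forall>k. cr_structure X A n U (V k) \<and> strictly_pseudoconvex X A U (V k)) \<and>
              subbundles_tendsto X A U V T10 \<and>
              (\<forall>k. \<exists>N F. cr_embedding X A U (V k) N F \<and> F ` U \<subseteq> unit_csphere N))"
proof (rule convexify)
  show "Re (levi z) > 0" if "(\<Sum>j\<le>n. b j * z j) = 0" "\<exists>j\<le>n. z j \<noteq> 0" for z by (rule pos[OF that])
next
  fix D' G' assume E': "embedded_point X A D' \<phi> n P nu a b p G' T10"
    and hess: "\<And>v. v \<noteq> 0 \<Longrightarrow> hess (\<lambda>x. Re (\<Sum>j\<le>n. b j * (G' j \<circ> inv_into D' \<phi>) x)) (\<phi> p) v > 0"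
  interpret E': embedded_point X A D' \<phi> n P nu a b p G' T10 by (rule E')
  show ?thesis
  proof (rule E'.graph_coordinates)
    show "hess E'.gy (\<phi> p) v > 0" if "v \<noteq> 0" for v
      unfolding E'.gy_def[abs_def] by (rule hess[OF that])
  next
    fix D2 \<xi> c R m u assume g: "compatible_chart X A D2 \<xi>" "p \<in> D2" "\<xi> p = c" "\<xi> ` D2 = ball c R" "R > 0" "m > 0"
      "smooth_on (ball c R) u" "\<And>x v. x \<in> ball c R \<Longrightarrow> hess u x v \<ge> m * (norm v)\<^sup>2"
      "\<And>q. q \<in> D2 \<Longrightarrow> T10 q = {Z \<in> ctangent X A q. \<forall>j\<le>n.
         Z (\<lambda>y. cnj ((\<Sum>i\<in>UNIV. P i j * complex_of_real (\<xi> y $ i)) + nu j * complex_of_real (u (\<xi> y)))) = 0}"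
    show ?thesis by (rule spherical_approximation_graph[OF atlas real_frame_axioms g])
  qed
qed

section \<open>Sign normalisation, and the pointwise data obtained from the given embedding\<close>

context embedded_point
begin

lemma flip: "embedded_point X A D \<phi> n P (\<lambda>j. - nu j) a (\<lambda>j. - b j) p G T10"
proof -
  interpret F: real_frame n P "\<lambda>j. - nu j" a "\<lambda>j. - b j" by (rule real_frame_flip[OF real_frame_axioms])
  show ?thesis
    by unfold_locales (rule pD G_smooth G_zero G_deriv T10_eq T10_bundle; assumption)+
qed

text \<open>\<open>gy\<close> changes sign together with \<open>b\<close>, while the forms
  \<open>a\<close> inserted into its Hessian are unaffected.\<close>

lemma flip_levi: "embedded_point.levi D \<phi> n a (\<lambda>j. - b j) p G z = - levi z"
proof -
  interpret F: embedded_point X A D \<phi> n P "\<lambda>j. - nu j" a "\<lambda>j. - b j" p G T10 by (rule flip)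
  have g: "F.gy = (\<lambda>x. - gy x)" by (simp add: fun_eq_iff F.gy_def gy_def sum_negf)
  have neg: "bounded_linear (\<lambda>x::real. - x)" by (rule bounded_linear_minus[OF bounded_linear_ident])
  have pS: "\<phi> p \<in> \<phi> ` D" using pD by blast
  have "ddir w (ddir w' F.gy) (\<phi> p) = - ddir w (ddir w' gy) (\<phi> p)" for w w'
  proof -
    have "ddir w (ddir w' F.gy) (\<phi> p) = ddir w (\<lambda>x. - ddir w' gy x) (\<phi> p)"
      unfolding g
      by (rule ddir_cong[OF D_image_open pS]) (rule bounded_linear_ddir[OF neg smooth_on_differentiable[OF gy_smooth]])
    also have "\<dots> = - ddir w (ddir w' gy) (\<phi> p)"
      by (rule bounded_linear_ddir[OF neg smooth_on_differentiable[OF smooth_on_ddir[OF gy_smooth] pS]])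
    finally show ?thesis .
  qed
  then show ?thesis unfolding F.levi_def levi_def by (simp add: sum_negf)
qed

end

lemma (in smooth_atlas_on) complex_subbundle_ctangent:
  assumes V: "complex_subbundle X A r U V" and q: "q \<in> U"
  shows "V q \<subseteq> ctangent X A q"
proof -
  from bspec[OF V[unfolded complex_subbundle_def] q]
  obtain W E where W: "openin X W \<and> q \<in> W \<and> W \<subseteq> U \<and> (\<forall>j<r. smooth_field X A W (E j)) \<and>
      (\<forall>q\<in>W. (\<forall>c. (\<lambda>f. \<Sum>j<r. c j * E j q f) = (\<lambda>f. 0) \<longrightarrow> (\<forall>j<r. c j = 0)) \<and>
         V q = {\<lambda>f. \<Sum>j<r. c j * E j q f |c. True})"
    by (elim exE) (rule that)
  then have Vq: "V q = {\<lambda>f. \<Sum>j<r. c j * E j q f |c. True}" and E: "\<And>j. j \<in> {..<r} \<Longrightarrow> E j q \<in> ctangent X A q"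
    using smooth_field_ctangent[of W _ q] by simp_all
  show ?thesis
  proof
    fix Z assume "Z \<in> V q"
    then have "\<exists>c. Z = (\<lambda>f. \<Sum>j<r. c j * E j q f)" unfolding Vq by (simp only: mem_Collect_eq simp_thms)
    then obtain c where Z: "Z = (\<lambda>f. \<Sum>j<r. c j * E j q f)" by (rule exE)
    show "Z \<in> ctangent X A q" unfolding Z by (rule ctangent_combination) (rule E)
  qed
qed

text \<open>The CR condition identifies images only. Injectivity of the pushforward on the tangent
  space lifts the description of (1,0) vectors back to the fibre.\<close>

lemma cr_embedding_kernel:
  assumes F: "cr_embedding X A U V N F" and q: "q \<in> U" and V: "V q \<subseteq> ctangent X A q"
  shows "V q = {Z \<in> ctangent X A q. \<forall>j<N. Z (\<lambda>y. cnj (F y j)) = 0}"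
proof -
  have im: "pushforward N F ` V q = pushforward N F ` ctangent X A q \<inter> T10_cspace N"
    and inj: "inj_on (pushforward N F) (ctangent X A q)"
    using F q unfolding cr_embedding_def smooth_embedding_def by blast+
  have k: "pushforward N F Z \<in> T10_cspace N \<longleftrightarrow> (\<forall>j<N. Z (\<lambda>y. cnj (F y j)) = 0)" for Z
    by (auto simp: pushforward_def T10_cspace_def restrict_def fun_eq_iff PiE_def extensional_def)
  show ?thesis
  proof (intro equalityI subsetI)
    fix Z assume "Z \<in> V q"
    then show "Z \<in> {Z \<in> ctangent X A q. \<forall>j<N. Z (\<lambda>y. cnj (F y j)) = 0}" using im V k by blast
  next
    fix Z assume "Z \<in> {Z \<in> ctangent X A q. \<forall>j<N. Z (\<lambda>y. cnj (F y j)) = 0}"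
    then have Z: "Z \<in> ctangent X A q" "pushforward N F Z \<in> pushforward N F ` V q" using im k by blast+
    then obtain Y where Y: "Y \<in> V q" "pushforward N F Z = pushforward N F Y" by blast
    then have "Z = Y" using inj_onD[OF inj Y(2) Z(1)] V by blast
    then show "Z \<in> V q" using Y(1) by simp
  qed
qed

lemma embedded_point_exists:
  fixes X :: "'a topology" and A :: "('a, 'm::finite) chart set"
  assumes cr: "cr_manifold X A n T10" and le: "locally_embeddable X A n T10" and p: "p \<in> topspace X"
  obtains D \<phi> P nu a b G where "embedded_point X A D \<phi> n P nu a b p G T10"
proof -
  have A: "smooth_atlas X A" and card: "CARD('m) = 2 * n + 1" and bun: "complex_subbundle X A n (topspace X) T10"
    using cr unfolding cr_manifold_def smooth_manifold_def cr_structure_def by blast+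
  obtain D0 \<phi> where D0: "(D0, \<phi>) \<in> A" "p \<in> D0"
    using smooth_atlas_on.chart_cover[OF smooth_atlas_on.intro[OF A] p] by auto
  obtain U0 H where U0: "openin X U0" "p \<in> U0" and H: "cr_embedding X A U0 T10 (n + 1) H"
    using le p unfolding locally_embeddable_def by blast
  define D where "D = D0 \<inter> U0"
  have oD0: "openin X D0" using D0(1) A unfolding smooth_atlas_def by blast
  have D: "openin X D" "D \<subseteq> D0" "D \<subseteq> U0" "p \<in> D" using oD0 U0 D0(2) by (auto simp: D_def)
  interpret coordinate_chart X A D \<phi>
    by (intro coordinate_chart.intro smooth_atlas_on.intro A coordinate_chart_axioms.intro
        compatible_chart_subset[OF A compatible_chart_atlas[OF A D0(1)] D(1,2)])
  \<comment> \<open>Translated to vanish at \<open>p\<close>; added constants do not influence the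
    action of tangent vectors.\<close>
  define G where "G = (\<lambda>j y. H y j + - H p j)"
  define P where "P = (\<lambda>i j. ddir (axis i 1) (G j \<circ> inv_into D \<phi>) (\<phi> p))"
  have Hs: "smooth_fun A D (\<lambda>q. H q j)" if "j \<le> n" for j
  proof -
    have "smooth_fun A U0 (\<lambda>q. H q j)"
      using H that unfolding cr_embedding_def smooth_embedding_def by (simp add: less_Suc_eq_le)
    then show ?thesis by (rule smooth_fun_subset[OF _ D(3)])
  qed
  have Gs: "smooth_fun A D (G j)" if "j \<le> n" for j
    unfolding G_def by (intro smooth_fun_add D_open Hs that smooth_fun_const)
  have nH: "smooth_near X A q (\<lambda>y. H y j)" if "j \<le> n" "q \<in> D" for j q by (rule smooth_nearI[OF D_open that(2) Hs[OF that(1)]])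
  have GH: "Z (G j) = Z (\<lambda>y. H y j)" "Z (\<lambda>y. cnj (G j y)) = Z (\<lambda>y. cnj (H y j))"
    if "Z \<in> ctangent X A q" "q \<in> D" "j \<le> n" for Z q j
    using ctangent_add[OF that(1) nH[OF that(3,2)] smooth_near_const[OF D_topspace[OF that(2)]], of "- H p j"]
      ctangent_add[OF that(1) smooth_near_cnj[OF nH[OF that(3,2)]] smooth_near_const[OF D_topspace[OF that(2)]], of "- cnj (H p j)"]
      ctangent_const[OF that(1) D_topspace[OF that(2)]] by (simp_all add: G_def)
  \<comment> \<open>A real vector annihilating all \<open>G j\<close> annihilates their conjugates
    as well, hence has zero pushforward and vanishes. This is the rank condition under which a real
    frame exists.\<close>
  have "v = (\<lambda>i. 0)" if v: "\<And>j. j \<le> n \<Longrightarrow> (\<Sum>i\<in>UNIV. P i j * complex_of_real (v i)) = 0" for v :: "'m \<Rightarrow> real"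
  proof -
    define Z where "Z = cvec p (\<lambda>i. complex_of_real (v i))"
    have Z: "Z \<in> ctangent X A p" "Z (xc i) = complex_of_real (v i)" for i
      using cvec_ctangent[OF D(4)] cvec_xc[OF D(4)] by (simp_all add: Z_def)
    have ZG: "Z (G j) = 0" "Z (\<lambda>y. cnj (G j y)) = 0" if j: "j \<le> n" for j
    proof -
      note nG = smooth_nearI[OF D_open D(4) Gs[OF j]]
      show "Z (G j) = 0" using v[OF j] ctangent_expansion[OF Z(1) D(4) nG] by (simp add: Z(2) P_def mult.commute)
      have "ddir w ((\<lambda>y. cnj (G j y)) \<circ> inv_into D \<phi>) (\<phi> p) = cnj (ddir w (G j \<circ> inv_into D \<phi>) (\<phi> p))" for w
        using bounded_linear_ddir[OF bounded_linear_cnj smooth_near_differentiable[OF nG D(4)], of w] by (simp add: o_def)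
      then have "Z (\<lambda>y. cnj (G j y)) = cnj (\<Sum>i\<in>UNIV. P i j * complex_of_real (v i))"
        using ctangent_expansion[OF Z(1) D(4) smooth_near_cnj[OF nG]] by (simp add: Z(2) P_def mult.commute)
      then show "Z (\<lambda>y. cnj (G j y)) = 0" using v[OF j] by simp
    qed
    have "inj_on (pushforward (n + 1) H) (ctangent X A p)"
      using H U0(2) unfolding cr_embedding_def smooth_embedding_def by blast
    moreover have "pushforward (n + 1) H Z = pushforward (n + 1) H (\<lambda>f. 0)"
      using ZG GH[OF Z(1) D(4)] by (auto simp: pushforward_def restrict_def fun_eq_iff)
    ultimately have "Z = (\<lambda>f. 0)" using zero_ctangent by (rule inj_onD[OF _ _ Z(1)])
    then have "complex_of_real (v i) = 0" for i using Z(2)[of i] by simp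
    then show ?thesis by (simp add: fun_eq_iff)
  qed
  then obtain nu a b where fr: "real_frame n P nu a b" using real_frame_exists[OF card] by blast
  interpret R: real_frame n P nu a b by (rule fr)
  have "embedded_point X A D \<phi> n P nu a b p G T10"
  proof unfold_locales
    show "p \<in> D" by (rule D(4))
    show "smooth_fun A D (G j)" if "j \<le> n" for j by (rule Gs[OF that])
    show "G j p = 0" if "j \<le> n" for j by (simp add: G_def)
    show "ddir (axis i 1) (G j \<circ> inv_into D \<phi>) (\<phi> p) = P i j" if "j \<le> n" for i j by (simp add: P_def)
    show "complex_subbundle X A n D T10" by (rule complex_subbundle_subset[OF bun D_open openin_subset[OF D_open]])
    fix q assume q: "q \<in> D"
    have "T10 q \<subseteq> ctangent X A q" by (rule complex_subbundle_ctangent[OF bun D_topspace[OF q]])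
    then have T: "T10 q = {Z \<in> ctangent X A q. \<forall>j<n + 1. Z (\<lambda>y. cnj (H y j)) = 0}"
      by (rule cr_embedding_kernel[OF H subsetD[OF D(3) q]])
    show "T10 q = {Z \<in> ctangent X A q. \<forall>j\<le>n. Z (\<lambda>y. cnj (G j y)) = 0}"
      unfolding T by (intro Collect_cong conj_cong refl) (simp add: GH(2)[OF _ q] less_Suc_eq_le)
  qed
  then show ?thesis by (rule that)
qed

theorem corollary1p22:
  fixes X :: "'a topology"
    and A :: "('a, 'm::finite) chart set"
    and n :: nat
    and T10 :: "'a \<Rightarrow> 'a cvector set"
  assumes "cr_manifold X A n T10"
    and "strictly_pseudoconvex X A (topspace X) T10"
    and "locally_embeddable X A n T10"
  shows "\<forall>p\<in>topspace X. \<exists>U. openin X U \<and> p \<in> U \<and>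
           (\<exists>V :: nat \<Rightarrow> 'a \<Rightarrow> 'a cvector set.
              (\<forall>k. cr_structure X A n U (V k) \<and> strictly_pseudoconvex X A U (V k)) \<and>
              subbundles_tendsto X A U V T10 \<and>
              (\<forall>k. \<exists>N F. cr_embedding X A U (V k) N F \<and> F ` U \<subseteq> unit_csphere N))"
proof
  fix p assume p: "p \<in> topspace X"
  obtain D \<phi> P nu a b G where E: "embedded_point X A D \<phi> n P nu a b p G T10"
    by (rule embedded_point_exists[OF assms(1,3) p]) (rule that)
  interpret E: embedded_point X A D \<phi> n P nu a b p G T10 by (rule E)
  have "strictly_pseudoconvex X A D T10"
    by (rule strictly_pseudoconvex_subset[OF assms(2) openin_subset[OF E.D_open]])
  \<comment> \<open>The sign compares the given contact form with the normal direction
    \<open>nu\<close>, which was chosen without regard to it. In the negative case the argument is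
    run with the reversed frame.\<close>
  then obtain s :: real where s: "s = 1 \<or> s = - 1"
    "\<And>z. (\<Sum>j\<le>n. b j * z j) = 0 \<Longrightarrow> (\<exists>j\<le>n. z j \<noteq> 0) \<Longrightarrow> s * Re (E.levi z) > 0"
    using E.levi_sign by blast
  show "\<exists>U. openin X U \<and> p \<in> U \<and>
           (\<exists>V :: nat \<Rightarrow> 'a \<Rightarrow> 'a cvector set.
              (\<forall>k. cr_structure X A n U (V k) \<and> strictly_pseudoconvex X A U (V k)) \<and>
              subbundles_tendsto X A U V T10 \<and>
              (\<forall>k. \<exists>N F. cr_embedding X A U (V k) N F \<and> F ` U \<subseteq> unit_csphere N))"
    using s(1)
  proof
    assume "s = 1"
    then show ?thesis using s(2) by (intro E.spherical_approximation) simp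
  next
    assume s': "s = - 1"
    show ?thesis
    proof (rule embedded_point.spherical_approximation[OF E.flip])
      fix z assume "(\<Sum>j\<le>n. - b j * z j) = 0" and nz: "\<exists>j\<le>n. z j \<noteq> 0"
      then have "(\<Sum>j\<le>n. b j * z j) = 0" by (simp add: sum_negf)
      from s(2)[OF this nz] show "Re (embedded_point.levi D \<phi> n a (\<lambda>j. - b j) p G z) > 0"
        unfolding E.flip_levi s' by simp
    qed
  qed
qed

end
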